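(* Let $F^2$ be a punctured surface other than the disk. Every triangulation $G\in\mathcal{F}_{\circ}^2(4)$ of $F^2$ can be obtained from an irreducible triangulation of $F^2$ by a sequence of 3-splitting triodes, additions of flags, 4-splittings and additions of octahedra.
   Context: A triangulation of a compact connected surface $F^2$ (possibly with boundary) is a simple graph $G$ embedded in $F^2$ such that every face is bounded by a 3-cycle and any two faces share at most one edge (so vertices, edges and faces form a simplicial complex with underlying space $F^2$); triangulations are considered up to homeomorphisms of $F^2$. $\partial G$ is the subgraph triangulating $\partial F^2$; its vertices and edges are boundary vertices/edges, all others are inner vertices/edges (an inner edge may have both ends on $\partial G$). A punctured surface is a closed surface with the interior of a disk removed; the disk is the punctured sphere. Contracting an edge $e=uv$ means identifying $u$ and $v$ and deleting the resulting multiple edges, giving $G/e$; $e$ is contractible if $G/e$ is again a triangulation of $F^2$; vertex splitting is the inverse operation. $G$ is irreducible if it has no contractible edge. A contractible edge $e$ is 4-contractible if $G/e$ has minimum degree $\ge 4$; a 4-splitting is the inverse of such a contraction (applied to a triangulation of minimum degree $\ge4$). $\mathcal{F}_{\circ}^2(4)$ is the class of triangulations of $F^2$ in which every vertex has degree $\ge 3$ and every inner vertex has degree $\ge 4$; all operations below are required to stay in $\mathcal{F}_{\circ}^2(4)$. A triode is a boundary vertex of degree $3$. A contractible edge $e$ of $G\in\mathcal{F}_{\circ}^2(4)$ is a triode detecting edge if all vertices of degree $3$ produced by its contraction are triodes; a 3-splitting triode is the inverse of the contraction of a triode detecting edge. Flag: let $x$ be an inner vertex of degree $4$ none of whose neighbours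 has degree $4$, with neighbours $x_1,a,b,x_2$ such that $x_1a,ab,bx_2,x_2x_1$ form its link, $x_1a,ab,bx_2\in\partial G$, the edge $x_1x_2$ meets $\partial G$ only in $\{x_1,x_2\}$, and $\deg a=\deg b=3$. The subgraph induced by $\{x,x_1,x_2,a,b\}$ is a flag centred at $x$; it is removable if $G-\{a,b,x\}\in\mathcal{F}_{\circ}^2(4)$. Adding a flag along a boundary edge of $G'$ is the inverse of removing a removable flag. Octahedron component: let $v_1v_2v_3$ be a cycle of $G$ with $\deg v_i=4$, and $a_1,a_2,a_3$ the only vertices such that $a_i$ is adjacent to $v_j$ and $v_k$ ($\{i,j,k\}=\{1,2,3\}$). The subgraph induced by $\{a_i,v_i\}$ is an octahedron component centred at $v_1v_2v_3$ if the cycle $a_1a_2a_3$ exists in $G$ and one of: (1) no $v_i$ lies in $\partial G$; (2) exactly one $v_i\in\partial G$ and $\partial G=v_ia_ja_k$; (3) exactly $v_i,v_j\in\partial G$ and $\partial G=v_iv_ja_k$; (4) all $v_i\in\partial G$ and $\partial G=v_1v_2v_3$. It is external if two edges $a_ia_j,a_ja_k$ lie in $\partial G$. It is removable if $G-\{v_1,v_2,v_3\}\in\mathcal{F}_{\circ}^2(4)$; an external one (with $a_ia_j,a_ja_k\in\partial G$) is redundant if $G-\{a_j,v_1,v_2,v_3\}\in\mathcal{F}_{\circ}^2(4)$. An addition of an octahedron is the inverse of removing a removable octahedron component or of deleting a redundant one (adding an octahedron along a boundary edge). *)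

theory Defs
  imports "HOL-Analysis.Analysis"
begin

section \<open>Punctured surfaces\<close>

abbreviation open_disk :: "complex topology" where
  "open_disk \<equiv> top_of_set (ball 0 1)"

abbreviation closed_disk :: "complex topology" where
  "closed_disk \<equiv> top_of_set (cball 0 1)"

definition disk_nbhd_at :: "'a topology \<Rightarrow> 'a \<Rightarrow> bool" where
  "disk_nbhd_at X x \<longleftrightarrow>
     (\<exists>U. openin X U \<and> x \<in> U \<and> subtopology X U homeomorphic_space open_disk)"

definition closed_surface :: "'a topology \<Rightarrow> bool" where
  "closed_surface S \<longleftrightarrow>
     topspace S \<noteq> {} \<and> compact_space S \<and> connected_space S \<and> Hausdorff_space S \<and>
     (\<forall>x \<in> topspace S. disk_nbhd_at S x)"

text \<open>The closed surface may be taken over the same type as the punctured one: both have the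
  cardinality of the continuum, and only the homeomorphism type matters.\<close>

definition punctured_surface :: "'a topology \<Rightarrow> bool" where
  "punctured_surface F \<longleftrightarrow>
     (\<exists>(S :: 'a topology) h. closed_surface S \<and> embedding_map closed_disk S h \<and>
        F homeomorphic_space subtopology S (topspace S - h ` ball 0 1))"

definition surface_boundary :: "'a topology \<Rightarrow> 'a set" where
  "surface_boundary X = {x \<in> topspace X. \<not> disk_nbhd_at X x}"


section \<open>Triangulations\<close>

text \<open>A triangulation is represented, up to homeomorphism, by the abstract simplicial complex of
  its vertices, edges and faces, given as vertex sets of cardinality 1, 2 and 3. Two faces on the
  same three vertices would share three edges, so this loses no information.\<close>

definition abstract_2_complex :: "'v set set \<Rightarrow> bool" where
  "abstract_2_complex K \<longleftrightarrow>
     finite K \<and> (\<forall>s \<in> K. s \<noteq> {} \<and> finite s \<and> card s \<le> 3) \<and>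
     (\<forall>s \<in> K. \<forall>t. t \<subseteq> s \<and> t \<noteq> {} \<longrightarrow> t \<in> K)"

text \<open>Points of the underlying space in barycentric coordinates; the topology used on them is the
  product topology. As the coordinates sum to 1, their support is nonempty, and a member
  \<open>{}\<close> of \<open>K\<close> contributes no point.\<close>

definition realization :: "'v set set \<Rightarrow> ('v \<Rightarrow> real) set" where
  "realization K =
     {\<alpha>. (\<forall>v. 0 \<le> \<alpha> v) \<and> {v. \<alpha> v \<noteq> 0} \<in> K \<and> (\<Sum>v | \<alpha> v \<noteq> 0. \<alpha> v) = 1}"

definition triangulates :: "'v set set \<Rightarrow> 'a topology \<Rightarrow> bool" where
  "triangulates K F \<longleftrightarrow>
     abstract_2_complex K \<and> top_of_set (realization K) homeomorphic_space F"

definition vertices :: "'v set set \<Rightarrow> 'v set" where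
  "vertices K = {v. {v} \<in> K}"

definition nbrs :: "'v set set \<Rightarrow> 'v \<Rightarrow> 'v set" where
  "nbrs K v = {w. w \<noteq> v \<and> {v, w} \<in> K}"

definition deg :: "'v set set \<Rightarrow> 'v \<Rightarrow> nat" where
  "deg K v = card (nbrs K v)"

definition link :: "'v set set \<Rightarrow> 'v \<Rightarrow> 'v set set" where
  "link K v = {s. s \<noteq> {} \<and> v \<notin> s \<and> insert v s \<in> K}"

text \<open>The subcomplex triangulating the boundary of the surface: the simplices all of whose points
  are boundary points. An edge with both ends on the boundary need not belong to it.\<close>

definition bd :: "'v set set \<Rightarrow> 'v set set" where
  "bd K = {s \<in> K. realization (Pow s) \<subseteq> surface_boundary (top_of_set (realization K))}"

definition inner_vertex :: "'v set set \<Rightarrow> 'v \<Rightarrow> bool" where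
  "inner_vertex K v \<longleftrightarrow> {v} \<in> K \<and> {v} \<notin> bd K"

definition boundary_vertex :: "'v set set \<Rightarrow> 'v \<Rightarrow> bool" where
  "boundary_vertex K v \<longleftrightarrow> {v} \<in> bd K"

definition F4 :: "'a topology \<Rightarrow> 'v set set set" where
  "F4 F = {K. triangulates K F \<and> (\<forall>v \<in> vertices K. deg K v \<ge> 3) \<and>
              (\<forall>v. inner_vertex K v \<longrightarrow> deg K v \<ge> 4)}"

text \<open>Deletion of a set of vertices together with all incident edges and faces.\<close>

definition del :: "'v set \<Rightarrow> 'v set set \<Rightarrow> 'v set set" where
  "del X K = {s \<in> K. s \<inter> X = {}}"

definition cycle3 :: "'v \<Rightarrow> 'v \<Rightarrow> 'v \<Rightarrow> 'v set set" where
  "cycle3 a b c = {{a}, {b}, {c}, {a, b}, {b, c}, {a, c}}"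


section \<open>Edge contractions\<close>

text \<open>\<open>u\<close> and \<open>v\<close> are identified to a vertex that keeps the name \<open>u\<close>;
  multiple edges merge because simplices are vertex sets.\<close>

definition contract :: "'v \<Rightarrow> 'v \<Rightarrow> 'v set set \<Rightarrow> 'v set set" where
  "contract u v K = (\<lambda>s. (\<lambda>x. if x = v then u else x) ` s) ` K"

definition contractible_edge :: "'a topology \<Rightarrow> 'v set set \<Rightarrow> 'v \<Rightarrow> 'v \<Rightarrow> bool" where
  "contractible_edge F K u v \<longleftrightarrow>
     u \<noteq> v \<and> {u, v} \<in> K \<and> triangulates (contract u v K) F"

definition irreducible_triangulation :: "'a topology \<Rightarrow> 'v set set \<Rightarrow> bool" where
  "irreducible_triangulation F K \<longleftrightarrow>
     triangulates K F \<and> \<not> (\<exists>u v. contractible_edge F K u v)"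

definition four_contractible_edge :: "'a topology \<Rightarrow> 'v set set \<Rightarrow> 'v \<Rightarrow> 'v \<Rightarrow> bool" where
  "four_contractible_edge F K u v \<longleftrightarrow>
     contractible_edge F K u v \<and>
     (\<forall>w \<in> vertices (contract u v K). deg (contract u v K) w \<ge> 4)"

definition triode :: "'v set set \<Rightarrow> 'v \<Rightarrow> bool" where
  "triode K v \<longleftrightarrow> boundary_vertex K v \<and> deg K v = 3"

text \<open>The vertices of degree 3 produced by a contraction: the merged vertex \<open>u\<close>, and the other
  vertices whose degree was not already 3.\<close>

definition triode_detecting_edge :: "'a topology \<Rightarrow> 'v set set \<Rightarrow> 'v \<Rightarrow> 'v \<Rightarrow> bool" where
  "triode_detecting_edge F K u v \<longleftrightarrow>
     K \<in> F4 F \<and> contractible_edge F K u v \<and>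
     (\<forall>w \<in> vertices (contract u v K).
        deg (contract u v K) w = 3 \<and> (w = u \<or> deg K w \<noteq> 3) \<longrightarrow> triode (contract u v K) w)"


section \<open>Flags\<close>

definition flag :: "'v set set \<Rightarrow> 'v \<Rightarrow> 'v \<Rightarrow> 'v \<Rightarrow> 'v \<Rightarrow> 'v \<Rightarrow> bool" where
  "flag K x x1 a b x2 \<longleftrightarrow>
     inner_vertex K x \<and> deg K x = 4 \<and> (\<forall>y \<in> nbrs K x. deg K y \<noteq> 4) \<and>
     distinct [x1, a, b, x2] \<and> nbrs K x = {x1, a, b, x2} \<and>
     link K x = {{x1}, {a}, {b}, {x2}, {x1, a}, {a, b}, {b, x2}, {x2, x1}} \<and>
     {x1, a} \<in> bd K \<and> {a, b} \<in> bd K \<and> {b, x2} \<in> bd K \<and>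
     {s \<in> bd K. s \<subseteq> {x1, x2}} = {{x1}, {x2}} \<and>
     deg K a = 3 \<and> deg K b = 3"


section \<open>Octahedron components\<close>

text \<open>The vertices are indexed by 1, 2, 3; the condition \<open>{i, j, k} = {1, 2, 3}\<close> makes
  \<open>i\<close>, \<open>j\<close>, \<open>k\<close> a permutation of the indices.\<close>

definition octahedron_component ::
  "'v set set \<Rightarrow> (nat \<Rightarrow> 'v) \<Rightarrow> (nat \<Rightarrow> 'v) \<Rightarrow> bool" where
  "octahedron_component K v a \<longleftrightarrow>
     inj_on v {1, 2, 3} \<and> cycle3 (v 1) (v 2) (v 3) \<subseteq> K \<and>
     (\<forall>i \<in> {1, 2, 3}. deg K (v i) = 4) \<and>
     (\<forall>i j k. {i, j, k} = {1, 2, 3} \<longrightarrow>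
        (nbrs K (v j) \<inter> nbrs K (v k)) - {v i} = {a i}) \<and>
     inj_on a {1, 2, 3} \<and> cycle3 (a 1) (a 2) (a 3) \<subseteq> K \<and>
     ((\<forall>i \<in> {1, 2, 3}. \<not> boundary_vertex K (v i)) \<or>
      (\<exists>i j k. {i, j, k} = {1, 2, 3} \<and> {l \<in> {1, 2, 3}. boundary_vertex K (v l)} = {i} \<and>
         bd K = cycle3 (v i) (a j) (a k)) \<or>
      (\<exists>i j k. {i, j, k} = {1, 2, 3} \<and> {l \<in> {1, 2, 3}. boundary_vertex K (v l)} = {i, j} \<and>
         bd K = cycle3 (v i) (v j) (a k)) \<or>
      ((\<forall>i \<in> {1, 2, 3}. boundary_vertex K (v i)) \<and> bd K = cycle3 (v 1) (v 2) (v 3)))"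

text \<open>The graph left when \<open>v 1\<close>, \<open>v 2\<close>, \<open>v 3\<close> are deleted from the surface. If none of them is
  on the boundary, the component fills an open disk bounded by the cycle of the \<open>a i\<close>, which
  becomes a face. Otherwise the component surrounds the puncture and the cycle of the
  \<open>a i\<close> becomes the new boundary, with no face inside it.\<close>

definition remove_octahedron ::
  "'v set set \<Rightarrow> (nat \<Rightarrow> 'v) \<Rightarrow> (nat \<Rightarrow> 'v) \<Rightarrow> 'v set set" where
  "remove_octahedron K v a =
     del {v 1, v 2, v 3} K \<union>
     (if \<forall>i \<in> {1, 2, 3}. \<not> boundary_vertex K (v i) then {{a 1, a 2, a 3}} else {})"

definition removable_octahedron ::
  "'a topology \<Rightarrow> 'v set set \<Rightarrow> (nat \<Rightarrow> 'v) \<Rightarrow> (nat \<Rightarrow> 'v) \<Rightarrow> bool" where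
  "removable_octahedron F K v a \<longleftrightarrow>
     octahedron_component K v a \<and> remove_octahedron K v a \<in> F4 F"

text \<open>An external octahedron component, whose boundary edges meet in \<open>a j\<close>.\<close>

definition redundant_octahedron ::
  "'a topology \<Rightarrow> 'v set set \<Rightarrow> (nat \<Rightarrow> 'v) \<Rightarrow> (nat \<Rightarrow> 'v) \<Rightarrow> nat \<Rightarrow> bool" where
  "redundant_octahedron F K v a j \<longleftrightarrow>
     octahedron_component K v a \<and>
     (\<exists>i k. {i, j, k} = {1, 2, 3} \<and> {a i, a j} \<in> bd K \<and> {a j, a k} \<in> bd K) \<and>
     del {a j, v 1, v 2, v 3} K \<in> F4 F"


section \<open>Generating operations\<close>

text \<open>Each relation says that its last argument arises from the one before by the operation,
  i.e. that the corresponding reduction leads back. Since a reduction keeps the names of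
  the remaining vertices, no relabelling is needed to describe these operations up to
  isomorphism.\<close>

definition three_splitting_triode :: "'a topology \<Rightarrow> 'v set set \<Rightarrow> 'v set set \<Rightarrow> bool" where
  "three_splitting_triode F H K \<longleftrightarrow>
     (\<exists>u v. triode_detecting_edge F K u v \<and> H = contract u v K)"

definition four_splitting :: "'a topology \<Rightarrow> 'v set set \<Rightarrow> 'v set set \<Rightarrow> bool" where
  "four_splitting F H K \<longleftrightarrow>
     (\<exists>u v. four_contractible_edge F K u v \<and> H = contract u v K)"

definition flag_addition :: "'a topology \<Rightarrow> 'v set set \<Rightarrow> 'v set set \<Rightarrow> bool" where
  "flag_addition F H K \<longleftrightarrow>
     (\<exists>x x1 a b x2. flag K x x1 a b x2 \<and> H = del {a, b, x} K \<and> H \<in> F4 F)"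

definition octahedron_addition :: "'a topology \<Rightarrow> 'v set set \<Rightarrow> 'v set set \<Rightarrow> bool" where
  "octahedron_addition F H K \<longleftrightarrow>
     (\<exists>v a. removable_octahedron F K v a \<and> H = remove_octahedron K v a) \<or>
     (\<exists>v a j. redundant_octahedron F K v a j \<and> H = del {a j, v 1, v 2, v 3} K)"

definition generating_step :: "'a topology \<Rightarrow> 'v set set \<Rightarrow> 'v set set \<Rightarrow> bool" where
  "generating_step F H K \<longleftrightarrow>
     H \<in> F4 F \<and> K \<in> F4 F \<and>
     (three_splitting_triode F H K \<or> flag_addition F H K \<or>
      four_splitting F H K \<or> octahedron_addition F H K)"

end

theory Submission
  imports Defs
begin

text \<open>By induction on the number of simplices it suffices that a triangulation \<open>K\<close> which arises from
  no smaller one by a generating step is irreducible. Suppose that it has a contractible edge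
  \<open>uv\<close>. The Euler characteristic is a topological invariant, so \<open>u\<close> and \<open>v\<close>
  have no common neighbours outside the faces at \<open>uv\<close>. Hence the only obstruction to staying in
  the class is a vertex \<open>x\<close> opposite to \<open>uv\<close> that is light: of degree 4 if inner, of
  degree 3 if on the boundary. For the same reason the diagonals of the link of \<open>x\<close> are missing,
  so an edge from \<open>x\<close> to a neighbour can be contracted as well, which gives further light vertices.
  Two adjacent light vertices in the link of a vertex of degree 4 form with it a flag if they lie on the
  boundary, and an octahedron if they are inner. Both can be removed, unless \<open>F\<close> is a disk or a degree
  bound breaks; then the contraction of an edge at the flag, or the deletion of the redundant external
  octahedron, is a reducing step.

  Homology is not needed for the Euler characteristic: nowhere zero functions modulo squares form a
  group which depends on the space only, and which is isomorphic to the cocycles modulo the cuts. All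
  homeomorphisms between the triangulations that occur are compositions of explicit bistellar moves.\<close>

section \<open>Bistellar moves\<close>

text \<open>The class is defined by topology and the argument is combinatorial. The bridge is that
  every embedded open disk of a punctured surface is open. A subcomplex that contains a disk around
  a point therefore contains all simplices above that point. This limits an edge to two faces and
  lets a cycle in a link exhaust the link. That the link of a boundary vertex is a single path is
  derived only where it is needed, from the bound of two boundary edges at a vertex.

  A contraction that stays in the class is always the reverse of a 3-splitting triode, because there
  only boundary vertices can have degree 3. So in a stuck triangulation every available contraction
  leaves the class, and each one exhibits a vertex at its degree bound.

  The degree bounds shape the endgame. Removing a flag takes two neighbours from each of its ends,
  and deleting an external octahedron takes three from each of the two remaining corners, so
  separate contractions must first show that these vertices have degree at least 5 and 6.\<close>

lemma complex_mono:
  assumes "abstract_2_complex K" "s \<in> K" "t \<subseteq> s" "t \<noteq> {}"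
  shows "t \<in> K"
  using assms unfolding abstract_2_complex_def by blast

lemma complex_finite: "abstract_2_complex K \<Longrightarrow> s \<in> K \<Longrightarrow> finite s"
  and complex_card: "abstract_2_complex K \<Longrightarrow> s \<in> K \<Longrightarrow> card s \<le> 3"
  and complex_nonempty: "abstract_2_complex K \<Longrightarrow> s \<in> K \<Longrightarrow> s \<noteq> {}"
  and complex_finite_all: "abstract_2_complex K \<Longrightarrow> finite K"
  unfolding abstract_2_complex_def by blast+

definition supp :: "('v \<Rightarrow> real) \<Rightarrow> 'v set" where
  "supp \<alpha> = {v. \<alpha> v \<noteq> 0}"

lemma sum_supp:
  assumes "supp \<alpha> \<subseteq> A" "finite A"
  shows "sum \<alpha> (supp \<alpha>) = sum \<alpha> A"
  by (rule sum.mono_neutral_left) (use assms in \<open>auto simp: supp_def\<close>)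

lemma realization_iff:
  "\<alpha> \<in> realization K \<longleftrightarrow>
    (\<forall>v. 0 \<le> \<alpha> v) \<and> supp \<alpha> \<in> K \<and> sum \<alpha> (supp \<alpha>) = 1"
  unfolding realization_def supp_def by auto

text \<open>The barycentre of \<open>\<sigma>\<close> is replaced by that of \<open>\<tau>\<close> with the same total weight. The two
  weights agree because \<open>\<sigma>\<close> loses the smallest coordinate at each of its vertices.\<close>

definition bistellar_map :: "'v set \<Rightarrow> 'v set \<Rightarrow> ('v \<Rightarrow> real) \<Rightarrow> 'v \<Rightarrow> real" where
  "bistellar_map \<sigma> \<tau> \<alpha> = (\<lambda>v. \<alpha> v - (if v \<in> \<sigma> then Min (\<alpha> ` \<sigma>) else 0)
     + (if v \<in> \<tau> then Min (\<alpha> ` \<sigma>) * card \<sigma> / card \<tau> else 0))"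

text \<open>If the link of \<sigma> is the join of the boundary of \<tau> with a complex
  \<open>L\<close>, then the join of \<sigma>, the boundary of \<tau> and \<open>L\<close> is
  replaced by the join of the boundary of \<sigma>, \<tau> and \<open>L\<close>. For trivial
  \<open>L\<close> this is a Pachner move; the factor \<open>L\<close> also covers the removal of a
  vertex whose link is a path or a square.\<close>

definition bistellar :: "'v set \<Rightarrow> 'v set \<Rightarrow> 'v set set \<Rightarrow> 'v set set" where
  "bistellar \<sigma> \<tau> K = {s \<in> K. \<not> \<sigma> \<subseteq> s} \<union>
     {s - \<sigma> \<union> \<rho> \<union> \<tau> | s \<rho>. s \<in> K \<and> \<sigma> \<subseteq> s \<and> \<rho> \<subset> \<sigma>}"

lemma continuous_on_Min_image:
  fixes f :: "'i \<Rightarrow> 'a::topological_space \<Rightarrow> real"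
  assumes "finite I" "I \<noteq> {}" "\<And>i. i \<in> I \<Longrightarrow> continuous_on S (f i)"
  shows "continuous_on S (\<lambda>x. Min ((\<lambda>i. f i x) ` I))"
  using assms
proof (induction I rule: finite_ne_induct)
  case (insert i I)
  then have "(\<lambda>x. Min ((\<lambda>i. f i x) ` insert i I)) = (\<lambda>x. min (f i x) (Min ((\<lambda>i. f i x) ` I)))"
    by (auto simp: fun_eq_iff)
  with insert show ?case by (auto intro!: continuous_on_min)
qed auto

lemma continuous_on_coordinate [continuous_intros]:
  "continuous_on S (\<lambda>\<alpha>::'a \<Rightarrow> 'b::topological_space. \<alpha> v)"
  by (rule continuous_on_subset[OF continuous_on_product_coordinates subset_UNIV])

lemma continuous_on_bistellar_map:
  assumes "finite \<sigma>" "\<sigma> \<noteq> {}"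
  shows "continuous_on S (bistellar_map \<sigma> \<tau>)"
proof (rule continuous_on_coordinatewise_then_product)
  fix v
  have c: "continuous_on S (\<lambda>\<alpha>::'a\<Rightarrow>real. Min (\<alpha> ` \<sigma>))"
    by (rule continuous_on_Min_image[OF assms, of S "\<lambda>v \<alpha>. \<alpha> v"]) (rule continuous_on_coordinate)
  have "continuous_on S (\<lambda>\<alpha>. \<alpha> v - (if v \<in> \<sigma> then 1 else 0) * Min (\<alpha> ` \<sigma>)
      + (if v \<in> \<tau> then card \<sigma> / card \<tau> else 0) * Min (\<alpha> ` \<sigma>))"
    by (intro continuous_intros c)
  also have "(\<lambda>\<alpha>. \<alpha> v - (if v \<in> \<sigma> then 1 else 0) * Min (\<alpha> ` \<sigma>)
      + (if v \<in> \<tau> then card \<sigma> / card \<tau> else 0) * Min (\<alpha> ` \<sigma>)) = (\<lambda>\<alpha>. bistellar_map \<sigma> \<tau> \<alpha> v)"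
    by (auto simp: bistellar_map_def fun_eq_iff)
  finally show "continuous_on S (\<lambda>\<alpha>. bistellar_map \<sigma> \<tau> \<alpha> v)" .
qed

lemma bistellar_map_properties:
  assumes \<sigma>: "finite \<sigma>" "\<sigma> \<noteq> {}" and \<tau>: "finite \<tau>" "\<tau> \<noteq> {}" and disj: "\<sigma> \<inter> \<tau> = {}"
    and nn: "\<And>v. 0 \<le> \<alpha> v" and fin: "finite (supp \<alpha>)"
  shows "0 \<le> bistellar_map \<sigma> \<tau> \<alpha> v"
    and "\<not> \<sigma> \<subseteq> supp \<alpha> \<Longrightarrow> bistellar_map \<sigma> \<tau> \<alpha> = \<alpha>"
    and "\<sigma> \<subseteq> supp \<alpha> \<Longrightarrow> \<exists>\<rho>. \<rho> \<subset> \<sigma> \<and> supp (bistellar_map \<sigma> \<tau> \<alpha>) = supp \<alpha> - \<sigma> \<union> \<rho> \<union> \<tau>"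
    and "sum (bistellar_map \<sigma> \<tau> \<alpha>) (supp (bistellar_map \<sigma> \<tau> \<alpha>)) = sum \<alpha> (supp \<alpha>)"
    and "\<not> \<tau> \<subseteq> supp \<alpha> \<Longrightarrow> bistellar_map \<tau> \<sigma> (bistellar_map \<sigma> \<tau> \<alpha>) = \<alpha>"
proof -
  define m where "m = Min (\<alpha> ` \<sigma>)"
  have m0: "0 \<le> m" using nn \<sigma> by (auto simp: m_def)
  have mle: "m \<le> \<alpha> v" if "v \<in> \<sigma>" for v using that \<sigma> by (auto simp: m_def)
  have "m \<in> \<alpha> ` \<sigma>" unfolding m_def by (rule Min_in) (use \<sigma> in auto)
  then obtain v0 where v0: "v0 \<in> \<sigma>" "m = \<alpha> v0" by blast
  let ?f = "bistellar_map \<sigma> \<tau> \<alpha>"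
  have cs: "real (card \<sigma>) > 0" "real (card \<tau>) > 0"
    using \<sigma> \<tau> by (auto simp: card_gt_0_iff)
  have f: "?f v = \<alpha> v - (if v \<in> \<sigma> then m else 0) + (if v \<in> \<tau> then m * card \<sigma> / card \<tau> else 0)" for v
    unfolding bistellar_map_def m_def by simp
  have f1: "v \<in> \<sigma> \<Longrightarrow> ?f v = \<alpha> v - m" for v using disj by (auto simp: f)
  have f2: "v \<in> \<tau> \<Longrightarrow> ?f v = \<alpha> v + m * card \<sigma> / card \<tau>" for v using disj by (auto simp: f)
  have f3: "v \<notin> \<sigma> \<Longrightarrow> v \<notin> \<tau> \<Longrightarrow> ?f v = \<alpha> v" for v by (auto simp: f)
  have mc: "0 \<le> m * card \<sigma> / card \<tau>" using m0 by simp
  show "0 \<le> ?f v" for v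
    using f1[of v] f2[of v] f3[of v] nn[of v] mle[of v] mc by (cases "v \<in> \<sigma>"; cases "v \<in> \<tau>") auto
  show "?f = \<alpha>" if ns: "\<not> \<sigma> \<subseteq> supp \<alpha>"
  proof -
    obtain v where "v \<in> \<sigma>" "\<alpha> v = 0" using ns by (auto simp: supp_def)
    then have "m = 0" using mle[of v] m0 by simp
    then show ?thesis by (auto simp: f)
  qed
  show "\<exists>\<rho>. \<rho> \<subset> \<sigma> \<and> supp ?f = supp \<alpha> - \<sigma> \<union> \<rho> \<union> \<tau>" if "\<sigma> \<subseteq> supp \<alpha>"
  proof (intro exI conjI)
    have "m > 0" using v0 that nn[of v0] by (auto simp: supp_def order_less_le)
    then have mp: "m * card \<sigma> / card \<tau> > 0" using cs by simp
    show "{v \<in> \<sigma>. \<alpha> v \<noteq> m} \<subset> \<sigma>" using v0 by auto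
    show "supp ?f = supp \<alpha> - \<sigma> \<union> {v \<in> \<sigma>. \<alpha> v \<noteq> m} \<union> \<tau>"
    proof (rule set_eqI)
      fix v show "v \<in> supp ?f \<longleftrightarrow> v \<in> supp \<alpha> - \<sigma> \<union> {v \<in> \<sigma>. \<alpha> v \<noteq> m} \<union> \<tau>"
        using f1[of v] f2[of v] f3[of v] nn[of v] mp disj
        by (cases "v \<in> \<sigma>"; cases "v \<in> \<tau>") (auto simp: supp_def)
    qed
  qed
  show "sum ?f (supp ?f) = sum \<alpha> (supp \<alpha>)"
  proof -
    define A where "A = supp \<alpha> \<union> \<sigma> \<union> \<tau>"
    have fA: "finite A" using fin \<sigma> \<tau> by (auto simp: A_def)
    have "supp ?f \<subseteq> A" unfolding A_def using f3 by (auto simp: supp_def)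
    then have "sum ?f (supp ?f) = sum ?f A" using fA by (rule sum_supp)
    also have "\<dots> = sum \<alpha> A - (\<Sum>v\<in>A. if v \<in> \<sigma> then m else 0)
        + (\<Sum>v\<in>A. if v \<in> \<tau> then m * card \<sigma> / card \<tau> else 0)"
      by (simp add: f sum.distrib sum_subtractf)
    also have "(\<Sum>v\<in>A. if v \<in> \<sigma> then m else 0) = card \<sigma> * m"
    proof -
      have "A \<inter> \<sigma> = \<sigma>" by (auto simp: A_def)
      then show ?thesis using fA by (simp add: sum.If_cases)
    qed
    also have "(\<Sum>v\<in>A. if v \<in> \<tau> then m * card \<sigma> / card \<tau> else 0) = card \<sigma> * m"
    proof -
      have "A \<inter> \<tau> = \<tau>" by (auto simp: A_def)
      then show ?thesis using fA cs by (simp add: sum.If_cases)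
    qed
    also have "sum \<alpha> A = sum \<alpha> (supp \<alpha>)"
      by (rule sum_supp[symmetric]) (use fA in \<open>auto simp: A_def\<close>)
    finally show ?thesis by simp
  qed
  show "bistellar_map \<tau> \<sigma> ?f = \<alpha>" if nt: "\<not> \<tau> \<subseteq> supp \<alpha>"
  proof -
    let ?c = "m * card \<sigma> / card \<tau>"
    obtain w where w: "w \<in> \<tau>" "\<alpha> w = 0" using nt by (auto simp: supp_def)
    \<comment> \<open>Before the move some vertex of \<tau> has weight 0, so afterwards the least
      weight on \<tau> is exactly the amount added. The reverse map takes off precisely this
      amount.\<close>
    have "Min (?f ` \<tau>) = ?c"
    proof (rule Min_eqI)
      show "finite (?f ` \<tau>)" using \<tau> by simp
      show "?c \<le> y" if "y \<in> ?f ` \<tau>" for y using that f2 nn by auto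
      show "?c \<in> ?f ` \<tau>" using w f2[of w] by (auto intro!: image_eqI[of _ _ w])
    qed
    then have "bistellar_map \<tau> \<sigma> ?f v = ?f v - (if v \<in> \<tau> then ?c else 0) + (if v \<in> \<sigma> then m else 0)" for v
      unfolding bistellar_map_def[of \<tau> \<sigma>] using cs by simp
    then show ?thesis using f by (auto simp: fun_eq_iff)
  qed
qed

text \<open>\<open>lnk\<close> expresses the join structure of the star of \<sigma> without naming
  the third factor: in a simplex above \<sigma> the part inside \<tau> may be exchanged for any
  proper face of \<tau>. Since \<tau> is not a simplex of \<open>K\<close>, the reverse map undoes
  the move.\<close>

locale bistellar_move =
  fixes K :: "'v set set" and \<sigma> \<tau> :: "'v set"
  assumes K: "abstract_2_complex K"
    and \<sigma>: "finite \<sigma>" "\<sigma> \<noteq> {}" and \<tau>: "finite \<tau>" "\<tau> \<noteq> {}" and disj: "\<sigma> \<inter> \<tau> = {}"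
    and \<tau>K: "\<tau> \<notin> K"
    and lnk: "\<And>s \<rho>. s \<in> K \<Longrightarrow> \<sigma> \<subseteq> s \<Longrightarrow> \<rho> \<subset> \<tau> \<Longrightarrow> s - \<tau> \<union> \<rho> \<in> K"
begin

abbreviation "K' \<equiv> bistellar \<sigma> \<tau> K"

lemma not_tau: "s \<in> K \<Longrightarrow> \<not> \<tau> \<subseteq> s"
  using complex_mono[OF K] \<tau>K \<tau> by blast

lemma mem_cases:
  assumes "t \<in> K'"
  obtains "t \<in> K" "\<not> \<sigma> \<subseteq> t" "\<not> \<tau> \<subseteq> t"
  | s \<rho> where "t = s - \<sigma> \<union> \<rho> \<union> \<tau>" "s \<in> K" "\<sigma> \<subseteq> s" "\<rho> \<subset> \<sigma>" "\<tau> \<subseteq> t" "\<not> \<sigma> \<subseteq> t"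
  using assms not_tau disj unfolding bistellar_def by blast

lemma complex: "abstract_2_complex K'"
  unfolding abstract_2_complex_def
proof (intro conjI ballI allI impI)
  have "K' \<subseteq> K \<union> (\<lambda>(s, \<rho>). s - \<sigma> \<union> \<rho> \<union> \<tau>) ` (K \<times> Pow \<sigma>)"
    unfolding bistellar_def by auto
  then show "finite K'" by (rule finite_subset) (use complex_finite_all[OF K] \<sigma> in auto)
next
  fix t assume t: "t \<in> K'"
  then show "t \<noteq> {}" "finite t"
    by (cases rule: mem_cases; use complex_finite[OF K] complex_nonempty[OF K] \<sigma> \<tau> finite_subset in auto)+
  show "card t \<le> 3" using t
  proof (cases rule: mem_cases)
    case 1 then show ?thesis using complex_card[OF K] by simp
  next
    case (2 s \<rho>)
    \<comment> \<open>The dimension does not grow: \<open>s\<close> can take in all of \<tau> except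
      \<open>x\<close>, and trading a vertex \<open>y\<close> of \<sigma> outside \<rho> for
      \<open>x\<close> keeps the size.\<close>
    obtain x where x: "x \<in> \<tau>" "x \<notin> s" using not_tau[OF 2(2)] by auto
    have u: "s - \<tau> \<union> (\<tau> - {x}) \<in> K" by (rule lnk) (use 2 x in auto)
    obtain y where y: "y \<in> \<sigma>" "y \<notin> \<rho>" using 2 by auto
    have fs: "finite s" using complex_finite[OF K] 2 by simp
    have "t \<subseteq> insert x ((s - \<tau> \<union> (\<tau> - {x})) - {y})" using 2 x y disj by auto
    moreover have "y \<in> s - \<tau> \<union> (\<tau> - {x})" using y 2 disj by auto
    ultimately have "card t \<le> card (insert x ((s - \<tau> \<union> (\<tau> - {x})) - {y}))"
      by (intro card_mono) (use fs \<tau> in auto)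
    also have "\<dots> \<le> Suc (card ((s - \<tau> \<union> (\<tau> - {x})) - {y}))" by (rule card_insert_le_m1[THEN order_trans]) (auto simp: fs \<tau> card_insert_if)
    also have "\<dots> = card (s - \<tau> \<union> (\<tau> - {x}))"
      using \<open>y \<in> s - \<tau> \<union> (\<tau> - {x})\<close> fs \<tau> by (metis card_Suc_Diff1 finite_Diff finite_UnI)
    also have "\<dots> \<le> 3" using complex_card[OF K u] .
    finally show ?thesis .
  qed
next
  fix t u assume t: "t \<in> K'" and u: "u \<subseteq> t \<and> u \<noteq> {}"
  show "u \<in> K'" using t
  proof (cases rule: mem_cases)
    case 1 then show ?thesis using complex_mono[OF K] u by (auto simp: bistellar_def)
  next
    case (2 s \<rho>)
    show ?thesis
    proof (cases "\<tau> \<subseteq> u")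
      case True
      have "u = (s \<inter> u \<union> \<sigma>) - \<sigma> \<union> (u \<inter> \<sigma>) \<union> \<tau>" using 2 u True by auto
      moreover have "s \<inter> u \<union> \<sigma> \<in> K" by (rule complex_mono[OF K 2(2)]) (use 2 \<sigma> in auto)
      moreover have "u \<inter> \<sigma> \<subset> \<sigma>" using 2 u by auto
      ultimately show ?thesis unfolding bistellar_def by blast
    next
      case False
      have "s - \<tau> \<union> (u \<inter> \<tau>) \<in> K" by (rule lnk) (use 2 False in auto)
      moreover have "u \<subseteq> s - \<tau> \<union> (u \<inter> \<tau>)" using u 2 by auto
      ultimately have "u \<in> K" using complex_mono[OF K] u by blast
      moreover have "\<not> \<sigma> \<subseteq> u" using 2 u by auto
      ultimately show ?thesis by (auto simp: bistellar_def)
    qed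
  qed
qed

text \<open>This makes the reverse map land in \<open>K\<close>: the simplex of \<open>K\<close>
  behind \<open>t\<close> contributes its part outside \<tau>, and \<open>lnk\<close> lets any
  proper face of \<tau> be added.\<close>

lemma reverse: assumes "t \<in> K'" "\<tau> \<subseteq> t" "\<rho> \<subset> \<tau>"
  shows "t - \<tau> \<union> \<rho> \<union> \<sigma> \<in> K"
  using assms(1)
proof (cases rule: mem_cases)
  case 1 then show ?thesis using assms by simp
next
  case (2 s \<rho>')
  have "t - \<tau> \<union> \<rho> \<union> \<sigma> = s - \<tau> \<union> \<rho>" using 2 disj by auto
  then show ?thesis using lnk[of s \<rho>] 2 assms by auto
qed

lemma maps_to: "\<alpha> \<in> realization K \<Longrightarrow> bistellar_map \<sigma> \<tau> \<alpha> \<in> realization K'"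
proof -
  assume "\<alpha> \<in> realization K"
  then have a: "\<And>v. 0 \<le> \<alpha> v" "supp \<alpha> \<in> K" "sum \<alpha> (supp \<alpha>) = 1"
    by (auto simp: realization_iff)
  note p = bistellar_map_properties[OF \<sigma> \<tau> disj a(1) complex_finite[OF K a(2)]]
  have "supp (bistellar_map \<sigma> \<tau> \<alpha>) \<in> K'"
  proof (cases "\<sigma> \<subseteq> supp \<alpha>")
    case True then show ?thesis using p(3) a(2) unfolding bistellar_def by blast
  next
    case False then show ?thesis using p(2) a(2) unfolding bistellar_def by simp
  qed
  then show ?thesis using p(1,4) a(3) by (simp add: realization_iff)
qed

lemma maps_back: "\<beta> \<in> realization K' \<Longrightarrow> bistellar_map \<tau> \<sigma> \<beta> \<in> realization K"
proof -
  assume "\<beta> \<in> realization K'"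
  then have a: "\<And>v. 0 \<le> \<beta> v" "supp \<beta> \<in> K'" "sum \<beta> (supp \<beta>) = 1"
    by (auto simp: realization_iff)
  have disj': "\<tau> \<inter> \<sigma> = {}" using disj by auto
  note p = bistellar_map_properties[OF \<tau> \<sigma> disj' a(1) complex_finite[OF complex a(2)]]
  have "supp (bistellar_map \<tau> \<sigma> \<beta>) \<in> K"
  proof (cases "\<tau> \<subseteq> supp \<beta>")
    case True then show ?thesis using p(3) reverse[OF a(2)] by (metis)
  next
    case False then show ?thesis using p(2) a(2) mem_cases by metis
  qed
  then show ?thesis using p(1,4) a(3) by (simp add: realization_iff)
qed

lemma homeomorphic_maps:
  "homeomorphic_maps (top_of_set (realization K)) (top_of_set (realization K'))
     (bistellar_map \<sigma> \<tau>) (bistellar_map \<tau> \<sigma>)"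
  unfolding homeomorphic_maps_def
proof (intro conjI ballI)
  show "continuous_map (top_of_set (realization K)) (top_of_set (realization K')) (bistellar_map \<sigma> \<tau>)"
    using maps_to by (auto simp: continuous_on_bistellar_map \<sigma>)
  show "continuous_map (top_of_set (realization K')) (top_of_set (realization K)) (bistellar_map \<tau> \<sigma>)"
    using maps_back by (auto simp: continuous_on_bistellar_map \<tau>)
next
  fix \<alpha> assume "\<alpha> \<in> topspace (top_of_set (realization K))"
  then have a: "\<And>v. 0 \<le> \<alpha> v" "supp \<alpha> \<in> K" by (auto simp: realization_iff)
  show "bistellar_map \<tau> \<sigma> (bistellar_map \<sigma> \<tau> \<alpha>) = \<alpha>"
    using bistellar_map_properties(5)[OF \<sigma> \<tau> disj a(1) complex_finite[OF K a(2)]] not_tau a(2) by auto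
next
  fix \<beta> assume "\<beta> \<in> topspace (top_of_set (realization K'))"
  then have a: "\<And>v. 0 \<le> \<beta> v" "supp \<beta> \<in> K'" by (auto simp: realization_iff)
  have disj': "\<tau> \<inter> \<sigma> = {}" using disj by auto
  have "\<not> \<sigma> \<subseteq> supp \<beta>" using a(2) by (cases rule: mem_cases) auto
  then show "bistellar_map \<sigma> \<tau> (bistellar_map \<tau> \<sigma> \<beta>) = \<beta>"
    using bistellar_map_properties(5)[OF \<tau> \<sigma> disj' a(1) complex_finite[OF complex a(2)]] by auto
qed

lemma homeomorphic:
  "top_of_set (realization K) homeomorphic_space top_of_set (realization K')"
  using homeomorphic_maps unfolding homeomorphic_space_def by blast

end

section \<open>Invariance of domain for punctured surfaces\<close>

text \<open>In contrast to \<open>disk_nbhd_at\<close>, the set need not be open. A disk found in a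
  subcomplex is thus also a disk in the whole complex, and openness comes afterwards from invariance
  of domain, in \<open>disk_open\<close>.\<close>

definition disk_in :: "'b topology \<Rightarrow> 'b set \<Rightarrow> bool" where
  "disk_in X U \<longleftrightarrow> U \<subseteq> topspace X \<and> subtopology X U homeomorphic_space open_disk"

lemma disk_nbhd_at_iff: "disk_nbhd_at X x \<longleftrightarrow> (\<exists>U. openin X U \<and> x \<in> U \<and> disk_in X U)"
  unfolding disk_nbhd_at_def disk_in_def using openin_subset by blast

lemma disk_inE:
  assumes "disk_in X U"
  obtains \<psi> \<xi> where "continuous_map open_disk X \<psi>" "\<psi> ` ball 0 1 = U" "inj_on \<psi> (ball 0 1)"
    "continuous_map (subtopology X U) euclidean \<xi>" "\<And>z. z \<in> ball 0 1 \<Longrightarrow> \<xi> (\<psi> z) = z"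
    "\<And>x. x \<in> U \<Longrightarrow> \<xi> x \<in> ball 0 1 \<and> \<psi> (\<xi> x) = x" "homeomorphic_map open_disk (subtopology X U) \<psi>"
proof -
  have U: "U \<subseteq> topspace X" and "subtopology X U homeomorphic_space open_disk"
    using assms unfolding disk_in_def by auto
  then have "open_disk homeomorphic_space subtopology X U"
    using homeomorphic_space_sym by blast
  then obtain \<psi> \<xi> where m: "homeomorphic_maps open_disk (subtopology X U) \<psi> \<xi>"
    unfolding homeomorphic_space_def by blast
  have *: "continuous_map open_disk (subtopology X U) \<psi>" "continuous_map (subtopology X U) open_disk \<xi>"
    "\<And>z. z \<in> ball 0 1 \<Longrightarrow> \<xi> (\<psi> z) = z" "\<And>x. x \<in> U \<Longrightarrow> \<psi> (\<xi> x) = x"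
    using m U unfolding homeomorphic_maps_def by auto
  have im: "\<psi> ` ball 0 1 \<subseteq> U" "\<xi> ` U \<subseteq> ball 0 1"
    using continuous_map_image_subset_topspace[OF *(1)] continuous_map_image_subset_topspace[OF *(2)] U
    by (auto simp: Int_absorb1 simp del: mem_ball)
  show thesis
  proof
    show "continuous_map open_disk X \<psi>" using *(1) continuous_map_into_fulltopology by blast
    show "continuous_map (subtopology X U) euclidean \<xi>" using *(2) continuous_map_into_fulltopology by blast
    show "\<psi> ` ball 0 1 = U" using im * by (force simp del: mem_ball simp: image_subset_iff)
    show "inj_on \<psi> (ball 0 1)" using * by (metis inj_onI)
    show "homeomorphic_map open_disk (subtopology X U) \<psi>" using m homeomorphic_map_maps by blast
  qed (use * im in \<open>auto simp del: mem_ball\<close>)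
qed

lemma disk_in_homeomorphic_map:
  assumes "homeomorphic_map X Y f" "U \<subseteq> topspace X"
  shows "disk_in Y (f ` U) \<longleftrightarrow> disk_in X U"
proof -
  have "homeomorphic_map (subtopology X U) (subtopology Y (f ` U)) f"
    by (rule homeomorphic_map_subtopologies[OF assms(1)])
      (use assms homeomorphic_imp_surjective_map[OF assms(1)] in auto)
  then have "subtopology X U homeomorphic_space subtopology Y (f ` U)"
    using homeomorphic_map_imp_homeomorphic_space by blast
  then show ?thesis
    unfolding disk_in_def using assms homeomorphic_imp_surjective_map[OF assms(1)]
    by (metis homeomorphic_space_sym homeomorphic_space_trans image_mono)
qed

text \<open>Through a disk chart at \<open>p\<close> the map \<phi> becomes injective and continuous
  on an open planar set, so invariance of domain applies. With barycentric coordinates as \<phi> it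
  shows that a point with too few faces around it has no disk neighbourhood.\<close>

lemma planar_chart_open:
  fixes \<phi> :: "'b \<Rightarrow> complex"
  assumes "disk_nbhd_at X p" "openin X W" "p \<in> W"
    and "continuous_map (subtopology X W) euclidean \<phi>" "inj_on \<phi> W"
  shows "\<exists>e>0. ball (\<phi> p) e \<subseteq> \<phi> ` W"
proof -
  obtain U where U: "openin X U" "p \<in> U" "disk_in X U" using assms disk_nbhd_at_iff by metis
  obtain \<psi> \<xi> where c: "continuous_map open_disk X \<psi>" "\<psi> ` ball 0 1 = U" "inj_on \<psi> (ball 0 1)"
    using U(3) by (elim disk_inE)
  define B where "B = {z \<in> ball 0 1. \<psi> z \<in> W}"
  have "openin open_disk {z \<in> topspace open_disk. \<psi> z \<in> W}"
    using openin_continuous_map_preimage c assms by blast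
  then have oB: "open B" unfolding B_def by (simp add: openin_open_eq)
  have "continuous_map (top_of_set B) (subtopology X W) \<psi>"
    using c(1) by (auto simp: continuous_map_in_subtopology B_def subtopology_subtopology
       intro!: continuous_map_from_subtopology_mono[of euclidean "ball 0 1"])
  then have "continuous_map (top_of_set B) euclidean (\<phi> \<circ> \<psi>)"
    using assms(4) continuous_map_compose by blast
  then have "continuous_on B (\<phi> \<circ> \<psi>)" by simp
  moreover have "inj_on (\<phi> \<circ> \<psi>) B"
    using c(3) assms(5) unfolding B_def by (auto simp: inj_on_def)
  ultimately have "open ((\<phi> \<circ> \<psi>) ` B)" using oB invariance_of_domain by blast
  moreover have "\<phi> p \<in> (\<phi> \<circ> \<psi>) ` B"
    using U c(2) assms(3) unfolding B_def by auto
  ultimately obtain e where "e > 0" "ball (\<phi> p) e \<subseteq> (\<phi> \<circ> \<psi>) ` B"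
    by (meson open_contains_ball)
  then show ?thesis unfolding B_def by (intro exI[of _ e]) auto
qed

lemma homeomorphic_imp_homeomorphic_space:
  assumes "A homeomorphic B"
  shows "top_of_set A homeomorphic_space top_of_set B"
proof -
  obtain f g where "homeomorphism A B f g" using assms unfolding homeomorphic_def by blast
  then have "homeomorphic_maps (top_of_set A) (top_of_set B) f g"
    unfolding homeomorphism_def homeomorphic_maps_def by auto
  then show ?thesis unfolding homeomorphic_space_def by blast
qed

lemma disk_nbhd_shrink:
  assumes "disk_nbhd_at X p" "openin X V" "p \<in> V"
  shows "\<exists>U. openin X U \<and> p \<in> U \<and> disk_in X U \<and> U \<subseteq> V"
proof -
  obtain U where U: "openin X U" "p \<in> U" "disk_in X U" using assms disk_nbhd_at_iff by metis
  obtain \<psi> \<xi> where c: "continuous_map open_disk X \<psi>" "\<psi> ` ball 0 1 = U"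
    and \<xi>: "\<And>x. x \<in> U \<Longrightarrow> \<xi> x \<in> ball 0 1 \<and> \<psi> (\<xi> x) = x"
    and h: "homeomorphic_map open_disk (subtopology X U) \<psi>"
    by (rule disk_inE[OF U(3)]) (assumption | rule that)+
  have "openin open_disk {z \<in> topspace open_disk. \<psi> z \<in> V}"
    using openin_continuous_map_preimage c assms by blast
  then have "open {z \<in> ball 0 1. \<psi> z \<in> V}" by (simp add: openin_open_eq)
  moreover have "\<xi> p \<in> {z \<in> ball 0 1. \<psi> z \<in> V}" using \<xi>[OF U(2)] assms by auto
  ultimately obtain e where e: "e > 0" "ball (\<xi> p) e \<subseteq> {z \<in> ball 0 1. \<psi> z \<in> V}"
    by (meson open_contains_ball)
  define B where "B = ball (\<xi> p) e"
  have B: "B \<subseteq> ball 0 1" "\<psi> ` B \<subseteq> V" "\<psi> ` B \<subseteq> U" "\<xi> p \<in> B"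
    using e c(2) unfolding B_def by auto
  show ?thesis
  proof (intro exI conjI)
    have "openin open_disk B" using B unfolding B_def by (simp add: openin_open_eq)
    then have "openin (subtopology X U) (\<psi> ` B)"
      using homeomorphic_map_openness[OF h, of B] B by simp
    then show "openin X (\<psi> ` B)" using U(1) openin_open_subtopology by metis
    show "p \<in> \<psi> ` B" using \<xi>[OF U(2)] B by (metis imageI)
    show "\<psi> ` B \<subseteq> V" using B by simp
    have "B homeomorphic (ball 0 1 :: complex set)"
      unfolding B_def by (rule homeomorphic_balls) (use e in auto)
    then have "subtopology open_disk B homeomorphic_space open_disk"
      using B(1) homeomorphic_imp_homeomorphic_space by (simp add: subtopology_subtopology Int_absorb1)
    then have "disk_in open_disk B" using B(1) by (simp add: disk_in_def)
    then have "disk_in (subtopology X U) (\<psi> ` B)"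
      using disk_in_homeomorphic_map[OF h, of B] B by simp
    then show "disk_in X (\<psi> ` B)"
      using B(3) by (auto simp: disk_in_def subtopology_subtopology Int_absorb1)
  qed
qed

text \<open>Openness is local, so the planar theorem can be used in a disk chart around each image
  point.\<close>

lemma invariance_of_domain_surface:
  fixes \<psi> :: "complex \<Rightarrow> 'b"
  assumes S: "\<And>x. x \<in> topspace S \<Longrightarrow> disk_nbhd_at S x"
    and "open B" "continuous_map (top_of_set B) S \<psi>" "inj_on \<psi> B"
  shows "openin S (\<psi> ` B)"
  unfolding openin_subopen[of S "\<psi> ` B"]
proof
  fix p assume "p \<in> \<psi> ` B"
  then obtain z where z: "z \<in> B" "p = \<psi> z" by auto
  have pS: "p \<in> topspace S"
    using continuous_map_image_subset_topspace[OF assms(3)] z by auto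
  obtain U where U: "openin S U" "p \<in> U" "disk_in S U"
    using S[OF pS] unfolding disk_nbhd_at_iff by metis
  obtain \<psi>' and \<xi> :: "'b \<Rightarrow> complex" where c: "continuous_map (subtopology S U) euclidean \<xi>"
    and \<xi>: "\<And>x. x \<in> U \<Longrightarrow> \<xi> x \<in> ball 0 1 \<and> \<psi>' (\<xi> x) = x"
    by (rule disk_inE[OF U(3)]) (assumption | rule that)+
  define B' where "B' = {w \<in> B. \<psi> w \<in> U}"
  have "openin (top_of_set B) {w \<in> topspace (top_of_set B). \<psi> w \<in> U}"
    using openin_continuous_map_preimage assms U by blast
  then have oB: "open B'" unfolding B'_def using assms(2) by (simp add: openin_open_eq)
  have "continuous_map (top_of_set B') (subtopology S U) \<psi>"
    using assms(3) by (auto simp: continuous_map_in_subtopology B'_def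
       intro!: continuous_map_from_subtopology_mono[of euclidean B])
  then have "continuous_map (top_of_set B') euclidean (\<xi> \<circ> \<psi>)"
    using c continuous_map_compose by blast
  then have "continuous_on B' (\<xi> \<circ> \<psi>)" by simp
  moreover have "inj_on (\<xi> \<circ> \<psi>) B'"
    using assms(4) \<xi> unfolding B'_def by (smt (verit) comp_apply inj_on_def mem_Collect_eq)
  ultimately have o: "open ((\<xi> \<circ> \<psi>) ` B')" using oB invariance_of_domain by blast
  have "openin (subtopology S U) {x \<in> topspace (subtopology S U). \<xi> x \<in> (\<xi> \<circ> \<psi>) ` B'}"
    by (rule openin_continuous_map_preimage[OF c]) (use o in simp)
  moreover have "{x \<in> topspace (subtopology S U). \<xi> x \<in> (\<xi> \<circ> \<psi>) ` B'} = \<psi> ` B'"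
  proof -
    have "x \<in> \<psi> ` B'" if "x \<in> U" "\<xi> x = \<xi> (\<psi> w)" "w \<in> B'" for x w
      using \<xi>[of x] \<xi>[of "\<psi> w"] that unfolding B'_def by (metis (mono_tags, lifting) image_eqI mem_Collect_eq)
    moreover have "U \<subseteq> topspace S" using U openin_subset by blast
    ultimately show ?thesis unfolding B'_def by auto
  qed
  ultimately have "openin (subtopology S U) (\<psi> ` B')" by simp
  then have "openin S (\<psi> ` B')" using U(1) openin_open_subtopology by metis
  moreover have "p \<in> \<psi> ` B'" "\<psi> ` B' \<subseteq> \<psi> ` B" using z U unfolding B'_def by auto
  ultimately show "\<exists>T. openin S T \<and> p \<in> T \<and> T \<subseteq> \<psi> ` B" by blast
qed

section \<open>The complement of an open disk in a closed surface\<close>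

locale punctured =
  fixes X :: "'b topology" and S :: "'a topology" and h :: "complex \<Rightarrow> 'a" and k :: "'b \<Rightarrow> 'a"
  assumes S: "closed_surface S" and h: "embedding_map closed_disk S h"
    and k: "homeomorphic_map X (subtopology S (topspace S - h ` ball 0 1)) k"
begin

lemma Sd: "x \<in> topspace S \<Longrightarrow> disk_nbhd_at S x"
  and SH: "Hausdorff_space S" and SC: "connected_space S"
  using S unfolding closed_surface_def by auto

abbreviation "F0 \<equiv> topspace S - h ` ball 0 1"

lemma hc: "continuous_map closed_disk S h"
  and hinj: "inj_on h (cball 0 1)"
  and himg: "h ` cball 0 1 \<subseteq> topspace S"
proof -
  have hm: "homeomorphic_map closed_disk (subtopology S (h ` topspace closed_disk)) h"
    using h unfolding embedding_map_def .
  show *: "continuous_map closed_disk S h"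
    using homeomorphic_imp_continuous_map[OF hm] continuous_map_into_fulltopology by blast
  show "inj_on h (cball 0 1)" using homeomorphic_imp_injective_map[OF hm] by simp
  show "h ` cball 0 1 \<subseteq> topspace S" using continuous_map_image_subset_topspace[OF *] by simp
qed

text \<open>It makes \<open>F0\<close> closed in \<open>S\<close>, on which both the connectedness
  of the punctured surface and the existence of boundary points rest.\<close>

lemma open_hball: "openin S (h ` ball 0 1)"
proof (rule invariance_of_domain_surface)
  show "continuous_map open_disk S h"
    using hc by (rule continuous_map_from_subtopology_mono) auto
  show "inj_on h (ball 0 1)" using hinj by (rule inj_on_subset) auto
qed (use Sd in auto)

lemma compact_h: "compact T \<Longrightarrow> T \<subseteq> cball 0 1 \<Longrightarrow> closedin S (h ` T)"
  by (rule compactin_imp_closedin[OF SH], rule image_compactin[OF _ hc])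
    (simp add: compactin_subtopology compactin_euclidean_iff)

lemma hmem: "z \<in> cball 0 1 \<Longrightarrow> h z \<in> F0 \<longleftrightarrow> z \<notin> ball 0 1"
proof -
  assume z: "z \<in> cball 0 1"
  have "h z \<in> h ` ball 0 1 \<longleftrightarrow> z \<in> ball 0 1"
    using inj_on_image_mem_iff[OF hinj z ball_subset_cball] .
  then show ?thesis using himg z by blast
qed

lemma kc: "continuous_map X S k" and kinj: "inj_on k (topspace X)" and kimg: "k ` topspace X = F0"
proof -
  show "continuous_map X S k"
    using homeomorphic_imp_continuous_map[OF k] continuous_map_into_fulltopology by blast
  show "inj_on k (topspace X)" using homeomorphic_imp_injective_map[OF k] .
  show "k ` topspace X = F0" using homeomorphic_imp_surjective_map[OF k] by auto
qed

lemma k_preimage_open: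
  assumes "openin S V" "V = k ` U" "U \<subseteq> topspace X" shows "openin X U"
proof -
  have "U = {x \<in> topspace X. k x \<in> V}" using assms kinj by (auto simp: inj_on_def)
  then show ?thesis using openin_continuous_map_preimage[OF kc assms(1)] by simp
qed

text \<open>The ambient surface \<open>S\<close> is used because all of its points have disk
  neighbourhoods, which fails in \<open>X\<close>. So the image of a disk is open in
  \<open>S\<close> even if the disk was not assumed open in \<open>X\<close>.\<close>

lemma disk_open_image: assumes "disk_in X U" shows "openin S (k ` U)"
proof -
  obtain \<psi> \<xi> where c: "continuous_map open_disk X \<psi>" "\<psi> ` ball 0 1 = U" "inj_on \<psi> (ball 0 1)"
    using assms by (elim disk_inE)
  have U: "U \<subseteq> topspace X" using assms unfolding disk_in_def by simp
  have "openin S ((k \<circ> \<psi>) ` ball 0 1)"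
  proof (rule invariance_of_domain_surface)
    show "continuous_map open_disk S (k \<circ> \<psi>)" using c(1) kc continuous_map_compose by blast
    show "inj_on (k \<circ> \<psi>) (ball 0 1)"
      by (rule comp_inj_on) (use c U kinj inj_on_subset in metis)+
  qed (use Sd in auto)
  then show ?thesis using c(2) by (metis image_comp)
qed

lemma disk_open: "disk_in X U \<Longrightarrow> openin X U"
  using k_preimage_open disk_open_image unfolding disk_in_def by blast

text \<open>A point off the closed disk inherits a small disk from \<open>S\<close>. If no point of
  \<open>W\<close> were off the closed disk, an open set \<open>W'\<close> of \<open>S\<close>
  extending the image of \<open>W\<close> would lie in the closed disk, and the inverse of
  \<open>h\<close> would map it onto a planar set that is a neighbourhood of each of its points. A
  point on the circle would then be interior to \<open>cball 0 1\<close>.\<close>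

lemma disk_points_dense:
  assumes "openin X W" "W \<noteq> {}"
  shows "\<exists>x\<in>W. disk_nbhd_at X x"
proof -
  have WX: "W \<subseteq> topspace X" using assms openin_subset by blast
  have kW: "k ` W \<subseteq> F0" using WX kimg by blast
  show ?thesis
  proof (cases "\<exists>x\<in>W. k x \<notin> h ` cball 0 1")
    case True
    then obtain x where x: "x \<in> W" "k x \<notin> h ` cball 0 1" by auto
    have "k x \<in> topspace S" using x kW by auto
    moreover have "openin S (topspace S - h ` cball 0 1)"
      using compact_h[of "cball 0 1"] by auto
    ultimately obtain U where U: "openin S U" "k x \<in> U" "disk_in S U" "U \<subseteq> topspace S - h ` cball 0 1"
      using disk_nbhd_shrink[OF Sd[of "k x"], of "topspace S - h ` cball 0 1"] x by auto
    have UF: "U \<subseteq> F0" using U(4) ball_subset_cball by blast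
    define U' where "U' = {x \<in> topspace X. k x \<in> U}"
    have U': "U' \<subseteq> topspace X" unfolding U'_def by blast
    have kU': "k ` U' = U"
    proof (rule set_eqI)
      fix y
      have "y \<in> U \<Longrightarrow> y \<in> k ` topspace X" using UF kimg by blast
      then show "y \<in> k ` U' \<longleftrightarrow> y \<in> U" unfolding U'_def by auto
    qed
    have "openin X U'" using k_preimage_open[OF U(1)] U' kU' by simp
    moreover have "x \<in> U'" using x WX U unfolding U'_def by auto
    moreover have "disk_in (subtopology S F0) U"
      using U(3) UF by (auto simp: disk_in_def subtopology_subtopology Int_absorb1)
    then have "disk_in X U'" using disk_in_homeomorphic_map[OF k, of U'] U' kU' by simp
    ultimately have "disk_nbhd_at X x" unfolding disk_nbhd_at_iff by metis
    then show ?thesis using x(1) by metis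
  next
    case False
    obtain W' where W': "openin S W'" "k ` W = W' \<inter> F0"
    proof -
      have "openin (subtopology S F0) (k ` W)"
        using homeomorphic_map_openness[OF k, of W] assms WX by simp
      then show ?thesis using that by (auto simp: openin_subtopology)
    qed
    have W'h: "W' \<subseteq> h ` cball 0 1"
    proof
      fix y assume y: "y \<in> W'"
      show "y \<in> h ` cball 0 1"
      proof (cases "y \<in> F0")
        case True
        then have "y \<in> k ` W" unfolding W'(2) using y by (rule IntI[rotated])
        then show ?thesis using False by (metis imageE)
      next
        case f: False
        then have "y \<in> h ` ball 0 1" using y W' openin_subset by blast
        then show ?thesis using ball_subset_cball by blast
      qed
    qed
    obtain p where p: "p \<in> W'" "p \<in> F0" using assms(2) W' by blast
    have hm: "homeomorphic_map closed_disk (subtopology S (h ` cball 0 1)) h"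
      using h unfolding embedding_map_def by simp
    then obtain g' where g': "homeomorphic_maps closed_disk (subtopology S (h ` cball 0 1)) h g'"
      using homeomorphic_map_maps by blast
    have "continuous_map (subtopology S (h ` cball 0 1)) closed_disk g'"
      using g' unfolding homeomorphic_maps_def by blast
    then have gc: "continuous_map (subtopology S W') euclidean g'"
      using W'h continuous_map_from_subtopology_mono continuous_map_into_fulltopology by blast
    have g'h: "\<And>z. z \<in> cball 0 1 \<Longrightarrow> g' (h z) = z"
      using g' unfolding homeomorphic_maps_def by simp
    have img: "\<And>y. y \<in> W' \<Longrightarrow> g' y \<in> cball 0 1 \<and> h (g' y) = y"
    proof -
      fix y assume "y \<in> W'"
      then obtain z where "z \<in> cball 0 1" "y = h z" using W'h by blast
      then show "g' y \<in> cball 0 1 \<and> h (g' y) = y" using g'h by metis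
    qed
    have "inj_on g' W'" using img by (metis inj_onI)
    then obtain e where e: "e > 0" "ball (g' p) e \<subseteq> g' ` W'"
      using planar_chart_open[OF Sd W'(1) p(1) gc] p by auto
    have "g' p \<in> interior (cball 0 1)"
    proof -
      have "g' ` W' \<subseteq> cball 0 1" using img by (auto simp del: mem_cball)
      then show ?thesis using e unfolding mem_interior by (meson subset_trans)
    qed
    then have "g' p \<in> ball 0 1" by simp
    then have "p \<in> h ` ball 0 1" using img[OF p(1)] by (metis imageI)
    then show ?thesis using p by simp
  qed
qed

text \<open>If \<open>F0\<close> fell into two closed pieces, the circle, being connected, would lie
  in one of them. Adding the closed disk to that piece would then separate \<open>S\<close>.\<close>

lemma connected_X: "connected_space X"
proof -
  have "connectedin S F0"
  proof (rule ccontr)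
    assume "\<not> connectedin S F0"
    then have "\<not> connected_space (subtopology S F0)" unfolding connectedin_def by auto
    then obtain A B where AB: "closedin (subtopology S F0) A" "closedin (subtopology S F0) B"
      "F0 \<subseteq> A \<union> B" "A \<inter> B = {}" "A \<noteq> {}" "B \<noteq> {}"
      unfolding connected_space_closedin by (auto simp: Int_absorb1)
    have cF: "closedin S F0" using open_hball by auto
    then have cl: "closedin S A" "closedin S B"
      using AB closedin_closed_subtopology by blast+
    have sub: "A \<subseteq> F0" "B \<subseteq> F0"
      using closedin_subset[OF AB(1)] closedin_subset[OF AB(2)] by auto
    have cs: "connectedin S (h ` sphere 0 1)"
      by (rule connectedin_continuous_map_image[OF hc])
        (auto simp: connectedin_subtopology connectedin_iff_connected intro!: connected_sphere)
    have sF: "h ` sphere 0 1 \<subseteq> F0" using hmem by force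
    have key: False if A: "closedin S A" "A \<subseteq> F0" and B: "closedin S B" "B \<subseteq> F0"
      and u: "F0 \<subseteq> A \<union> B" "A \<inter> B = {}" "B \<noteq> {}" and s: "h ` sphere 0 1 \<subseteq> A" for A B
    proof -
      define A' where "A' = A \<union> h ` cball 0 1"
      have "closedin S A'" unfolding A'_def using A compact_h[of "cball 0 1"] by auto
      moreover have "topspace S \<subseteq> A' \<union> B" unfolding A'_def using u ball_subset_cball by blast
      moreover have "h ` cball 0 1 \<inter> B = {}"
      proof -
        have "y \<notin> B" if "y = h z" "z \<in> cball 0 1" for y z
        proof (cases "z \<in> ball 0 1")
          case True then show ?thesis using B that by blast
        next
          case False
          then have "z \<in> sphere 0 1" using that by auto
          then show ?thesis using s u that by blast
        qed
        then show ?thesis by blast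
      qed
      then have "A' \<inter> B = {}" unfolding A'_def using u by blast
      moreover have "A' \<noteq> {}" unfolding A'_def by auto
      ultimately show False using SC B u(3) unfolding connected_space_closedin by blast
    qed
    have "h ` sphere 0 1 \<subseteq> A \<or> h ` sphere 0 1 \<subseteq> B"
    proof (rule ccontr)
      assume "\<not> ?thesis"
      then have "h ` sphere 0 1 \<inter> A \<noteq> {}" "h ` sphere 0 1 \<inter> B \<noteq> {}" using sF AB(3) by blast+
      moreover have "A \<inter> B \<inter> h ` sphere 0 1 = {}" "h ` sphere 0 1 \<subseteq> A \<union> B"
        using AB(3,4) sF by blast+
      ultimately show False
        using cs cl unfolding connectedin_closedin by (metis Int_commute)
    qed
    then show False using key[of A B] key[of B A] cl sub AB by blast
  qed
  then have "connected_space (subtopology S F0)" unfolding connectedin_def by simp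
  then show ?thesis
    using homeomorphic_connected_space[OF homeomorphic_map_imp_homeomorphic_space[OF k]] by simp
qed

text \<open>Otherwise \<open>disk_open_image\<close> would make \<open>F0\<close> open as well as
  closed in the connected surface \<open>S\<close>, although it contains \<open>h 1\<close> and
  misses \<open>h 0\<close>.\<close>

lemma exists_boundary_point: "\<exists>x\<in>topspace X. \<not> disk_nbhd_at X x"
proof (rule ccontr)
  assume a: "\<not> ?thesis"
  have "openin S F0"
    unfolding openin_subopen[of S F0]
  proof
    fix y assume "y \<in> F0"
    then obtain x where x: "x \<in> topspace X" "y = k x" using kimg by blast
    then obtain U where U: "openin X U" "x \<in> U" "disk_in X U" using a disk_nbhd_at_iff by metis
    then have "openin S (k ` U)" "k ` U \<subseteq> F0" "y \<in> k ` U"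
      using disk_open_image x kimg openin_subset by blast+
    then show "\<exists>T. openin S T \<and> y \<in> T \<and> T \<subseteq> F0" by blast
  qed
  moreover have "closedin S F0" using open_hball by auto
  ultimately have "F0 = {} \<or> F0 = topspace S" using SC connected_space_clopen_in by metis
  moreover have "h 1 \<in> F0" "h 0 \<notin> F0" "h 0 \<in> topspace S" using hmem[of 1] hmem[of 0] himg by auto
  ultimately show False by (elim disjE) (simp_all only: empty_iff not_True_eq_False)
qed

end

section \<open>Disk neighbourhoods in complexes\<close>

abbreviation body :: "'v set set \<Rightarrow> ('v \<Rightarrow> real) topology" where
  "body K \<equiv> top_of_set (realization K)"

definition face_complex :: "'v set \<Rightarrow> 'v set set" where
  "face_complex s = Pow s - {{}}"

lemma realization_mono: "K \<subseteq> L \<Longrightarrow> realization K \<subseteq> realization L"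
  by (auto simp: realization_iff)

lemma simplex_subset: "abstract_2_complex K \<Longrightarrow> s \<in> K \<Longrightarrow> face_complex s \<subseteq> K"
  using complex_mono unfolding face_complex_def by blast

lemma disk_in_top_of_set:
  "disk_in (top_of_set A) U \<longleftrightarrow> U \<subseteq> A \<and> top_of_set U homeomorphic_space open_disk"
  by (auto simp: disk_in_def subtopology_subtopology Int_absorb1)

lemma disk_in_mono: "disk_in (body K) U \<Longrightarrow> K \<subseteq> L \<Longrightarrow> disk_in (body L) U"
  using realization_mono unfolding disk_in_top_of_set by blast

lemma finite_supp: "\<alpha> \<in> realization K \<Longrightarrow> finite (supp \<alpha>)"
  using sum.infinite unfolding realization_iff by fastforce

lemma supp_nonempty: "\<alpha> \<in> realization K \<Longrightarrow> supp \<alpha> \<noteq> {}"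
  unfolding realization_iff by auto

definition vertex_point :: "'v \<Rightarrow> 'v \<Rightarrow> real" where
  "vertex_point x = (\<lambda>v. if v = x then 1 else 0)"

lemma supp_vertex_point [simp]: "supp (vertex_point x) = {x}"
  by (auto simp: supp_def vertex_point_def)

lemma vertex_point_mem [simp]: "vertex_point x \<in> realization K \<longleftrightarrow> {x} \<in> K"
  unfolding realization_iff supp_vertex_point by (auto simp: vertex_point_def)

definition segment_point :: "('v \<Rightarrow> real) \<Rightarrow> ('v \<Rightarrow> real) \<Rightarrow> real \<Rightarrow> 'v \<Rightarrow> real" where
  "segment_point \<alpha> \<beta> t = (\<lambda>v. (1 - t) * \<alpha> v + t * \<beta> v)"

lemma continuous_on_segment_point: "continuous_on A (segment_point \<alpha> \<beta>)"
  unfolding segment_point_def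
  by (rule continuous_on_coordinatewise_then_product) (intro continuous_intros)

lemma segment_point_ends [simp]: "segment_point \<alpha> \<beta> 0 = \<alpha>" "segment_point \<alpha> \<beta> 1 = \<beta>"
  by (auto simp: segment_point_def)

lemma supp_segment_point:
  assumes "\<And>v. 0 \<le> \<alpha> v" "\<And>v. 0 \<le> \<beta> v" "0 < t" "t < 1"
  shows "supp (segment_point \<alpha> \<beta> t) = supp \<alpha> \<union> supp \<beta>"
proof -
  have "(1 - t) * \<alpha> v + t * \<beta> v = 0 \<longleftrightarrow> \<alpha> v = 0 \<and> \<beta> v = 0" for v
    using assms by (simp add: add_nonneg_eq_0_iff)
  then show ?thesis unfolding supp_def segment_point_def by auto
qed

lemma sum_segment_point: "sum (segment_point \<alpha> \<beta> t) A = (1 - t) * sum \<alpha> A + t * sum \<beta> A"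
  by (simp add: segment_point_def sum.distrib sum_distrib_left)

lemma segment_point_mem:
  assumes "\<alpha> \<in> realization K" "\<beta> \<in> realization K" "0 \<le> t" "t \<le> 1" "supp \<alpha> \<union> supp \<beta> \<in> K"
  shows "segment_point \<alpha> \<beta> t \<in> realization K"
proof (cases "t = 0 \<or> t = 1")
  case True then show ?thesis using assms by auto
next
  case False
  then have t: "0 < t" "t < 1" using assms by auto
  have nn: "\<And>v. 0 \<le> \<alpha> v" "\<And>v. 0 \<le> \<beta> v" using assms by (auto simp: realization_iff)
  have f: "finite (supp \<alpha> \<union> supp \<beta>)" using assms finite_supp by blast
  have "sum \<alpha> (supp \<alpha> \<union> supp \<beta>) = 1" "sum \<beta> (supp \<alpha> \<union> supp \<beta>) = 1"
    using assms sum_supp[of \<alpha> "supp \<alpha> \<union> supp \<beta>"] sum_supp[of \<beta> "supp \<alpha> \<union> supp \<beta>"] f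
    by (auto simp: realization_iff)
  moreover have "supp (segment_point \<alpha> \<beta> t) = supp \<alpha> \<union> supp \<beta>"
    by (rule supp_segment_point) (use nn t in auto)
  moreover have "0 \<le> segment_point \<alpha> \<beta> t v" for v
    using nn[of v] assms(3,4) by (simp add: segment_point_def)
  ultimately show ?thesis
    using assms(5) by (simp add: realization_iff sum_segment_point)
qed

definition barycentre :: "'v set \<Rightarrow> 'v \<Rightarrow> real" where
  "barycentre s = (\<lambda>v. if v \<in> s then 1 / card s else 0)"

lemma supp_barycentre: "finite s \<Longrightarrow> s \<noteq> {} \<Longrightarrow> supp (barycentre s) = s"
  by (auto simp: supp_def barycentre_def)

lemma barycentre_mem:
  assumes "finite s" "s \<noteq> {}" "s \<in> K" shows "barycentre s \<in> realization K"
proof -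
  have "card s \<noteq> 0" using assms by simp
  then have "sum (barycentre s) s = 1" by (simp add: barycentre_def)
  then show ?thesis using assms supp_barycentre[of s] by (simp add: realization_iff) (simp add: barycentre_def)
qed

text \<open>A short move from \<alpha> towards the barycentre of \<open>s\<close> stays in
  \<open>U\<close> and spreads the support to \<open>s\<close>. In this way an open set sees every
  simplex above the support of one of its points.\<close>

lemma open_meets_cofaces:
  assumes U: "openin (body K) U" "\<alpha> \<in> U" and s: "s \<in> K" "supp \<alpha> \<subseteq> s" and fs: "finite s"
  shows "\<exists>\<beta>\<in>U. supp \<beta> = s"
proof -
  obtain W where W: "open W" "U = W \<inter> realization K" using U(1) by (auto simp: openin_open)
  have a: "\<alpha> \<in> realization K" "\<And>v. 0 \<le> \<alpha> v" using U W by (auto simp: realization_iff)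
  have ne: "s \<noteq> {}" using supp_nonempty[OF a(1)] s by auto
  have b: "barycentre s \<in> realization K" using barycentre_mem fs ne s by blast
  then have bn: "\<And>v. 0 \<le> barycentre s v" by (auto simp: realization_iff)
  have sb: "supp (barycentre s) = s" using supp_barycentre fs ne by blast
  let ?g = "segment_point \<alpha> (barycentre s)"
  have "open (?g -` W)" using open_vimage[OF W(1) continuous_on_segment_point] .
  moreover have "0 \<in> ?g -` W" using U W by simp
  ultimately obtain d where d: "d > 0" "ball 0 d \<subseteq> ?g -` W" by (meson open_contains_ball)
  define t where "t = min (d/2) (1/2)"
  have t: "0 < t" "t < 1" "t \<in> ball 0 d" using d by (auto simp: t_def)
  have "supp (?g t) = supp \<alpha> \<union> supp (barycentre s)"
    by (rule supp_segment_point) (use a bn t in auto)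
  then have sg: "supp (?g t) = s" using sb s by auto
  have "?g t \<in> realization K" by (rule segment_point_mem) (use a b t sb s in \<open>auto simp: Un_absorb1\<close>)
  moreover have "?g t \<in> W" using d(2) t(3) by blast
  ultimately show ?thesis using W sg by blast
qed

lemma openin_open_star:
  assumes "finite s" shows "openin (body K) {\<alpha> \<in> realization K. s \<subseteq> supp \<alpha>}"
proof -
  have "{\<alpha> \<in> realization K. s \<subseteq> supp \<alpha>} = realization K \<inter> (\<Inter>v\<in>s. {\<alpha>. \<alpha> v \<noteq> 0})"
    by (auto simp: supp_def)
  moreover have "open (\<Inter>v\<in>s. {\<alpha>::'a \<Rightarrow> real. \<alpha> v \<noteq> 0})"
    by (intro open_INT assms ballI open_Collect_neq continuous_intros)
  ultimately show ?thesis by (auto simp: openin_open)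
qed

lemma disk_in_open_simplex:
  assumes d: "a \<noteq> b" "b \<noteq> c" "a \<noteq> c" and \<alpha>: "\<alpha> \<in> realization K" "supp \<alpha> = {a, b, c}"
  shows "\<exists>U. \<alpha> \<in> U \<and> disk_in (body (face_complex {a, b, c})) U"
proof -
  have nn: "\<And>v. 0 \<le> \<alpha> v" and s1: "\<alpha> a + \<alpha> b + \<alpha> c = 1"
    using \<alpha> d by (auto simp: realization_iff)
  have pos: "\<alpha> a > 0" "\<alpha> b > 0" "\<alpha> c > 0"
    using \<alpha>(2) nn by (auto simp: supp_def set_eq_iff order_less_le)
  have z: "\<And>v. v \<notin> {a,b,c} \<Longrightarrow> \<alpha> v = 0" using \<alpha>(2) by (auto simp: supp_def)
  \<comment> \<open>Two coordinates serve as a chart and change by less than \<open>e\<close> each.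
    The third one loses less than \<open>2 * e\<close>, so a third of the smallest weight keeps all
    three positive.\<close>
  define e where "e = min (\<alpha> a) (min (\<alpha> b) (\<alpha> c)) / 3"
  have e: "e > 0" using pos by (auto simp: e_def)
  define \<psi> :: "complex \<Rightarrow> 'a \<Rightarrow> real" where "\<psi> z = (\<lambda>v. if v = a then \<alpha> a + Re z else
     if v = b then \<alpha> b + Im z else if v = c then \<alpha> c - Re z - Im z else 0)" for z
  define \<phi> where "\<phi> \<beta> = Complex (\<beta> a - \<alpha> a) (\<beta> b - \<alpha> b)" for \<beta> :: "'a \<Rightarrow> real"
  let ?U = "\<psi> ` ball 0 e"
  have c1: "continuous_on (ball 0 e) \<psi>"
  proof (rule continuous_on_coordinatewise_then_product)
    show "continuous_on (ball 0 e) (\<lambda>z. \<psi> z v)" for v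
      unfolding \<psi>_def
      by (cases "v = a"; cases "v = b"; cases "v = c") (simp_all add: continuous_intros)
  qed
  have c2: "continuous_on ?U \<phi>"
    unfolding \<phi>_def Complex_eq by (intro continuous_intros)
  have inv: "\<phi> (\<psi> z) = z" for z using d by (simp add: \<phi>_def \<psi>_def complex_eq_iff)
  have sub: "?U \<subseteq> realization (face_complex {a, b, c})"
  proof clarify
    fix z assume "z \<in> ball (0::complex) e"
    then have "norm z < e" by simp
    then have m: "\<bar>Re z\<bar> < e" "\<bar>Im z\<bar> < e"
      using abs_Re_le_cmod abs_Im_le_cmod le_less_trans by blast+
    have p: "\<alpha> a + Re z > 0" "\<alpha> b + Im z > 0" "\<alpha> c - Re z - Im z > 0"
      using m pos unfolding e_def by (auto simp: abs_if split: if_splits)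
    then have s: "supp (\<psi> z) = {a,b,c}" using d by (auto simp: supp_def \<psi>_def)
    show "\<psi> z \<in> realization (face_complex {a, b, c})"
      unfolding realization_iff s using p s1 d by (auto simp: \<psi>_def face_complex_def)
  qed
  have "homeomorphism (ball 0 e) ?U \<psi> \<phi>"
    unfolding homeomorphism_def using c1 c2 inv by (auto simp: image_image)
  then have "?U homeomorphic ball (0::complex) e"
    using homeomorphic_def homeomorphic_sym by blast
  also have "ball (0::complex) e homeomorphic ball (0::complex) 1"
    by (rule homeomorphic_balls) (use e in auto)
  finally have "top_of_set ?U homeomorphic_space open_disk"
    by (rule homeomorphic_imp_homeomorphic_space)
  then have "disk_in (body (face_complex {a, b, c})) ?U" using sub disk_in_top_of_set by blast
  moreover have "\<alpha> \<in> ?U"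
    by (rule image_eqI[of _ _ 0]) (use z e in \<open>auto simp: \<psi>_def\<close>)
  ultimately show ?thesis by blast
qed

lemma (in bistellar_move) disk_in_pullback:
  assumes "\<alpha> \<in> realization K" "bistellar_map \<sigma> \<tau> \<alpha> \<in> U'" "disk_in (body K') U'"
  shows "\<exists>U. \<alpha> \<in> U \<and> disk_in (body K) U"
proof (intro exI conjI)
  have h: "homeomorphic_map (body K') (body K) (bistellar_map \<tau> \<sigma>)"
    using homeomorphic_maps homeomorphic_maps_sym homeomorphic_map_maps by blast
  have "U' \<subseteq> topspace (body K')" using assms(3) unfolding disk_in_def by blast
  then show "disk_in (body K) (bistellar_map \<tau> \<sigma> ` U')"
    using disk_in_homeomorphic_map[OF h] assms(3) by blast
  show "\<alpha> \<in> bistellar_map \<tau> \<sigma> ` U'"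
    using homeomorphic_maps assms unfolding homeomorphic_maps_def by (auto intro!: image_eqI[of _ _ "bistellar_map \<sigma> \<tau> \<alpha>"])
qed

lemma complex_simplex: "finite s \<Longrightarrow> card s \<le> 3 \<Longrightarrow> abstract_2_complex (face_complex s)"
  unfolding abstract_2_complex_def face_complex_def
  by (auto dest: finite_subset card_mono intro: order_trans)

lemma complex_UN:
  assumes "finite I" "\<And>i. i \<in> I \<Longrightarrow> abstract_2_complex (K i)"
  shows "abstract_2_complex (\<Union>i\<in>I. K i)"
  unfolding abstract_2_complex_def
proof (intro conjI ballI allI impI)
  show "finite (\<Union>i\<in>I. K i)" using assms complex_finite_all by blast
next
  fix s assume "s \<in> (\<Union>i\<in>I. K i)"
  then obtain i where i: "i \<in> I" "s \<in> K i" by blast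
  then show "s \<noteq> {}" "finite s" "card s \<le> 3"
    using assms(2)[OF i(1)] complex_finite complex_nonempty complex_card by metis+
  show "t \<in> (\<Union>i\<in>I. K i)" if "t \<subseteq> s \<and> t \<noteq> {}" for t
    using complex_mono[OF assms(2)[OF i(1)] i(2)] that i(1) by blast
qed

lemma complex_Un:
  assumes "abstract_2_complex K" "abstract_2_complex L"
  shows "abstract_2_complex (K \<union> L)"
  using complex_UN[of "{True, False}" "\<lambda>b. if b then K else L"] assms by (simp add: Un_commute)

lemma card3_le: "card {a, b, c} \<le> 3"
  by (simp add: card_insert_if)

text \<open>The move with \<sigma> = \<open>{u}\<close> and \<tau> = \<open>{x, y}\<close> turns the
  two triangles into the single triangle \<open>v x y\<close> and carries the inside of the edge
  \<open>u v\<close> into its interior, where the two-coordinate chart is available.\<close>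

lemma disk_in_two_faces:
  assumes d: "distinct [u, v, x, y]"
    and \<alpha>: "\<alpha> \<in> realization (face_complex {u, v, x} \<union> face_complex {u, v, y})" "supp \<alpha> = {u, v}"
  shows "\<exists>U. \<alpha> \<in> U \<and> disk_in (body (face_complex {u, v, x} \<union> face_complex {u, v, y})) U"
proof -
  let ?T = "face_complex {u, v, x} \<union> face_complex {u, v, y}"
  interpret bistellar_move ?T "{u}" "{x, y}"
  proof
    show "abstract_2_complex ?T" by (intro complex_Un complex_simplex) (auto simp: card3_le)
    show "s - {x, y} \<union> \<rho> \<in> ?T" if "s \<in> ?T" "{u} \<subseteq> s" "\<rho> \<subset> {x, y}" for s \<rho>
    proof -
      have "\<rho> \<subseteq> {x} \<or> \<rho> \<subseteq> {y}" using that by auto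
      then show ?thesis using that d unfolding face_complex_def by auto
    qed
  qed (use d in \<open>auto simp: face_complex_def\<close>)
  have fs: "finite (supp \<alpha>)" and nn: "\<And>v. 0 \<le> \<alpha> v" using \<alpha> by (auto simp: realization_iff)
  have "supp (bistellar_map {u} {x, y} \<alpha>) = {v, x, y}"
    using bistellar_map_properties(3)[OF \<sigma> \<tau> disj nn fs] \<alpha>(2) d by auto
  then obtain U where U: "bistellar_map {u} {x, y} \<alpha> \<in> U" "disk_in (body (face_complex {v, x, y})) U"
    using disk_in_open_simplex[of v x y, OF _ _ _ maps_to[OF \<alpha>(1)]] d by auto
  have "face_complex {v, x, y} \<subseteq> K'"
  proof
    fix t assume t: "t \<in> face_complex {v, x, y}"
    show "t \<in> K'"
    proof (cases "{x, y} \<subseteq> t")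
      case True
      have "t = ({u} \<union> (t \<inter> {v})) - {u} \<union> {} \<union> {x, y}" using t True d by (auto simp: face_complex_def)
      moreover have "{u} \<union> (t \<inter> {v}) \<in> ?T" by (auto simp: face_complex_def)
      ultimately show ?thesis unfolding bistellar_def by blast
    next
      case False then show ?thesis using t d by (auto simp: face_complex_def bistellar_def)
    qed
  qed
  then have "disk_in (body K') U" using U disk_in_mono by blast
  then show ?thesis using disk_in_pullback \<alpha>(1) U(1) by blast
qed

definition cone_over :: "'v \<Rightarrow> 'v set set \<Rightarrow> 'v set set" where
  "cone_over x \<Gamma> = (\<Union>e\<in>\<Gamma>. face_complex (insert x e))"

text \<open>As the edge set of a graph: a disjoint union of cycles. In the link of a vertex of a
  punctured surface there is room for one only, because a single cycle already exhausts the
  link.\<close>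

definition two_regular :: "'v set set \<Rightarrow> bool" where
  "two_regular \<Gamma> \<longleftrightarrow> finite \<Gamma> \<and> (\<forall>e\<in>\<Gamma>. card e = 2 \<and> (\<forall>v\<in>e. card {e'\<in>\<Gamma>. v \<in> e'} = 2))"

lemma two_regular_nbrs:
  assumes "two_regular \<Gamma>" "e \<in> \<Gamma>" "p1 \<in> e"
  obtains p0 p2 where "{e'\<in>\<Gamma>. p1 \<in> e'} = {{p0, p1}, {p1, p2}}" "p0 \<noteq> p1" "p1 \<noteq> p2" "p0 \<noteq> p2"
    "{p0, p1} \<in> \<Gamma>" "{p1, p2} \<in> \<Gamma>"
proof -
  have "card {e'\<in>\<Gamma>. p1 \<in> e'} = 2" using assms unfolding two_regular_def by blast
  then obtain e1 e2 where e: "{e'\<in>\<Gamma>. p1 \<in> e'} = {e1, e2}" "e1 \<noteq> e2" by (auto simp: card_2_iff)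
  then have *: "e1 \<in> \<Gamma>" "p1 \<in> e1" "e2 \<in> \<Gamma>" "p1 \<in> e2" by blast+
  then have "card e1 = 2" "card e2 = 2" using assms(1) unfolding two_regular_def by blast+
  then obtain p0 p2 where p: "e1 = {p0, p1}" "p0 \<noteq> p1" "e2 = {p1, p2}" "p1 \<noteq> p2"
    using * by (auto simp: card_2_iff insert_commute doubleton_eq_iff)
  then show thesis using that[of p0 p2] e * by auto
qed

text \<open>The cycle through \<open>p0 p1 p2\<close> is shortened. If the chord
  \<open>p0 p2\<close> is absent, the move that replaces the edge \<open>x p1\<close> by
  \<open>p0 p2\<close> fixes the vertex point of \<open>x\<close>, whose support does not contain
  that edge. If the chord is present, the three triangles around \<open>x\<close> are exchanged for
  \<open>p0 p1 p2\<close>, and \<open>x\<close> moves into its interior. As the disk need not be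
  open in the cone, \<Gamma> may have further components.\<close>

lemma disk_in_cone:
  assumes "two_regular \<Gamma>" "\<Gamma> \<noteq> {}" "\<And>e. e \<in> \<Gamma> \<Longrightarrow> x \<notin> e"
  shows "\<exists>U. vertex_point x \<in> U \<and> disk_in (body (cone_over x \<Gamma>)) U"
  using assms
proof (induction "card \<Gamma>" arbitrary: \<Gamma> rule: less_induct)
  case less
  have fin: "finite \<Gamma>" using less.prems(1) unfolding two_regular_def by blast
  obtain e where e: "e \<in> \<Gamma>" using less.prems by auto
  then have "card e = 2" using less.prems unfolding two_regular_def by blast
  then obtain p1 where p1: "p1 \<in> e" by (auto simp: card_2_iff)
  obtain p0 p2 where p: "{e'\<in>\<Gamma>. p1 \<in> e'} = {{p0, p1}, {p1, p2}}" "p0 \<noteq> p1" "p1 \<noteq> p2" "p0 \<noteq> p2"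
    "{p0, p1} \<in> \<Gamma>" "{p1, p2} \<in> \<Gamma>"
    by (rule two_regular_nbrs[OF less.prems(1) e p1])
  have x: "x \<noteq> p0" "x \<noteq> p1" "x \<noteq> p2" using less.prems(3) p by blast+
  have vn: "\<And>v. 0 \<le> vertex_point x v" by (simp add: vertex_point_def)
  have vf: "finite (supp (vertex_point x))" by simp
  show ?case
  proof (cases "{p0, p2} \<in> \<Gamma>")
    case True
    let ?T = "face_complex {x, p0, p1} \<union> face_complex {x, p1, p2} \<union> face_complex {x, p0, p2}"
    have TC: "?T \<subseteq> cone_over x \<Gamma>" unfolding cone_over_def using True p by auto
    interpret bistellar_move ?T "{x}" "{p0, p1, p2}"
    proof
      show "abstract_2_complex ?T" by (intro complex_Un complex_simplex) (auto simp: card3_le)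
      show "s - {p0, p1, p2} \<union> \<rho> \<in> ?T" if "s \<in> ?T" "{x} \<subseteq> s" "\<rho> \<subset> {p0, p1, p2}" for s \<rho>
      proof -
        have r: "\<rho> \<subseteq> {p0, p1} \<or> \<rho> \<subseteq> {p1, p2} \<or> \<rho> \<subseteq> {p0, p2}" using that(3) by blast
        have eq: "s - {p0, p1, p2} \<union> \<rho> = insert x \<rho>"
        proof -
          have "s \<subseteq> {x, p0, p1, p2}" using that(1) unfolding face_complex_def by (elim UnE) blast+
          then show ?thesis using that(2) x by fast
        qed
        show ?thesis unfolding eq using r unfolding face_complex_def by (elim disjE; simp; blast)
      qed
    qed (use x p in \<open>auto simp: face_complex_def\<close>)
    have "supp (bistellar_map {x} {p0, p1, p2} (vertex_point x)) = {p0, p1, p2}"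
      using bistellar_map_properties(3)[OF \<sigma> \<tau> disj vn vf] by (simp add: psubset_eq subset_singleton_iff conj_disj_distribR ex_disj_distrib)
    moreover have v: "vertex_point x \<in> realization ?T" by (auto simp: face_complex_def)
    ultimately obtain U where U: "bistellar_map {x} {p0, p1, p2} (vertex_point x) \<in> U"
      "disk_in (body (face_complex {p0, p1, p2})) U"
      using disk_in_open_simplex[OF p(2,3,4) maps_to[OF v]] p by blast
    have "face_complex {p0, p1, p2} \<subseteq> K'"
    proof
      fix t assume t: "t \<in> face_complex {p0, p1, p2}"
      show "t \<in> K'"
      proof (cases "{p0, p1, p2} \<subseteq> t")
        case True
        have "t = {x} - {x} \<union> {} \<union> {p0, p1, p2}" using t True by (auto simp: face_complex_def)
        moreover have "{x} \<in> ?T" by (auto simp: face_complex_def)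
        ultimately show ?thesis unfolding bistellar_def by blast
      next
        case False
        have t': "t \<subseteq> {p0, p1, p2}" "t \<noteq> {}" using t by (auto simp: face_complex_def)
        then have "t \<subseteq> {p0, p1} \<or> t \<subseteq> {p1, p2} \<or> t \<subseteq> {p0, p2}" using False by blast
        then have "t \<in> ?T" using t'(2) unfolding face_complex_def by (elim disjE; simp; blast)
        moreover have "x \<notin> t" using t'(1) x by blast
        ultimately show ?thesis by (simp add: bistellar_def)
      qed
    qed
    then have "disk_in (body K') U" using U disk_in_mono by blast
    then show ?thesis using disk_in_pullback v U(1) disk_in_mono[OF _ TC] by blast
  next
    case False
    let ?K = "cone_over x \<Gamma>"
    define \<Gamma>' where "\<Gamma>' = insert {p0, p2} (\<Gamma> - {{p0, p1}, {p1, p2}})"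
    have cd: "card e = 2" if "e \<in> \<Gamma>" for e using less.prems(1) that unfolding two_regular_def by blast
    have pe: "e = {p0, p1} \<or> e = {p1, p2}" if "e \<in> \<Gamma>" "p1 \<in> e" for e using p(1) that by blast
    interpret bistellar_move ?K "{x, p1}" "{p0, p2}"
    proof
      show "abstract_2_complex ?K" unfolding cone_over_def
        by (intro complex_UN fin complex_simplex) (use cd less.prems(3) in \<open>auto simp: card_insert_if card_ge_0_finite\<close>)
      show "{p0, p2} \<notin> ?K"
      proof
        assume "{p0, p2} \<in> ?K"
        then obtain e where "e \<in> \<Gamma>" "{p0, p2} \<subseteq> e" using x by (auto simp: cone_over_def face_complex_def)
        then have "e = {p0, p2}" using cd[of e] p(4) by (auto simp: card_2_iff)
        then show False using False \<open>e \<in> \<Gamma>\<close> by simp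
      qed
      show "s - {p0, p2} \<union> \<rho> \<in> ?K" if sp: "s \<in> ?K" "{x, p1} \<subseteq> s" "\<rho> \<subset> {p0, p2}" for s \<rho>
      proof -
        obtain e where "e \<in> \<Gamma>" "s \<subseteq> insert x e" using sp by (auto simp: cone_over_def face_complex_def)
        moreover have "p1 \<in> e" using sp calculation x by auto
        ultimately have s: "s \<subseteq> {x, p0, p1} \<or> s \<subseteq> {x, p1, p2}" using pe by blast
        have r: "\<rho> \<subseteq> {p0} \<or> \<rho> \<subseteq> {p2}" using sp by blast
        have "s - {p0, p2} \<union> \<rho> \<subseteq> insert x {p0, p1} \<or> s - {p0, p2} \<union> \<rho> \<subseteq> insert x {p1, p2}" "s - {p0, p2} \<union> \<rho> \<noteq> {}"
          using s r sp x p by auto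
        then show ?thesis using p(5,6) unfolding cone_over_def face_complex_def by blast
      qed
    qed (use x p in auto)
    have reg: "two_regular \<Gamma>'"
      unfolding two_regular_def
    proof (intro conjI ballI)
      show "finite \<Gamma>'" using fin by (simp add: \<Gamma>'_def)
      show "card e = 2" if "e \<in> \<Gamma>'" for e using that cd p(4) by (auto simp: \<Gamma>'_def)
      fix e v assume e: "e \<in> \<Gamma>'" "v \<in> e"
      have v1: "v \<noteq> p1" using e pe p(2,3) by (auto simp: \<Gamma>'_def)
      have c2: "card {e'\<in>\<Gamma>. v \<in> e'} = 2"
      proof (cases "e \<in> \<Gamma>")
        case True then show ?thesis using e less.prems(1) unfolding two_regular_def by blast
      next
        case False
        then have "v = p0 \<or> v = p2" using e by (auto simp: \<Gamma>'_def)
        then show ?thesis using p(5,6) less.prems(1) unfolding two_regular_def by blast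
      qed
      show "card {e'\<in>\<Gamma>'. v \<in> e'} = 2"
      proof (cases "v = p0 \<or> v = p2")
        case False
        then have "{e'\<in>\<Gamma>'. v \<in> e'} = {e'\<in>\<Gamma>. v \<in> e'}" using v1 by (auto simp: \<Gamma>'_def)
        then show ?thesis using c2 by simp
      next
        case True
        define f where "f = (if v = p0 then {p0, p1} else {p1, p2})"
        have f: "f \<in> {e'\<in>\<Gamma>. v \<in> e'}" using True p by (auto simp: f_def)
        have "{e'\<in>\<Gamma>'. v \<in> e'} = insert {p0, p2} ({e'\<in>\<Gamma>. v \<in> e'} - {f})"
          using True v1 p(2,3,4) by (auto simp: \<Gamma>'_def f_def)
        moreover have "{p0, p2} \<notin> {e'\<in>\<Gamma>. v \<in> e'} - {f}" using \<open>{p0, p2} \<notin> \<Gamma>\<close> by simp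
        ultimately show ?thesis using c2 f fin by (simp add: card_Diff_singleton)
      qed
    qed
    have "card \<Gamma>' < card \<Gamma>"
    proof -
      have ne: "{p0, p1} \<noteq> {p1, p2}" using p by (auto simp: doubleton_eq_iff)
      have "card (\<Gamma> - {{p0, p1}, {p1, p2}}) = card \<Gamma> - 2"
        using fin p(5,6) ne by (subst card_Diff_subset) auto
      moreover have "card \<Gamma> \<ge> 2"
        using card_mono[OF fin, of "{{p0, p1}, {p1, p2}}"] p(5,6) ne by simp
      ultimately show ?thesis unfolding \<Gamma>'_def using fin False by simp
    qed
    moreover have "\<Gamma>' \<noteq> {}" by (simp add: \<Gamma>'_def)
    moreover have "\<And>e. e \<in> \<Gamma>' \<Longrightarrow> x \<notin> e" using less.prems(3) x by (auto simp: \<Gamma>'_def)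
    ultimately have "\<exists>U. vertex_point x \<in> U \<and> disk_in (body (cone_over x \<Gamma>')) U"
      using less.hyps[OF _ reg] by simp
    then obtain U where U: "vertex_point x \<in> U" "disk_in (body (cone_over x \<Gamma>')) U" by blast
    have "cone_over x \<Gamma>' \<subseteq> K'"
    proof
      fix t assume "t \<in> cone_over x \<Gamma>'"
      then obtain e where e: "e \<in> \<Gamma>'" "t \<subseteq> insert x e" "t \<noteq> {}" by (auto simp: cone_over_def face_complex_def)
      show "t \<in> K'"
      proof (cases "e \<in> \<Gamma>")
        case True
        then have "p1 \<notin> e" using e(1) pe False by (auto simp: \<Gamma>'_def)
        then have "p1 \<notin> t" using e x by auto
        moreover have "t \<in> ?K" using True e by (auto simp: cone_over_def face_complex_def)
        ultimately show ?thesis by (auto simp: bistellar_def)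
      next
        case F: False
        then have e': "e = {p0, p2}" using e by (auto simp: \<Gamma>'_def)
        show ?thesis
        proof (cases "{p0, p2} \<subseteq> t")
          case True
          have "t = {x, p1} - {x, p1} \<union> (t \<inter> {x}) \<union> {p0, p2}" using True e e' by auto
          moreover have "{x, p1} \<in> ?K" using p(5) by (auto simp: cone_over_def face_complex_def)
          moreover have "t \<inter> {x} \<subset> {x, p1}" using x by auto
          ultimately show ?thesis unfolding bistellar_def by blast
        next
          case nt: False
          then have "t \<subseteq> insert x {p0, p1} \<or> t \<subseteq> insert x {p1, p2}" using e e' by auto
          then have "t \<in> ?K" using p(5,6) e(3) unfolding cone_over_def face_complex_def by blast
          moreover have "p1 \<notin> t" using e e' x p by auto
          ultimately show ?thesis by (auto simp: bistellar_def)
        qed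
      qed
    qed
    then have dk: "disk_in (body K') U" using U disk_in_mono by blast
    have v: "vertex_point x \<in> realization ?K" using p(5) by (auto simp: cone_over_def face_complex_def)
    have "\<not> {x, p1} \<subseteq> supp (vertex_point x)" using x by auto
    then have "bistellar_map {x, p1} {p0, p2} (vertex_point x) = vertex_point x"
      using bistellar_map_properties(2)[OF \<sigma> \<tau> disj vn vf] by blast
    then show ?thesis using disk_in_pullback v U(1) dk by metis
  qed
qed

section \<open>Triangulations of punctured surfaces\<close>

definition opp :: "'v set set \<Rightarrow> 'v \<Rightarrow> 'v \<Rightarrow> 'v set" where
  "opp K u v = {x. {u, v, x} \<in> K \<and> x \<noteq> u \<and> x \<noteq> v}"

definition link_edges :: "'v set set \<Rightarrow> 'v \<Rightarrow> 'v set set" where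
  "link_edges K x = {e. card e = 2 \<and> x \<notin> e \<and> insert x e \<in> K}"

lemma opp_commute: "opp K u v = opp K v u"
  by (auto simp: opp_def insert_commute)

lemma finite_vertices: "abstract_2_complex K \<Longrightarrow> finite (vertices K)"
proof -
  assume K: "abstract_2_complex K"
  have "vertices K \<subseteq> \<Union>K" by (auto simp: vertices_def)
  moreover have "finite (\<Union>K)" using K complex_finite complex_finite_all by blast
  ultimately show ?thesis by (rule finite_subset)
qed

lemma simplex_vertices: "abstract_2_complex K \<Longrightarrow> s \<in> K \<Longrightarrow> v \<in> s \<Longrightarrow> v \<in> vertices K"
  using complex_mono[of K s "{v}"] by (auto simp: vertices_def)

lemma opp_subset_vertices: "abstract_2_complex K \<Longrightarrow> opp K u v \<subseteq> vertices K"
  unfolding opp_def by (auto intro: simplex_vertices)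

lemma finite_opp: "abstract_2_complex K \<Longrightarrow> finite (opp K u v)"
  using opp_subset_vertices finite_vertices finite_subset by metis

lemma finite_link_edges: "abstract_2_complex K \<Longrightarrow> finite (link_edges K x)"
proof -
  assume K: "abstract_2_complex K"
  have "link_edges K x \<subseteq> Pow (vertices K)"
    unfolding link_edges_def using simplex_vertices[OF K] by blast
  then show ?thesis using finite_vertices[OF K] finite_subset by blast
qed

lemma link_edges_at:
  assumes "u \<noteq> v"
  shows "{e \<in> link_edges K v. u \<in> e} = (\<lambda>x. {u, x}) ` opp K v u"
    and "card {e \<in> link_edges K v. u \<in> e} = card (opp K v u)"
proof -
  show *: "{e \<in> link_edges K v. u \<in> e} = (\<lambda>x. {u, x}) ` opp K v u"
  proof (intro equalityI subsetI)
    fix e assume "e \<in> {e \<in> link_edges K v. u \<in> e}"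
    then have e: "card e = 2" "v \<notin> e" "insert v e \<in> K" "u \<in> e" by (auto simp: link_edges_def)
    then obtain x where "e = {u, x}" "x \<noteq> u" by (auto simp: card_2_iff)
    then show "e \<in> (\<lambda>x. {u, x}) ` opp K v u" using e by (auto simp: opp_def)
  next
    fix e assume "e \<in> (\<lambda>x. {u, x}) ` opp K v u"
    then show "e \<in> {e \<in> link_edges K v. u \<in> e}"
      using assms by (auto simp: opp_def link_edges_def)
  qed
  have "inj_on (\<lambda>x. {u, x}) (opp K v u)"
    by (auto simp: inj_on_def doubleton_eq_iff)
  then show "card {e \<in> link_edges K v. u \<in> e} = card (opp K v u)"
    unfolding * by (rule card_image)
qed

text \<open>The combinatorial content of triangulating a punctured surface.
  \<open>cycle_link\<close> stands for the structure of links: a link that contains a cycle is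
  nothing but that cycle.\<close>

locale surface_complex =
  fixes K :: "'v set set"
  assumes complex: "abstract_2_complex K"
    and pure: "\<And>s. s \<in> K \<Longrightarrow> \<exists>t\<in>K. s \<subseteq> t \<and> card t = 3"
    and card_opp: "\<And>u v. u \<noteq> v \<Longrightarrow> {u, v} \<in> K \<Longrightarrow> card (opp K u v) = 1 \<or> card (opp K u v) = 2"
    and cycle_link: "\<And>\<Gamma> x. \<Gamma> \<subseteq> link_edges K x \<Longrightarrow> \<Gamma> \<noteq> {} \<Longrightarrow> two_regular \<Gamma> \<Longrightarrow> \<Gamma> = link_edges K x"
    and connected: "\<And>A. A \<noteq> {} \<Longrightarrow> A \<subseteq> vertices K \<Longrightarrow>
      (\<And>a b. a \<in> A \<Longrightarrow> {a, b} \<in> K \<Longrightarrow> b \<in> A) \<Longrightarrow> A = vertices K"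
    and boundary: "\<exists>u v. u \<noteq> v \<and> {u, v} \<in> K \<and> card (opp K u v) = 1"

section \<open>From disk neighbourhoods to counts of faces\<close>

locale punctured_complex = punctured "body K" S h k
  for K :: "'v set set" and S :: "'a topology" and h :: "complex \<Rightarrow> 'a" and k :: "('v \<Rightarrow> real) \<Rightarrow> 'a" +
  assumes complex: "abstract_2_complex K"
begin

lemma disk_nbhdI:
  assumes "T \<subseteq> K" "disk_in (body T) U" "\<alpha> \<in> U"
  shows "disk_nbhd_at (body K) \<alpha>"
  using disk_in_mono[OF assms(2,1)] disk_open assms(3) disk_nbhd_at_iff by metis

text \<open>By \<open>disk_open\<close> the disk is open in the body of all of \<open>K\<close>, so
  it has a point in the interior of every simplex \<open>s\<close> above the support of \<alpha>.
  But it lies in the body of \<open>T\<close>. Invariance of domain thus turns a disk found in a few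
  simplices into the statement that there are no others.\<close>

lemma cofaces_subcomplex:
  assumes "T \<subseteq> K" "disk_in (body T) U" "\<alpha> \<in> U" "s \<in> K" "supp \<alpha> \<subseteq> s"
  shows "s \<in> T"
proof -
  have "openin (body K) U" using disk_in_mono[OF assms(2,1)] disk_open by blast
  then obtain \<beta> where \<beta>: "\<beta> \<in> U" "supp \<beta> = s"
    using open_meets_cofaces assms complex_finite[OF complex] by metis
  then have "\<beta> \<in> realization T" using assms(2) unfolding disk_in_top_of_set by blast
  then show ?thesis using \<beta> by (simp add: realization_iff)
qed

lemma disk_nbhd_face:
  assumes "\<alpha> \<in> realization K" "card (supp \<alpha>) = 3"
  shows "disk_nbhd_at (body K) \<alpha>"
proof -
  obtain a b c where s: "supp \<alpha> = {a, b, c}" "a \<noteq> b" "b \<noteq> c" "a \<noteq> c"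
    using assms(2) by (auto simp: card_3_iff)
  then obtain U where U: "\<alpha> \<in> U" "disk_in (body (face_complex {a, b, c})) U"
    using disk_in_open_simplex[OF s(2,3,4) assms(1)] by blast
  have "face_complex {a, b, c} \<subseteq> K"
    using simplex_subset[OF complex] s assms by (simp add: realization_iff)
  then show ?thesis using disk_nbhdI U by blast
qed

lemma two_faces:
  assumes "u \<noteq> v" "x \<in> opp K u v" "y \<in> opp K u v" "x \<noteq> y" "\<alpha> \<in> realization K" "supp \<alpha> = {u, v}"
  shows "disk_nbhd_at (body K) \<alpha>" "opp K u v = {x, y}"
proof -
  let ?T = "face_complex {u, v, x} \<union> face_complex {u, v, y}"
  have d: "distinct [u, v, x, y]" using assms by (auto simp: opp_def)
  have T: "?T \<subseteq> K" using simplex_subset[OF complex] assms by (simp add: opp_def)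
  have "\<alpha> \<in> realization ?T" using assms(5,6) by (auto simp: realization_iff face_complex_def)
  then obtain U where U: "\<alpha> \<in> U" "disk_in (body ?T) U"
    using disk_in_two_faces[OF d _ assms(6)] by blast
  then show "disk_nbhd_at (body K) \<alpha>" using disk_nbhdI T by blast
  have "z \<in> {x, y}" if z: "z \<in> opp K u v" for z
  proof -
    have "{u, v, z} \<in> ?T"
      using cofaces_subcomplex[OF T U(2,1), of "{u, v, z}"] z assms(6) by (auto simp: opp_def)
    then show ?thesis using z by (auto simp: face_complex_def opp_def)
  qed
  then show "opp K u v = {x, y}" using assms by blast
qed

lemma edge_point:
  assumes "{u, v} \<in> K"
  shows "barycentre {u, v} \<in> realization K" "supp (barycentre {u, v}) = {u, v}"
  using barycentre_mem[OF _ _ assms] supp_barycentre[of "{u, v}"] by auto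

lemma planar_chart_star:
  fixes \<phi> :: "('v \<Rightarrow> real) \<Rightarrow> complex"
  assumes s: "s \<in> K" and p: "p \<in> realization K" "s \<subseteq> supp p" "disk_nbhd_at (body K) p"
    and \<phi>: "continuous_on UNIV \<phi>" "inj_on \<phi> {\<alpha> \<in> realization K. s \<subseteq> supp \<alpha>}"
  shows "\<exists>e>0. ball (\<phi> p) e \<subseteq> \<phi> ` {\<alpha> \<in> realization K. s \<subseteq> supp \<alpha>}"
proof (rule planar_chart_open[OF p(3)])
  show "openin (body K) {\<alpha> \<in> realization K. s \<subseteq> supp \<alpha>}"
    using openin_open_star complex_finite[OF complex s] by blast
  show "continuous_map (subtopology (body K) {\<alpha> \<in> realization K. s \<subseteq> supp \<alpha>}) euclidean \<phi>"
    using \<phi>(1) continuous_on_subset by (auto simp: subtopology_subtopology)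
qed (use p \<phi> in auto)

text \<open>On the open star of a maximal simplex with at most two vertices one barycentric
  coordinate is injective. Viewed in the complex plane its image lies on the real line, so it
  contains no ball; but the open star contains disk points, where it would have to.\<close>

lemma pure:
  assumes "s \<in> K" shows "\<exists>t\<in>K. s \<subseteq> t \<and> card t = 3"
proof -
  let ?C = "{t \<in> K. s \<subseteq> t}"
  have "finite (card ` ?C)" "card ` ?C \<noteq> {}" using complex_finite_all[OF complex] assms by auto
  then have "Max (card ` ?C) \<in> card ` ?C" by (rule Max_in)
  then obtain t where t: "t \<in> K" "s \<subseteq> t" "card t = Max (card ` ?C)" by auto
  have max: "t' = t" if "t' \<in> K" "t \<subseteq> t'" for t'
  proof -
    have "card t' \<le> card t" unfolding t(3) using \<open>finite (card ` ?C)\<close> that t by (intro Max_ge) auto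
    then show ?thesis using that complex_finite[OF complex] card_seteq by metis
  qed
  have "card t = 3"
  proof (rule ccontr)
    assume "card t \<noteq> 3"
    moreover have "card t \<noteq> 0" using complex_finite[OF complex t(1)] complex_nonempty[OF complex t(1)] by simp
    ultimately have "card t = 1 \<or> card t = 2" using complex_card[OF complex t(1)] by linarith
    \<comment> \<open>A single vertex is included as the case \<open>a = b\<close>.\<close>
    then obtain a b where ab: "t = {a, b}" by (auto simp: card_1_singleton_iff card_2_iff)
    let ?W = "{\<alpha> \<in> realization K. t \<subseteq> supp \<alpha>}"
    define \<phi> :: "('v \<Rightarrow> real) \<Rightarrow> complex" where "\<phi> \<alpha> = of_real (\<alpha> a)" for \<alpha>
    have W: "supp \<alpha> = t" if "\<alpha> \<in> ?W" for \<alpha> using that max[of "supp \<alpha>"] by (auto simp: realization_iff)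
    have inj: "inj_on \<phi> ?W"
    proof (rule inj_onI, rule ext)
      fix \<alpha> \<beta> v assume *: "\<alpha> \<in> ?W" "\<beta> \<in> ?W" "\<phi> \<alpha> = \<phi> \<beta>"
      have s: "supp \<alpha> = {a, b}" "supp \<beta> = {a, b}" using W[OF *(1)] W[OF *(2)] ab by simp_all
      then have "sum \<alpha> {a, b} = 1" "sum \<beta> {a, b} = 1" using * by (auto simp: realization_iff)
      then have "\<alpha> b = \<beta> b" "\<alpha> a = \<beta> a" using *(3) by (cases "a = b"; simp add: \<phi>_def)+
      then show "\<alpha> v = \<beta> v" using s by (auto simp: supp_def set_eq_iff)
    qed
    have "openin (body K) ?W" using openin_open_star complex_finite[OF complex t(1)] by blast
    moreover have "barycentre t \<in> ?W" using edge_point t ab by auto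
    ultimately obtain p where p: "p \<in> ?W" "disk_nbhd_at (body K) p"
      using disk_points_dense by blast
    obtain e where e: "e > 0" "ball (\<phi> p) e \<subseteq> \<phi> ` ?W"
      using planar_chart_star[OF t(1) _ _ p(2) _ inj] p(1)
      by (auto simp: \<phi>_def intro!: continuous_intros)
    have "\<phi> p + \<i> * (e / 2) \<in> ball (\<phi> p) e" using e by (simp add: dist_norm norm_mult)
    then obtain \<beta> where "\<phi> p + \<i> * (e / 2) = \<phi> \<beta>" using e by blast
    then have "Im (\<phi> p + \<i> * (e / 2)) = Im (\<phi> \<beta>)" by simp
    then show False using e by (simp add: \<phi>_def)
  qed
  then show ?thesis using t by blast
qed

text \<open>Around such a point the coordinates of \<open>u\<close> and \<open>x\<close> form an
  injective planar map. Its second component is never negative and is 0 at \<alpha>, so the image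
  contains no ball around the image of \<alpha>.\<close>

lemma one_face:
  assumes uv: "u \<noteq> v" and o: "opp K u v = {x}" and \<alpha>: "\<alpha> \<in> realization K" "supp \<alpha> = {u, v}"
  shows "\<not> disk_nbhd_at (body K) \<alpha>"
proof
  assume dk: "disk_nbhd_at (body K) \<alpha>"
  have uvK: "{u, v} \<in> K" using \<alpha> by (simp add: realization_iff)
  have x: "x \<noteq> u" "x \<noteq> v" using o by (auto simp: opp_def)
  let ?W = "{\<beta> \<in> realization K. {u, v} \<subseteq> supp \<beta>}"
  define \<phi> :: "('v \<Rightarrow> real) \<Rightarrow> complex" where "\<phi> \<beta> = Complex (\<beta> u) (\<beta> x)" for \<beta>
  have W: "supp \<beta> \<subseteq> {u, v, x}" if "\<beta> \<in> ?W" for \<beta>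
  proof
    fix y assume y: "y \<in> supp \<beta>"
    show "y \<in> {u, v, x}"
    proof (rule ccontr)
      assume "y \<notin> {u, v, x}"
      moreover have "{u, v, y} \<in> K"
        using complex_mono[OF complex, of "supp \<beta>" "{u, v, y}"] that y by (auto simp: realization_iff)
      ultimately have "y \<in> opp K u v" by (auto simp: opp_def)
      then show False using o \<open>y \<notin> {u, v, x}\<close> by auto
    qed
  qed
  have inj: "inj_on \<phi> ?W"
  proof (rule inj_onI, rule ext)
    fix \<beta> \<gamma> w assume *: "\<beta> \<in> ?W" "\<gamma> \<in> ?W" "\<phi> \<beta> = \<phi> \<gamma>"
    have "sum \<beta> {u, v, x} = 1" "sum \<gamma> {u, v, x} = 1"
      using * W[OF *(1)] W[OF *(2)] sum_supp[of \<beta> "{u, v, x}"] sum_supp[of \<gamma> "{u, v, x}"] by (auto simp: realization_iff)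
    then have "\<beta> u = \<gamma> u" "\<beta> x = \<gamma> x" "\<beta> v = \<gamma> v" using *(3) x uv by (auto simp: \<phi>_def)
    then show "\<beta> w = \<gamma> w"
      using W[OF *(1)] W[OF *(2)] unfolding supp_def
      by (cases "w \<in> {u, v, x}") (blast, (metis (mono_tags, lifting) mem_Collect_eq subsetD))
  qed
  have c: "continuous_on UNIV \<phi>" unfolding \<phi>_def Complex_eq by (intro continuous_intros)
  obtain e where e: "e > 0" "ball (\<phi> \<alpha>) e \<subseteq> \<phi> ` ?W"
    using planar_chart_star[OF uvK \<alpha>(1) _ dk c inj] \<alpha>(2) by auto
  have "\<alpha> x = 0" using \<alpha>(2) x by (auto simp: supp_def)
  have "\<phi> \<alpha> - \<i> * (e / 2) \<in> ball (\<phi> \<alpha>) e" using e by (simp add: dist_norm norm_mult)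
  then obtain \<beta> where \<beta>: "\<phi> \<alpha> - \<i> * (e / 2) = \<phi> \<beta>" "\<beta> \<in> realization K" using e by blast
  then have "Im (\<phi> \<alpha> - \<i> * (e / 2)) = Im (\<phi> \<beta>)" by simp
  then have "\<beta> x < 0" using e \<open>\<alpha> x = 0\<close> by (simp add: \<phi>_def)
  then show False using \<beta>(2) by (auto simp: realization_iff not_less[symmetric])
qed

lemma card_opp:
  assumes "u \<noteq> v" "{u, v} \<in> K"
  shows "card (opp K u v) = 1 \<or> card (opp K u v) = 2"
proof -
  obtain t where t: "t \<in> K" "{u, v} \<subseteq> t" "card t = 3" using pure[OF assms(2)] by blast
  then obtain x where "t = {u, v, x}" "x \<noteq> u" "x \<noteq> v" using assms(1) by (auto simp: card_3_iff insert_commute)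
  then have x: "x \<in> opp K u v" using t by (simp add: opp_def)
  show ?thesis
  proof (cases "opp K u v = {x}")
    case False
    then obtain y where y: "y \<in> opp K u v" "x \<noteq> y" using x by blast
    then show ?thesis using two_faces(2)[OF assms(1) x y edge_point[OF assms(2)]] by simp
  qed simp
qed

lemma cycle_link:
  assumes \<Gamma>: "\<Gamma> \<subseteq> link_edges K x" "\<Gamma> \<noteq> {}" "two_regular \<Gamma>"
  shows "\<Gamma> = link_edges K x" "disk_nbhd_at (body K) (vertex_point x)"
proof -
  have T: "cone_over x \<Gamma> \<subseteq> K"
    unfolding cone_over_def using simplex_subset[OF complex] \<Gamma>(1) by (auto simp: link_edges_def)
  obtain U where U: "vertex_point x \<in> U" "disk_in (body (cone_over x \<Gamma>)) U"
  proof -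
    have "\<And>e. e \<in> \<Gamma> \<Longrightarrow> x \<notin> e" using \<Gamma>(1) by (auto simp: link_edges_def)
    then show ?thesis using disk_in_cone[OF \<Gamma>(3,2), of x] that by auto
  qed
  show "disk_nbhd_at (body K) (vertex_point x)" using disk_nbhdI T U by blast
  have "e \<in> \<Gamma>" if e: "e \<in> link_edges K x" for e
  proof -
    have "insert x e \<in> cone_over x \<Gamma>"
      using cofaces_subcomplex[OF T U(2,1), of "insert x e"] e by (auto simp: link_edges_def)
    then obtain e' where e': "e' \<in> \<Gamma>" "insert x e \<subseteq> insert x e'" by (auto simp: cone_over_def face_complex_def)
    then have "e \<subseteq> e'" using e by (auto simp: link_edges_def)
    moreover have "card e = 2" "card e' = 2" using e e' \<Gamma>(1) by (auto simp: link_edges_def)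
    ultimately have "e = e'" by (metis card_seteq card_eq_0_iff order_refl zero_neq_numeral)
    then show ?thesis using e' by simp
  qed
  then show "\<Gamma> = link_edges K x" using \<Gamma>(1) by blast
qed

lemma vertex_has_link_edge: assumes "{v} \<in> K" shows "link_edges K v \<noteq> {}"
proof -
  obtain t where t: "t \<in> K" "v \<in> t" "card t = 3" using pure[OF assms] by blast
  then have "t - {v} \<in> link_edges K v" by (auto simp: link_edges_def insert_absorb)
  then show ?thesis by blast
qed

text \<open>A disk neighbourhood of the vertex reaches into each edge at it and is one for the
  points there, which excludes edges with a single face by \<open>one_face\<close>. Conversely, two
  faces at every edge make the link two-regular.\<close>

lemma disk_vertex_iff:
  assumes "{v} \<in> K"
  shows "disk_nbhd_at (body K) (vertex_point v) \<longleftrightarrow> (\<forall>z. z \<noteq> v \<longrightarrow> {v, z} \<in> K \<longrightarrow> card (opp K v z) = 2)"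
proof (intro iffI allI impI)
  fix z assume d: "disk_nbhd_at (body K) (vertex_point v)" and z: "z \<noteq> v" "{v, z} \<in> K"
  show "card (opp K v z) = 2"
  proof (rule ccontr)
    assume "card (opp K v z) \<noteq> 2"
    then obtain x where x: "opp K v z = {x}" using card_opp[of v z] z by (auto simp: card_1_singleton_iff)
    obtain U where U: "openin (body K) U" "vertex_point v \<in> U" "disk_in (body K) U"
      using d disk_nbhd_at_iff by metis
    obtain \<beta> where \<beta>: "\<beta> \<in> U" "supp \<beta> = {v, z}"
      using open_meets_cofaces[OF U(1,2) z(2)] by auto
    have "disk_nbhd_at (body K) \<beta>" using U \<beta> disk_nbhd_at_iff by metis
    moreover have "\<beta> \<in> realization K" using U(1) \<beta> openin_subset by fastforce
    ultimately show False using one_face[of v z x \<beta>] x z \<beta> by auto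
  qed
next
  assume two: "\<forall>z. z \<noteq> v \<longrightarrow> {v, z} \<in> K \<longrightarrow> card (opp K v z) = 2"
  have "two_regular (link_edges K v)"
    unfolding two_regular_def
  proof (intro conjI ballI finite_link_edges[OF complex])
    fix e u assume e: "e \<in> link_edges K v" "u \<in> e"
    then have "u \<noteq> v" by (auto simp: link_edges_def)
    moreover have "{v, u} \<in> K" using complex_mono[OF complex, of "insert v e" "{v, u}"] e by (auto simp: link_edges_def)
    ultimately show "card {e' \<in> link_edges K v. u \<in> e'} = 2" using two link_edges_at(2)[of u v] by simp
  qed (auto simp: link_edges_def)
  then show "disk_nbhd_at (body K) (vertex_point v)"
    using cycle_link(2) vertex_has_link_edge[OF assms] by blast
qed

text \<open>For a set \<open>A\<close> closed under adjacency the total weight on \<open>A\<close>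
  is a continuous function on the body with values 0 and 1 only.\<close>

lemma connected:
  assumes A: "A \<noteq> {}" "A \<subseteq> vertices K" "\<And>a b. a \<in> A \<Longrightarrow> {a, b} \<in> K \<Longrightarrow> b \<in> A"
  shows "A = vertices K"
proof (rule ccontr)
  assume "A \<noteq> vertices K"
  then obtain b where b: "b \<in> vertices K" "b \<notin> A" using A by blast
  obtain a where a: "a \<in> A" using A by blast
  have fA: "finite A" using A(2) finite_vertices[OF complex] finite_subset by blast
  define f where "f \<alpha> = sum \<alpha> A" for \<alpha> :: "'v \<Rightarrow> real"
  have "connected (realization K)" using connected_X by (simp flip: connectedin_iff_connected add: connectedin_def)
  moreover have "continuous_on (realization K) f" unfolding f_def by (intro continuous_intros)
  ultimately have c: "Topological_Spaces.connected (f ` realization K)" using connected_continuous_image by blast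
  have v01: "f \<alpha> \<in> {0, 1}" if \<alpha>: "\<alpha> \<in> realization K" for \<alpha>
  proof (cases "supp \<alpha> \<inter> A = {}")
    case True
    then have "f \<alpha> = 0" unfolding f_def by (intro sum.neutral) (auto simp: supp_def)
    then show ?thesis by simp
  next
    case False
    then obtain c where c: "c \<in> supp \<alpha>" "c \<in> A" by blast
    have "supp \<alpha> \<subseteq> A"
    proof
      fix d assume "d \<in> supp \<alpha>"
      then have "{c, d} \<in> K" using c \<alpha> complex_mono[OF complex, of "supp \<alpha>" "{c, d}"] by (auto simp: realization_iff)
      then show "d \<in> A" using A(3) c by blast
    qed
    then have "f \<alpha> = 1" unfolding f_def using sum_supp[OF _ fA] \<alpha> by (simp add: realization_iff)
    then show ?thesis by simp
  qed
  have "f (vertex_point a) = 1" "f (vertex_point b) = 0"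
    using a b fA by (auto simp: f_def vertex_point_def)
  moreover have "vertex_point a \<in> realization K" "vertex_point b \<in> realization K"
    using a b A by (auto simp: vertices_def)
  ultimately have "f ` realization K = {0, 1}" using v01 by (metis (no_types, lifting) image_eqI image_subsetI insert_subset subset_antisym empty_subsetI)
  then show False using c connected_finite_iff_sing[of "{0::real, 1}"] by auto
qed

text \<open>A boundary point is not inside a face. Inside an edge it shows that this edge has only
  one face, and at a vertex it shows that some edge there does.\<close>

lemma boundary: "\<exists>u v. u \<noteq> v \<and> {u, v} \<in> K \<and> card (opp K u v) = 1"
proof -
  obtain \<alpha> where \<alpha>: "\<alpha> \<in> realization K" "\<not> disk_nbhd_at (body K) \<alpha>" using exists_boundary_point by auto
  have s: "supp \<alpha> \<in> K" using \<alpha> by (simp add: realization_iff)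
  have "card (supp \<alpha>) \<noteq> 3" using disk_nbhd_face \<alpha> by blast
  moreover have "card (supp \<alpha>) \<noteq> 0" using finite_supp[OF \<alpha>(1)] supp_nonempty[OF \<alpha>(1)] by simp
  ultimately have "card (supp \<alpha>) = 1 \<or> card (supp \<alpha>) = 2" using complex_card[OF complex s] by linarith
  then show ?thesis
  proof
    assume "card (supp \<alpha>) = 2"
    then obtain u v where uv: "supp \<alpha> = {u, v}" "u \<noteq> v" by (auto simp: card_2_iff)
    have "card (opp K u v) \<noteq> 2"
    proof
      assume "card (opp K u v) = 2"
      then obtain x y where "opp K u v = {x, y}" "x \<noteq> y" by (auto simp: card_2_iff)
      then show False using two_faces(1)[OF uv(2) _ _ _ \<alpha>(1) uv(1), of x y] \<alpha>(2) by blast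
    qed
    then show ?thesis using card_opp uv s by metis
  next
    assume "card (supp \<alpha>) = 1"
    then obtain v where v: "supp \<alpha> = {v}" by (auto simp: card_1_singleton_iff)
    then have "\<alpha> = vertex_point v"
      using \<alpha> by (auto simp: realization_iff vertex_point_def supp_def fun_eq_iff set_eq_iff)
    then obtain z where "z \<noteq> v" "{v, z} \<in> K" "card (opp K v z) \<noteq> 2"
      using disk_vertex_iff[of v] v s \<alpha> by auto
    then show ?thesis using card_opp by metis
  qed
qed

sublocale surface_complex K
  by unfold_locales (use complex pure card_opp cycle_link(1) connected boundary in metis)+

lemma realization_Pow_vertex: "realization (Pow {v}) = {vertex_point v}"
proof -
  have "\<alpha> = vertex_point v" if "\<alpha> \<in> realization (Pow {v})" for \<alpha>
  proof -
    have "supp \<alpha> = {v}" using that supp_nonempty[OF that] by (auto simp: realization_iff)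
    then show ?thesis
      using that by (auto simp: realization_iff vertex_point_def supp_def fun_eq_iff set_eq_iff)
  qed
  then show ?thesis by auto
qed

lemma inner_vertex_iff:
  "inner_vertex K v \<longleftrightarrow> {v} \<in> K \<and> (\<forall>z. z \<noteq> v \<longrightarrow> {v, z} \<in> K \<longrightarrow> card (opp K v z) = 2)"
  using disk_vertex_iff[of v]
  by (auto simp: inner_vertex_def bd_def realization_Pow_vertex surface_boundary_def)

lemma bd_edge_iff:
  assumes "u \<noteq> v"
  shows "{u, v} \<in> bd K \<longleftrightarrow> {u, v} \<in> K \<and> card (opp K u v) = 1"
proof (intro iffI conjI)
  assume b: "{u, v} \<in> bd K"
  then show uvK: "{u, v} \<in> K" by (simp add: bd_def)
  have "card (opp K u v) \<noteq> 2"
  proof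
    assume "card (opp K u v) = 2"
    then obtain x y where "opp K u v = {x, y}" "x \<noteq> y" by (auto simp: card_2_iff)
    then have "disk_nbhd_at (body K) (barycentre {u, v})"
      using two_faces(1)[OF assms _ _ _ edge_point[OF uvK], of x y] by blast
    moreover have "barycentre {u, v} \<in> realization (Pow {u, v})"
      using edge_point[OF uvK] by (auto simp: realization_iff)
    ultimately show False using b by (auto simp: bd_def surface_boundary_def)
  qed
  then show "card (opp K u v) = 1" using card_opp[OF assms uvK] by simp
next
  assume uv: "{u, v} \<in> K \<and> card (opp K u v) = 1"
  then obtain x where x: "opp K u v = {x}" by (auto simp: card_1_singleton_iff)
  \<comment> \<open>\<open>bd\<close> asks every point of the closed edge to be a boundary point, so
    the ends have to be treated as well; each of them sees the edge with a single face.\<close>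
  have vx: "\<not> disk_nbhd_at (body K) (vertex_point w)" "{w} \<in> K" if "w = u \<or> w = v" for w
  proof -
    show "{w} \<in> K" using complex_mono[OF complex, of "{u, v}" "{w}"] uv that by auto
    then show "\<not> disk_nbhd_at (body K) (vertex_point w)"
      using disk_vertex_iff[of w] uv assms that by (metis insert_commute numeral_eq_one_iff opp_commute semiring_norm(85))
  qed
  have "\<alpha> \<in> surface_boundary (body K)" if \<alpha>: "\<alpha> \<in> realization (Pow {u, v})" for \<alpha>
  proof -
    have "supp \<alpha> = {u, v} \<or> \<alpha> \<in> realization (Pow {u}) \<or> \<alpha> \<in> realization (Pow {v})"
      using \<alpha> by (auto simp: realization_iff)
    then show ?thesis
    proof (elim disjE)
      assume s: "supp \<alpha> = {u, v}"
      then have "\<alpha> \<in> realization K" using \<alpha> uv by (simp add: realization_iff)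
      then show ?thesis using one_face[OF assms x _ s] by (simp add: surface_boundary_def)
    qed (use vx in \<open>auto simp: realization_Pow_vertex surface_boundary_def\<close>)
  qed
  then show "{u, v} \<in> bd K" using uv by (auto simp: bd_def)
qed

end

lemma punctured_complexI:
  fixes F :: "'a topology" and K :: "'v set set"
  assumes "punctured_surface F" "triangulates K F"
  obtains S :: "'a topology" and h k where "punctured_complex K S h k"
proof -
  obtain S :: "'a topology" and h where S: "closed_surface S" "embedding_map closed_disk S h"
    "F homeomorphic_space subtopology S (topspace S - h ` ball 0 1)"
    using assms(1) unfolding punctured_surface_def by blast
  have "body K homeomorphic_space subtopology S (topspace S - h ` ball 0 1)"
    using assms(2) S(3) homeomorphic_space_trans unfolding triangulates_def by blast
  then obtain k where "homeomorphic_map (body K) (subtopology S (topspace S - h ` ball 0 1)) k"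
    unfolding homeomorphic_space by blast
  then have "punctured_complex K S h k"
    using S assms(2) by unfold_locales (auto simp: triangulates_def)
  then show thesis using that by blast
qed

text \<open>The exit from the topological definitions: inner vertices and boundary edges are
  recognised from the number of faces at edges.\<close>

lemma triangulates_surface_complex:
  assumes "punctured_surface F" "triangulates K F"
  shows "surface_complex K"
    and "inner_vertex K v \<longleftrightarrow> {v} \<in> K \<and> (\<forall>z. z \<noteq> v \<longrightarrow> {v, z} \<in> K \<longrightarrow> card (opp K v z) = 2)"
    and "u \<noteq> v \<Longrightarrow> {u, v} \<in> bd K \<longleftrightarrow> {u, v} \<in> K \<and> card (opp K u v) = 1"
proof -
  obtain S :: "'a topology" and h k where p: "punctured_complex K S h k" using punctured_complexI assms .
  interpret punctured_complex K S h k by (rule p)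
  show "surface_complex K" by (rule surface_complex_axioms)
  show "inner_vertex K v \<longleftrightarrow> {v} \<in> K \<and> (\<forall>z. z \<noteq> v \<longrightarrow> {v, z} \<in> K \<longrightarrow> card (opp K v z) = 2)"
    by (rule inner_vertex_iff)
  show "u \<noteq> v \<Longrightarrow> {u, v} \<in> bd K \<longleftrightarrow> {u, v} \<in> K \<and> card (opp K u v) = 1" by (rule bd_edge_iff)
qed

section \<open>Cocycles and cuts\<close>

definition edges :: "'v set set \<Rightarrow> 'v set set" where
  "edges K = {e \<in> K. card e = 2}"

definition faces :: "'v set set \<Rightarrow> 'v set set" where
  "faces K = {t \<in> K. card t = 3}"

lemma face_verts:
  assumes "card t = 3" "a \<in> t" "b \<in> t" "a \<noteq> b"
  obtains c where "t = {a, b, c}" "c \<noteq> a" "c \<noteq> b"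
proof -
  have "card (t - {a, b}) = 1" using assms by (simp add: card_Diff_subset)
  then obtain c where "t - {a, b} = {c}" by (auto simp: card_1_singleton_iff)
  then show thesis using that[of c] assms by blast
qed

lemma edge_verts:
  assumes "card e = 2" "u \<in> e" obtains c where "e = {u, c}" "u \<noteq> c"
  using assms by (auto simp: card_2_iff)

lemma face_mem:
  "{a, b, c} \<in> faces K \<longleftrightarrow> {a, b, c} \<in> K \<and> distinct [a, b, c]"
  by (auto simp: faces_def card_insert_if)

lemma edge_mem: "{a, b} \<in> edges K \<longleftrightarrow> {a, b} \<in> K \<and> a \<noteq> b"
  by (auto simp: edges_def card_insert_if)

lemma edge_cases:
  assumes "e \<in> edges K" obtains a b where "e = {a, b}" "a \<noteq> b" "{a, b} \<in> K"
  using assms by (auto simp: edges_def card_2_iff)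

lemma opp_iff_face: "u \<noteq> v \<Longrightarrow> x \<in> opp K u v \<longleftrightarrow> {u, v, x} \<in> faces K"
  by (auto simp: opp_def face_mem)

text \<open>Sets of edges are 1-cochains mod 2, and the condition says that each face in
  \<open>T\<close> has an even number of edges in \<phi>. The set \<open>T\<close> is a parameter so
  that the faces can be brought in one at a time.\<close>

definition cocycle :: "'v set set \<Rightarrow> 'v set set \<Rightarrow> bool" where
  "cocycle T \<phi> \<longleftrightarrow> (\<forall>a b c. {a, b, c} \<in> T \<longrightarrow> distinct [a, b, c] \<longrightarrow>
     ({a, b} \<in> \<phi>) = (({b, c} \<in> \<phi>) \<noteq> ({a, c} \<in> \<phi>)))"

definition cocycles :: "'v set set \<Rightarrow> 'v set set \<Rightarrow> 'v set set set" where
  "cocycles K T = {\<phi>. \<phi> \<subseteq> edges K \<and> cocycle T \<phi>}"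

text \<open>The mod 2 coboundary of the indicator function of \<open>A\<close>.\<close>

definition cut :: "'v set set \<Rightarrow> 'v set \<Rightarrow> 'v set set" where
  "cut K A = {e \<in> edges K. \<exists>a\<in>e. \<exists>b\<in>e. a \<in> A \<and> b \<notin> A}"

definition cuts :: "'v set set \<Rightarrow> 'v set set set" where
  "cuts K = cut K ` Pow (vertices K)"

lemma cut_mem: "{a, b} \<in> cut K A \<longleftrightarrow> {a, b} \<in> K \<and> (a \<in> A) \<noteq> (b \<in> A)"
  by (auto simp: cut_def edges_def card_insert_if)

lemma subset_edges_eqI:
  assumes "\<phi> \<subseteq> edges K" "\<psi> \<subseteq> edges K" "\<And>a b. a \<noteq> b \<Longrightarrow> {a, b} \<in> K \<Longrightarrow> {a, b} \<in> \<phi> \<longleftrightarrow> {a, b} \<in> \<psi>"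
  shows "\<phi> = \<psi>"
proof -
  have "e \<in> \<phi> \<longleftrightarrow> e \<in> \<psi>" if "e \<in> edges K" for e
    using that assms(3) by (elim edge_cases) auto
  then show ?thesis using assms(1,2) by blast
qed

lemma cut_subset: "cut K A \<subseteq> edges K"
  by (auto simp: cut_def)

lemma cut_sym_diff: "sym_diff (cut K A) (cut K B) = cut K (sym_diff A B)"
  by (rule subset_edges_eqI[of _ K]) (use cut_subset[of K] in \<open>auto simp: cut_mem\<close>)

lemma cuts_sym_diff: "\<phi> \<in> cuts K \<Longrightarrow> \<psi> \<in> cuts K \<Longrightarrow> sym_diff \<phi> \<psi> \<in> cuts K"
proof -
  assume "\<phi> \<in> cuts K" "\<psi> \<in> cuts K"
  then obtain A B where "A \<subseteq> vertices K" "B \<subseteq> vertices K" "\<phi> = cut K A" "\<psi> = cut K B"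
    unfolding cuts_def by blast
  moreover from this have "sym_diff A B \<in> Pow (vertices K)" by blast
  ultimately show ?thesis using cut_sym_diff[of K A B] unfolding cuts_def by (metis imageI)
qed

lemma cocycles_sym_diff:
  "\<phi> \<in> cocycles K T \<Longrightarrow> \<psi> \<in> cocycles K T \<Longrightarrow> sym_diff \<phi> \<psi> \<in> cocycles K T"
  unfolding cocycles_def cocycle_def by (simp add: sup.coboundedI1) (smt (verit) Diff_subset subset_trans le_sup_iff)

lemma cocycle_insert:
  assumes "distinct [a, b, c]"
  shows "cocycle (insert {a, b, c} T) \<phi> \<longleftrightarrow>
    cocycle T \<phi> \<and> ({a, b} \<in> \<phi>) = (({b, c} \<in> \<phi>) \<noteq> ({a, c} \<in> \<phi>))"
proof -
  have "({x, y} \<in> \<phi>) = (({y, z} \<in> \<phi>) \<noteq> ({x, z} \<in> \<phi>))"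
    if *: "({a, b} \<in> \<phi>) = (({b, c} \<in> \<phi>) \<noteq> ({a, c} \<in> \<phi>))" and e: "{x, y, z} = {a, b, c}" "distinct [x, y, z]" for x y z
  proof -
    have "x \<in> {a, b, c}" "y \<in> {a, b, c}" "z \<in> {a, b, c}" using e by blast+
    then consider "x = a" "y = b" "z = c" | "x = a" "y = c" "z = b" | "x = b" "y = a" "z = c"
      | "x = b" "y = c" "z = a" | "x = c" "y = a" "z = b" | "x = c" "y = b" "z = a"
      using e(2) by auto
    then show ?thesis using * by cases (simp_all only: insert_commute, blast+)
  qed
  note eq = this
  show ?thesis
  proof
    assume l: "cocycle (insert {a, b, c} T) \<phi>"
    show "cocycle T \<phi> \<and> ({a, b} \<in> \<phi>) = (({b, c} \<in> \<phi>) \<noteq> ({a, c} \<in> \<phi>))"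
      using l[unfolded cocycle_def] assms unfolding cocycle_def by (meson insertI1 insertI2)
  next
    assume r: "cocycle T \<phi> \<and> ({a, b} \<in> \<phi>) = (({b, c} \<in> \<phi>) \<noteq> ({a, c} \<in> \<phi>))"
    show "cocycle (insert {a, b, c} T) \<phi>"
      unfolding cocycle_def
    proof (intro allI impI)
      fix x y z assume t: "{x, y, z} \<in> insert {a, b, c} T" "distinct [x, y, z]"
      from t(1) show "({x, y} \<in> \<phi>) = (({y, z} \<in> \<phi>) \<noteq> ({x, z} \<in> \<phi>))"
      proof
        assume "{x, y, z} = {a, b, c}"
        then show ?thesis using eq[OF conjunct2[OF r]] t(2) by blast
      next
        assume "{x, y, z} \<in> T"
        then show ?thesis using conjunct1[OF r] t(2) unfolding cocycle_def by blast
      qed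
    qed
  qed
qed

context surface_complex
begin

lemma finite_edges: "finite (edges K)" and finite_faces: "finite (faces K)"
  using complex_finite_all[OF complex] by (auto simp: edges_def faces_def)

lemma face_edges: "{a, b, c} \<in> K \<Longrightarrow> {a, b} \<in> K \<and> {b, c} \<in> K \<and> {a, c} \<in> K \<and> {a} \<in> K \<and> {b} \<in> K \<and> {c} \<in> K"
  using complex_mono[OF complex, of "{a, b, c}"] by simp

lemma edge_ends: "{a, b} \<in> K \<Longrightarrow> {a} \<in> K \<and> {b} \<in> K"
  using complex_mono[OF complex, of "{a, b}"] by simp

lemma opp_nonempty: "u \<noteq> v \<Longrightarrow> {u, v} \<in> K \<Longrightarrow> opp K u v \<noteq> {}"
  using card_opp by fastforce

text \<open>Without a free edge, every edge of a face in \<open>T\<close> has two faces, both in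
  \<open>T\<close>. The faces of \<open>T\<close> at a vertex then form cycles in its link, hence
  the whole link by \<open>cycle_link\<close>, and by connectedness \<open>T\<close> reaches every
  vertex and every face. But the face at a boundary edge has a free edge.\<close>

lemma free_edge:
  assumes T: "T \<subseteq> faces K" "T \<noteq> {}"
  shows "\<exists>a b c. {a, b, c} \<in> T \<and> distinct [a, b, c] \<and> (\<forall>t\<in>T. {a, b} \<subseteq> t \<longrightarrow> t = {a, b, c})"
proof (rule ccontr)
  assume no: "\<not> ?thesis"
  \<comment> \<open>An edge has at most two faces, and the absence of free edges supplies two of
    them inside \<open>T\<close>.\<close>
  have key: "card (opp K u v) = 2 \<and> (\<forall>x\<in>opp K u v. {u, v, x} \<in> T)" if uv: "{u, v, c} \<in> T" "u \<noteq> v" for u v c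
  proof -
    have "{u, v, c} \<in> faces K" using uv T by blast
    then have d: "distinct [u, v, c]" by (simp only: face_mem)
    then obtain t where t: "t \<in> T" "{u, v} \<subseteq> t" "t \<noteq> {u, v, c}" using no uv by blast
    then have "card t = 3" using T by (auto simp: faces_def)
    then obtain d where d: "t = {u, v, d}" "d \<noteq> u" "d \<noteq> v" using face_verts[of t u v] t uv by auto
    have s: "{c, d} \<subseteq> opp K u v" using d t uv T opp_iff_face[OF uv(2)] by auto
    moreover have "c \<noteq> d" using d t by auto
    moreover have "card (opp K u v) \<le> 2" using card_opp[OF uv(2)] uv T face_edges[of u v c] by (auto simp: faces_def)
    ultimately have "opp K u v = {c, d}"
      using card_seteq[OF finite_opp[OF complex] s] by simp
    then show ?thesis using \<open>c \<noteq> d\<close> uv t d by auto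
  qed
  have link: "{v, u, x} \<in> T" if v: "v \<in> \<Union>T" and e: "{v, u, x} \<in> faces K" for v u x
  proof -
    define \<Gamma> where "\<Gamma> = {e \<in> link_edges K v. insert v e \<in> T}"
    have "two_regular \<Gamma>"
      unfolding two_regular_def
    proof (intro conjI ballI)
      show "finite \<Gamma>" using finite_link_edges[OF complex] by (simp add: \<Gamma>_def)
      show "card e = 2" if "e \<in> \<Gamma>" for e using that by (simp add: \<Gamma>_def link_edges_def)
      fix e u assume e: "e \<in> \<Gamma>" "u \<in> e"
      then obtain c where c: "e = {u, c}" "u \<noteq> c" "u \<noteq> v" "{v, u, c} \<in> T"
      proof -
        have e': "card e = 2" "v \<notin> e" "insert v e \<in> T" using e(1) by (auto simp: \<Gamma>_def link_edges_def)
        then obtain c where "e = {u, c}" "u \<noteq> c" using edge_verts e(2) by metis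
        then show ?thesis using that e' by auto
      qed
      have k: "card (opp K v u) = 2" "\<forall>x\<in>opp K v u. {v, u, x} \<in> T" using key[OF c(4)] c(3) by auto
      have "{e' \<in> \<Gamma>. u \<in> e'} = {e' \<in> link_edges K v. u \<in> e'}"
        using k(2) unfolding link_edges_at(1)[OF c(3)] \<Gamma>_def
        using link_edges_at(1)[OF c(3), of K] by auto
      then show "card {e' \<in> \<Gamma>. u \<in> e'} = 2" using k(1) link_edges_at(2)[OF c(3)] by simp
    qed
    moreover have "\<Gamma> \<noteq> {}"
    proof -
      obtain t where "t \<in> T" "v \<in> t" using v by blast
      then have "t - {v} \<in> \<Gamma>" using T by (auto simp: \<Gamma>_def link_edges_def faces_def insert_absorb)
      then show ?thesis by blast
    qed
    ultimately have "\<Gamma> = link_edges K v" using cycle_link[of \<Gamma> v] by (auto simp: \<Gamma>_def)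
    moreover have "{u, x} \<in> link_edges K v" using e by (auto simp: link_edges_def face_mem)
    ultimately show ?thesis by (auto simp: \<Gamma>_def)
  qed
  have "\<Union>T = vertices K"
  proof (rule connected)
    show "\<Union>T \<noteq> {}" using T by (fastforce simp: faces_def)
    show "\<Union>T \<subseteq> vertices K" using T simplex_vertices[OF complex] by (auto simp: faces_def)
    fix a b assume ab: "a \<in> \<Union>T" "{a, b} \<in> K"
    show "b \<in> \<Union>T"
    proof (cases "a = b")
      case False
      then obtain x where "x \<in> opp K a b" using opp_nonempty ab by blast
      then have "{a, b, x} \<in> T" using link[of a b x] ab opp_iff_face[OF False] by auto
      then show ?thesis by blast
    qed (use ab in simp)
  qed
  moreover obtain u v where uv: "u \<noteq> v" "{u, v} \<in> K" "card (opp K u v) = 1" using boundary by blast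
  ultimately have "u \<in> \<Union>T" using edge_ends by (auto simp: vertices_def)
  moreover obtain x where "x \<in> opp K u v" using opp_nonempty uv by blast
  ultimately have "{u, v, x} \<in> T" using link opp_iff_face[OF uv(1)] by blast
  then show False using key uv by fastforce
qed

text \<open>A collapse read backwards: each new face brings an edge that lies in no earlier
  face.\<close>

lemma faces_induct [consumes 1, case_names empty insert]:
  assumes "T \<subseteq> faces K"
    and "P {}"
    and "\<And>T a b c. T \<subseteq> faces K \<Longrightarrow> {a, b, c} \<in> faces K \<Longrightarrow> {a, b, c} \<notin> T \<Longrightarrow> distinct [a, b, c] \<Longrightarrow>
      (\<And>t. t \<in> T \<Longrightarrow> \<not> {a, b} \<subseteq> t) \<Longrightarrow> P T \<Longrightarrow> P (insert {a, b, c} T)"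
  shows "P T"
  using assms(1)
proof (induction "card T" arbitrary: T)
  case 0
  then have "T = {}" using finite_subset[OF _ finite_faces] by simp
  then show ?case using assms(2) by simp
next
  case (Suc n)
  then have "T \<noteq> {}" by auto
  then obtain a b c where f: "{a, b, c} \<in> T" "distinct [a, b, c]" "\<forall>t\<in>T. {a, b} \<subseteq> t \<longrightarrow> t = {a, b, c}"
    using free_edge[OF Suc.prems] by blast
  let ?T = "T - {{a, b, c}}"
  have "n = card ?T" using Suc.hyps(2) f(1) by simp
  then have "P ?T" using Suc.hyps(1) Suc.prems by blast
  then have "P (insert {a, b, c} ?T)"
  proof (intro assms(3))
    show "?T \<subseteq> faces K" "{a, b, c} \<in> faces K" "{a, b, c} \<notin> ?T" using Suc.prems f(1) by blast+
    show "\<not> {a, b} \<subseteq> t" if "t \<in> ?T" for t using f(3) that by blast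
  qed (rule f(2), rule \<open>P ?T\<close>)
  then show ?case using f(1) by (simp add: insert_absorb)
qed

text \<open>Toggling the membership of the new edge \<open>a b\<close> does not touch the conditions
  of the earlier faces and reverses that of the new face. So each face halves the number of
  cocycles.\<close>

lemma card_cocycles: "T \<subseteq> faces K \<Longrightarrow> card (cocycles K T) * 2 ^ card T = 2 ^ card (edges K)"
proof (induction rule: faces_induct)
  case empty
  have "cocycles K {} = Pow (edges K)" by (auto simp: cocycles_def cocycle_def)
  then show ?case using finite_edges by (simp add: card_Pow)
next
  case (insert T a b c)
  let ?cond = "\<lambda>\<phi>. ({a, b} \<in> \<phi>) = (({b, c} \<in> \<phi>) \<noteq> ({a, c} \<in> \<phi>))"
  let ?f = "\<lambda>\<phi>. sym_diff \<phi> {{a, b}}"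
  have ab: "{a, b} \<in> edges K" using insert.hyps face_edges by (auto simp: edge_mem face_mem)
  have fin: "finite (cocycles K T)"
    by (rule finite_subset[of _ "Pow (edges K)"]) (use finite_edges in \<open>auto simp: cocycles_def\<close>)
  have nab: "{x, y} \<noteq> {a, b}" if "{x, y, z} \<in> T" for x y z
    using insert.hyps(5)[OF that] by (auto simp: doubleton_eq_iff)
  have nab': "{y, z} \<noteq> {a, b}" "{x, z} \<noteq> {a, b}" if "{x, y, z} \<in> T" for x y z
    using nab[of y z x] nab[of x z y] that by (auto simp: insert_commute)
  have f: "?f \<phi> \<in> cocycles K T" if \<phi>: "\<phi> \<in> cocycles K T" for \<phi>
  proof -
    have "({x, y} \<in> ?f \<phi>) = ({x, y} \<in> \<phi>)" "({y, z} \<in> ?f \<phi>) = ({y, z} \<in> \<phi>)" "({x, z} \<in> ?f \<phi>) = ({x, z} \<in> \<phi>)"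
      if "{x, y, z} \<in> T" for x y z
      using nab[OF that] nab'[OF that] by blast+
    note eq = this
    have "cocycle T (?f \<phi>)"
      unfolding cocycle_def
    proof (intro allI impI)
      fix x y z assume t: "{x, y, z} \<in> T" "distinct [x, y, z]"
      show "({x, y} \<in> ?f \<phi>) = (({y, z} \<in> ?f \<phi>) \<noteq> ({x, z} \<in> ?f \<phi>))"
        unfolding eq[OF t(1)] using \<phi> t unfolding cocycles_def cocycle_def by blast
    qed
    then show ?thesis using \<phi> ab by (auto simp: cocycles_def)
  qed
  have fc: "?cond (?f \<phi>) = (\<not> ?cond \<phi>)" for \<phi>
    using insert.hyps(4) by (auto simp: doubleton_eq_iff)
  let ?A = "{\<phi> \<in> cocycles K T. ?cond \<phi>}" and ?B = "{\<phi> \<in> cocycles K T. \<not> ?cond \<phi>}"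
  have ff: "?f (?f \<phi>) = \<phi>" for \<phi> by blast
  have "bij_betw ?f ?A ?B"
    by (rule bij_betw_byWitness[of _ ?f]) (use f fc ff in \<open>auto simp del: Un_iff Diff_iff\<close>)
  then have "card ?A = card ?B" by (rule bij_betw_same_card)
  moreover have "card (cocycles K T) = card ?A + card ?B"
    using fin by (subst card_Un_disjoint[symmetric]) (auto intro!: arg_cong[where f = card])
  ultimately have 2: "card (cocycles K T) = 2 * card ?A" by (simp only: mult_2)
  have eq: "cocycles K (insert {a, b, c} T) = ?A"
    using cocycle_insert[OF insert.hyps(4)] by (auto simp: cocycles_def)
  have "finite T" using insert.hyps(1) finite_faces finite_subset by blast
  then have cs: "card (insert {a, b, c} T) = Suc (card T)" using insert.hyps(3) by simp
  show ?case using insert.IH[unfolded 2] unfolding eq cs power_Suc by (simp only: mult_ac)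
qed

lemma vertices_nonempty: "vertices K \<noteq> {}"
  using boundary edge_ends by (auto simp: vertices_def)

text \<open>A set and its complement have the same cut, and by connectedness there is no other
  coincidence. The sets that avoid a fixed vertex \<open>v0\<close> represent these pairs.\<close>

lemma card_cuts: "card (cuts K) * 2 = 2 ^ card (vertices K)"
proof -
  let ?V = "vertices K"
  have fV: "finite ?V" by (rule finite_vertices[OF complex])
  obtain v0 where v0: "v0 \<in> ?V" using vertices_nonempty by blast
  have inj: "inj_on (cut K) (Pow (?V - {v0}))"
  proof (rule inj_onI)
    fix A B assume AB: "A \<in> Pow (?V - {v0})" "B \<in> Pow (?V - {v0})" "cut K A = cut K B"
    have "sym_diff A B = {}"
    proof (rule ccontr)
      assume ne: "sym_diff A B \<noteq> {}"
      have "sym_diff A B = ?V"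
      proof (rule connected[OF ne])
        fix a b assume a: "a \<in> sym_diff A B" and ab: "{a, b} \<in> K"
        have "{a, b} \<in> cut K A \<longleftrightarrow> {a, b} \<in> cut K B" using AB by simp
        then have "(a \<in> A) \<noteq> (b \<in> A) \<longleftrightarrow> (a \<in> B) \<noteq> (b \<in> B)" using ab unfolding cut_mem by blast
        then show "b \<in> sym_diff A B" using a by blast
      qed (use AB in auto)
      then show False using v0 AB by blast
    qed
    then show "A = B" by blast
  qed
  have "cuts K = cut K ` Pow (?V - {v0})"
  proof
    have "cut K A \<in> cut K ` Pow (?V - {v0})" if "A \<subseteq> ?V" for A
    proof (cases "v0 \<in> A")
      case True
      have "cut K A = cut K (?V - A)"
      proof (rule subset_edges_eqI[OF cut_subset cut_subset])
        fix a b assume "{a, b} \<in> K"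
        then have "a \<in> ?V" "b \<in> ?V" using edge_ends by (auto simp: vertices_def)
        then show "{a, b} \<in> cut K A \<longleftrightarrow> {a, b} \<in> cut K (?V - A)" by (auto simp: cut_mem)
      qed
      then show ?thesis using True by (intro image_eqI[of _ _ "?V - A"]) auto
    qed (use that in auto)
    then show "cuts K \<subseteq> cut K ` Pow (?V - {v0})" unfolding cuts_def by auto
  qed (auto simp: cuts_def)
  then have "card (cuts K) = 2 ^ card (?V - {v0})" using card_image[OF inj] fV by (simp add: card_Pow)
  moreover have "card ?V = Suc (card (?V - {v0}))" using v0 fV by (metis card_Suc_Diff1)
  ultimately show ?thesis by simp
qed

lemma cuts_subset_cocycles: "cuts K \<subseteq> cocycles K (faces K)"
proof -
  have "cut K A \<in> cocycles K (faces K)" for A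
    unfolding cocycles_def cocycle_def
  proof (intro CollectI conjI allI impI cut_subset)
    fix a b c assume "{a, b, c} \<in> faces K"
    then have "{a, b} \<in> K" "{b, c} \<in> K" "{a, c} \<in> K" using face_edges[of a b c] by (auto simp: face_mem)
    then show "({a, b} \<in> cut K A) = (({b, c} \<in> cut K A) \<noteq> ({a, c} \<in> cut K A))" unfolding cut_mem by blast
  qed
  then show ?thesis unfolding cuts_def by blast
qed

text \<open>The obstruction to lifting a cocycle vanishes because the faces can be removed one by one
  through free edges: the value on the free edge absorbs the defect of the face.\<close>

lemma integer_lift:
  assumes \<phi>: "\<phi> \<in> cocycles K (faces K)" and "T \<subseteq> faces K"
  shows "\<exists>c::'v \<Rightarrow> 'v \<Rightarrow> int. (\<forall>a b. c a b = - c b a) \<and>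
    (\<forall>a b. {a, b} \<in> edges K \<longrightarrow> (odd (c a b) \<longleftrightarrow> {a, b} \<in> \<phi>)) \<and>
    (\<forall>a b d. {a, b, d} \<in> T \<longrightarrow> distinct [a, b, d] \<longrightarrow> c a b + c b d = c a d)"
  using assms(2)
proof (induction rule: faces_induct)
  case empty
  obtain idx :: "'v \<Rightarrow> nat" where idx: "inj_on idx (vertices K)"
    using finite_imp_inj_to_nat_seg[OF finite_vertices[OF complex]] by blast
  \<comment> \<open>Before any face is present only antisymmetry and parity are prescribed.
    Orienting each edge by the numbering \<open>idx\<close> provides both.\<close>
  define c :: "'v \<Rightarrow> 'v \<Rightarrow> int" where
    "c a b = (if {a, b} \<in> \<phi> then (if idx a < idx b then 1 else if idx b < idx a then -1 else 0) else 0)" for a b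
  have "odd (c a b) \<longleftrightarrow> {a, b} \<in> \<phi>" if "{a, b} \<in> edges K" for a b
  proof -
    have "a \<in> vertices K" "b \<in> vertices K" "a \<noteq> b" using that edge_ends by (auto simp: edge_mem vertices_def)
    then have "idx a \<noteq> idx b" using idx by (auto simp: inj_on_def)
    then show ?thesis by (auto simp: c_def)
  qed
  moreover have "c a b = - c b a" for a b by (auto simp: c_def insert_commute)
  ultimately show ?case by blast
next
  case (insert T a b d)
  obtain c :: "'v \<Rightarrow> 'v \<Rightarrow> int" where c: "\<And>a b. c a b = - c b a"
    "\<And>a b. {a, b} \<in> edges K \<Longrightarrow> odd (c a b) \<longleftrightarrow> {a, b} \<in> \<phi>"
    "\<And>a b d. {a, b, d} \<in> T \<Longrightarrow> distinct [a, b, d] \<Longrightarrow> c a b + c b d = c a d"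
    using insert.IH by metis
  have dist: "a \<noteq> b" "b \<noteq> d" "a \<noteq> d" using insert.hyps(4) by auto
  have E: "{a, b} \<in> edges K" "{b, d} \<in> edges K" "{a, d} \<in> edges K"
    using insert.hyps(2) dist face_edges[of a b d] by (auto simp: face_mem edge_mem)
  define s where "s = c a b + c b d - c a d"
  have "({a, b} \<in> \<phi>) = (({b, d} \<in> \<phi>) \<noteq> ({a, d} \<in> \<phi>))"
    using \<phi> insert.hyps(2,4) unfolding cocycles_def cocycle_def by blast
  then have "even s" using c(2)[OF E(1)] c(2)[OF E(2)] c(2)[OF E(3)] unfolding s_def by (auto)
  \<comment> \<open>The defect \<open>s\<close> is even because \<phi> is a cocycle, so the parities
    survive its subtraction on \<open>a b\<close>. The value on \<open>b a\<close> is changed as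
    well, to keep \<open>c'\<close> antisymmetric.\<close>
  define c' where "c' x y = (if x = a \<and> y = b then c a b - s else if x = b \<and> y = a then c b a + s else c x y)" for x y
  have c'1: "c' x y = - c' y x" for x y
    using c(1)[of x y] c(1)[of a b] dist by (auto simp: c'_def)
  have c'2: "odd (c' x y) \<longleftrightarrow> {x, y} \<in> \<phi>" if "{x, y} \<in> edges K" for x y
  proof (cases "x = a \<and> y = b \<or> x = b \<and> y = a")
    case True
    then show ?thesis
    proof
      assume xy: "x = a \<and> y = b"
      then show ?thesis using c(2)[OF that] \<open>even s\<close> by (simp add: c'_def)
    next
      assume xy: "x = b \<and> y = a"
      then show ?thesis using c(2)[OF that] \<open>even s\<close> dist by (simp add: c'_def)
    qed
  next
    case False
    then have "c' x y = c x y" by (auto simp: c'_def)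
    then show ?thesis using c(2)[OF that] by simp
  qed
  have c'T: "c' x y + c' y z = c' x z" if "{x, y, z} \<in> T" "distinct [x, y, z]" for x y z
  proof -
    have "\<not> {a, b} \<subseteq> {x, y, z}" using insert.hyps(5) that by blast
    then have "c' x y = c x y" "c' y z = c y z" "c' x z = c x z" by (auto simp: c'_def)
    then show ?thesis using c(3)[OF that] by simp
  qed
  have base: "c' a b + c' b d = c' a d" using dist by (auto simp: c'_def s_def)
  have "c' x y + c' y z = c' x z" if e: "{x, y, z} = {a, b, d}" "distinct [x, y, z]" for x y z
  proof -
    have "x \<in> {a, b, d}" "y \<in> {a, b, d}" "z \<in> {a, b, d}" using e by blast+
    then consider "x = a" "y = b" "z = d" | "x = a" "y = d" "z = b" | "x = b" "y = a" "z = d"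
      | "x = b" "y = d" "z = a" | "x = d" "y = a" "z = b" | "x = d" "y = b" "z = a"
      using e(2) by auto
    then show ?thesis using base c'1[of a b] c'1[of b d] c'1[of a d] by cases (hypsubst, linarith)+
  qed
  then have "\<forall>x y z. {x, y, z} \<in> insert {a, b, d} T \<longrightarrow> distinct [x, y, z] \<longrightarrow> c' x y + c' y z = c' x z"
    using c'T by blast
  then show ?case using c'1 c'2 by blast
qed

end

section \<open>Nowhere zero functions and their square roots\<close>

abbreviation closed_simplex :: "'v set \<Rightarrow> ('v \<Rightarrow> real) set" where
  "closed_simplex s \<equiv> realization (Pow s)"

lemma closed_simplex_iff:
  assumes "finite s"
  shows "\<alpha> \<in> closed_simplex s \<longleftrightarrow> (\<forall>v. 0 \<le> \<alpha> v) \<and> (\<forall>v. v \<notin> s \<longrightarrow> \<alpha> v = 0) \<and> sum \<alpha> s = 1"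
proof -
  have "supp \<alpha> \<subseteq> s \<longleftrightarrow> (\<forall>v. v \<notin> s \<longrightarrow> \<alpha> v = 0)" by (auto simp: supp_def)
  then show ?thesis using sum_supp[of \<alpha> s] assms by (auto simp: realization_iff)
qed

lemma closed_closed_simplex: "finite s \<Longrightarrow> closed (closed_simplex s)"
proof -
  assume s: "finite s"
  have "closed_simplex s = (\<Inter>v. {\<alpha>. 0 \<le> \<alpha> v}) \<inter> (\<Inter>v\<in>-s. {\<alpha>. \<alpha> v = 0}) \<inter> {\<alpha>. sum \<alpha> s = 1}"
    using closed_simplex_iff[OF s] by auto
  moreover have "closed (\<Inter>v. {\<alpha>::'a \<Rightarrow> real. 0 \<le> \<alpha> v})"
    by (intro closed_INT ballI closed_Collect_le continuous_intros)
  moreover have "closed (\<Inter>v\<in>-s. {\<alpha>::'a \<Rightarrow> real. \<alpha> v = 0})"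
    by (intro closed_INT ballI closed_Collect_eq continuous_intros)
  moreover have "closed {\<alpha>::'a \<Rightarrow> real. sum \<alpha> s = 1}"
    by (intro closed_Collect_eq continuous_intros)
  ultimately show ?thesis by (simp add: closed_Int)
qed

lemma closed_simplex_mono: "s \<subseteq> t \<Longrightarrow> closed_simplex s \<subseteq> closed_simplex t"
  by (rule realization_mono) auto

lemma vertex_point_closed_simplex: "v \<in> s \<Longrightarrow> vertex_point v \<in> closed_simplex s"
  by simp

text \<open>Along the segment from \<alpha> to the vertex point the quotient \<open>g / h\<close> is
  continuous with values 1 and -1, hence constant.\<close>

lemma sqrt_unique:
  fixes g h :: "('v \<Rightarrow> real) \<Rightarrow> complex"
  assumes c: "continuous_on (closed_simplex s) g" "continuous_on (closed_simplex s) h"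
    and eq: "\<And>\<alpha>. \<alpha> \<in> closed_simplex s \<Longrightarrow> (g \<alpha>)\<^sup>2 = (h \<alpha>)\<^sup>2 \<and> h \<alpha> \<noteq> 0"
    and v: "v \<in> s" "g (vertex_point v) = h (vertex_point v)" and \<alpha>: "\<alpha> \<in> closed_simplex s"
  shows "g \<alpha> = h \<alpha>"
proof -
  let ?p = "segment_point \<alpha> (vertex_point v)"
  have p: "?p t \<in> closed_simplex s" if "t \<in> {0..1}" for t
    by (rule segment_point_mem[OF \<alpha> vertex_point_closed_simplex[OF v(1)]])
      (use that \<alpha> v in \<open>auto simp: realization_iff\<close>)
  define q where "q t = g (?p t) / h (?p t)" for t
  have pc: "continuous_on {0..1} ?p" by (rule continuous_on_segment_point)
  have im: "?p ` {0..1} \<subseteq> closed_simplex s" using p by blast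
  have "continuous_on {0..1} (g \<circ> ?p)" "continuous_on {0..1} (h \<circ> ?p)"
    using c im pc by (meson continuous_on_compose continuous_on_subset)+
  then have "continuous_on {0..1} q"
    unfolding q_def comp_def using eq p by (intro continuous_on_divide) auto
  then have con: "connected (q ` {0..1})" by (intro connected_continuous_image) auto
  have "q t \<in> {1, -1}" if "t \<in> {0..1}" for t
  proof -
    have "(q t)\<^sup>2 = 1" using eq[OF p[OF that]] by (simp add: q_def power_divide)
    then show ?thesis by (simp add: power2_eq_1_iff)
  qed
  then have "q ` {0..1} \<subseteq> {1, -1}" by blast
  then have "finite (q ` {0..1})" by (rule finite_subset) simp
  then obtain z where z: "q ` {0..1} = {z}" using connected_finite_iff_sing[OF con] by auto
  have "q 1 = 1" using v eq[OF vertex_point_closed_simplex[OF v(1)]] by (simp add: q_def)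
  moreover have "q 0 = q 1" using z by (metis atLeastAtMost_iff imageI order_refl singletonD zero_le_one)
  ultimately show ?thesis using eq[OF \<alpha>] by (simp add: q_def)
qed

text \<open>Two coordinates identify the triangle with a convex planar set. On such a contractible
  set a nowhere zero continuous function has a continuous square root.\<close>

lemma sqrt_face:
  fixes f :: "('v \<Rightarrow> real) \<Rightarrow> complex"
  assumes d: "distinct [a, b, c]"
    and f: "continuous_on (closed_simplex {a, b, c}) f" "\<And>\<alpha>. \<alpha> \<in> closed_simplex {a, b, c} \<Longrightarrow> f \<alpha> \<noteq> 0"
  shows "\<exists>g. continuous_on (closed_simplex {a, b, c}) g \<and> (\<forall>\<alpha>\<in>closed_simplex {a, b, c}. (g \<alpha>)\<^sup>2 = f \<alpha>)"
proof -
  define D where "D = {z :: real \<times> real. 0 \<le> fst z \<and> 0 \<le> snd z \<and> fst z + snd z \<le> 1}"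
  define p :: "real \<times> real \<Rightarrow> 'v \<Rightarrow> real" where
    "p z = (\<lambda>v. if v = a then fst z else if v = b then snd z else if v = c then 1 - fst z - snd z else 0)" for z
  have p: "p z \<in> closed_simplex {a, b, c}" if "z \<in> D" for z
    unfolding closed_simplex_iff[OF finite.insertI[OF finite.insertI[OF finite.insertI[OF finite.emptyI]]]]
    using that d by (auto simp: D_def p_def)
  have pc: "continuous_on D p"
  proof (rule continuous_on_coordinatewise_then_product)
    show "continuous_on D (\<lambda>z. p z v)" for v
      unfolding p_def by (cases "v = a"; cases "v = b"; cases "v = c") (simp_all add: continuous_intros)
  qed
  have q: "(\<alpha> a, \<alpha> b) \<in> D \<and> p (\<alpha> a, \<alpha> b) = \<alpha>" if \<alpha>: "\<alpha> \<in> closed_simplex {a, b, c}" for \<alpha>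
  proof -
    have \<alpha>': "\<And>v. 0 \<le> \<alpha> v" "\<And>v. v \<notin> {a, b, c} \<Longrightarrow> \<alpha> v = 0" "\<alpha> a + \<alpha> b + \<alpha> c = 1"
      using \<alpha> closed_simplex_iff[of "{a, b, c}" \<alpha>] d by auto
    moreover have "\<alpha> a + \<alpha> b \<le> 1" using \<alpha>'(1)[of c] \<alpha>'(3) by linarith
    ultimately show ?thesis by (auto simp: D_def p_def fun_eq_iff)
  qed
  have "convex D" unfolding convex_alt D_def
  proof (intro ballI allI impI CollectI conjI)
    fix z z' :: "real \<times> real" and u :: real
    assume z: "z \<in> {z. 0 \<le> fst z \<and> 0 \<le> snd z \<and> fst z + snd z \<le> 1}"
      and z': "z' \<in> {z. 0 \<le> fst z \<and> 0 \<le> snd z \<and> fst z + snd z \<le> 1}" and u: "0 \<le> u \<and> u \<le> 1"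
    show "0 \<le> fst ((1 - u) *\<^sub>R z + u *\<^sub>R z')" "0 \<le> snd ((1 - u) *\<^sub>R z + u *\<^sub>R z')"
      using z z' u by simp_all
    have "(1 - u) * (fst z + snd z) + u * (fst z' + snd z') \<le> (1 - u) * 1 + u * 1"
      using z z' u by (intro add_mono mult_left_mono) auto
    then show "fst ((1 - u) *\<^sub>R z + u *\<^sub>R z') + snd ((1 - u) *\<^sub>R z + u *\<^sub>R z') \<le> 1"
      by (simp add: algebra_simps)
  qed
  then have "contractible D" by (rule convex_imp_contractible)
  moreover have "continuous_on D (f \<circ> p)"
    using f(1) pc p by (meson continuous_on_compose continuous_on_subset image_subsetI)
  ultimately obtain g where g: "continuous_on D g" "\<And>z. z \<in> D \<Longrightarrow> (f \<circ> p) z = (g z)\<^sup>2"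
    using continuous_sqrt_on_contractible[of D "f \<circ> p"] f(2) p by auto
  have "continuous_on (closed_simplex {a, b, c}) (g \<circ> (\<lambda>\<alpha>. (\<alpha> a, \<alpha> b)))"
    by (rule continuous_on_compose[OF _ continuous_on_subset[OF g(1)]])
      (use q in \<open>auto intro!: continuous_intros\<close>)
  moreover have "((g \<circ> (\<lambda>\<alpha>. (\<alpha> a, \<alpha> b))) \<alpha>)\<^sup>2 = f \<alpha>" if "\<alpha> \<in> closed_simplex {a, b, c}" for \<alpha>
    using g(2)[of "(\<alpha> a, \<alpha> b)"] q[OF that] by simp
  ultimately show ?thesis by blast
qed

text \<open>A nowhere zero function on the body determines a cocycle mod 2 up to cuts: the edges along
  which the continuation of a square root changes the chosen sign.\<close>

definition sqrt_on_edge :: "(('v \<Rightarrow> real) \<Rightarrow> complex) \<Rightarrow> 'v \<Rightarrow> 'v \<Rightarrow> complex \<Rightarrow> complex \<Rightarrow> bool" where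
  "sqrt_on_edge f a b x y \<longleftrightarrow> (\<exists>g. continuous_on (closed_simplex {a, b}) g \<and>
     (\<forall>\<alpha>\<in>closed_simplex {a, b}. (g \<alpha>)\<^sup>2 = f \<alpha>) \<and> g (vertex_point a) = x \<and> g (vertex_point b) = y)"

definition represents :: "'v set set \<Rightarrow> (('v \<Rightarrow> real) \<Rightarrow> complex) \<Rightarrow> 'v set set \<Rightarrow> bool" where
  "represents K f \<phi> \<longleftrightarrow> (\<exists>r. (\<forall>v\<in>vertices K. (r v)\<^sup>2 = f (vertex_point v)) \<and>
     (\<forall>a b. {a, b} \<in> edges K \<longrightarrow> sqrt_on_edge f a b (r a) (if {a, b} \<in> \<phi> then - r b else r b)))"

definition unit_function :: "'v set set \<Rightarrow> (('v \<Rightarrow> real) \<Rightarrow> complex) \<Rightarrow> bool" where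
  "unit_function K f \<longleftrightarrow> continuous_on (realization K) f \<and> (\<forall>\<alpha>\<in>realization K. f \<alpha> \<noteq> 0)"

definition square_function :: "'v set set \<Rightarrow> (('v \<Rightarrow> real) \<Rightarrow> complex) \<Rightarrow> bool" where
  "square_function K f \<longleftrightarrow> (\<exists>g. continuous_on (realization K) g \<and> (\<forall>\<alpha>\<in>realization K. (g \<alpha>)\<^sup>2 = f \<alpha>))"

lemma sqrt_on_edge_unique:
  assumes "sqrt_on_edge f a b x y" "sqrt_on_edge f a b x y'"
    and "\<And>\<alpha>. \<alpha> \<in> closed_simplex {a, b} \<Longrightarrow> f \<alpha> \<noteq> 0"
  shows "y = y'"
proof -
  obtain g where g: "continuous_on (closed_simplex {a, b}) g" "\<And>\<alpha>. \<alpha> \<in> closed_simplex {a, b} \<Longrightarrow> (g \<alpha>)\<^sup>2 = f \<alpha>"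
    "g (vertex_point a) = x" "g (vertex_point b) = y"
    using assms(1) unfolding sqrt_on_edge_def by blast
  obtain h where h: "continuous_on (closed_simplex {a, b}) h" "\<And>\<alpha>. \<alpha> \<in> closed_simplex {a, b} \<Longrightarrow> (h \<alpha>)\<^sup>2 = f \<alpha>"
    "h (vertex_point a) = x" "h (vertex_point b) = y'"
    using assms(2) unfolding sqrt_on_edge_def by blast
  have "g (vertex_point b) = h (vertex_point b)"
  proof (rule sqrt_unique[OF g(1) h(1), of a])
    fix \<alpha> assume "\<alpha> \<in> closed_simplex {a, b}"
    then show "(g \<alpha>)\<^sup>2 = (h \<alpha>)\<^sup>2 \<and> h \<alpha> \<noteq> 0" using g(2) h(2) assms(3) by (metis zero_power2)
  qed (use g h in auto)
  then show ?thesis using g h by simp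
qed

lemma sqrt_on_edge_neg: "sqrt_on_edge f a b x y \<Longrightarrow> sqrt_on_edge f a b (- x) (- y)"
  unfolding sqrt_on_edge_def by (metis (no_types, lifting) continuous_on_minus power2_minus)

lemma sqrt_on_edge_restrict:
  assumes "continuous_on A g" "\<And>\<alpha>. \<alpha> \<in> A \<Longrightarrow> (g \<alpha>)\<^sup>2 = f \<alpha>" "closed_simplex {a, b} \<subseteq> A"
  shows "sqrt_on_edge f a b (g (vertex_point a)) (g (vertex_point b))"
  unfolding sqrt_on_edge_def using assms continuous_on_subset[OF assms(1,3)] by blast

text \<open>The quotients of the chosen roots are roots of the quotient, and their signs along an
  edge multiply. Two functions agree modulo squares when their quotient is a square, which is how
  the lemma is applied.\<close>

lemma represents_divide:
  assumes "represents K f \<phi>" "represents K f' \<phi>'"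
    and u: "unit_function K f'" and K: "abstract_2_complex K"
  shows "represents K (\<lambda>\<alpha>. f \<alpha> / f' \<alpha>) (sym_diff \<phi> \<phi>')"
proof -
  obtain r where r: "\<And>v. v \<in> vertices K \<Longrightarrow> (r v)\<^sup>2 = f (vertex_point v)"
    "\<And>a b. {a, b} \<in> edges K \<Longrightarrow> sqrt_on_edge f a b (r a) (if {a, b} \<in> \<phi> then - r b else r b)"
    using assms(1) unfolding represents_def by blast
  obtain r' where r': "\<And>v. v \<in> vertices K \<Longrightarrow> (r' v)\<^sup>2 = f' (vertex_point v)"
    "\<And>a b. {a, b} \<in> edges K \<Longrightarrow> sqrt_on_edge f' a b (r' a) (if {a, b} \<in> \<phi>' then - r' b else r' b)"
    using assms(2) unfolding represents_def by blast
  have "sqrt_on_edge (\<lambda>\<alpha>. f \<alpha> / f' \<alpha>) a b (r a / r' a) (if {a, b} \<in> sym_diff \<phi> \<phi>' then - (r b / r' b) else r b / r' b)"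
    if e: "{a, b} \<in> edges K" for a b
  proof -
    obtain g where g: "continuous_on (closed_simplex {a, b}) g" "\<And>\<alpha>. \<alpha> \<in> closed_simplex {a, b} \<Longrightarrow> (g \<alpha>)\<^sup>2 = f \<alpha>"
      "g (vertex_point a) = r a" "g (vertex_point b) = (if {a, b} \<in> \<phi> then - r b else r b)"
      using r(2)[OF e] unfolding sqrt_on_edge_def by blast
    obtain g' where g': "continuous_on (closed_simplex {a, b}) g'" "\<And>\<alpha>. \<alpha> \<in> closed_simplex {a, b} \<Longrightarrow> (g' \<alpha>)\<^sup>2 = f' \<alpha>"
      "g' (vertex_point a) = r' a" "g' (vertex_point b) = (if {a, b} \<in> \<phi>' then - r' b else r' b)"
      using r'(2)[OF e] unfolding sqrt_on_edge_def by blast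
    have sub: "closed_simplex {a, b} \<subseteq> realization K"
    proof
      fix \<alpha> assume \<alpha>: "\<alpha> \<in> closed_simplex {a, b}"
      then have "supp \<alpha> \<in> K"
        using complex_mono[OF K, of "{a, b}" "supp \<alpha>"] e supp_nonempty[OF \<alpha>] by (auto simp: realization_iff edges_def)
      then show "\<alpha> \<in> realization K" using \<alpha> by (simp add: realization_iff)
    qed
    have nz: "g' \<alpha> \<noteq> 0" if "\<alpha> \<in> closed_simplex {a, b}" for \<alpha>
      using g'(2)[OF that] u sub that unfolding unit_function_def by (metis subsetD zero_power2)
    show ?thesis unfolding sqrt_on_edge_def
    proof (intro exI[of _ "\<lambda>\<alpha>. g \<alpha> / g' \<alpha>"] conjI ballI)
      show "continuous_on (closed_simplex {a, b}) (\<lambda>\<alpha>. g \<alpha> / g' \<alpha>)"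
        using g(1) g'(1) nz by (intro continuous_on_divide) auto
      show "(g \<alpha> / g' \<alpha>)\<^sup>2 = f \<alpha> / f' \<alpha>" if "\<alpha> \<in> closed_simplex {a, b}" for \<alpha>
        using g(2)[OF that] g'(2)[OF that] by (simp add: power_divide)
    qed (use g(3,4) g'(3,4) in auto)
  qed
  then show ?thesis
    unfolding represents_def using r(1) r'(1)
    by (intro exI[of _ "\<lambda>v. r v / r' v"]) (auto simp: power_divide)
qed

context surface_complex
begin

lemma closed_simplex_subset: "s \<in> K \<Longrightarrow> closed_simplex s \<subseteq> realization K"
proof
  fix \<alpha> assume s: "s \<in> K" and \<alpha>: "\<alpha> \<in> closed_simplex s"
  then have "supp \<alpha> \<in> K"
    using complex_mono[OF complex s, of "supp \<alpha>"] supp_nonempty[OF \<alpha>] by (auto simp: realization_iff)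
  then show "\<alpha> \<in> realization K" using \<alpha> by (simp add: realization_iff)
qed

lemma realization_faces: "realization K = (\<Union>t\<in>faces K. closed_simplex t)"
proof
  show "realization K \<subseteq> (\<Union>t\<in>faces K. closed_simplex t)"
  proof
    fix \<alpha> assume \<alpha>: "\<alpha> \<in> realization K"
    then obtain t where "t \<in> K" "supp \<alpha> \<subseteq> t" "card t = 3" using pure[of "supp \<alpha>"] by (auto simp: realization_iff)
    then show "\<alpha> \<in> (\<Union>t\<in>faces K. closed_simplex t)" using \<alpha> by (auto simp: realization_iff faces_def)
  qed
  show "(\<Union>t\<in>faces K. closed_simplex t) \<subseteq> realization K"
    using closed_simplex_subset by (auto simp: faces_def)
qed

lemma sqrt_on_face:
  assumes "unit_function K f" "t \<in> faces K"
  shows "\<exists>g. continuous_on (closed_simplex t) g \<and> (\<forall>\<alpha>\<in>closed_simplex t. (g \<alpha>)\<^sup>2 = f \<alpha>)"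
proof -
  obtain a b c where t: "t = {a, b, c}" "distinct [a, b, c]"
    using assms(2) by (auto simp: faces_def card_3_iff)
  have "closed_simplex t \<subseteq> realization K" using closed_simplex_subset assms(2) by (auto simp: faces_def)
  then show ?thesis
    using sqrt_face[OF t(2), of f] assms(1) continuous_on_subset unfolding unit_function_def t(1) by blast
qed

lemma unit_nonzero:
  assumes "unit_function K f" "s \<in> K" "\<alpha> \<in> closed_simplex s" shows "f \<alpha> \<noteq> 0"
  using assms closed_simplex_subset unfolding unit_function_def by blast

text \<open>A root exists over each whole face, so the number of sign changes around the face is
  even. This is the cocycle condition.\<close>

lemma represents_exists:
  assumes u: "unit_function K f"
  shows "\<exists>\<phi>\<in>cocycles K (faces K). represents K f \<phi>"
proof -
  define r where "r v = csqrt (f (vertex_point v))" for v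
  have r2: "(r v)\<^sup>2 = f (vertex_point v)" for v by (simp add: r_def)
  have r0: "r v \<noteq> 0" if "{v} \<in> K" for v
    using unit_nonzero[OF u that vertex_point_closed_simplex] r2[of v] by auto
  define \<phi> where "\<phi> = {e \<in> edges K. \<exists>a b. e = {a, b} \<and> sqrt_on_edge f a b (r a) (- r b)}"
  have on_face: "sqrt_on_edge f a b (g (vertex_point a)) (g (vertex_point b))"
    if "{a, b, c} \<in> faces K" "continuous_on (closed_simplex {a, b, c}) g" "\<forall>\<alpha>\<in>closed_simplex {a, b, c}. (g \<alpha>)\<^sup>2 = f \<alpha>" for a b c g
    by (rule sqrt_on_edge_restrict[OF that(2)]) (use that(3) closed_simplex_mono[of "{a, b}" "{a, b, c}"] in auto)
  have sgn: "g (vertex_point v) = r v \<or> g (vertex_point v) = - r v"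
    if "\<forall>\<alpha>\<in>closed_simplex t. (g \<alpha>)\<^sup>2 = f \<alpha>" "v \<in> t" for g t v
  proof -
    have "(g (vertex_point v))\<^sup>2 = (r v)\<^sup>2" using that r2[of v] by auto
    then show ?thesis by (simp add: power2_eq_iff)
  qed
  have sym: "sqrt_on_edge f b a (r b) (- r a)" if "sqrt_on_edge f a b (r a) (- r b)" for a b
    using sqrt_on_edge_neg[OF that] unfolding sqrt_on_edge_def by (metis (no_types, lifting) insert_commute minus_minus)
  have phi: "{a, b} \<in> \<phi> \<longleftrightarrow> sqrt_on_edge f a b (r a) (- r b)" if "{a, b} \<in> edges K" for a b
    using that sym unfolding \<phi>_def by (auto simp: doubleton_eq_iff)
  \<comment> \<open>Whether an edge belongs to \<phi> can be read off from any root \<open>g\<close>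
    on a face at it, by comparing \<open>g\<close> with the chosen root \<open>r\<close> at both
    ends. Thus one root per face settles all three edges.\<close>
  have side: "{a, b} \<in> \<phi> \<longleftrightarrow> (g (vertex_point a) = r a) \<noteq> (g (vertex_point b) = r b)"
    if t: "{a, b, c} \<in> faces K" "continuous_on (closed_simplex {a, b, c}) g" "\<forall>\<alpha>\<in>closed_simplex {a, b, c}. (g \<alpha>)\<^sup>2 = f \<alpha>" for a b c g
  proof -
    have K: "{a, b} \<in> K" "{a} \<in> K" "{b} \<in> K" "a \<noteq> b" using t(1) face_edges[of a b c] by (auto simp: face_mem)
    have E: "{a, b} \<in> edges K" using K by (simp add: edge_mem)
    have nz: "r a \<noteq> - r a" "r b \<noteq> - r b" using r0[OF K(2)] r0[OF K(3)] by auto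
    have nf: "\<And>\<alpha>. \<alpha> \<in> closed_simplex {a, b} \<Longrightarrow> f \<alpha> \<noteq> 0" using unit_nonzero[OF u K(1)] .
    have g: "sqrt_on_edge f a b (g (vertex_point a)) (g (vertex_point b))" using on_face t by blast
    have uq: "y = y'" if "sqrt_on_edge f a b x y" "sqrt_on_edge f a b x y'" for x y y'
      using sqrt_on_edge_unique[OF that nf] .
    have "g (vertex_point a) = r a \<or> g (vertex_point a) = - r a" "g (vertex_point b) = r b \<or> g (vertex_point b) = - r b"
      using sgn[OF t(3)] by auto
    then show ?thesis unfolding phi[OF E]
      using g uq nz sqrt_on_edge_neg[of f a b "g (vertex_point a)" "g (vertex_point b)"] by (metis minus_minus)
  qed
  have "\<phi> \<in> cocycles K (faces K)"
    unfolding cocycles_def cocycle_def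
  proof (intro CollectI conjI allI impI)
    show "\<phi> \<subseteq> edges K" by (auto simp: \<phi>_def)
    fix a b c assume t: "{a, b, c} \<in> faces K"
    obtain g where g: "continuous_on (closed_simplex {a, b, c}) g" "\<forall>\<alpha>\<in>closed_simplex {a, b, c}. (g \<alpha>)\<^sup>2 = f \<alpha>"
      using sqrt_on_face[OF u t] by blast
    have p: "{b, c, a} = {a, b, c}" "{a, c, b} = {a, b, c}" by auto
    show "({a, b} \<in> \<phi>) = (({b, c} \<in> \<phi>) \<noteq> ({a, c} \<in> \<phi>))"
      using side[of a b c g] side[of b c a g] side[of a c b g] t g unfolding p by metis
  qed
  moreover have "represents K f \<phi>"
    unfolding represents_def
  proof (intro exI[of _ r] conjI ballI allI impI r2)
    fix a b assume E: "{a, b} \<in> edges K"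
    then have ab: "a \<noteq> b" "{a, b} \<in> K" by (auto simp: edge_mem)
    then obtain c where "c \<in> opp K a b" using opp_nonempty by blast
    then have t: "{a, b, c} \<in> faces K" using opp_iff_face[OF ab(1)] by blast
    obtain g where g: "continuous_on (closed_simplex {a, b, c}) g" "\<forall>\<alpha>\<in>closed_simplex {a, b, c}. (g \<alpha>)\<^sup>2 = f \<alpha>"
      using sqrt_on_face[OF u t] by blast
    have "sqrt_on_edge f a b (g (vertex_point a)) (g (vertex_point b))" using on_face t g by blast
    moreover have "g (vertex_point a) = r a \<or> g (vertex_point a) = - r a" "g (vertex_point b) = r b \<or> g (vertex_point b) = - r b"
      using sgn[OF g(2)] by auto
    ultimately have "sqrt_on_edge f a b (r a) (r b) \<or> sqrt_on_edge f a b (r a) (- r b)"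
      using sqrt_on_edge_neg by (metis minus_minus)
    then show "sqrt_on_edge f a b (r a) (if {a, b} \<in> \<phi> then - r b else r b)" using phi[OF E] by auto
  qed
  ultimately show ?thesis by blast
qed

text \<open>A global root agrees with \<open>r\<close> at some vertices and with its negative at the
  others. The continuation changes the chosen sign exactly along the edges between these two
  kinds.\<close>

lemma square_imp_cut:
  assumes u: "unit_function K f" and rep: "represents K f \<phi>" and sub: "\<phi> \<subseteq> edges K"
    and sq: "square_function K f"
  shows "\<phi> \<in> cuts K"
proof -
  obtain r where r: "\<And>v. v \<in> vertices K \<Longrightarrow> (r v)\<^sup>2 = f (vertex_point v)"
    "\<And>a b. {a, b} \<in> edges K \<Longrightarrow> sqrt_on_edge f a b (r a) (if {a, b} \<in> \<phi> then - r b else r b)"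
    using rep unfolding represents_def by blast
  obtain h where h: "continuous_on (realization K) h" "\<And>\<alpha>. \<alpha> \<in> realization K \<Longrightarrow> (h \<alpha>)\<^sup>2 = f \<alpha>"
    using sq unfolding square_function_def by blast
  define A where "A = {v \<in> vertices K. h (vertex_point v) = r v}"
  have sgn: "h (vertex_point v) = r v \<or> h (vertex_point v) = - r v" "r v \<noteq> 0" if "v \<in> vertices K" for v
  proof -
    have v: "{v} \<in> K" using that by (simp add: vertices_def)
    have "(h (vertex_point v))\<^sup>2 = (r v)\<^sup>2" using h(2) r(1)[OF that] v by simp
    then show "h (vertex_point v) = r v \<or> h (vertex_point v) = - r v" by (simp add: power2_eq_iff)
    have "f (vertex_point v) \<noteq> 0" using unit_nonzero[OF u v] by simp
    then show "r v \<noteq> 0" using r(1)[OF that] by auto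
  qed
  have "\<phi> = cut K A"
  proof (rule subset_edges_eqI[OF sub cut_subset])
    fix a b assume ab: "a \<noteq> b" "{a, b} \<in> K"
    then have E: "{a, b} \<in> edges K" and V: "a \<in> vertices K" "b \<in> vertices K"
      using edge_ends by (auto simp: edge_mem vertices_def)
    have nf: "\<And>\<alpha>. \<alpha> \<in> closed_simplex {a, b} \<Longrightarrow> f \<alpha> \<noteq> 0" using unit_nonzero[OF u ab(2)] .
    have g: "sqrt_on_edge f a b (h (vertex_point a)) (h (vertex_point b))"
      by (rule sqrt_on_edge_restrict[OF h(1)]) (use h(2) closed_simplex_subset[OF ab(2)] in auto)
    have uq: "y = y'" if "sqrt_on_edge f a b x y" "sqrt_on_edge f a b x y'" for x y y'
      using sqrt_on_edge_unique[OF that nf] .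
    have nz: "r a \<noteq> - r a" "r b \<noteq> - r b" using sgn(2) V by auto
    have "{a, b} \<in> \<phi> \<longleftrightarrow> (h (vertex_point a) = r a) \<noteq> (h (vertex_point b) = r b)"
      using r(2)[OF E] g uq nz sqrt_on_edge_neg[OF g] sgn(1)[OF V(1)] sgn(1)[OF V(2)]
      by (smt (verit) minus_minus)
    then show "{a, b} \<in> \<phi> \<longleftrightarrow> {a, b} \<in> cut K A" using ab V by (auto simp: cut_mem A_def)
  qed
  then show ?thesis unfolding cuts_def A_def by auto
qed

text \<open>Reversing the sign of \<open>r\<close> on one side of the cut makes the chosen roots
  compatible along all edges. The root on each face can then be chosen with these values at its
  vertices.\<close>

lemma cut_imp_square:
  assumes u: "unit_function K f" and rep: "represents K f \<phi>" and cut: "\<phi> \<in> cuts K"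
  shows "square_function K f"
proof -
  obtain r where r: "\<And>v. v \<in> vertices K \<Longrightarrow> (r v)\<^sup>2 = f (vertex_point v)"
    "\<And>a b. {a, b} \<in> edges K \<Longrightarrow> sqrt_on_edge f a b (r a) (if {a, b} \<in> \<phi> then - r b else r b)"
    using rep unfolding represents_def by blast
  obtain A where A: "\<phi> = cut K A" using cut unfolding cuts_def by blast
  define r' where "r' v = (if v \<in> A then - r v else r v)" for v
  have r'2: "(r' v)\<^sup>2 = f (vertex_point v)" if "{v} \<in> K" for v
    using r(1)[of v] that by (auto simp: r'_def vertices_def)
  have r': "sqrt_on_edge f a b (r' a) (r' b)" if "{a, b} \<in> edges K" for a b
    using r(2)[OF that] sqrt_on_edge_neg[OF r(2)[OF that]] that
    by (auto simp: A cut_mem r'_def edge_mem split: if_splits)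
  have "\<exists>g. continuous_on (closed_simplex t) g \<and> (\<forall>\<alpha>\<in>closed_simplex t. (g \<alpha>)\<^sup>2 = f \<alpha>) \<and>
     (\<forall>v\<in>t. g (vertex_point v) = r' v)" if t: "t \<in> faces K" for t
  proof -
    obtain g where g: "continuous_on (closed_simplex t) g" "\<forall>\<alpha>\<in>closed_simplex t. (g \<alpha>)\<^sup>2 = f \<alpha>"
      using sqrt_on_face[OF u t] by blast
    obtain a where a: "a \<in> t" using t by (fastforce simp: faces_def)
    have tK: "t \<in> K" using t by (simp add: faces_def)
    have "(g (vertex_point a))\<^sup>2 = (r' a)\<^sup>2"
      using g(2) a r'2[of a] simplex_vertices[OF complex tK a] by (auto simp: vertices_def)
    then have "g (vertex_point a) = r' a \<or> g (vertex_point a) = - r' a" by (simp add: power2_eq_iff)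
    then obtain g' where g': "continuous_on (closed_simplex t) g'" "\<forall>\<alpha>\<in>closed_simplex t. (g' \<alpha>)\<^sup>2 = f \<alpha>"
      "g' (vertex_point a) = r' a"
    proof
      assume "g (vertex_point a) = - r' a"
      then show ?thesis using g by (intro that[of "\<lambda>\<alpha>. - g \<alpha>"]) (auto intro: continuous_on_minus)
    qed (use g in \<open>auto intro: that\<close>)
    have "g' (vertex_point v) = r' v" if v: "v \<in> t" for v
    proof (cases "v = a")
      case False
      have av: "{a, v} \<in> K" using complex_mono[OF complex tK, of "{a, v}"] a v by auto
      then have E: "{a, v} \<in> edges K" using False by (simp add: edge_mem)
      have "sqrt_on_edge f a v (g' (vertex_point a)) (g' (vertex_point v))"
        by (rule sqrt_on_edge_restrict[OF g'(1)]) (use g'(2) closed_simplex_mono[of "{a, v}" t] a v in auto)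
      then show ?thesis
        using sqrt_on_edge_unique[of f a v "r' a"] r'[OF E] g'(3) unit_nonzero[OF u av] by metis
    qed (use g' in simp)
    then show ?thesis using g' by blast
  qed
  then obtain G where G: "\<And>t. t \<in> faces K \<Longrightarrow> continuous_on (closed_simplex t) (G t)"
    "\<And>t \<alpha>. t \<in> faces K \<Longrightarrow> \<alpha> \<in> closed_simplex t \<Longrightarrow> (G t \<alpha>)\<^sup>2 = f \<alpha>"
    "\<And>t v. t \<in> faces K \<Longrightarrow> v \<in> t \<Longrightarrow> G t (vertex_point v) = r' v"
    by metis
  \<comment> \<open>The choice of the face does not matter: on the intersection of two faces their
    roots coincide at a common vertex, hence everywhere by \<open>sqrt_unique\<close>.\<close>
  define h where "h \<alpha> = G (SOME t. t \<in> faces K \<and> \<alpha> \<in> closed_simplex t) \<alpha>" for \<alpha>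
  have h: "h \<alpha> = G t \<alpha>" if t: "t \<in> faces K" "\<alpha> \<in> closed_simplex t" for t \<alpha>
  proof -
    define t' where "t' = (SOME t. t \<in> faces K \<and> \<alpha> \<in> closed_simplex t)"
    have t': "t' \<in> faces K" "\<alpha> \<in> closed_simplex t'"
      using someI[of "\<lambda>t. t \<in> faces K \<and> \<alpha> \<in> closed_simplex t" t] t unfolding t'_def by auto
    have s: "supp \<alpha> \<subseteq> t \<inter> t'" using t t' by (auto simp: realization_iff)
    obtain v where v: "v \<in> supp \<alpha>" using supp_nonempty[OF t(2)] by blast
    have sub: "closed_simplex (t \<inter> t') \<subseteq> closed_simplex t" "closed_simplex (t \<inter> t') \<subseteq> closed_simplex t'"
      using closed_simplex_mono[of "t \<inter> t'"] by auto
    have "G t' \<alpha> = G t \<alpha>"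
    proof (rule sqrt_unique[of "t \<inter> t'" _ _ v])
      show "continuous_on (closed_simplex (t \<inter> t')) (G t')" "continuous_on (closed_simplex (t \<inter> t')) (G t)"
        using G(1) t(1) t'(1) sub continuous_on_subset by blast+
      show "\<alpha> \<in> closed_simplex (t \<inter> t')" using t(2) s by (simp add: realization_iff)
      show "v \<in> t \<inter> t'" using v s by auto
      show "G t' (vertex_point v) = G t (vertex_point v)" using v s G(3)[OF t(1)] G(3)[OF t'(1)] by (metis IntD1 IntD2 subsetD)
      fix \<beta> assume \<beta>: "\<beta> \<in> closed_simplex (t \<inter> t')"
      then have "(G t' \<beta>)\<^sup>2 = f \<beta>" "(G t \<beta>)\<^sup>2 = f \<beta>" using G(2) t(1) t'(1) sub by blast+
      moreover have "f \<beta> \<noteq> 0" using unit_nonzero[OF u, of t] sub \<beta> t(1) by (auto simp: faces_def)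
      ultimately show "(G t' \<beta>)\<^sup>2 = (G t \<beta>)\<^sup>2 \<and> G t \<beta> \<noteq> 0" by auto
    qed
    then show ?thesis by (simp add: h_def t'_def)
  qed
  have "continuous_on (\<Union>t\<in>faces K. closed_simplex t) h"
  proof (rule continuous_on_closed_Union[OF finite_faces])
    fix t assume t: "t \<in> faces K"
    show "closed (closed_simplex t)"
      using closed_closed_simplex complex_finite[OF complex] t by (auto simp: faces_def)
    show "continuous_on (closed_simplex t) h"
      using G(1)[OF t] h[OF t] continuous_on_cong by (metis (no_types, lifting))
  qed
  moreover have "(h \<alpha>)\<^sup>2 = f \<alpha>" if "\<alpha> \<in> realization K" for \<alpha>
    using that h G(2) unfolding realization_faces by auto
  ultimately show ?thesis unfolding square_function_def realization_faces[symmetric] by blast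
qed

text \<open>On a face with vertex \<open>w\<close> the function has the angle 2 pi times the sum of
  \<open>\<alpha> v * c w v\<close>, where \<open>c\<close> is an integer lift of \<phi>. Another
  base vertex of the face changes this sum by the integer \<open>c w w'\<close>, because the lift is
  additive on faces, so the functions on the faces fit together.\<close>

lemma cocycle_represented:
  assumes \<phi>: "\<phi> \<in> cocycles K (faces K)"
  shows "\<exists>f. unit_function K f \<and> represents K f \<phi>"
proof -
  obtain c :: "'v \<Rightarrow> 'v \<Rightarrow> int" where c: "\<And>a b. c a b = - c b a"
    "\<And>a b. {a, b} \<in> edges K \<Longrightarrow> odd (c a b) \<longleftrightarrow> {a, b} \<in> \<phi>"
    "\<And>a b d. {a, b, d} \<in> faces K \<Longrightarrow> distinct [a, b, d] \<Longrightarrow> c a b + c b d = c a d"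
    using integer_lift[OF \<phi> order_refl] by metis
  have c0: "c a a = 0" for a using c(1)[of a a] by simp
  have cc: "c a b + c b d = c a d" if "t \<in> faces K" "{a, b, d} \<subseteq> t" for a b d t
  proof (cases "distinct [a, b, d]")
    case True
    moreover have "card t = 3" "finite t" using that by (auto simp: faces_def card_ge_0_finite)
    ultimately have "{a, b, d} = t" using that by (intro card_subset_eq) auto
    then show ?thesis using c(3) True that by simp
  next
    case False then show ?thesis using c0 c(1)[of a b] by auto
  qed
  define F where "F w \<alpha> = cis (2 * pi * (\<Sum>v\<in>supp \<alpha>. \<alpha> v * of_int (c w v)))" for w and \<alpha> :: "'v \<Rightarrow> real"
  have Fw: "F w \<alpha> = F w' \<alpha>" if t: "t \<in> faces K" "w \<in> t" "w' \<in> t" and \<alpha>: "\<alpha> \<in> closed_simplex t" for t w w' \<alpha>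
  proof -
    have s: "supp \<alpha> \<subseteq> t" "sum \<alpha> (supp \<alpha>) = 1" using \<alpha> by (auto simp: realization_iff)
    have "(\<Sum>v\<in>supp \<alpha>. \<alpha> v * of_int (c w v)) = (\<Sum>v\<in>supp \<alpha>. \<alpha> v * of_int (c w' v) + of_int (c w w') * \<alpha> v)"
    proof (rule sum.cong[OF refl])
      fix v assume "v \<in> supp \<alpha>"
      then have "c w v = c w w' + c w' v" using cc[OF t(1), of w w' v] t s by auto
      then show "\<alpha> v * of_int (c w v) = \<alpha> v * of_int (c w' v) + of_int (c w w') * \<alpha> v" by (simp add: algebra_simps)
    qed
    also have "\<dots> = (\<Sum>v\<in>supp \<alpha>. \<alpha> v * of_int (c w' v)) + of_int (c w w')"
      using s(2) by (simp add: sum.distrib flip: sum_distrib_left)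
    finally have *: "2 * pi * (\<Sum>v\<in>supp \<alpha>. \<alpha> v * of_int (c w v)) =
        2 * pi * (\<Sum>v\<in>supp \<alpha>. \<alpha> v * of_int (c w' v)) + 2 * pi * of_int (c w w')"
      by (simp add: algebra_simps)
    have "cis (2 * pi * of_int (c w w')) = 1" by (rule cis_multiple_2pi) simp
    then show ?thesis unfolding F_def * cis_mult[symmetric] by simp
  qed
  define f where "f \<alpha> = F (SOME w. w \<in> supp \<alpha>) \<alpha>" for \<alpha>
  have f: "f \<alpha> = F w \<alpha>" if "t \<in> faces K" "w \<in> t" "\<alpha> \<in> closed_simplex t" for t w \<alpha>
  proof -
    have "(SOME w. w \<in> supp \<alpha>) \<in> supp \<alpha>" using supp_nonempty[OF that(3)] by (simp add: some_in_eq)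
    then show ?thesis unfolding f_def using Fw[OF that(1) _ that(2,3)] that(3) by (auto simp: realization_iff)
  qed
  have Fsum: "F w \<alpha> = cis (2 * pi * (\<Sum>v\<in>t. \<alpha> v * of_int (c w v)))" if "\<alpha> \<in> closed_simplex t" "finite t" for w \<alpha> t
  proof -
    have "(\<Sum>v\<in>supp \<alpha>. \<alpha> v * of_int (c w v)) = (\<Sum>v\<in>t. \<alpha> v * of_int (c w v))"
      by (rule sum.mono_neutral_left) (use that in \<open>auto simp: realization_iff supp_def\<close>)
    then show ?thesis by (simp add: F_def)
  qed
  have "continuous_on (\<Union>t\<in>faces K. closed_simplex t) f"
  proof (rule continuous_on_closed_Union[OF finite_faces])
    fix t assume t: "t \<in> faces K"
    then have ft: "finite t" using complex_finite[OF complex] by (auto simp: faces_def)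
    show "closed (closed_simplex t)" using closed_closed_simplex ft by blast
    obtain w where w: "w \<in> t" using t by (fastforce simp: faces_def)
    have "continuous_on (closed_simplex t) (\<lambda>\<alpha>. cis (2 * pi * (\<Sum>v\<in>t. \<alpha> v * of_int (c w v))))"
      by (intro continuous_intros)
    then show "continuous_on (closed_simplex t) f"
      using f[OF t w] Fsum[OF _ ft] by (auto elim!: continuous_on_eq)
  qed
  then have u: "unit_function K f"
    unfolding unit_function_def realization_faces[symmetric] by (simp add: f_def F_def)
  have "represents K f \<phi>"
    unfolding represents_def
  proof (intro exI[of _ "\<lambda>_. 1"] conjI ballI allI impI)
    fix v assume "v \<in> vertices K"
    show "1\<^sup>2 = f (vertex_point v)" by (simp add: f_def F_def vertex_point_def[of v] c0) (simp add: supp_def c0)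
  next
    fix a b assume E: "{a, b} \<in> edges K"
    then have ab: "a \<noteq> b" "{a, b} \<in> K" by (auto simp: edge_mem)
    then obtain d where "d \<in> opp K a b" using opp_nonempty by blast
    then have t: "{a, b, d} \<in> faces K" using opp_iff_face[OF ab(1)] by blast
    \<comment> \<open>Half the angle of \<open>f\<close> on the edge. It starts at the root 1 and
      ends at the sign given by the parity of \<open>c a b\<close>, that is, by membership of the
      edge in \<phi>.\<close>
    let ?g = "\<lambda>\<alpha>. cis (pi * (\<alpha> b * of_int (c a b)))"
    show "sqrt_on_edge f a b 1 (if {a, b} \<in> \<phi> then - 1 else 1)"
      unfolding sqrt_on_edge_def
    proof (intro exI[of _ ?g] conjI ballI)
      show "continuous_on (closed_simplex {a, b}) ?g" by (intro continuous_intros)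
      fix \<alpha> assume \<alpha>: "\<alpha> \<in> closed_simplex {a, b}"
      then have "\<alpha> \<in> closed_simplex {a, b, d}" using closed_simplex_mono[of "{a, b}" "{a, b, d}"] by blast
      then have "f \<alpha> = F a \<alpha>" using f[OF t, of a] by simp
      also have "\<dots> = cis (2 * pi * (\<alpha> b * of_int (c a b)))"
        using Fsum[OF \<alpha>, of a] ab c0 by simp
      finally show "(?g \<alpha>)\<^sup>2 = f \<alpha>" by (simp add: power2_eq_square cis_mult algebra_simps)
    next
      show "?g (vertex_point a) = 1" using ab by (simp add: vertex_point_def)
      have "?g (vertex_point b) = cis (pi * of_int (c a b))" by (simp add: vertex_point_def)
      also have "\<dots> = (if {a, b} \<in> \<phi> then - 1 else 1)"
      proof -
        have "cis (pi * of_int n) = (if odd n then -1 else 1)" for n :: int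
          by (simp add: cis.ctr complex_eq_iff mult.commute cos_int_times_real sin_int_times_real)
        then show ?thesis using c(2)[OF E] by simp
      qed
      finally show "?g (vertex_point b) = (if {a, b} \<in> \<phi> then - 1 else 1)" .
    qed
  qed
  then show ?thesis using u by blast
qed

end

section \<open>Euler characteristic and contractible edges\<close>

definition inner_at :: "'v set set \<Rightarrow> 'v \<Rightarrow> bool" where
  "inner_at K v \<longleftrightarrow> (\<forall>z. z \<noteq> v \<longrightarrow> {v, z} \<in> K \<longrightarrow> card (opp K v z) = 2)"

definition degree_ok :: "'v set set \<Rightarrow> bool" where
  "degree_ok K \<longleftrightarrow> (\<forall>v\<in>vertices K. deg K v \<ge> 3 \<and> (inner_at K v \<longrightarrow> deg K v \<ge> 4))"

lemma F4_iff:
  assumes "punctured_surface F"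
  shows "K \<in> F4 F \<longleftrightarrow> triangulates K F \<and> degree_ok K"
  using triangulates_surface_complex(2)[OF assms, of K]
  unfolding F4_def degree_ok_def inner_at_def vertices_def by blast

text \<open>With \<open>n\<close> vertices, \<open>m\<close> edges and \<open>f\<close> faces there are
  \<open>2^(m - f)\<close> cocycles and \<open>2^(n - 1)\<close> cuts. Their quotient is the number of classes
  of nowhere zero functions modulo squares, a topological invariant.\<close>

lemma euler_inequality:
  fixes K :: "'v set set" and L :: "'w set set"
  assumes "surface_complex K" "surface_complex L" "body K homeomorphic_space body L"
  shows "card (edges K) + card (vertices L) + card (faces L) \<le> card (edges L) + card (vertices K) + card (faces K)"
proof -
  interpret K: surface_complex K by fact
  interpret L: surface_complex L by fact
  obtain p q where pq: "homeomorphic_maps (body K) (body L) p q"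
    using assms(3) unfolding homeomorphic_space_def by blast
  have p: "continuous_on (realization K) p" "\<And>\<alpha>. \<alpha> \<in> realization K \<Longrightarrow> p \<alpha> \<in> realization L \<and> q (p \<alpha>) = \<alpha>"
    and q: "continuous_on (realization L) q" "\<And>\<alpha>. \<alpha> \<in> realization L \<Longrightarrow> q \<alpha> \<in> realization K"
    using pq unfolding homeomorphic_maps_def by auto
  let ?ZK = "cocycles K (faces K)" and ?ZL = "cocycles L (faces L)"
  obtain f where f: "\<And>\<phi>. \<phi> \<in> ?ZK \<Longrightarrow> unit_function K (f \<phi>) \<and> represents K (f \<phi>) \<phi>"
    using K.cocycle_represented by metis
  have uq: "unit_function L (f \<phi> \<circ> q)" if "\<phi> \<in> ?ZK" for \<phi>
  proof -
    have "continuous_on (realization K) (f \<phi>)" using f[OF that] by (simp add: unit_function_def)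
    then have "continuous_on (realization L) (f \<phi> \<circ> q)"
      using q by (intro continuous_on_compose) (auto elim: continuous_on_subset)
    then show ?thesis using f[OF that] q(2) by (simp add: unit_function_def)
  qed
  then have "\<forall>\<phi>\<in>?ZK. \<exists>\<psi>. \<psi> \<in> ?ZL \<and> represents L (f \<phi> \<circ> q) \<psi>"
    using L.represents_exists by blast
  from bchoice[OF this] obtain \<Theta> where \<Theta>: "\<And>\<phi>. \<phi> \<in> ?ZK \<Longrightarrow> \<Theta> \<phi> \<in> ?ZL \<and> represents L (f \<phi> \<circ> q) (\<Theta> \<phi>)"
    by blast
  \<comment> \<open>If the two functions differ by a square after transport to \<open>L\<close>,
    then \<open>p\<close> carries the root back to \<open>K\<close>, where it shows that the
    cocycles differ by a cut.\<close>
  have key: "sym_diff \<phi> \<phi>' \<in> cuts K"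
    if \<phi>: "\<phi> \<in> ?ZK" "\<phi>' \<in> ?ZK" and c: "sym_diff (\<Theta> \<phi>) (\<Theta> \<phi>') \<in> cuts L" for \<phi> \<phi>'
  proof -
    let ?g = "\<lambda>\<alpha>. f \<phi> \<alpha> / f \<phi>' \<alpha>" and ?g' = "\<lambda>\<alpha>. (f \<phi> \<circ> q) \<alpha> / (f \<phi>' \<circ> q) \<alpha>"
    have divu: "unit_function M (\<lambda>\<alpha>. a \<alpha> / b \<alpha>)" if "unit_function M a" "unit_function M b" for M :: "'x set set" and a b
      using that unfolding unit_function_def by (auto intro!: continuous_on_divide)
    have "square_function L ?g'"
    proof (rule L.cut_imp_square[OF _ _ c])
      show "unit_function L ?g'" using divu uq \<phi> by blast
      show "represents L ?g' (sym_diff (\<Theta> \<phi>) (\<Theta> \<phi>'))"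
        using represents_divide[OF conjunct2[OF \<Theta>[OF \<phi>(1)]] conjunct2[OF \<Theta>[OF \<phi>(2)]] uq[OF \<phi>(2)] L.complex] .
    qed
    then obtain h where h: "continuous_on (realization L) h" "\<And>\<alpha>. \<alpha> \<in> realization L \<Longrightarrow> (h \<alpha>)\<^sup>2 = ?g' \<alpha>"
      unfolding square_function_def by blast
    have "continuous_on (realization K) (h \<circ> p)"
      using p by (intro continuous_on_compose continuous_on_subset[OF h(1)]) auto
    moreover have "((h \<circ> p) \<alpha>)\<^sup>2 = ?g \<alpha>" if "\<alpha> \<in> realization K" for \<alpha>
      using h(2)[of "p \<alpha>"] p(2)[OF that] by simp
    ultimately have "square_function K ?g" unfolding square_function_def by blast
    moreover have "unit_function K ?g" using divu f \<phi> by blast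
    moreover have "represents K ?g (sym_diff \<phi> \<phi>')"
      using represents_divide[of K "f \<phi>" \<phi> "f \<phi>'" \<phi>'] f \<phi> K.complex by blast
    moreover have "sym_diff \<phi> \<phi>' \<subseteq> edges K" using \<phi> by (auto simp: cocycles_def)
    ultimately show ?thesis using K.square_imp_cut by blast
  qed
  have fin: "finite ?ZL" "finite (cuts K)"
    using finite_subset[of ?ZL "Pow (edges L)"] L.finite_edges finite_subset[of "cuts K" "Pow (edges K)"] K.finite_edges
    by (auto simp: cocycles_def cuts_def cut_def)
  let ?P = "\<lambda>(\<phi>, \<beta>). sym_diff (\<Theta> \<phi>) \<beta>"
  \<comment> \<open>To count classes without forming quotient groups, pairs of a cocycle of
    \<open>K\<close> and a cut of \<open>L\<close> are injected into pairs of a cocycle of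
    \<open>L\<close> and a cut of \<open>K\<close>. A cocycle \<psi> determines one representative
    \<open>\<rho> \<psi>\<close>, and by \<open>key\<close> the given \<phi> differs from it by a
    cut. \<open>\<Theta>\<close> need not be additive.\<close>
  define \<rho> where "\<rho> \<psi> = (SOME \<phi>. \<phi> \<in> ?ZK \<and> (\<exists>\<beta>\<in>cuts L. sym_diff (\<Theta> \<phi>) \<beta> = \<psi>))" for \<psi>
  let ?Q = "\<lambda>(\<phi>, \<beta>). (sym_diff (\<Theta> \<phi>) \<beta>, sym_diff \<phi> (\<rho> (sym_diff (\<Theta> \<phi>) \<beta>)))"
  have cancel: "A = B" if "sym_diff A X = sym_diff B X" for A B X :: "'x set" using that by blast
  have inj: "inj_on ?Q (?ZK \<times> cuts L)"
  proof (rule inj_onI, clarify)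
    fix \<phi> \<beta> \<phi>' \<beta>'
    assume e: "sym_diff (\<Theta> \<phi>) \<beta> = sym_diff (\<Theta> \<phi>') \<beta>'"
      and e2: "sym_diff \<phi> (\<rho> (sym_diff (\<Theta> \<phi>) \<beta>)) = sym_diff \<phi>' (\<rho> (sym_diff (\<Theta> \<phi>') \<beta>'))"
    have "\<phi> = \<phi>'" using cancel e2 unfolding e by metis
    moreover have "\<beta> = \<beta>'" using e unfolding \<open>\<phi> = \<phi>'\<close> by blast
    ultimately show "\<phi> = \<phi>' \<and> \<beta> = \<beta>'" by blast
  qed
  have sub: "?Q ` (?ZK \<times> cuts L) \<subseteq> ?ZL \<times> cuts K"
  proof clarify
    fix \<phi> \<beta> assume \<phi>: "\<phi> \<in> ?ZK" and \<beta>: "\<beta> \<in> cuts L"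
    let ?\<psi> = "sym_diff (\<Theta> \<phi>) \<beta>"
    have "\<rho> ?\<psi> \<in> ?ZK \<and> (\<exists>\<beta>'\<in>cuts L. sym_diff (\<Theta> (\<rho> ?\<psi>)) \<beta>' = ?\<psi>)"
      unfolding \<rho>_def by (rule someI[of _ \<phi>]) (use \<phi> \<beta> in blast)
    then obtain \<beta>' where r: "\<rho> ?\<psi> \<in> ?ZK" "\<beta>' \<in> cuts L" "sym_diff (\<Theta> (\<rho> ?\<psi>)) \<beta>' = ?\<psi>" by blast
    have "sym_diff (\<Theta> \<phi>) (\<Theta> (\<rho> ?\<psi>)) = sym_diff \<beta> \<beta>'" using r(3) by blast
    then have "sym_diff (\<Theta> \<phi>) (\<Theta> (\<rho> ?\<psi>)) \<in> cuts L" using cuts_sym_diff[OF \<beta> r(2)] by simp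
    then have "sym_diff \<phi> (\<rho> ?\<psi>) \<in> cuts K" using key \<phi> r(1) by blast
    moreover have "?\<psi> \<in> ?ZL" using cocycles_sym_diff \<Theta>[OF \<phi>] \<beta> L.cuts_subset_cocycles by blast
    ultimately show "?\<psi> \<in> ?ZL \<and> sym_diff \<phi> (\<rho> ?\<psi>) \<in> cuts K" by blast
  qed
  have "card (?ZK \<times> cuts L) \<le> card (?ZL \<times> cuts K)"
    by (rule card_inj_on_le[OF inj sub]) (use fin in simp)
  then have le: "card ?ZK * card (cuts L) \<le> card ?ZL * card (cuts K)" by (simp add: card_cartesian_product)
  \<comment> \<open>The counts of cocycles and cuts are stated as products. The missing powers of 2
    are multiplied in, so that no division or subtraction of natural numbers occurs.\<close>
  have "2 ^ card (edges K) * 2 ^ card (vertices L) * 2 ^ card (faces L)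
      = (card ?ZK * card (cuts L)) * (2 * 2 ^ card (faces K) * 2 ^ card (faces L))"
    using K.card_cocycles[OF order_refl] L.card_cuts by (simp only: flip: K.card_cocycles[OF order_refl] L.card_cuts) (simp only: mult_ac)
  also have "\<dots> \<le> (card ?ZL * card (cuts K)) * (2 * 2 ^ card (faces K) * 2 ^ card (faces L))"
    using le by (rule mult_right_mono) simp
  also have "\<dots> = 2 ^ card (edges L) * 2 ^ card (vertices K) * 2 ^ card (faces K)"
    by (simp only: flip: L.card_cocycles[OF order_refl] K.card_cuts) (simp only: mult_ac)
  finally have "(2::nat) ^ (card (edges K) + card (vertices L) + card (faces L)) \<le>
      2 ^ (card (edges L) + card (vertices K) + card (faces K))" by (simp only: power_add)
  then show ?thesis by simp
qed

lemma contract_eq: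
  "contract u v K = {s \<in> K. v \<notin> s} \<union> {insert u (s - {v}) | s. s \<in> K \<and> v \<in> s}"
proof -
  have "(\<lambda>x. if x = v then u else x) ` s = (if v \<in> s then insert u (s - {v}) else s)" for s
    by auto
  then show ?thesis unfolding contract_def by (auto simp: image_iff)
qed

text \<open>Simplices of size \<open>k\<close> are lost in two ways. One that contains both ends
  shrinks to a smaller simplex, and one that contains \<open>v\<close> only is merged with its twin
  through \<open>u\<close> if that twin exists.\<close>

lemma card_contract_simplices:
  assumes K: "abstract_2_complex K" and uv: "u \<noteq> v" and uK: "{u} \<in> K"
  shows "card {s \<in> K. card s = k} = card {s \<in> contract u v K. card s = k}
    + card {s \<in> K. card s = k \<and> u \<in> s \<and> v \<in> s}
    + card {s \<in> K. card s = k \<and> v \<in> s \<and> u \<notin> s \<and> insert u (s - {v}) \<in> K}"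
proof -
  let ?A = "{s \<in> K. card s = k \<and> v \<notin> s}"
  let ?B = "{s \<in> K. card s = k \<and> v \<in> s \<and> u \<notin> s \<and> insert u (s - {v}) \<notin> K}"
  let ?C = "{s \<in> K. card s = k \<and> u \<in> s \<and> v \<in> s}"
  let ?D = "{s \<in> K. card s = k \<and> v \<in> s \<and> u \<notin> s \<and> insert u (s - {v}) \<in> K}"
  let ?f = "\<lambda>s. insert u (s - {v})"
  have fin: "finite K" by (rule complex_finite_all[OF K])
  have cf: "card (?f s) = card s" if "s \<in> K" "v \<in> s" "u \<notin> s" for s
    using complex_finite[OF K that(1)] that card_Suc_Diff1[of s v] by simp
  have "{s \<in> contract u v K. card s = k} = ?A \<union> ?f ` ?B"
  proof (intro equalityI subsetI)
    fix t assume t: "t \<in> {s \<in> contract u v K. card s = k}"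
    then consider "t \<in> K" "v \<notin> t" | s where "s \<in> K" "v \<in> s" "t = ?f s"
      unfolding contract_eq by blast
    then show "t \<in> ?A \<union> ?f ` ?B"
    proof cases
      case 1 then show ?thesis using t by blast
    next
      case (2 s)
      have vt: "v \<notin> t" using 2 uv by simp
      show ?thesis
      proof (cases "t \<in> K")
        case True then show ?thesis using vt t by blast
      next
        case False
        have "u \<notin> s"
        proof
          assume "u \<in> s"
          then have "t = s - {v}" using 2 uv by auto
          then have "t \<in> K" using complex_mono[OF K 2(1), of t] \<open>u \<in> s\<close> uv by auto
          then show False using False by simp
        qed
        then have "s \<in> ?B" using 2 False cf[OF 2(1,2)] t by auto
        then show ?thesis using 2 by blast
      qed
    qed
  next
    fix t assume "t \<in> ?A \<union> ?f ` ?B"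
    then show "t \<in> {s \<in> contract u v K. card s = k}"
    proof
      assume "t \<in> ?f ` ?B"
      then obtain s where "s \<in> ?B" "t = ?f s" by blast
      then show ?thesis using cf[of s] unfolding contract_eq by auto
    qed (auto simp: contract_eq)
  qed
  moreover have "?A \<inter> ?f ` ?B = {}" by blast
  moreover have "inj_on ?f ?B"
  proof (rule inj_onI)
    fix s t assume "s \<in> ?B" "t \<in> ?B" "?f s = ?f t"
    then have "s - {v} = t - {v}" "v \<in> s" "v \<in> t" by (simp_all add: insert_ident)
    then show "s = t" by (metis insert_Diff)
  qed
  ultimately have c1: "card {s \<in> contract u v K. card s = k} = card ?A + card ?B"
    using fin by (simp add: card_Un_disjoint card_image)
  have "{s \<in> K. card s = k} = ?A \<union> ?B \<union> ?C \<union> ?D" by blast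
  moreover have "card (?A \<union> ?B \<union> ?C \<union> ?D) = card ?A + card ?B + card ?C + card ?D"
    using fin by (subst card_Un_disjoint; (subst card_Un_disjoint)?; (subst card_Un_disjoint)?; auto)
  ultimately show ?thesis using c1 by simp
qed

lemma filter_insert_set: "{x \<in> insert a A. P x} = (if P a then insert a {x \<in> A. P x} else {x \<in> A. P x})"
  by auto

lemma two_regular_triangle:
  assumes "distinct [a, b, c]" shows "two_regular {{a, b}, {b, c}, {a, c}}"
proof -
  have d: "a \<noteq> b" "b \<noteq> c" "a \<noteq> c" using assms by auto
  have "card {e' \<in> {{a, b}, {b, c}, {a, c}}. x \<in> e'} = 2" if "x = a \<or> x = b \<or> x = c" for x
    unfolding filter_insert_set using that d d[symmetric] by (elim disjE) (simp_all add: doubleton_eq_iff)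
  then show ?thesis unfolding two_regular_def using d by auto
qed

lemma two_regular_square:
  assumes "distinct [a, b, c, d]" shows "two_regular {{a, b}, {b, c}, {c, d}, {d, a}}"
proof -
  have d: "a \<noteq> b" "b \<noteq> c" "a \<noteq> c" "a \<noteq> d" "b \<noteq> d" "c \<noteq> d" using assms by auto
  have "card {e' \<in> {{a, b}, {b, c}, {c, d}, {d, a}}. x \<in> e'} = 2" if "x = a \<or> x = b \<or> x = c \<or> x = d" for x
    unfolding filter_insert_set using that d d[symmetric] by (elim disjE) (simp_all add: doubleton_eq_iff)
  then show ?thesis unfolding two_regular_def using d by auto
qed

context surface_complex
begin

lemma link_edge_mem: "{a, b} \<in> link_edges K x \<longleftrightarrow> {x, a, b} \<in> faces K"
  by (auto simp: link_edges_def face_mem card_insert_if)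

lemma nbrs_link_edges: "nbrs K x = \<Union>(link_edges K x)"
proof (intro equalityI subsetI)
  fix w assume "w \<in> nbrs K x"
  then have w: "x \<noteq> w" "{x, w} \<in> K" by (auto simp: nbrs_def)
  then obtain y where "y \<in> opp K x w" using opp_nonempty by blast
  then have "{w, y} \<in> link_edges K x" using w by (simp add: link_edge_mem opp_iff_face)
  then show "w \<in> \<Union>(link_edges K x)" by blast
next
  fix w assume "w \<in> \<Union>(link_edges K x)"
  then obtain e where e: "card e = 2" "x \<notin> e" "insert x e \<in> K" "w \<in> e" by (auto simp: link_edges_def)
  then show "w \<in> nbrs K x" using complex_mono[OF complex e(3), of "{x, w}"] by (auto simp: nbrs_def)
qed

lemma finite_nbrs: "finite (nbrs K x)"
  by (rule finite_subset[OF _ finite_vertices[OF complex]])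
    (use edge_ends in \<open>auto simp: nbrs_def vertices_def\<close>)

lemma cycle_link_inner:
  assumes "\<Gamma> \<subseteq> link_edges K x" "\<Gamma> \<noteq> {}" "two_regular \<Gamma>"
  shows "link_edges K x = \<Gamma>" "nbrs K x = \<Union>\<Gamma>" "inner_at K x"
proof -
  show *: "link_edges K x = \<Gamma>" using cycle_link assms by blast
  show "nbrs K x = \<Union>\<Gamma>" using nbrs_link_edges * by simp
  show "inner_at K x" unfolding inner_at_def
  proof (intro allI impI)
    fix z assume z: "z \<noteq> x" "{x, z} \<in> K"
    then have "z \<in> nbrs K x" by (simp add: nbrs_def)
    then obtain e where "e \<in> \<Gamma>" "z \<in> e" using nbrs_link_edges * by auto
    then have "card {e' \<in> \<Gamma>. z \<in> e'} = 2" using assms(3) unfolding two_regular_def by blast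
    then show "card (opp K x z) = 2" using link_edges_at(2)[OF z(1), of K] * by simp
  qed
qed

lemma triangle_link:
  assumes "{x, a, b} \<in> faces K" "{x, b, c} \<in> faces K" "{x, a, c} \<in> faces K" "b \<noteq> c"
    "a \<noteq> b" "a \<noteq> c"
  shows "nbrs K x = {a, b, c}" "inner_at K x" "deg K x = 3"
proof -
  have *: "{{a, b}, {b, c}, {a, c}} \<subseteq> link_edges K x" using assms by (simp add: link_edge_mem)
  have r: "two_regular {{a, b}, {b, c}, {a, c}}" by (rule two_regular_triangle) (use assms in auto)
  show n: "nbrs K x = {a, b, c}" using cycle_link_inner(2)[OF * _ r] by auto
  show "inner_at K x" using cycle_link_inner(3)[OF * _ r] by auto
  show "deg K x = 3" using n assms by (simp add: deg_def)
qed

text \<open>The three faces close the link of \<open>x\<close> to a triangle, so \<open>x\<close>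
  would be inner of degree 3. This excludes an unwanted face at a vertex with few
  neighbours.\<close>

lemma degree_ok_no_triangle_link:
  assumes "degree_ok K" "{x, a, b} \<in> faces K" "{x, b, c} \<in> faces K" "{x, a, c} \<in> faces K" "b \<noteq> c"
    "a \<noteq> b" "a \<noteq> c"
  shows False
proof -
  have "x \<in> vertices K" using assms(2) face_edges[of x a b] by (auto simp: faces_def vertices_def)
  then have "deg K x \<ge> 4" using assms(1) triangle_link(2)[OF assms(2-7)] unfolding degree_ok_def by blast
  then show False using triangle_link(3)[OF assms(2-7)] by simp
qed

end

text \<open>The contraction identifies one pair of edges for each common neighbour, and one pair of faces
  for each common link edge. Equality of the Euler characteristics forces the common link edges to be a
  union of cycles on the common neighbours not opposite to \<open>uv\<close>; but a cycle would be the whole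
  link of \<open>u\<close>.\<close>

lemma link_condition:
  assumes "surface_complex K" "surface_complex (contract u v K)"
    and homeo: "body (contract u v K) homeomorphic_space body K"
    and ok: "degree_ok K" and uv: "u \<noteq> v" "{u, v} \<in> K"
    and w: "w \<noteq> u" "w \<noteq> v" "{u, w} \<in> K" "{v, w} \<in> K"
  shows "w \<in> opp K u v"
proof -
  interpret surface_complex K by fact
  let ?L = "contract u v K"
  define C where "C = {w. w \<noteq> u \<and> w \<noteq> v \<and> {u, w} \<in> K \<and> {v, w} \<in> K}"
  define M where "M = link_edges K u \<inter> link_edges K v"
  let ?O = "opp K u v"
  have ends: "{u} \<in> K" "{v} \<in> K" using edge_ends uv by auto
  note cnt = card_contract_simplices[OF complex uv(1) ends(1)]
  have vc: "card (vertices J) = card {s \<in> J. card s = 1}" for J :: "'a set set"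
  proof -
    have "{s \<in> J. card s = 1} = (\<lambda>v. {v}) ` vertices J"
      by (auto simp: vertices_def card_1_singleton_iff)
    moreover have "inj_on (\<lambda>v. {v}) (vertices J)" by (auto simp: inj_on_def)
    ultimately show ?thesis by (simp add: card_image)
  qed
  have V: "card (vertices K) = card (vertices ?L) + 1"
  proof -
    have "{s \<in> K. card s = 1 \<and> u \<in> s \<and> v \<in> s} = {}" using uv by (auto simp: card_1_singleton_iff)
    then have "card {s \<in> K. card s = 1 \<and> u \<in> s \<and> v \<in> s} = 0" by (simp only: card.empty)
    moreover have "{s \<in> K. card s = 1 \<and> v \<in> s \<and> u \<notin> s \<and> insert u (s - {v}) \<in> K} = {{v}}"
      using uv ends by (auto simp: card_1_singleton_iff)
    ultimately show ?thesis using cnt[of 1] unfolding vc by simp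
  qed
  have E: "card (edges K) = card (edges ?L) + 1 + card C"
  proof -
    have "{s \<in> K. card s = 2 \<and> u \<in> s \<and> v \<in> s} = {{u, v}}" using uv by (auto simp: card_2_iff)
    moreover have "{s \<in> K. card s = 2 \<and> v \<in> s \<and> u \<notin> s \<and> insert u (s - {v}) \<in> K} = (\<lambda>w. {v, w}) ` C"
    proof (intro equalityI subsetI)
      fix s assume s: "s \<in> {s \<in> K. card s = 2 \<and> v \<in> s \<and> u \<notin> s \<and> insert u (s - {v}) \<in> K}"
      then obtain w where "s = {v, w}" "v \<noteq> w" using edge_verts[of s v] by auto
      then show "s \<in> (\<lambda>w. {v, w}) ` C" using s by (auto simp: C_def)
    qed (use uv in \<open>auto simp: C_def insert_Diff_if\<close>)
    moreover have "inj_on (\<lambda>w. {v, w}) C" by (auto simp: inj_on_def doubleton_eq_iff)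
    ultimately show ?thesis using cnt[of 2] by (simp add: edges_def card_image)
  qed
  have Fc: "card (faces K) = card (faces ?L) + card ?O + card M"
  proof -
    have "{s \<in> K. card s = 3 \<and> u \<in> s \<and> v \<in> s} = (\<lambda>x. {u, v, x}) ` ?O"
    proof (intro equalityI subsetI)
      fix s assume s: "s \<in> {s \<in> K. card s = 3 \<and> u \<in> s \<and> v \<in> s}"
      then obtain x where "s = {u, v, x}" "x \<noteq> u" "x \<noteq> v" using face_verts[of s u v] uv by auto
      then show "s \<in> (\<lambda>x. {u, v, x}) ` ?O" using s by (auto simp: opp_def)
    qed (use uv in \<open>auto simp: opp_def\<close>)
    moreover have "inj_on (\<lambda>x. {u, v, x}) ?O" by (auto simp: inj_on_def opp_def)
    moreover have "{s \<in> K. card s = 3 \<and> v \<in> s \<and> u \<notin> s \<and> insert u (s - {v}) \<in> K} = insert v ` M"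
    proof (intro equalityI subsetI)
      fix s assume s: "s \<in> {s \<in> K. card s = 3 \<and> v \<in> s \<and> u \<notin> s \<and> insert u (s - {v}) \<in> K}"
      then have "s - {v} \<in> M" by (auto simp: M_def link_edges_def insert_absorb)
      then show "s \<in> insert v ` M" using s by (auto intro!: image_eqI[of _ _ "s - {v}"])
    qed (use uv in \<open>auto simp: M_def link_edges_def card_insert_if card_ge_0_finite\<close>)
    moreover have "inj_on (insert v) M" unfolding M_def link_edges_def by (rule inj_onI) (auto dest: insert_ident)
    ultimately show ?thesis using cnt[of 3] by (simp add: faces_def card_image)
  qed
  have hs: "body K homeomorphic_space body ?L" using homeo homeomorphic_space_sym by blast
  \<comment> \<open>The Euler inequality in both directions gives equality. The contraction loses
    one vertex, the edge \<open>u v\<close> and one edge for each common neighbour, and the faces at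
    \<open>u v\<close> and one for each common link edge.\<close>
  have CM: "card C = card ?O + card M"
    using euler_inequality[OF assms(1,2) hs] euler_inequality[OF assms(2,1) homeo] V E Fc by linarith
  have fC: "finite C"
    by (rule finite_subset[OF _ finite_nbrs[of u]]) (auto simp: C_def nbrs_def)
  have OC: "?O \<subseteq> C" using face_edges by (fastforce simp: opp_def C_def)
  \<comment> \<open>A common link edge \<open>x z\<close> at an opposite vertex \<open>x\<close>
    would give the faces \<open>u x z\<close> and \<open>v x z\<close> beside \<open>u v x\<close>,
    hence a triangle \<open>u v z\<close> as link of \<open>x\<close>.\<close>
  have Mno: "e \<inter> ?O = {}" if e: "e \<in> M" for e
  proof (rule ccontr)
    assume "e \<inter> ?O \<noteq> {}"
    then obtain x where x: "x \<in> e" "x \<in> ?O" by blast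
    have "card e = 2" using e by (simp add: M_def link_edges_def)
    then obtain z where z: "e = {x, z}" "x \<noteq> z" using edge_verts x by metis
    then have zz: "{u, x, z} \<in> faces K" "{v, x, z} \<in> faces K" using e by (simp_all add: M_def link_edge_mem)
    then have "z \<noteq> u" "z \<noteq> v" by (auto simp: face_mem)
    moreover have "{u, v, x} \<in> faces K" using x(2) opp_iff_face[OF uv(1)] by simp
    ultimately show False using degree_ok_no_triangle_link[OF ok, of x u v z] zz uv by (simp add: insert_commute)
  qed
  have MC: "e \<subseteq> C - ?O" if e: "e \<in> M" for e
  proof
    fix y assume y: "y \<in> e"
    have "u \<notin> e" "v \<notin> e" "insert u e \<in> K" "insert v e \<in> K" using e by (auto simp: M_def link_edges_def)
    then have "{u, y} \<in> K" "{v, y} \<in> K" "y \<noteq> u" "y \<noteq> v"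
      using complex_mono[OF complex, of "insert u e" "{u, y}"] complex_mono[OF complex, of "insert v e" "{v, y}"] y by auto
    then show "y \<in> C - ?O" using Mno[OF e] y by (auto simp: C_def)
  qed
  have "C = ?O"
  proof (rule ccontr)
    assume ne: "C \<noteq> ?O"
    let ?D = "C - ?O"
    have cD: "card ?D = card M" using CM OC fC finite_subset[OF OC fC] by (simp add: card_Diff_subset)
    have fM: "finite M" unfolding M_def using finite_link_edges[OF complex] by blast
    have le: "card {e \<in> M. y \<in> e} \<le> 2" if "y \<in> ?D" for y
    proof -
      have y: "y \<noteq> u" "{u, y} \<in> K" using that by (auto simp: C_def)
      have "card {e \<in> M. y \<in> e} \<le> card {e \<in> link_edges K u. y \<in> e}"
        by (rule card_mono) (use finite_link_edges[OF complex] in \<open>auto simp: M_def\<close>)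
      also have "\<dots> = card (opp K u y)" by (rule link_edges_at(2)[OF y(1)])
      also have "\<dots> \<le> 2" using card_opp[of u y] y by auto
      finally show ?thesis .
    qed
    \<comment> \<open>Double counting in the graph with vertices \<open>?D\<close> and edges
      \<open>M\<close>. It has as many edges as vertices and no degree above 2, so every degree is
      2.\<close>
    have "(\<Sum>y\<in>?D. card {e \<in> M. y \<in> e}) = (\<Sum>e\<in>M. card {y \<in> ?D. y \<in> e})"
      using fC fM by (intro sum_multicount_gen[symmetric]) auto
    also have "\<dots> = (\<Sum>e\<in>M. 2)"
    proof (rule sum.cong[OF refl])
      fix e assume e: "e \<in> M"
      have "{y \<in> ?D. y \<in> e} = e" using MC[OF e] by blast
      then show "card {y \<in> ?D. y \<in> e} = 2" using e by (simp add: M_def link_edges_def)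
    qed
    also have "\<dots> = (\<Sum>y\<in>?D. 2)" using cD by simp
    finally have sums: "(\<Sum>y\<in>?D. card {e \<in> M. y \<in> e}) = (\<Sum>y\<in>?D. 2)" .
    have eq2: "card {e \<in> M. y \<in> e} = 2" if "y \<in> ?D" for y
    proof (rule ccontr)
      assume "card {e \<in> M. y \<in> e} \<noteq> 2"
      then have "(\<Sum>y\<in>?D. card {e \<in> M. y \<in> e}) < (\<Sum>y\<in>?D. 2)"
        using le that fC by (intro sum_strict_mono_ex1) (auto intro!: bexI[of _ y] simp: order_less_le)
      then show False using sums by simp
    qed
    have reg: "two_regular M"
      unfolding two_regular_def
    proof (intro conjI ballI fM)
      show "card e = 2" if "e \<in> M" for e using that by (simp add: M_def link_edges_def)
      show "card {e' \<in> M. y \<in> e'} = 2" if "e \<in> M" "y \<in> e" for e y using eq2 MC that by blast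
    qed
    have "card ?D > 0" using ne OC fC by (auto simp: card_gt_0_iff)
    then have "M \<noteq> {}" using cD by auto
    then have "M = link_edges K u" using cycle_link[OF _ _ reg, of u] by (auto simp: M_def)
    moreover obtain x where "x \<in> ?O" using opp_nonempty uv by blast
    then have "{v, x} \<in> link_edges K u" using opp_iff_face[OF uv(1)] by (simp add: link_edge_mem)
    ultimately have "{v, x} \<in> link_edges K v" by (auto simp: M_def)
    then show False by (simp add: link_edges_def)
  qed
  then show ?thesis using w by (auto simp: C_def)
qed

section \<open>Degrees after a contraction\<close>

definition light :: "'v set set \<Rightarrow> 'v \<Rightarrow> bool" where
  "light K x \<longleftrightarrow> deg K x = (if inner_at K x then 4 else 3)"

lemma contract_mem:
  assumes K: "abstract_2_complex K" and uv: "u \<noteq> v"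
  shows "s \<in> contract u v K \<longleftrightarrow> v \<notin> s \<and> (s \<in> K \<or> u \<in> s \<and> insert v (s - {u}) \<in> K)"
proof
  assume "s \<in> contract u v K"
  then consider "s \<in> K" "v \<notin> s" | t where "t \<in> K" "v \<in> t" "s = insert u (t - {v})"
    unfolding contract_eq by blast
  then show "v \<notin> s \<and> (s \<in> K \<or> u \<in> s \<and> insert v (s - {u}) \<in> K)"
  proof cases
    case (2 t)
    have "v \<notin> s" "u \<in> s" using 2 uv by auto
    moreover have "insert v (s - {u}) \<in> K"
      using complex_mono[OF K 2(1), of "insert v (s - {u})"] 2 by auto
    ultimately show ?thesis by blast
  qed blast
next
  assume s: "v \<notin> s \<and> (s \<in> K \<or> u \<in> s \<and> insert v (s - {u}) \<in> K)"
  show "s \<in> contract u v K"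
  proof (cases "s \<in> K")
    case False
    then have "insert v (s - {u}) \<in> K" "s = insert u (insert v (s - {u}) - {v})" using s by auto
    then show ?thesis unfolding contract_eq by blast
  qed (use s in \<open>simp add: contract_eq\<close>)
qed

lemma nbrs_contract:
  assumes "abstract_2_complex K" "u \<noteq> v" "w \<noteq> u" "w \<noteq> v"
  shows "nbrs (contract u v K) w = nbrs K w - {v} \<union> (if v \<in> nbrs K w then {u} else {})"
  using assms by (auto simp: nbrs_def contract_mem insert_Diff_if insert_commute)

lemma nbrs_contract_merged:
  assumes "abstract_2_complex K" "u \<noteq> v"
  shows "nbrs (contract u v K) u = nbrs K u \<union> nbrs K v - {u, v}"
  using assms by (auto simp: nbrs_def contract_mem insert_Diff_if)

lemma opp_contract:
  assumes "abstract_2_complex K" "u \<noteq> v" "w \<noteq> u" "w \<noteq> v" "z \<noteq> u" "z \<noteq> v"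
  shows "opp (contract u v K) w z = opp K w z - {v} \<union> (if v \<in> opp K w z then {u} else {})"
  using assms by (auto simp: opp_def contract_mem insert_Diff_if insert_commute)

lemma opp_contract_merged:
  assumes "abstract_2_complex K" "u \<noteq> v" "w \<noteq> u" "w \<noteq> v"
  shows "opp (contract u v K) w u = (opp K w u \<union> opp K w v) - {u, v}"
  using assms by (auto simp: opp_def contract_mem insert_Diff_if insert_commute)

lemma vertices_contract:
  assumes "abstract_2_complex K" "u \<noteq> v" "{u} \<in> K"
  shows "vertices (contract u v K) = vertices K - {v}"
  using assms by (auto simp: vertices_def contract_mem)

context surface_complex
begin

lemma opp_subset_nbrs: "opp K a b \<subseteq> nbrs K a"
proof
  fix x assume "x \<in> opp K a b"
  then show "x \<in> nbrs K a" using face_edges[of a b x] by (auto simp: opp_def nbrs_def)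
qed

lemma opp_subset_nbrs': "opp K a b \<subseteq> nbrs K b"
  using opp_subset_nbrs[of b a] opp_commute[of K a b] by simp

text \<open>The neighbours of \<open>u\<close> are \<open>v\<close>, \<open>x\<close> and
  \<open>y\<close>, and a face \<open>u x y\<close> would close the link of \<open>u\<close> to a
  triangle.\<close>

lemma degree_three_two_faces:
  assumes ok: "degree_ok K" and uv: "u \<noteq> v" "{u, v} \<in> K" and d: "deg K u = 3"
    and o: "opp K u v = {x, y}" "x \<noteq> y"
  shows "opp K u x = {v}"
proof -
  have xy: "{u, v, x} \<in> faces K" "{u, v, y} \<in> faces K" using o opp_iff_face[OF uv(1)] by auto
  then have ne: "x \<noteq> u" "x \<noteq> v" "y \<noteq> u" "y \<noteq> v" by (auto simp: face_mem)
  have "{v, x, y} \<subseteq> nbrs K u" using uv opp_subset_nbrs[of u v] o by (auto simp: nbrs_def)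
  moreover have "card {v, x, y} = 3" using ne o(2) by auto
  ultimately have n: "nbrs K u = {v, x, y}"
    using d finite_nbrs card_subset_eq unfolding deg_def by metis
  have "y \<notin> opp K u x"
  proof
    assume "y \<in> opp K u x"
    then have "{u, x, y} \<in> faces K" using opp_iff_face ne by metis
    then show False using degree_ok_no_triangle_link[OF ok xy(1) _ xy(2) o(2)] ne by auto
  qed
  moreover have "v \<in> opp K u x" using xy(1) opp_iff_face[of u x v] ne by (simp add: insert_commute)
  moreover have "opp K u x \<subseteq> nbrs K u - {x}" using opp_subset_nbrs by (auto simp: opp_def)
  ultimately show ?thesis unfolding n by auto
qed

text \<open>Here \<open>p\<close> is the third neighbour of \<open>u\<close> beside \<open>v\<close>
  and \<open>x\<close>; it lies in no face with the edge \<open>u v\<close>. After a contraction of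
  \<open>u v\<close> the edge \<open>u p\<close> still shows that the merged vertex is on the
  boundary.\<close>

lemma degree_three_one_face:
  assumes uv: "u \<noteq> v" "{u, v} \<in> K" and d: "deg K u = 3" and o: "opp K u v = {x}"
  shows "\<exists>p. p \<noteq> u \<and> p \<noteq> v \<and> {u, p} \<in> K \<and> p \<notin> opp K u v \<and> opp K u p = {x}"
proof -
  have x: "{u, v, x} \<in> faces K" using o opp_iff_face[OF uv(1)] by auto
  then have ne: "x \<noteq> u" "x \<noteq> v" by (auto simp: face_mem)
  have s: "{v, x} \<subseteq> nbrs K u" using uv opp_subset_nbrs[of u v] o by (auto simp: nbrs_def)
  have "card (nbrs K u - {v, x}) = 1" using d s ne by (simp add: deg_def card_Diff_subset)
  then obtain p where "nbrs K u - {v, x} = {p}" by (auto simp: card_1_singleton_iff)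
  then have n: "nbrs K u = {v, x, p}" "p \<noteq> v" "p \<noteq> x" using s by auto
  then have pu: "{u, p} \<in> K" "p \<noteq> u" by (auto simp: nbrs_def)
  have "v \<notin> opp K u p"
  proof
    assume "v \<in> opp K u p"
    then have "{u, v, p} \<in> faces K" using opp_iff_face[of u p v] pu by (simp add: insert_commute)
    then show False using o opp_iff_face[OF uv(1)] n by auto
  qed
  moreover have "opp K u p \<subseteq> nbrs K u - {p}" using opp_subset_nbrs by (auto simp: opp_def)
  ultimately have "opp K u p \<subseteq> {x}" unfolding n by auto
  then have "opp K u p = {x}" using opp_nonempty[of u p] pu by auto
  then show ?thesis using pu n o by auto
qed

end

text \<open>By \<open>lc\<close> only opposite vertices lose a neighbour, and only one. The merged
  vertex has degree \<open>deg K u + deg K v - card (opp K u v) - 2\<close>. This can drop to 3 only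
  if an end had degree 3, and then a boundary edge keeps the merged vertex on the boundary.\<close>

lemma light_opposite:
  assumes "surface_complex K" "surface_complex (contract u v K)"
    and ok: "degree_ok K" and uv: "u \<noteq> v" "{u, v} \<in> K"
    and lc: "\<And>w. w \<noteq> u \<Longrightarrow> w \<noteq> v \<Longrightarrow> {u, w} \<in> K \<Longrightarrow> {v, w} \<in> K \<Longrightarrow> w \<in> opp K u v"
    and nl: "\<And>x. x \<in> opp K u v \<Longrightarrow> \<not> light K x"
  shows "degree_ok (contract u v K)"
proof -
  interpret surface_complex K by fact
  let ?L = "contract u v K"
  interpret L: surface_complex ?L by fact
  let ?O = "opp K u v"
  have ends: "{u} \<in> K" "{v} \<in> K" using edge_ends uv by auto
  have vn: "v \<in> nbrs K w \<longleftrightarrow> {v, w} \<in> K \<and> w \<noteq> v" for w by (auto simp: nbrs_def insert_commute)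
  have un: "u \<in> nbrs K w \<longleftrightarrow> {u, w} \<in> K \<and> w \<noteq> u" for w by (auto simp: nbrs_def insert_commute)
  have both: "w \<in> ?O \<longleftrightarrow> u \<in> nbrs K w \<and> v \<in> nbrs K w" if "w \<noteq> u" "w \<noteq> v" for w
  proof
    assume "w \<in> ?O"
    then show "u \<in> nbrs K w \<and> v \<in> nbrs K w" using face_edges[of u v w] that by (auto simp: opp_def vn un)
  qed (use lc that in \<open>auto simp: vn un\<close>)
  note nb = nbrs_contract[OF complex uv(1)] and op = opp_contract[OF complex uv(1)]
    and opm = opp_contract_merged[OF complex uv(1)]
  have le_opp: "card (opp ?L w z) \<le> card (opp K w z)" if "w \<noteq> u" "w \<noteq> v" "z \<noteq> u" "z \<noteq> v" for w z
  proof (cases "v \<in> opp K w z")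
    case True
    have "card (opp ?L w z) = card (insert u (opp K w z - {v}))" using op[OF that] True by simp
    also have "\<dots> \<le> Suc (card (opp K w z - {v}))" by (simp add: card_insert_if finite_opp[OF complex])
    also have "\<dots> = card (opp K w z)" using True finite_opp[OF complex] by (metis card_Suc_Diff1)
    finally show ?thesis .
  qed (use op[OF that] in simp)
  \<comment> \<open>The contraction must not turn a boundary vertex into an inner one, since the
    bound for inner vertices is larger.\<close>
  have inner: "inner_at K w" if w: "w \<noteq> u" "w \<noteq> v" and i: "inner_at ?L w" for w
    unfolding inner_at_def
  proof (intro allI impI)
    fix z assume z: "z \<noteq> w" "{w, z} \<in> K"
    have one: "card (opp K w z) = 1 \<or> card (opp K w z) = 2" using card_opp[of w z] z by auto
    show "card (opp K w z) = 2"
    proof (rule ccontr)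
      assume "card (opp K w z) \<noteq> 2"
      then obtain y where y: "opp K w z = {y}" using one by (auto simp: card_1_singleton_iff)
      show False
      proof (cases "z = u \<or> z = v")
        case False
        then have "{w, z} \<in> ?L" using z w by (auto simp: contract_mem[OF complex uv(1)])
        then have "card (opp ?L w z) = 2" using i z unfolding inner_at_def by auto
        then show False using le_opp[of w z] w False y by simp
      next
        case True
        have wuL: "{w, u} \<in> ?L" using True z w uv(1)
          by (auto simp: contract_mem[OF complex uv(1)] insert_Diff_if insert_commute)
        then have two: "card (opp ?L w u) = 2" using i w unfolding inner_at_def by auto
        \<comment> \<open>The other end of the contracted edge: the edges from \<open>w\<close> to
          \<open>z\<close> and to \<open>z'\<close> merge. Since \<open>w z\<close> has a single
          face, the merged edge cannot have two.\<close>
        define z' where "z' = (if z = u then v else u)"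
        have e: "opp ?L w u = (opp K w z \<union> opp K w z') - {u, v}" using opm w True by (auto simp: z'_def)
        show False
        proof (cases "z' \<in> nbrs K w")
          case False
          have "opp K w z' = {}" using False opp_nonempty face_edges[of w z'] w True
            by (auto simp: nbrs_def opp_def z'_def)
          then have "card (opp ?L w u) \<le> 1" unfolding e y by (simp add: card_le_Suc0_iff_eq)
          then show False using two by simp
        next
          case nz: True
          then have "w \<in> ?O" using both[OF w] True z w nz uv(1) uv(1)[symmetric] by (auto simp: z'_def nbrs_def)
          then have f: "{w, u, v} \<in> K" by (simp add: opp_def insert_commute)
          have "z' \<in> opp K w z" using f w uv(1) True by (auto simp: opp_def z'_def insert_commute)
          then have yz: "y = z'" using y by simp
          have "z \<in> opp K w z'" using f w uv(1) True by (auto simp: opp_def z'_def insert_commute)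
          then have "card (opp K w z' - {z}) < card (opp K w z')"
            using finite_opp[OF complex] by (intro psubset_card_mono) auto
          moreover have "card (opp K w z') \<le> 2" using card_opp[of w z'] nz by (auto simp: nbrs_def)
          moreover have "opp ?L w u = opp K w z' - {z}" unfolding e y yz using True by (auto simp: z'_def opp_def)
          ultimately show False using two by simp
        qed
      qed
    qed
  qed
  have degw: "deg ?L w = (if w \<in> ?O then deg K w - 1 else deg K w)" if w: "w \<noteq> u" "w \<noteq> v" for w
  proof (cases "v \<in> nbrs K w")
    case False
    then show ?thesis using nb[OF w] both[OF w] by (simp add: deg_def)
  next
    case True
    have f: "finite (nbrs K w)" by (rule finite_nbrs)
    show ?thesis
    proof (cases "u \<in> nbrs K w")
      case u: True
      have "nbrs K w - {v} \<union> {u} = nbrs K w - {v}" using u uv(1) by auto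
      then have "deg ?L w = card (nbrs K w - {v})" using nb[OF w] True by (simp add: deg_def)
      then show ?thesis using both[OF w] u True f by (simp add: deg_def)
    next
      case False
      have "deg ?L w = card (insert u (nbrs K w - {v}))" using nb[OF w] True by (simp add: deg_def)
      also have "\<dots> = Suc (card (nbrs K w - {v}))" using False f by simp
      also have "\<dots> = deg K w" using True f unfolding deg_def by (metis card_Suc_Diff1)
      finally show ?thesis using both[OF w] False by simp
    qed
  qed
  have dK: "deg K w \<ge> 3" "inner_at K w \<Longrightarrow> deg K w \<ge> 4" if "{w} \<in> K" for w
    using ok that unfolding degree_ok_def vertices_def by auto
  have other: "deg ?L w \<ge> 3 \<and> (inner_at ?L w \<longrightarrow> deg ?L w \<ge> 4)" if w: "w \<noteq> u" "w \<noteq> v" "{w} \<in> K" for w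
  proof (cases "w \<in> ?O")
    case False
    then show ?thesis using dK[OF w(3)] degw[OF w(1,2)] inner[OF w(1,2)] by simp
  next
    case True
    then show ?thesis
      using dK[OF w(3)] degw[OF w(1,2)] inner[OF w(1,2)] nl[OF True] unfolding light_def by (auto split: if_splits)
  qed
  have not_inner: "\<not> inner_at ?L u" if p: "p \<noteq> u" "{u, p} \<in> ?L" "card (opp ?L u p) = 1" for p
    using p unfolding inner_at_def by auto
  \<comment> \<open>Common neighbours, which are the opposite vertices, are counted once instead of
    twice, and \<open>u\<close> and \<open>v\<close> cease to be neighbours of each other. Addition
    replaces truncated subtraction.\<close>
  have degu: "deg ?L u + card ?O + 2 = deg K u + deg K v"
  proof -
    have "nbrs K u \<inter> nbrs K v = ?O"
      using both vn un by (auto simp: nbrs_def insert_commute opp_def)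
    then have "card (nbrs K u \<union> nbrs K v) + card ?O = deg K u + deg K v"
      using card_Un_Int[OF finite_nbrs finite_nbrs, of u v] by (simp add: deg_def)
    moreover have "{u, v} \<subseteq> nbrs K u \<union> nbrs K v" using uv by (auto simp: nbrs_def insert_commute)
    then have "card (nbrs K u \<union> nbrs K v) = card (nbrs K u \<union> nbrs K v - {u, v}) + 2"
      using uv(1) finite_nbrs card_mono[of "nbrs K u \<union> nbrs K v" "{u, v}"] by (simp add: card_Diff_subset)
    ultimately show ?thesis using nbrs_contract_merged[OF complex uv(1)] by (simp add: deg_def)
  qed
  have merged: "deg ?L u \<ge> 3 \<and> (inner_at ?L u \<longrightarrow> deg ?L u \<ge> 4)"
  proof -
    consider "card ?O = 1" | "card ?O = 2" using card_opp uv by blast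
    then show ?thesis
    proof cases
      case 1
      show ?thesis
      proof (cases "deg K u = 3")
        case True
        obtain x where x: "?O = {x}" using 1 by (auto simp: card_1_singleton_iff)
        obtain p where p: "p \<noteq> u" "p \<noteq> v" "{u, p} \<in> K" "p \<notin> ?O" "opp K u p = {x}"
          using degree_three_one_face[OF uv True x] by blast
        have pL: "{u, p} \<in> ?L" using p uv(1) by (simp add: contract_mem[OF complex uv(1)])
        have "v \<notin> nbrs K p" using both[OF p(1,2)] p un by (auto simp: nbrs_def insert_commute)
        then have "opp K p v = {}" using face_edges[of p v] p(2) by (auto simp: opp_def nbrs_def)
        moreover have "x \<noteq> u" "x \<noteq> v" using x by (auto simp: opp_def)
        ultimately have "opp ?L u p = {x}"
          using opm[of p] p opp_commute[of ?L u p] opp_commute[of K u p] by auto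
        then have "\<not> inner_at ?L u" using not_inner[OF p(1) pL] by simp
        then show ?thesis using degu 1 dK[OF ends(1)] dK[OF ends(2)] by simp
      next
        case False
        then show ?thesis using degu 1 dK[OF ends(1)] dK[OF ends(2)] by simp
      qed
    next
      case 2
      then obtain x y where xy: "?O = {x, y}" "x \<noteq> y" by (auto simp: card_2_iff)
      have xn: "x \<noteq> u" "x \<noteq> v" "{u, v, x} \<in> K" using xy by (auto simp: opp_def)
      have xL: "{u, x} \<in> ?L" using xn face_edges[of u v x] uv(1) by (simp add: contract_mem[OF complex uv(1)])
      have vu: "{v, u} \<in> K" "opp K v u = {x, y}" using uv xy opp_commute[of K u v] by (auto simp: insert_commute)
      have ox: "opp ?L u x = (opp K u x \<union> opp K v x) - {u, v}"
        using opm[OF xn(1,2)] by (simp add: opp_commute)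
      have nex: "opp ?L u x \<noteq> {}" using L.opp_nonempty[of u x] xn xL by auto
      have c2: "card (opp K u x) \<le> 2" "card (opp K v x) \<le> 2"
        using card_opp[of u x] card_opp[of v x] xn face_edges[of u v x] by auto
      have mem: "v \<in> opp K u x" "u \<in> opp K v x" using xn uv(1) by (auto simp: opp_def insert_commute)
      \<comment> \<open>If at most one third vertex survives at the edge obtained from
        \<open>u x\<close> and \<open>v x\<close>, that edge is a boundary edge of the
        contraction.\<close>
      have small: "\<not> inner_at ?L u" if "opp ?L u x \<subseteq> A - {w}" "w \<in> A" "card A \<le> 2" "finite A" for A w
      proof -
        have "card (opp ?L u x) \<le> card (A - {w})" using that by (intro card_mono) auto
        then have "card (opp ?L u x) \<le> 1" using that by simp
        moreover have "card (opp ?L u x) \<noteq> 0" using nex finite_opp[OF L.complex] by simp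
        ultimately have "card (opp ?L u x) = 1" by linarith
        then show ?thesis using not_inner[OF xn(1) xL] by simp
      qed
      show ?thesis
      proof (cases "deg K u = 3")
        case True
        have e: "opp K u x = {v}" using degree_three_two_faces[OF ok uv True xy] .
        have ni: "\<not> inner_at ?L u"
          by (rule small[of "opp K v x" u]) (use e ox mem c2 finite_opp[OF complex] in auto)
        \<comment> \<open>With two ends of degree 3, \<open>u v x\<close> would be the only face at
          \<open>u x\<close> and at \<open>v x\<close>, so the merged edge would be left without a
          face.\<close>
        have "deg K v \<noteq> 3"
        proof
          assume "deg K v = 3"
          then have "opp K v x = {u}" using degree_three_two_faces[OF ok _ vu(1) _ vu(2) xy(2)] uv(1) by auto
          then show False using e ox nex by auto
        qed
        then show ?thesis using ni degu 2 True dK[OF ends(2)] by simp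
      next
        case F: False
        show ?thesis
        proof (cases "deg K v = 3")
          case True
          have e: "opp K v x = {u}" using degree_three_two_faces[OF ok _ vu(1) True vu(2) xy(2)] uv(1) by auto
          have ni: "\<not> inner_at ?L u"
            by (rule small[of "opp K u x" v]) (use e ox mem c2 finite_opp[OF complex] in auto)
          then show ?thesis using degu 2 True F dK[OF ends(1)] by simp
        next
          case False
          then show ?thesis using degu 2 F dK[OF ends(1)] dK[OF ends(2)] by simp
        qed
      qed
    qed
  qed
  show ?thesis
    unfolding degree_ok_def vertices_contract[OF complex uv(1) ends(1)]
  proof
    fix w assume "w \<in> vertices K - {v}"
    then show "deg ?L w \<ge> 3 \<and> (inner_at ?L w \<longrightarrow> deg ?L w \<ge> 4)"
      using other merged by (cases "w = u") (auto simp: vertices_def)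
  qed
qed

section \<open>At most two boundary edges at a vertex\<close>

context punctured_complex
begin

text \<open>All points without a disk neighbourhood lie on the boundary circle of the removed disk,
  and a triod does not embed in a circle.\<close>

lemma boundary_degree:
  assumes d: "distinct [v, z1, z2, z3]"
    and o: "\<And>z. z \<in> {z1, z2, z3} \<Longrightarrow> {v, z} \<in> K \<and> card (opp K v z) = 1"
  shows False
proof -
  define B where "B = {\<alpha> \<in> realization K. \<not> disk_nbhd_at (body K) \<alpha>}"
  have "homeomorphic_map closed_disk (subtopology S (h ` cball 0 1)) h"
    using h unfolding embedding_map_def by simp
  then obtain g where g: "homeomorphic_maps closed_disk (subtopology S (h ` cball 0 1)) h g"
    using homeomorphic_map_maps by blast
  have gc: "continuous_map (subtopology S (h ` cball 0 1)) euclidean g"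
    using g continuous_map_into_fulltopology unfolding homeomorphic_maps_def by blast
  have gh: "\<And>z. z \<in> cball 0 1 \<Longrightarrow> g (h z) = z" using g unfolding homeomorphic_maps_def by simp
  \<comment> \<open>A boundary point sent outside the closed disk would inherit a disk neighbourhood
    from \<open>S\<close>, and points of the open disk are not in \<open>F0\<close>. Only the circle
    is left.\<close>
  have kB: "\<exists>z\<in>sphere 0 1. k \<alpha> = h z" if \<alpha>: "\<alpha> \<in> B" for \<alpha>
  proof -
    have \<alpha>X: "\<alpha> \<in> topspace (body K)" using \<alpha> by (simp add: B_def)
    have kF: "k \<alpha> \<in> F0" using kimg \<alpha>X by blast
    have "k \<alpha> \<in> h ` cball 0 1"
    proof (rule ccontr)
      assume n: "k \<alpha> \<notin> h ` cball 0 1"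
      have "openin S (topspace S - h ` cball 0 1)" using compact_h[of "cball 0 1"] by auto
      then obtain U where U: "openin S U" "k \<alpha> \<in> U" "disk_in S U" "U \<subseteq> topspace S - h ` cball 0 1"
        using disk_nbhd_shrink[OF Sd[of "k \<alpha>"], of "topspace S - h ` cball 0 1"] n kF by auto
      have UF: "U \<subseteq> F0" using U(4) ball_subset_cball by blast
      define U' where "U' = {x \<in> topspace (body K). k x \<in> U}"
      have U': "U' \<subseteq> topspace (body K)" unfolding U'_def by blast
      have kU': "k ` U' = U"
      proof (rule set_eqI)
        fix y
        have "y \<in> U \<Longrightarrow> y \<in> k ` topspace (body K)" using UF kimg by blast
        then show "y \<in> k ` U' \<longleftrightarrow> y \<in> U" unfolding U'_def by auto
      qed
      have "disk_in (subtopology S F0) U"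
        using U(3) UF by (auto simp: disk_in_def subtopology_subtopology Int_absorb1)
      then have "disk_in (body K) U'" using disk_in_homeomorphic_map[OF k, of U'] U' kU' by simp
      moreover have "\<alpha> \<in> U'" using \<alpha>X U by (simp add: U'_def)
      ultimately have "disk_nbhd_at (body K) \<alpha>" using disk_open disk_nbhd_at_iff by metis
      then show False using \<alpha> by (simp add: B_def)
    qed
    then obtain z where z: "z \<in> cball 0 1" "k \<alpha> = h z" by blast
    then have "z \<notin> ball 0 1" using hmem kF by metis
    then show ?thesis using z by (intro bexI[of _ z]) auto
  qed
  have BK: "B \<subseteq> realization K" by (auto simp: B_def)
  define G where "G = g \<circ> k"
  have G1: "norm (G \<alpha>) = 1" if "\<alpha> \<in> B" for \<alpha>
    using kB[OF that] gh by (auto simp: G_def)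
  have Ginj: "\<alpha> = \<beta>" if ab: "\<alpha> \<in> B" "\<beta> \<in> B" "G \<alpha> = G \<beta>" for \<alpha> \<beta>
  proof -
    obtain z z' where z: "z \<in> sphere 0 1" "k \<alpha> = h z" "z' \<in> sphere 0 1" "k \<beta> = h z'"
      using kB[OF ab(1)] kB[OF ab(2)] by blast
    then have "z = z'" using ab(3) gh[of z] gh[of z'] by (simp add: G_def)
    then have "k \<alpha> = k \<beta>" using z by simp
    then show ?thesis using kinj ab BK by (auto simp: inj_on_def subset_iff)
  qed
  have Gc: "continuous_on B G"
  proof -
    have "continuous_map (top_of_set B) S k"
      using continuous_map_from_subtopology_mono[OF kc BK] .
    moreover have "k ` B \<subseteq> h ` cball 0 1"
      using kB sphere_cball[of "0::complex" 1] by blast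
    ultimately have "continuous_map (top_of_set B) (subtopology S (h ` cball 0 1)) k"
      by (auto simp: continuous_map_in_subtopology)
    then have "continuous_map (top_of_set B) euclidean (g \<circ> k)"
      using gc continuous_map_compose by blast
    then show ?thesis by (simp add: G_def)
  qed
  \<comment> \<open>A path along two boundary edges, from near \<open>a\<close> through
    \<open>v\<close> at \<open>t = 0\<close> to near \<open>b\<close>.\<close>
  define \<gamma> where "\<gamma> a b t = (\<lambda>w. if w = v then 1 - \<bar>t\<bar> else if w = a then max (- t) 0 else if w = b then max t 0 else 0)"
    for a b :: 'v and t :: real
  have \<gamma>c: "continuous_on A (\<gamma> a b)" for A a b
  proof (rule continuous_on_coordinatewise_then_product)
    show "continuous_on A (\<lambda>t. \<gamma> a b t w)" for w
      unfolding \<gamma>_def by (cases "w = v"; cases "w = a"; cases "w = b") (auto intro!: continuous_intros)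
  qed
  have vK: "{v} \<in> K" using edge_ends[of v z1] o[of z1] by auto
  have supp\<gamma>: "supp (\<gamma> a b t) = (if t = 0 then {v} else if t < 0 then {v, a} else {v, b})"
    if "distinct [v, a, b]" "\<bar>t\<bar> < 1" for a b t
    using that by (auto simp: supp_def \<gamma>_def)
  have vB: "vertex_point v \<in> B"
    using disk_vertex_iff[OF vK] o[of z1] d vK by (auto simp: B_def)
  have \<gamma>B: "\<gamma> a b t \<in> B" if ab: "a \<in> {z1, z2, z3}" "b \<in> {z1, z2, z3}" "a \<noteq> b" and t: "\<bar>t\<bar> < 1" for a b t
  proof (cases "t = 0")
    case True
    then have "\<gamma> a b t = vertex_point v" by (auto simp: \<gamma>_def vertex_point_def)
    then show ?thesis using vB by simp
  next
    case False
    define c where "c = (if t < 0 then a else b)"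
    have c: "c \<in> {z1, z2, z3}" "c \<noteq> v" using ab d by (auto simp: c_def)
    have dv: "distinct [v, a, b]" using ab d by auto
    have s: "supp (\<gamma> a b t) = {v, c}" using supp\<gamma>[OF dv t] False by (auto simp: c_def)
    have "\<gamma> a b t v + \<gamma> a b t c = 1" "\<And>w. 0 \<le> \<gamma> a b t w"
      using dv t False by (auto simp: \<gamma>_def c_def)
    then have r: "\<gamma> a b t \<in> realization K" using o[OF c(1)] c(2) unfolding realization_iff s by auto
    obtain x where "opp K v c = {x}" using o[OF c(1)] by (auto simp: card_1_singleton_iff)
    then show ?thesis using one_face[of v c x] r s c(2) by (auto simp: B_def)
  qed
  have ab12: "z1 \<in> {z1, z2, z3}" "z2 \<in> {z1, z2, z3}" "z1 \<noteq> z2" "distinct [v, z1, z2]"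
    and ab13: "z1 \<in> {z1, z2, z3}" "z3 \<in> {z1, z2, z3}" "z1 \<noteq> z3" "distinct [v, z1, z3]" using d by auto
  define D where "D = {z :: complex. \<bar>Re z\<bar> < 1 \<and> \<bar>Im z\<bar> < 1}"
  \<comment> \<open>The arc through \<open>z1\<close>, \<open>v\<close>, \<open>z2\<close> is mapped
    injectively into the unit circle. Polar coordinates with radius \<open>1 + Im z\<close> thicken
    it to an injective map from a planar open set, so that invariance of domain makes its image
    open.\<close>
  define \<Phi> where "\<Phi> z = of_real (1 + Im z) * G (\<gamma> z1 z2 (Re z))" for z
  have norm\<Phi>: "norm (\<Phi> z) = 1 + Im z" if z: "z \<in> D" for z
  proof -
    have "norm (G (\<gamma> z1 z2 (Re z))) = 1" using G1 \<gamma>B[OF ab12(1,2,3)] z by (simp add: D_def)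
    then have "norm (\<Phi> z) = \<bar>1 + Im z\<bar>" unfolding \<Phi>_def norm_mult norm_of_real by simp
    moreover have "\<bar>Im z\<bar> < 1" using z by (simp add: D_def)
    ultimately show ?thesis by linarith
  qed
  have "open D" unfolding D_def
    by (intro open_Collect_conj open_Collect_less continuous_intros)
  moreover have "continuous_on D \<Phi>"
  proof -
    have "continuous_on D (\<lambda>z. \<gamma> z1 z2 (Re z))"
      using continuous_on_compose[OF continuous_on_Re[OF continuous_on_id] \<gamma>c, of D z1 z2] by (simp add: comp_def)
    then have "continuous_on D (G \<circ> (\<lambda>z. \<gamma> z1 z2 (Re z)))"
      by (rule continuous_on_compose[OF _ continuous_on_subset[OF Gc]])
        (use \<gamma>B[OF ab12(1,2,3)] in \<open>auto simp: D_def\<close>)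
    then show ?thesis unfolding \<Phi>_def comp_def by (intro continuous_intros)
  qed
  moreover have "inj_on \<Phi> D"
  proof (rule inj_onI)
    fix z w assume zw: "z \<in> D" "w \<in> D" "\<Phi> z = \<Phi> w"
    have B: "\<gamma> z1 z2 (Re z) \<in> B" "\<gamma> z1 z2 (Re w) \<in> B" using \<gamma>B[OF ab12(1,2,3)] zw by (auto simp: D_def)
    have im: "Im z = Im w" using norm\<Phi>[OF zw(1)] norm\<Phi>[OF zw(2)] zw(3) by simp
    have "1 + Im z \<noteq> 0" using zw by (auto simp: D_def)
    then have "G (\<gamma> z1 z2 (Re z)) = G (\<gamma> z1 z2 (Re w))"
      using zw(3) im unfolding \<Phi>_def by (simp del: of_real_add)
    then have "\<gamma> z1 z2 (Re z) = \<gamma> z1 z2 (Re w)" using Ginj B by blast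
    then have "\<gamma> z1 z2 (Re z) z1 = \<gamma> z1 z2 (Re w) z1" "\<gamma> z1 z2 (Re z) z2 = \<gamma> z1 z2 (Re w) z2" by simp_all
    then have "Re z = Re w" using d by (auto simp: \<gamma>_def max_def split: if_splits)
    then show "z = w" using im by (simp add: complex_eq_iff)
  qed
  ultimately have op: "open (\<Phi> ` D)" using invariance_of_domain by blast
  \<comment> \<open>The third edge starts at the image of \<open>v\<close>, so its first points fall
    into the open image of \<open>\<Phi>\<close>. Having radius 1, they lie on the arc itself,
    against injectivity.\<close>
  have "continuous_on {0..<1} (G \<circ> \<gamma> z1 z3)"
    by (rule continuous_on_compose[OF \<gamma>c continuous_on_subset[OF Gc]])
      (use \<gamma>B[OF ab13(1,2,3)] in auto)
  then have "openin (top_of_set {0..<1}) ({0..<1} \<inter> (G \<circ> \<gamma> z1 z3) -` (\<Phi> ` D))"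
    using op by (rule continuous_openin_preimage_gen)
  then obtain W where W: "open W" "{0..<1} \<inter> (G \<circ> \<gamma> z1 z3) -` (\<Phi> ` D) = {0..<1} \<inter> W"
    by (auto simp: openin_open)
  have "\<gamma> z1 z3 0 = \<gamma> z1 z2 0" by (auto simp: \<gamma>_def)
  then have "(G \<circ> \<gamma> z1 z3) 0 = \<Phi> 0" by (simp add: \<Phi>_def)
  moreover have "\<Phi> 0 \<in> \<Phi> ` D" by (rule imageI) (simp add: D_def)
  ultimately have "(0::real) \<in> {0..<1} \<inter> (G \<circ> \<gamma> z1 z3) -` (\<Phi> ` D)" by simp
  then have "(0::real) \<in> W" unfolding W(2) by blast
  then obtain e where e: "e > 0" "ball 0 e \<subseteq> W" using W(1) by (meson open_contains_ball)
  define t where "t = min (e / 2) (1 / 2)"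
  have t: "0 < t" "t < 1" "t < e" using e(1) unfolding t_def by linarith+
  have "t \<in> W" using t e(2) by (auto simp: subset_iff)
  then have "t \<in> {0..<1} \<inter> (G \<circ> \<gamma> z1 z3) -` (\<Phi> ` D)" unfolding W(2) using t by simp
  then obtain z where z: "z \<in> D" "G (\<gamma> z1 z3 t) = \<Phi> z" by auto
  have B: "\<gamma> z1 z2 (Re z) \<in> B" "\<gamma> z1 z3 t \<in> B"
    using \<gamma>B[OF ab12(1,2,3)] \<gamma>B[OF ab13(1,2,3)] z t by (auto simp: D_def)
  have "Im z = 0" using norm\<Phi>[OF z(1)] z(2) G1[OF B(2)] by simp
  then have "G (\<gamma> z1 z3 t) = G (\<gamma> z1 z2 (Re z))" using z(2) by (simp add: \<Phi>_def)
  then have "\<gamma> z1 z3 t = \<gamma> z1 z2 (Re z)" using Ginj B by blast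
  then have "supp (\<gamma> z1 z3 t) = supp (\<gamma> z1 z2 (Re z))" by simp
  then have "z3 \<in> supp (\<gamma> z1 z2 (Re z))" using supp\<gamma>[OF ab13(4), of t] t by auto
  then show False using supp\<gamma>[OF ab12(4), of "Re z"] z(1) d by (auto simp: D_def split: if_splits)
qed

end

lemma triangulates_boundary_degree:
  fixes F :: "'a topology"
  assumes "punctured_surface F" "triangulates K F" "distinct [v, z1, z2, z3]"
    and "\<And>z. z \<in> {z1, z2, z3} \<Longrightarrow> {v, z} \<in> K \<and> card (opp K v z) = 1"
  shows False
proof -
  obtain S :: "'a topology" and h k where p: "punctured_complex K S h k"
    using punctured_complexI assms(1,2) .
  show False by (rule punctured_complex.boundary_degree[OF p assms(3,4)])
qed

section \<open>Changes of the triangulation\<close>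

definition same_body :: "'v set set \<Rightarrow> 'v set set \<Rightarrow> bool" where
  "same_body K L \<longleftrightarrow> abstract_2_complex K \<and> abstract_2_complex L \<and> body K homeomorphic_space body L"

lemma same_body_trans [trans]: "same_body K L \<Longrightarrow> same_body L M \<Longrightarrow> same_body K M"
  unfolding same_body_def using homeomorphic_space_trans by blast

lemma (in bistellar_move) same_body: "same_body K K'"
  unfolding same_body_def using K complex homeomorphic by blast

text \<open>\<Gamma> is an explicit generating list for the link of \<open>x\<close>. With it the
  link condition of a move becomes a check of finitely many edges.\<close>

definition star_in :: "'v set set \<Rightarrow> 'v \<Rightarrow> 'v set set \<Rightarrow> bool" where
  "star_in K x \<Gamma> \<longleftrightarrow> (\<forall>s\<in>K. x \<in> s \<longrightarrow> (\<exists>e\<in>\<Gamma>. s \<subseteq> insert x e)) \<and> (\<forall>e\<in>\<Gamma>. x \<notin> e \<and> insert x e \<in> K)"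

lemma star_in_cover: "star_in K x \<Gamma> \<Longrightarrow> s \<in> K \<Longrightarrow> x \<in> s \<Longrightarrow> \<exists>e\<in>\<Gamma>. s \<subseteq> insert x e"
  and star_in_mem: "star_in K x \<Gamma> \<Longrightarrow> e \<in> \<Gamma> \<Longrightarrow> insert x e \<in> K"
  unfolding star_in_def by blast+

lemma vertex_removal_move:
  assumes "abstract_2_complex K" "star_in K x \<Gamma>" "x \<notin> \<tau>" "finite \<tau>" "\<tau> \<noteq> {}" "\<tau> \<notin> K"
    and "\<And>e \<rho>. e \<in> \<Gamma> \<Longrightarrow> \<rho> \<subset> \<tau> \<Longrightarrow> \<exists>e'\<in>\<Gamma>. e - \<tau> \<union> \<rho> \<subseteq> e'"
  shows "bistellar_move K {x} \<tau>"
proof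
  fix s \<rho> assume s: "s \<in> K" "{x} \<subseteq> s" "\<rho> \<subset> \<tau>"
  then obtain e where e: "e \<in> \<Gamma>" "s \<subseteq> insert x e" using star_in_cover[OF assms(2), of s] by blast
  obtain e' where e': "e' \<in> \<Gamma>" "e - \<tau> \<union> \<rho> \<subseteq> e'" using assms(7)[OF e(1) s(3)] by blast
  then have "insert x e' \<in> K" using star_in_mem[OF assms(2)] by blast
  moreover have "s - \<tau> \<union> \<rho> \<subseteq> insert x e'" using e e' by blast
  moreover have "s - \<tau> \<union> \<rho> \<noteq> {}" using s assms(3) by blast
  ultimately show "s - \<tau> \<union> \<rho> \<in> K" using complex_mono[OF assms(1)] by blast
qed (use assms in auto)

lemma bistellar_vertex:
  "bistellar {x} \<tau> K = {s \<in> K. x \<notin> s} \<union> {s - {x} \<union> \<tau> | s. s \<in> K \<and> x \<in> s}"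
  unfolding bistellar_def by auto

text \<open>The link of \<open>x\<close> is a suspension with poles \<open>u\<close> and
  \<open>y\<close>. Sliding \<open>x\<close> to \<open>u\<close> collapses the half of the star at
  \<open>u\<close> and stretches the half at \<open>y\<close> over the edge \<open>u y\<close>,
  which is the result of the move.\<close>

lemma contract_bistellar:
  assumes "bistellar_move K {x} {u, y}" "u \<noteq> y"
  shows "contract u x K = bistellar {x} {u, y} K"
proof -
  interpret bistellar_move K "{x}" "{u, y}" by fact
  have x: "x \<noteq> u" "x \<noteq> y" using disj by auto
  have 1: "insert u (s - {x}) \<in> bistellar {x} {u, y} K" if s: "s \<in> K" "x \<in> s" for s
  proof (cases "y \<in> s")
    case True
    then have "insert u (s - {x}) = s - {x} \<union> {u, y}" using x by auto
    then show ?thesis using s unfolding bistellar_vertex by blast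
  next
    case False
    have "s - {u, y} \<union> {u} \<in> K" by (rule lnk) (use s assms(2) in auto)
    moreover have "insert u (s - {x}) \<subseteq> s - {u, y} \<union> {u}" using False by auto
    ultimately have "insert u (s - {x}) \<in> K" using complex_mono[OF K] by blast
    then show ?thesis using x unfolding bistellar_vertex by auto
  qed
  have 2: "s - {x} \<union> {u, y} \<in> contract u x K" if s: "s \<in> K" "x \<in> s" for s
  proof -
    have "s - {u, y} \<union> {y} \<in> K" by (rule lnk) (use s assms(2) in auto)
    moreover have "s - {x} \<union> {u, y} = insert u ((s - {u, y} \<union> {y}) - {x})" using x by auto
    moreover have "x \<in> s - {u, y} \<union> {y}" using s x by auto
    ultimately show ?thesis unfolding contract_eq by blast
  qed
  show ?thesis
  proof
    show "contract u x K \<subseteq> bistellar {x} {u, y} K"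
      unfolding contract_eq using 1 by (auto simp: bistellar_vertex)
    show "bistellar {x} {u, y} K \<subseteq> contract u x K"
      unfolding bistellar_vertex using 2 by (auto simp: contract_eq)
  qed
qed

text \<open>The path \<open>u v y\<close> is the join of \<open>v\<close> with the two points
  \<open>u\<close> and \<open>y\<close>, so the move with \<tau> = \<open>{u, y}\<close> applies as
  soon as this edge is absent.\<close>

lemma remove_path_vertex:
  assumes K: "abstract_2_complex K" and st: "star_in K x {{u, v}, {v, y}}"
    and d: "distinct [x, u, v, y]" and n: "{u, y} \<notin> K"
  shows "same_body K (del {x} K \<union> {{u, y}, {u, v, y}})"
    and "contract u x K = del {x} K \<union> {{u, y}, {u, v, y}}"
proof -
  have mv: "bistellar_move K {x} {u, y}"
  proof (rule vertex_removal_move[OF K st])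
    fix e \<rho> assume "e \<in> {{u, v}, {v, y}}" "\<rho> \<subset> {u, y}"
    then have "e - {u, y} \<subseteq> {v}" "\<rho> \<subseteq> {u} \<or> \<rho> \<subseteq> {y}" by auto
    then have "e - {u, y} \<union> \<rho> \<subseteq> {u, v} \<or> e - {u, y} \<union> \<rho> \<subseteq> {v, y}" by (elim disjE) blast+
    then show "\<exists>e'\<in>{{u, v}, {v, y}}. e - {u, y} \<union> \<rho> \<subseteq> e'" by simp
  qed (use d n in auto)
  have eq: "bistellar {x} {u, y} K = del {x} K \<union> {{u, y}, {u, v, y}}"
  proof -
    have xK: "{x} \<in> K" "{x, v} \<in> K"
      using complex_mono[OF K star_in_mem[OF st, of "{u, v}"]] by simp_all
    have "s - {x} \<union> {u, y} \<in> {{u, y}, {u, v, y}}" if s: "s \<in> K" "x \<in> s" for s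
    proof -
      have "s \<subseteq> {x, u, v} \<or> s \<subseteq> {x, v, y}" using st s by (auto simp: star_in_def)
      then have "s - {x} \<subseteq> {u, v, y}" by auto
      then show ?thesis by (cases "v \<in> s") auto
    qed
    note sub = this
    have "{x} - {x} \<union> {u, y} = {u, y}" "{x, v} - {x} \<union> {u, y} = {u, v, y}" using d by auto
    then have "\<exists>s. {u, y} = s - {x} \<union> {u, y} \<and> s \<in> K \<and> x \<in> s" "\<exists>s. {u, v, y} = s - {x} \<union> {u, y} \<and> s \<in> K \<and> x \<in> s"
      using xK by (metis insertI1)+
    then have "{s - {x} \<union> {u, y} | s. s \<in> K \<and> x \<in> s} = {{u, y}, {u, v, y}}" using sub by auto
    then show ?thesis unfolding bistellar_vertex del_def by auto
  qed
  show "same_body K (del {x} K \<union> {{u, y}, {u, v, y}})" using bistellar_move.same_body[OF mv] eq by simp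
  show "contract u x K = del {x} K \<union> {{u, y}, {u, v, y}}" using contract_bistellar[OF mv] eq d by simp
qed

lemma contract_path_vertex:
  assumes "abstract_2_complex K" "star_in K x {{u, v}, {v, y}}" "distinct [x, u, v, y]" "{u, y} \<notin> K"
  shows "same_body K (contract u x K)"
  using remove_path_vertex[OF assms] by metis

text \<open>A square is the join of its two pairs of opposite vertices. One pair is \<tau>, the
  other is the factor that the move leaves alone.\<close>

lemma remove_square_vertex:
  assumes K: "abstract_2_complex K" and st: "star_in K x {{u, v}, {v, y}, {y, z}, {z, u}}"
    and d: "distinct [x, u, v, y, z]" and n: "{u, y} \<notin> K"
  shows "same_body K (del {x} K \<union> {{u, y}, {u, v, y}, {u, y, z}})"
    and "contract u x K = del {x} K \<union> {{u, y}, {u, v, y}, {u, y, z}}"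
proof -
  have mv: "bistellar_move K {x} {u, y}"
  proof (rule vertex_removal_move[OF K st])
    fix e \<rho> assume "e \<in> {{u, v}, {v, y}, {y, z}, {z, u}}" "\<rho> \<subset> {u, y}"
    then have "e - {u, y} \<subseteq> {v} \<or> e - {u, y} \<subseteq> {z}" "\<rho> \<subseteq> {u} \<or> \<rho> \<subseteq> {y}" by auto
    then have "e - {u, y} \<union> \<rho> \<subseteq> {u, v} \<or> e - {u, y} \<union> \<rho> \<subseteq> {v, y} \<or> e - {u, y} \<union> \<rho> \<subseteq> {y, z} \<or> e - {u, y} \<union> \<rho> \<subseteq> {z, u}"
      by (elim disjE) blast+
    then show "\<exists>e'\<in>{{u, v}, {v, y}, {y, z}, {z, u}}. e - {u, y} \<union> \<rho> \<subseteq> e'" by simp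
  qed (use d n in auto)
  have eq: "bistellar {x} {u, y} K = del {x} K \<union> {{u, y}, {u, v, y}, {u, y, z}}"
  proof -
    have xK: "{x} \<in> K" "{x, v} \<in> K" "{x, z} \<in> K"
      using complex_mono[OF K star_in_mem[OF st, of "{u, v}"]] complex_mono[OF K star_in_mem[OF st, of "{z, u}"]]
      by simp_all
    have "s - {x} \<union> {u, y} \<in> {{u, y}, {u, v, y}, {u, y, z}}" if s: "s \<in> K" "x \<in> s" for s
    proof -
      have "s \<subseteq> {x, u, v} \<or> s \<subseteq> {x, v, y} \<or> s \<subseteq> {x, y, z} \<or> s \<subseteq> {x, z, u}" using st s by (auto simp: star_in_def)
      then have "s - {x} \<subseteq> {u, v, y} \<or> s - {x} \<subseteq> {u, z, y}" by auto
      then show ?thesis by (cases "v \<in> s"; cases "z \<in> s") (use d in auto)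
    qed
    note sub = this
    have "{x} - {x} \<union> {u, y} = {u, y}" "{x, v} - {x} \<union> {u, y} = {u, v, y}" "{x, z} - {x} \<union> {u, y} = {u, y, z}" using d by auto
    then have "\<exists>s. {u, y} = s - {x} \<union> {u, y} \<and> s \<in> K \<and> x \<in> s" "\<exists>s. {u, v, y} = s - {x} \<union> {u, y} \<and> s \<in> K \<and> x \<in> s"
      "\<exists>s. {u, y, z} = s - {x} \<union> {u, y} \<and> s \<in> K \<and> x \<in> s"
      using xK by (metis insertI1)+
    then have "{s - {x} \<union> {u, y} | s. s \<in> K \<and> x \<in> s} = {{u, y}, {u, v, y}, {u, y, z}}" using sub by auto
    then show ?thesis unfolding bistellar_vertex del_def by auto
  qed
  show "same_body K (del {x} K \<union> {{u, y}, {u, v, y}, {u, y, z}})" using bistellar_move.same_body[OF mv] eq by simp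
  show "contract u x K = del {x} K \<union> {{u, y}, {u, v, y}, {u, y, z}}" using contract_bistellar[OF mv] eq d by simp
qed

lemma contract_square_vertex:
  assumes "abstract_2_complex K" "star_in K x {{u, v}, {v, y}, {y, z}, {z, u}}"
    "distinct [x, u, v, y, z]" "{u, y} \<notin> K"
  shows "same_body K (contract u x K)"
  using remove_square_vertex[OF assms] by metis

lemma remove_triangle_vertex:
  assumes K: "abstract_2_complex K" and st: "star_in K x {{a, b}, {b, c}, {a, c}}"
    and d: "distinct [x, a, b, c]" and n: "{a, b, c} \<notin> K"
  shows "same_body K (del {x} K \<union> {{a, b, c}})"
proof -
  have mv: "bistellar_move K {x} {a, b, c}"
  proof (rule vertex_removal_move[OF K st])
    fix e \<rho> assume "e \<in> {{a, b}, {b, c}, {a, c}}" "\<rho> \<subset> {a, b, c}"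
    then have "e - {a, b, c} = {}" "\<rho> \<subseteq> {a, b} \<or> \<rho> \<subseteq> {b, c} \<or> \<rho> \<subseteq> {a, c}" by blast+
    then have "e - {a, b, c} \<union> \<rho> \<subseteq> {a, b} \<or> e - {a, b, c} \<union> \<rho> \<subseteq> {b, c} \<or> e - {a, b, c} \<union> \<rho> \<subseteq> {a, c}"
      by (simp only: Un_empty_left)
    then show "\<exists>e'\<in>{{a, b}, {b, c}, {a, c}}. e - {a, b, c} \<union> \<rho> \<subseteq> e'" by simp
  qed (use d n in auto)
  have "{s - {x} \<union> {a, b, c} | s. s \<in> K \<and> x \<in> s} = {{a, b, c}}"
  proof -
    have "{x} \<in> K" using st complex_mono[OF K, of "{x, a, b}"] by (auto simp: star_in_def)
    moreover have "s - {x} \<union> {a, b, c} = {a, b, c}" if s: "s \<in> K" "x \<in> s" for s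
    proof -
      have "s \<subseteq> {x, a, b} \<or> s \<subseteq> {x, b, c} \<or> s \<subseteq> {x, a, c}" using st s by (auto simp: star_in_def)
      then show ?thesis by blast
    qed
    ultimately show ?thesis by blast
  qed
  then have "bistellar {x} {a, b, c} K = del {x} K \<union> {{a, b, c}}"
    unfolding bistellar_vertex del_def by auto
  then show ?thesis using bistellar_move.same_body[OF mv] by simp
qed

section \<open>Flips of a diagonal and contractions at longer links\<close>

definition flip :: "'v \<Rightarrow> 'v \<Rightarrow> 'v \<Rightarrow> 'v \<Rightarrow> 'v set set \<Rightarrow> 'v set set" where
  "flip c p t q K = {s \<in> K. \<not> {c, p} \<subseteq> s} \<union> {{t, q}, {t, q, c}, {t, q, p}}"

text \<open>In the quadrilateral with diagonals \<open>c p\<close> and \<open>t q\<close>,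
  identifying \<open>c\<close> with \<open>t\<close> sends \<open>c p\<close> to the side
  \<open>t p\<close>, and sends \<open>t q\<close> to the image of the side \<open>c q\<close>. So
  the flip is invisible after the contraction, which can be studied where \<open>c\<close> has a
  shorter link.\<close>

lemma flip_move:
  assumes K: "abstract_2_complex K" and d: "distinct [c, p, t, q]"
    and f: "{c, p, t} \<in> K" "{c, p, q} \<in> K" and n: "{t, q} \<notin> K"
    and l: "\<And>s. s \<in> K \<Longrightarrow> c \<in> s \<Longrightarrow> p \<in> s \<Longrightarrow> s \<subseteq> {c, p, t} \<or> s \<subseteq> {c, p, q}"
  shows "same_body K (flip c p t q K)" and "contract t c (flip c p t q K) = contract t c K"
proof -
  have mv: "bistellar_move K {c, p} {t, q}"
  proof
    fix s \<rho> assume s: "s \<in> K" "{c, p} \<subseteq> s" "\<rho> \<subset> {t, q}"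
    have "\<rho> \<subseteq> {t} \<or> \<rho> \<subseteq> {q}" using s by auto
    then have "s - {t, q} \<union> \<rho> \<subseteq> {c, p, t} \<or> s - {t, q} \<union> \<rho> \<subseteq> {c, p, q}" using l[of s] s by blast
    moreover have "s - {t, q} \<union> \<rho> \<noteq> {}" using s d by auto
    ultimately show "s - {t, q} \<union> \<rho> \<in> K" using complex_mono[OF K f(1)] complex_mono[OF K f(2)] by (elim disjE)
  qed (use K d n in auto)
  have cp: "{c, p} \<in> K" using complex_mono[OF K f(1), of "{c, p}"] by simp
  have b: "bistellar {c, p} {t, q} K = flip c p t q K"
  proof -
    have "{s - {c, p} \<union> \<rho> \<union> {t, q} | s \<rho>. s \<in> K \<and> {c, p} \<subseteq> s \<and> \<rho> \<subset> {c, p}} = {{t, q}, {t, q, c}, {t, q, p}}"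
    proof (intro equalityI subsetI)
      fix r assume "r \<in> {s - {c, p} \<union> \<rho> \<union> {t, q} | s \<rho>. s \<in> K \<and> {c, p} \<subseteq> s \<and> \<rho> \<subset> {c, p}}"
      then obtain s \<rho> where r: "r = s - {c, p} \<union> \<rho> \<union> {t, q}" "s \<in> K" "{c, p} \<subseteq> s" "\<rho> \<subset> {c, p}" by blast
      then have "s - {c, p} \<subseteq> {t, q}" using l[of s] by blast
      moreover have "\<rho> = {} \<or> \<rho> = {c} \<or> \<rho> = {p}" using r(4) by blast
      ultimately show "r \<in> {{t, q}, {t, q, c}, {t, q, p}}" using r(1) by auto
    next
      fix r assume r: "r \<in> {{t, q}, {t, q, c}, {t, q, p}}"
      have "{c, p} - {c, p} \<union> {} \<union> {t, q} = {t, q}" "{c, p} - {c, p} \<union> {c} \<union> {t, q} = {t, q, c}"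
        "{c, p} - {c, p} \<union> {p} \<union> {t, q} = {t, q, p}" by auto
      moreover have "{} \<subset> {c, p}" "{c} \<subset> {c, p}" "{p} \<subset> {c, p}" using d by auto
      ultimately show "r \<in> {s - {c, p} \<union> \<rho> \<union> {t, q} | s \<rho>. s \<in> K \<and> {c, p} \<subseteq> s \<and> \<rho> \<subset> {c, p}}"
        using cp r by blast
    qed
    then show ?thesis unfolding bistellar_def flip_def by simp
  qed
  show "same_body K (flip c p t q K)" using bistellar_move.same_body[OF mv] b by simp
  have d': "c \<noteq> t" "p \<noteq> t" "p \<noteq> c" "q \<noteq> c" using d by auto
  have sub: "{t, p} \<in> K" "{c, q} \<in> K" "{t} \<in> K" using complex_mono[OF K f(1)] complex_mono[OF K f(2)] by auto
  have g: "insert t (s - {c}) = (\<lambda>x. if x = c then t else x) ` s" if "c \<in> s" for s using that d' by auto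
  show "contract t c (flip c p t q K) = contract t c K"
  proof (intro equalityI subsetI)
    fix r assume "r \<in> contract t c (flip c p t q K)"
    then consider s where "s \<in> K" "\<not> {c, p} \<subseteq> s" "r = (\<lambda>x. if x = c then t else x) ` s"
      | "r = (\<lambda>x. if x = c then t else x) ` {t, q}" | "r = (\<lambda>x. if x = c then t else x) ` {t, q, c}"
      | "r = (\<lambda>x. if x = c then t else x) ` {t, q, p}"
      unfolding contract_def flip_def by blast
    then show "r \<in> contract t c K"
    proof cases
      case 1 then show ?thesis unfolding contract_def by blast
    next
      case 4
      then have "r = (\<lambda>x. if x = c then t else x) ` {c, p, q}" using d' by auto
      then show ?thesis unfolding contract_def using f by blast
    next
      case 2
      then have "r = (\<lambda>x. if x = c then t else x) ` {c, q}" using d' by auto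
      then show ?thesis unfolding contract_def using sub by blast
    next
      case 3
      then have "r = (\<lambda>x. if x = c then t else x) ` {c, q}" using d' by auto
      then show ?thesis unfolding contract_def using sub by blast
    qed
  next
    fix r assume "r \<in> contract t c K"
    then obtain s where s: "s \<in> K" "r = (\<lambda>x. if x = c then t else x) ` s" unfolding contract_def by blast
    show "r \<in> contract t c (flip c p t q K)"
    proof (cases "{c, p} \<subseteq> s")
      case False
      then show ?thesis using s unfolding contract_def flip_def by blast
    next
      case True
      have "s \<subseteq> {c, p, t} \<or> s \<subseteq> {c, p, q}" using l s True by blast
      then have "r = (\<lambda>x. if x = c then t else x) ` {t, p} \<or> r = (\<lambda>x. if x = c then t else x) ` {t, q, p}"
        using True s(2) d' by (cases "q \<in> s") auto
      moreover have "{t, p} \<in> flip c p t q K" "{t, q, p} \<in> flip c p t q K" using sub d' by (auto simp: flip_def)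
      ultimately show ?thesis unfolding contract_def by blast
    qed
  qed
qed

lemma star_in_flip:
  assumes "star_in K c \<Gamma>" "distinct [c, p, t, q]"
    and "\<And>s. s \<in> K \<Longrightarrow> c \<in> s \<Longrightarrow> p \<in> s \<Longrightarrow> s \<subseteq> {c, p, t} \<or> s \<subseteq> {c, p, q}"
  shows "star_in (flip c p t q K) c ({e \<in> \<Gamma>. p \<notin> e} \<union> {{t, q}})"
  unfolding star_in_def
proof (intro conjI ballI impI)
  fix s assume s: "s \<in> flip c p t q K" "c \<in> s"
  show "\<exists>e\<in>{e \<in> \<Gamma>. p \<notin> e} \<union> {{t, q}}. s \<subseteq> insert c e"
  proof (cases "s \<in> K \<and> p \<notin> s")
    case True
    then obtain e where e: "e \<in> \<Gamma>" "s \<subseteq> insert c e" using assms(1) s unfolding star_in_def by blast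
    show ?thesis
    proof (cases "p \<in> e")
      case True
      have "insert c e \<in> K" using e assms(1) unfolding star_in_def by blast
      then have "insert c e \<subseteq> {c, p, t} \<or> insert c e \<subseteq> {c, p, q}" using assms(3) True by blast
      then show ?thesis using e \<open>s \<in> K \<and> p \<notin> s\<close> by auto
    qed (use e in blast)
  next
    case False
    then show ?thesis using s assms(2) by (auto simp: flip_def)
  qed
next
  fix e assume e: "e \<in> {e \<in> \<Gamma>. p \<notin> e} \<union> {{t, q}}"
  show "c \<notin> e" using e assms(1,2) unfolding star_in_def by auto
  show "insert c e \<in> flip c p t q K" using e assms(1,2) unfolding star_in_def flip_def by (auto simp: insert_commute)
qed

text \<open>Flipping \<open>w y\<close> to \<open>t v\<close> drops \<open>y\<close> from the link
  of \<open>w\<close> and leaves the path \<open>t v u\<close>, to which the basic case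
  applies.\<close>

lemma contract_path4:
  assumes K: "abstract_2_complex K" and st: "star_in K w {{u, v}, {v, y}, {y, t}}"
    and d: "distinct [w, u, v, y, t]" and n: "{u, t} \<notin> K" "{v, t} \<notin> K"
  shows "same_body K (contract t w K)"
proof -
  have l: "s \<subseteq> {w, y, t} \<or> s \<subseteq> {w, y, v}" if s: "s \<in> K" "w \<in> s" "y \<in> s" for s
  proof -
    obtain e where "e \<in> {{u, v}, {v, y}, {y, t}}" "s \<subseteq> insert w e" using st s unfolding star_in_def by blast
    then show ?thesis using s d by auto
  qed
  let ?L = "flip w y t v K"
  have f: "{w, y, t} \<in> K" "{w, y, v} \<in> K" "{t, v} \<notin> K"
    using st n by (auto simp: star_in_def insert_commute)
  have dd: "distinct [w, y, t, v]" using d by auto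
  note fl = flip_move[OF K dd f l]
  have "star_in ?L w ({e \<in> {{u, v}, {v, y}, {y, t}}. y \<notin> e} \<union> {{t, v}})"
    by (rule star_in_flip[OF st dd l])
  moreover have "{e \<in> {{u, v}, {v, y}, {y, t}}. y \<notin> e} \<union> {{t, v}} = {{t, v}, {v, u}}"
    using d by (auto simp: insert_commute)
  ultimately have st': "star_in ?L w {{t, v}, {v, u}}" by simp
  have "abstract_2_complex ?L" using fl(1) by (simp add: same_body_def)
  moreover have "{t, u} \<notin> ?L" using n d by (auto simp: flip_def insert_commute doubleton_eq_iff)
  moreover have "distinct [w, t, v, u]" using d by auto
  ultimately have "same_body ?L (contract t w ?L)" using contract_path_vertex[OF _ st'] by blast
  then show ?thesis using fl same_body_trans by metis
qed

text \<open>One more flip, of \<open>r s\<close> to \<open>t x\<close>, reduces to the path with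
  four vertices.\<close>

lemma contract_path5:
  assumes K: "abstract_2_complex K" and st: "star_in K r {{w, q}, {q, x}, {x, s}, {s, t}}"
    and d: "distinct [r, w, q, x, s, t]" and n: "{w, t} \<notin> K" "{q, t} \<notin> K" "{x, t} \<notin> K"
  shows "same_body K (contract t r K)"
proof -
  have l: "f \<subseteq> {r, s, t} \<or> f \<subseteq> {r, s, x}" if f: "f \<in> K" "r \<in> f" "s \<in> f" for f
  proof -
    obtain e where "e \<in> {{w, q}, {q, x}, {x, s}, {s, t}}" "f \<subseteq> insert r e" using st f unfolding star_in_def by blast
    then show ?thesis using f d by auto
  qed
  let ?L = "flip r s t x K"
  have f: "{r, s, t} \<in> K" "{r, s, x} \<in> K" "{t, x} \<notin> K"
    using st n by (auto simp: star_in_def insert_commute)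
  have dd: "distinct [r, s, t, x]" using d by auto
  note fl = flip_move[OF K dd f l]
  have "star_in ?L r ({e \<in> {{w, q}, {q, x}, {x, s}, {s, t}}. s \<notin> e} \<union> {{t, x}})"
    by (rule star_in_flip[OF st dd l])
  moreover have "{e \<in> {{w, q}, {q, x}, {x, s}, {s, t}}. s \<notin> e} \<union> {{t, x}} = {{w, q}, {q, x}, {x, t}}"
    using d by (auto simp: insert_commute)
  ultimately have st': "star_in ?L r {{w, q}, {q, x}, {x, t}}" by simp
  have "abstract_2_complex ?L" using fl(1) by (simp add: same_body_def)
  moreover have "{w, t} \<notin> ?L" "{q, t} \<notin> ?L" using n d by (auto simp: flip_def insert_commute doubleton_eq_iff)
  ultimately have "same_body ?L (contract t r ?L)"
    using contract_path4[OF _ st'] d by auto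
  then show ?thesis using fl same_body_trans by metis
qed

text \<open>Flipping \<open>w r\<close> to \<open>t q\<close> turns the pentagon into the square
  \<open>t s p q\<close>. The two missing edges at \<open>t\<close> are what the flip and the square
  case ask for.\<close>

lemma contract_cycle5:
  assumes K: "abstract_2_complex K" and st: "star_in K w {{s, p}, {p, q}, {q, r}, {r, t}, {t, s}}"
    and d: "distinct [w, s, p, q, r, t]" and n: "{p, t} \<notin> K" "{q, t} \<notin> K"
  shows "same_body K (contract t w K)"
proof -
  have l: "f \<subseteq> {w, r, t} \<or> f \<subseteq> {w, r, q}" if f: "f \<in> K" "w \<in> f" "r \<in> f" for f
  proof -
    obtain e where "e \<in> {{s, p}, {p, q}, {q, r}, {r, t}, {t, s}}" "f \<subseteq> insert w e" using st f unfolding star_in_def by blast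
    then show ?thesis using f d by auto
  qed
  let ?L = "flip w r t q K"
  have f: "{w, r, t} \<in> K" "{w, r, q} \<in> K" "{t, q} \<notin> K"
    using st n by (auto simp: star_in_def insert_commute)
  have dd: "distinct [w, r, t, q]" using d by auto
  note fl = flip_move[OF K dd f l]
  have "star_in ?L w ({e \<in> {{s, p}, {p, q}, {q, r}, {r, t}, {t, s}}. r \<notin> e} \<union> {{t, q}})"
    by (rule star_in_flip[OF st dd l])
  moreover have "{e \<in> {{s, p}, {p, q}, {q, r}, {r, t}, {t, s}}. r \<notin> e} \<union> {{t, q}} = {{t, s}, {s, p}, {p, q}, {q, t}}"
    using d by (auto simp: insert_commute)
  ultimately have st': "star_in ?L w {{t, s}, {s, p}, {p, q}, {q, t}}" by simp
  have "abstract_2_complex ?L" using fl(1) by (simp add: same_body_def)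
  moreover have "{t, p} \<notin> ?L" using n d by (auto simp: flip_def insert_commute doubleton_eq_iff)
  moreover have "distinct [w, t, s, p, q]" using d by auto
  ultimately have "same_body ?L (contract t w ?L)" using contract_square_vertex[OF _ st'] by blast
  then show ?thesis using fl same_body_trans by metis
qed

text \<open>The triangle at \<open>b\<close> hangs on the edge \<open>p q\<close>. After a flip of
  \<open>p q\<close> to \<open>b z\<close> the link of \<open>b\<close> is the path
  \<open>p z q\<close>, and removing \<open>b\<close> there brings back \<open>p q\<close> together
  with its face at \<open>z\<close>.\<close>

lemma remove_ear:
  assumes L: "abstract_2_complex L" and st: "star_in L b {{p, q}}"
    and l: "\<And>s. s \<in> L \<Longrightarrow> p \<in> s \<Longrightarrow> q \<in> s \<Longrightarrow> s \<subseteq> {p, q, b} \<or> s \<subseteq> {p, q, z}"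
    and z: "{p, q, z} \<in> L" and d: "distinct [b, p, q, z]"
  shows "same_body L (del {b} L)"
proof -
  have bs: "s \<subseteq> {b, p, q}" if "s \<in> L" "b \<in> s" for s using st that unfolding star_in_def by auto
  have f: "{p, q, b} \<in> L" using st by (auto simp: star_in_def insert_commute)
  have n: "{b, z} \<notin> L" using bs[of "{b, z}"] d by auto
  have dd: "distinct [p, q, b, z]" using d by auto
  let ?M = "flip p q b z L"
  note fl = flip_move(1)[OF L dd f z n l]
  have M: "abstract_2_complex ?M" using fl by (simp add: same_body_def)
  have st': "star_in ?M b {{p, z}, {z, q}}"
    unfolding star_in_def
  proof (intro conjI ballI impI)
    fix s assume s: "s \<in> ?M" "b \<in> s"
    then show "\<exists>e\<in>{{p, z}, {z, q}}. s \<subseteq> insert b e"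
      using bs[of s] by (auto simp: flip_def)
  qed (use d in \<open>auto simp: flip_def insert_commute\<close>)
  have npq: "{p, q} \<notin> ?M" using d by (auto simp: flip_def doubleton_eq_iff)
  have "same_body ?M (del {b} ?M \<union> {{p, q}, {p, z, q}})"
    by (rule remove_path_vertex(1)[OF M st' _ npq]) (use d in auto)
  also have "del {b} ?M \<union> {{p, q}, {p, z, q}} = del {b} L"
  proof -
    have pq: "{p, q} \<in> L" using complex_mono[OF L z, of "{p, q}"] by auto
    have two: "s = {p, q} \<or> s = {p, z, q}" if "s \<in> L" "b \<notin> s" "{p, q} \<subseteq> s" for s
      using l[of s] that by (cases "z \<in> s") auto
    have "{p, z, q} \<in> L" using z by (simp add: insert_commute)
    with pq have "{{p, q}, {p, z, q}} \<subseteq> del {b} L"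
      using d by (simp add: del_def)
    moreover have "del {b} L \<subseteq> del {b} ?M \<union> {{p, q}, {p, z, q}}"
    proof
      fix s assume s: "s \<in> del {b} L"
      show "s \<in> del {b} ?M \<union> {{p, q}, {p, z, q}}"
      proof (cases "{p, q} \<subseteq> s")
        case True then show ?thesis using two[of s] s by (auto simp: del_def)
      next
        case False then show ?thesis using s by (simp add: del_def flip_def)
      qed
    qed
    moreover have "del {b} ?M \<subseteq> del {b} L" by (auto simp: flip_def del_def)
    ultimately show ?thesis by blast
  qed
  finally show ?thesis using fl same_body_trans by blast
qed

section \<open>Removal of flags and octahedra\<close>

lemma star_in_del:
  assumes "star_in K y \<Gamma>"
    and "\<And>e. e \<in> \<Gamma> \<Longrightarrow> \<exists>e'\<in>\<Gamma>'. e - X \<subseteq> e'"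
    and "\<And>s. s \<in> A \<Longrightarrow> y \<in> s \<Longrightarrow> \<exists>e'\<in>\<Gamma>'. s \<subseteq> insert y e'"
    and "\<And>e'. e' \<in> \<Gamma>' \<Longrightarrow> y \<notin> e' \<and> insert y e' \<in> del X K \<union> A"
  shows "star_in (del X K \<union> A) y \<Gamma>'"
  unfolding star_in_def
proof (intro conjI ballI impI)
  fix s assume s: "s \<in> del X K \<union> A" "y \<in> s"
  show "\<exists>e'\<in>\<Gamma>'. s \<subseteq> insert y e'"
  proof (cases "s \<in> A")
    case False
    then have "s \<in> K" "s \<inter> X = {}" using s by (auto simp: del_def)
    then obtain e where e: "e \<in> \<Gamma>" "s \<subseteq> insert y e" using star_in_cover[OF assms(1)] s by blast
    then obtain e' where "e' \<in> \<Gamma>'" "e - X \<subseteq> e'" using assms(2) by blast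
    then show ?thesis using e \<open>s \<inter> X = {}\<close> by blast
  qed (use assms(3) s in blast)
qed (use assms(4) in blast)+

text \<open>The vertex \<open>a\<close> has the path \<open>x1 x b\<close> as link. Once it is
  removed, the link of \<open>x\<close> is the triangle \<open>x1 b x2\<close>, which then replaces
  the flag. This triangle is an ear if \<open>x1 x2\<close> has a further face, and otherwise it
  will turn out to be the whole surface.\<close>

lemma flag_to_triangle:
  assumes K: "abstract_2_complex K" and d: "distinct [x, x1, a, b, x2]"
    and sx: "star_in K x {{x1, a}, {a, b}, {b, x2}, {x2, x1}}"
    and sa: "star_in K a {{x1, x}, {x, b}}" and sb: "star_in K b {{a, x}, {x, x2}}"
  shows "same_body K (del {a, x} K \<union> {{x1, b}, {x1, b, x2}})"
    and "star_in (del {a, x} K \<union> {{x1, b}, {x1, b, x2}}) b {{x1, x2}}"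
proof -
  have bs: "s \<subseteq> {b, a, x, x2}" if "s \<in> K" "b \<in> s" for s
    using star_in_cover[OF sb that] by auto
  have n: "{x1, b} \<notin> K" using bs[of "{x1, b}"] d by auto
  have da: "distinct [a, x1, x, b]" using d by auto
  let ?K1 = "del {a} K \<union> {{x1, b}, {x1, x, b}}"
  have 1: "same_body K ?K1" by (rule remove_path_vertex(1)[OF K sa da n])
  have xm: "{x, b, x2} \<in> K" "{x, x2, x1} \<in> K" using star_in_mem[OF sx, of "{b, x2}"] star_in_mem[OF sx, of "{x2, x1}"] by auto
  have sx1: "star_in ?K1 x {{x1, b}, {b, x2}, {x1, x2}}"
  proof (rule star_in_del[OF sx])
    fix e assume "e \<in> {{x1, a}, {a, b}, {b, x2}, {x2, x1}}"
    then show "\<exists>e'\<in>{{x1, b}, {b, x2}, {x1, x2}}. e - {a} \<subseteq> e'" by auto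
  next
    fix e' assume "e' \<in> {{x1, b}, {b, x2}, {x1, x2}}"
    then show "x \<notin> e' \<and> insert x e' \<in> ?K1" using d xm by (auto simp: del_def insert_commute)
  qed auto
  have n1: "{x1, b, x2} \<notin> ?K1"
  proof
    assume "{x1, b, x2} \<in> ?K1"
    moreover have "x2 \<notin> {x1, b}" "x2 \<notin> {x1, x, b}" using d by auto
    ultimately have "{x1, b, x2} \<in> K" by (auto simp: del_def)
    then show False using bs[of "{x1, b, x2}"] d by auto
  qed
  have 2: "same_body ?K1 (del {x} ?K1 \<union> {{x1, b, x2}})"
    by (rule remove_triangle_vertex[OF _ sx1 _ n1]) (use 1 d in \<open>auto simp: same_body_def\<close>)
  have eq: "del {x} ?K1 \<union> {{x1, b, x2}} = del {a, x} K \<union> {{x1, b}, {x1, b, x2}}"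
    using d by (auto simp: del_def)
  show "same_body K (del {a, x} K \<union> {{x1, b}, {x1, b, x2}})"
    using same_body_trans[OF 1 2] unfolding eq .
  show "star_in (del {a, x} K \<union> {{x1, b}, {x1, b, x2}}) b {{x1, x2}}"
  proof (rule star_in_del[OF sb])
    fix e assume "e \<in> {{a, x}, {x, x2}}"
    then show "\<exists>e'\<in>{{x1, x2}}. e - {a, x} \<subseteq> e'" by auto
  qed (use d in \<open>auto simp: insert_commute\<close>)
qed

lemma remove_flag:
  assumes K: "abstract_2_complex K" and d: "distinct [x, x1, a, b, x2, z]"
    and sx: "star_in K x {{x1, a}, {a, b}, {b, x2}, {x2, x1}}"
    and sa: "star_in K a {{x1, x}, {x, b}}" and sb: "star_in K b {{a, x}, {x, x2}}"
    and z: "{x1, x2, z} \<in> K" "\<And>s. s \<in> K \<Longrightarrow> x1 \<in> s \<Longrightarrow> x2 \<in> s \<Longrightarrow> s \<subseteq> {x1, x2, x} \<or> s \<subseteq> {x1, x2, z}"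
  shows "same_body K (del {a, b, x} K)"
proof -
  let ?K2 = "del {a, x} K \<union> {{x1, b}, {x1, b, x2}}"
  have d5: "distinct [x, x1, a, b, x2]" using d by auto
  note t = flag_to_triangle[OF K d5 sx sa sb]
  have "same_body ?K2 (del {b} ?K2)"
  proof (rule remove_ear[OF _ t(2)])
    show "abstract_2_complex ?K2" using t(1) by (simp add: same_body_def)
    show "{x1, x2, z} \<in> ?K2" using z(1) d by (auto simp: del_def)
    show "distinct [b, x1, x2, z]" using d by auto
    fix s assume s: "s \<in> ?K2" "x1 \<in> s" "x2 \<in> s"
    then consider "s \<in> K" "x \<notin> s" | "s = {x1, b, x2}" using d by (auto simp: del_def)
    then show "s \<subseteq> {x1, x2, b} \<or> s \<subseteq> {x1, x2, z}"
    proof cases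
      case 1 then show ?thesis using z(2)[of s] s by auto
    qed auto
  qed
  moreover have "del {b} ?K2 = del {a, b, x} K" by (auto simp: del_def)
  ultimately show ?thesis using t(1) same_body_trans by metis
qed

text \<open>Removing \<open>x\<close> with its square link puts in the diagonal \<open>p r\<close>.
  Then \<open>q\<close> has the triangle \<open>p r w\<close> as link, and after its removal
  \<open>p\<close> has the triangle \<open>r s w\<close>. The diagonal is absent at the start
  because all neighbours of \<open>p\<close> are known.\<close>

lemma remove_octahedron_body:
  assumes K: "abstract_2_complex K" and d: "distinct [x, p, q, r, s, w]"
    and sx: "star_in K x {{p, q}, {q, r}, {r, s}, {s, p}}"
    and sp: "star_in K p {{s, x}, {x, q}, {q, w}, {w, s}}"
    and sq: "star_in K q {{p, x}, {x, r}, {r, w}, {w, p}}"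
    and n: "{w, r, s} \<notin> K"
  shows "same_body K (del {x, p, q} K \<union> {{w, r, s}})"
proof -
  have ps: "f \<subseteq> {p, s, x, q, w}" if "f \<in> K" "p \<in> f" for f
    using star_in_cover[OF sp that] by auto
  have pr: "{p, r} \<notin> K" using ps[of "{p, r}"] d by auto
  have dx: "distinct [x, p, q, r, s]" using d by auto
  let ?K1 = "del {x} K \<union> {{p, r}, {p, q, r}, {p, r, s}}"
  have 1: "same_body K ?K1" by (rule remove_square_vertex(1)[OF K sx dx pr])
  have m: "{q, r, w} \<in> K" "{q, w, p} \<in> K" "{p, w, s} \<in> K"
    using star_in_mem[OF sq, of "{r, w}"] star_in_mem[OF sq, of "{w, p}"] star_in_mem[OF sp, of "{w, s}"] by auto
  have sq1: "star_in ?K1 q {{p, r}, {r, w}, {p, w}}"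
  proof (rule star_in_del[OF sq])
    fix e assume "e \<in> {{p, x}, {x, r}, {r, w}, {w, p}}"
    then show "\<exists>e'\<in>{{p, r}, {r, w}, {p, w}}. e - {x} \<subseteq> e'" by auto
  next
    fix f assume "f \<in> {{p, r}, {p, q, r}, {p, r, s}}" "q \<in> f"
    then show "\<exists>e'\<in>{{p, r}, {r, w}, {p, w}}. f \<subseteq> insert q e'" using d by auto
  next
    fix e' assume "e' \<in> {{p, r}, {r, w}, {p, w}}"
    then show "q \<notin> e' \<and> insert q e' \<in> ?K1" using d m by (auto simp: del_def insert_commute)
  qed
  have n1: "{p, r, w} \<notin> ?K1"
  proof
    assume "{p, r, w} \<in> ?K1"
    moreover have "w \<notin> {p, r}" "w \<notin> {p, q, r}" "w \<notin> {p, r, s}" using d by auto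
    ultimately have "{p, r, w} \<in> K" by (auto simp: del_def)
    then show False using ps[of "{p, r, w}"] d by auto
  qed
  let ?K2 = "del {q} ?K1 \<union> {{p, r, w}}"
  have 2: "same_body ?K1 ?K2"
    by (rule remove_triangle_vertex[OF _ sq1 _ n1]) (use 1 d in \<open>auto simp: same_body_def\<close>)
  have eq2: "?K2 = del {x, q} K \<union> {{p, r}, {p, r, s}, {p, r, w}}"
    using d by (auto simp: del_def)
  have sp2: "star_in ?K2 p {{r, s}, {s, w}, {r, w}}"
    unfolding eq2
  proof (rule star_in_del[OF sp])
    fix e assume "e \<in> {{s, x}, {x, q}, {q, w}, {w, s}}"
    then show "\<exists>e'\<in>{{r, s}, {s, w}, {r, w}}. e - {x, q} \<subseteq> e'" by auto
  next
    fix f assume "f \<in> {{p, r}, {p, r, s}, {p, r, w}}" "p \<in> f"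
    then show "\<exists>e'\<in>{{r, s}, {s, w}, {r, w}}. f \<subseteq> insert p e'" by auto
  next
    fix e' assume "e' \<in> {{r, s}, {s, w}, {r, w}}"
    then show "p \<notin> e' \<and> insert p e' \<in> del {x, q} K \<union> {{p, r}, {p, r, s}, {p, r, w}}"
      using d m by (auto simp: del_def insert_commute)
  qed
  have n2: "{r, s, w} \<notin> ?K2"
  proof
    assume "{r, s, w} \<in> ?K2"
    moreover have "p \<notin> {r, s, w}" using d by auto
    moreover have "p \<in> {p, r}" "p \<in> {p, r, s}" "p \<in> {p, r, w}" by auto
    ultimately have "{r, s, w} \<in> K" unfolding eq2 by (auto simp: del_def)
    then show False using n by (simp add: insert_commute)
  qed
  have "same_body ?K2 (del {p} ?K2 \<union> {{r, s, w}})"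
    by (rule remove_triangle_vertex[OF _ sp2 _ n2]) (use 2 d in \<open>auto simp: same_body_def\<close>)
  also have "del {p} ?K2 \<union> {{r, s, w}} = del {x, p, q} K \<union> {{w, r, s}}"
    unfolding eq2 by (auto simp: del_def insert_commute)
  finally show ?thesis by (rule same_body_trans[OF same_body_trans[OF 1 2]])
qed

text \<open>Once the octahedron is exchanged for the face \<open>w r s\<close>, the vertex
  \<open>w\<close> has only this face left and is an ear on \<open>r s\<close>.\<close>

lemma remove_external_octahedron:
  assumes K: "abstract_2_complex K" and d: "distinct [x, p, q, r, s, w, z]"
    and sx: "star_in K x {{p, q}, {q, r}, {r, s}, {s, p}}"
    and sp: "star_in K p {{s, x}, {x, q}, {q, w}, {w, s}}"
    and sq: "star_in K q {{p, x}, {x, r}, {r, w}, {w, p}}"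
    and sw: "star_in K w {{s, p}, {p, q}, {q, r}}"
    and z: "{r, s, z} \<in> K" "\<And>f. f \<in> K \<Longrightarrow> r \<in> f \<Longrightarrow> s \<in> f \<Longrightarrow> f \<subseteq> {r, s, x} \<or> f \<subseteq> {r, s, z}"
  shows "same_body K (del {w, x, p, q} K)"
proof -
  have ws: "f \<subseteq> {w, s, p} \<or> f \<subseteq> {w, p, q} \<or> f \<subseteq> {w, q, r}" if "f \<in> K" "w \<in> f" for f
    using star_in_cover[OF sw that] by auto
  have n: "{w, r, s} \<notin> K" using ws[of "{w, r, s}"] d by auto
  have d6: "distinct [x, p, q, r, s, w]" using d by auto
  let ?L = "del {x, p, q} K \<union> {{w, r, s}}"
  have 1: "same_body K ?L" by (rule remove_octahedron_body[OF K d6 sx sp sq n])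
  have sw': "star_in ?L w {{r, s}}"
  proof (rule star_in_del[OF sw])
    fix e assume "e \<in> {{s, p}, {p, q}, {q, r}}"
    then show "\<exists>e'\<in>{{r, s}}. e - {x, p, q} \<subseteq> e'" by auto
  qed (use d in auto)
  have "same_body ?L (del {w} ?L)"
  proof (rule remove_ear[OF _ sw'])
    show "abstract_2_complex ?L" using 1 by (simp add: same_body_def)
    show "{r, s, z} \<in> ?L" using z(1) d by (auto simp: del_def)
    show "distinct [w, r, s, z]" using d by auto
    fix f assume f: "f \<in> ?L" "r \<in> f" "s \<in> f"
    then consider "f \<in> K" "x \<notin> f" | "f = {w, r, s}" by (auto simp: del_def)
    then show "f \<subseteq> {r, s, w} \<or> f \<subseteq> {r, s, z}"
    proof cases
      case 1 then show ?thesis using z(2)[of f] f by auto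
    qed auto
  qed
  also have "del {w} ?L = del {w, x, p, q} K" by (auto simp: del_def)
  finally show ?thesis using 1 same_body_trans by metis
qed

text \<open>In two coordinates the triangle is a compact convex planar set with interior points, and
  such sets are homeomorphic to the closed disk.\<close>

lemma triangle_body_disk:
  assumes d: "distinct [a, b, c]"
  shows "body (face_complex {a, b, c}) homeomorphic_space closed_disk"
proof -
  define D where "D = {z :: complex. 0 \<le> Re z \<and> 0 \<le> Im z \<and> Re z + Im z \<le> 1}"
  define p :: "complex \<Rightarrow> 'a \<Rightarrow> real" where
    "p z = (\<lambda>v. if v = a then Re z else if v = b then Im z else if v = c then 1 - Re z - Im z else 0)" for z
  define q where "q \<alpha> = Complex (\<alpha> a) (\<alpha> b)" for \<alpha> :: "'a \<Rightarrow> real"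
  have eq: "realization (face_complex {a, b, c}) = closed_simplex {a, b, c}"
    using supp_nonempty by (fastforce simp: realization_iff face_complex_def)
  have mem: "\<alpha> \<in> closed_simplex {a, b, c} \<longleftrightarrow> (\<forall>v. 0 \<le> \<alpha> v) \<and> (\<forall>v. v \<notin> {a, b, c} \<longrightarrow> \<alpha> v = 0) \<and> \<alpha> a + \<alpha> b + \<alpha> c = 1" for \<alpha>
    using closed_simplex_iff[of "{a, b, c}" \<alpha>] d by (auto simp: add.assoc)
  have pD: "p z \<in> closed_simplex {a, b, c}" if "z \<in> D" for z
    using that d by (auto simp: mem D_def p_def)
  have qD: "q \<alpha> \<in> D" "p (q \<alpha>) = \<alpha>" if \<alpha>: "\<alpha> \<in> closed_simplex {a, b, c}" for \<alpha>
  proof -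
    have \<alpha>': "\<And>v. 0 \<le> \<alpha> v" "\<And>v. v \<notin> {a, b, c} \<Longrightarrow> \<alpha> v = 0" "\<alpha> a + \<alpha> b + \<alpha> c = 1"
      using \<alpha> mem by auto
    have "\<alpha> a + \<alpha> b \<le> 1" using \<alpha>'(1)[of c] \<alpha>'(3) by linarith
    then show "q \<alpha> \<in> D" using \<alpha>' by (simp add: q_def D_def)
    show "p (q \<alpha>) = \<alpha>" using \<alpha>' by (auto simp: p_def q_def fun_eq_iff)
  qed
  have pq: "q (p z) = z" for z using d by (auto simp: p_def q_def complex_eq_iff)
  have pc: "continuous_on D p"
  proof (rule continuous_on_coordinatewise_then_product)
    show "continuous_on D (\<lambda>z. p z v)" for v
      unfolding p_def by (cases "v = a"; cases "v = b"; cases "v = c") (simp_all add: continuous_intros)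
  qed
  have qc: "continuous_on (closed_simplex {a, b, c}) q"
    unfolding q_def Complex_eq by (intro continuous_intros)
  have "homeomorphism D (closed_simplex {a, b, c}) p q"
    by (rule homeomorphismI[OF pc qc]) (use pD qD pq in auto)
  then have h: "closed_simplex {a, b, c} homeomorphic D"
    using homeomorphic_def homeomorphic_sym by blast
  have "convex D" unfolding convex_alt D_def
  proof (intro ballI allI impI CollectI conjI)
    fix z z' :: complex and u :: real
    assume z: "z \<in> {z. 0 \<le> Re z \<and> 0 \<le> Im z \<and> Re z + Im z \<le> 1}"
      and z': "z' \<in> {z. 0 \<le> Re z \<and> 0 \<le> Im z \<and> Re z + Im z \<le> 1}" and u: "0 \<le> u \<and> u \<le> 1"
    show "0 \<le> Re ((1 - u) *\<^sub>R z + u *\<^sub>R z')" "0 \<le> Im ((1 - u) *\<^sub>R z + u *\<^sub>R z')"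
      using z z' u by simp_all
    have "(1 - u) * (Re z + Im z) + u * (Re z' + Im z') \<le> (1 - u) * 1 + u * 1"
      using z z' u by (intro add_mono mult_left_mono) auto
    then show "Re ((1 - u) *\<^sub>R z + u *\<^sub>R z') + Im ((1 - u) *\<^sub>R z + u *\<^sub>R z') \<le> 1"
      by (simp add: algebra_simps)
  qed
  moreover have "compact D"
  proof (rule compact_eq_bounded_closed[THEN iffD2], intro conjI)
    have "norm z \<le> 2" if "z \<in> D" for z
      using that cmod_le[of z] by (auto simp: D_def)
    then show "bounded D" by (auto simp: bounded_iff)
    show "closed D" unfolding D_def
      by (intro closed_Collect_conj closed_Collect_le continuous_intros)
  qed
  moreover have "interior D \<noteq> {}"
  proof -
    have "open {z :: complex. 0 < Re z \<and> 0 < Im z \<and> Re z + Im z < 1}"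
      by (intro open_Collect_conj open_Collect_less continuous_intros)
    moreover have "{z :: complex. 0 < Re z \<and> 0 < Im z \<and> Re z + Im z < 1} \<subseteq> D" by (auto simp: D_def)
    ultimately have "{z :: complex. 0 < Re z \<and> 0 < Im z \<and> Re z + Im z < 1} \<subseteq> interior D"
      by (rule interior_maximal[rotated])
    moreover have "Complex (1/3) (1/3) \<in> {z :: complex. 0 < Re z \<and> 0 < Im z \<and> Re z + Im z < 1}" by simp
    ultimately show ?thesis by blast
  qed
  ultimately have "D homeomorphic (cball 0 1 :: complex set)"
    by (intro homeomorphic_convex_compact_cball) auto
  with h have "closed_simplex {a, b, c} homeomorphic (cball 0 1 :: complex set)"
    using homeomorphic_trans by blast
  then show ?thesis unfolding eq by (rule homeomorphic_imp_homeomorphic_space)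
qed

context surface_complex
begin

lemma star_in_link: "star_in K x (link_edges K x)"
  unfolding star_in_def
proof (intro conjI ballI impI)
  fix s assume "s \<in> K" "x \<in> s"
  then obtain t where t: "t \<in> K" "s \<subseteq> t" "card t = 3" using pure by blast
  then have "t - {x} \<in> link_edges K x" using \<open>x \<in> s\<close> by (auto simp: link_edges_def insert_absorb)
  then show "\<exists>e\<in>link_edges K x. s \<subseteq> insert x e" by (rule bexI[rotated]) (use t in auto)
qed (auto simp: link_edges_def)

lemma link_edges_from_opp: "link_edges K x = (\<Union>a\<in>nbrs K x. (\<lambda>b. {a, b}) ` opp K x a)"
proof (intro equalityI subsetI)
  fix e assume e: "e \<in> link_edges K x"
  then obtain a b where ab: "e = {a, b}" "a \<noteq> b" by (auto simp: link_edges_def card_2_iff)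
  then have "{x, a, b} \<in> faces K" using e by (simp add: link_edge_mem)
  then have "a \<in> nbrs K x" "b \<in> opp K x a" using face_edges[of x a b] by (auto simp: face_mem nbrs_def opp_def)
  then show "e \<in> (\<Union>a\<in>nbrs K x. (\<lambda>b. {a, b}) ` opp K x a)" using ab by blast
next
  fix e assume "e \<in> (\<Union>a\<in>nbrs K x. (\<lambda>b. {a, b}) ` opp K x a)"
  then obtain a b where "a \<in> nbrs K x" "b \<in> opp K x a" "e = {a, b}" by blast
  then show "e \<in> link_edges K x" by (auto simp: link_edge_mem nbrs_def opp_iff_face)
qed

lemma edge_cofaces:
  assumes "u \<noteq> v" "opp K u v = {y, z}" "s \<in> K" "u \<in> s" "v \<in> s"
  shows "s \<subseteq> {u, v, y} \<or> s \<subseteq> {u, v, z}"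
proof -
  obtain t where t: "t \<in> K" "s \<subseteq> t" "card t = 3" using pure assms by blast
  obtain c where c: "t = {u, v, c}" "c \<noteq> u" "c \<noteq> v"
    by (rule face_verts[OF t(3), of u v]) (use t assms in auto)
  then have "c \<in> opp K u v" using t by (auto simp: opp_def)
  then show ?thesis using assms(2) t c by auto
qed

end

section \<open>Triangulations without a reducing step\<close>

lemma nbrs_del: "v \<notin> X \<Longrightarrow> nbrs (del X K) v = nbrs K v - X"
  by (auto simp: nbrs_def del_def)

lemma opp_del: "u \<notin> X \<Longrightarrow> v \<notin> X \<Longrightarrow> opp (del X K) u v = opp K u v - X"
  by (auto simp: opp_def del_def)

lemma card_del:
  assumes "abstract_2_complex K" "{v} \<in> K" "v \<in> X"
  shows "card (del X K) < card K"
  by (rule psubset_card_mono[OF complex_finite_all[OF assms(1)]]) (use assms in \<open>auto simp: del_def\<close>)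

context surface_complex
begin

lemma opp_link: "a \<noteq> x \<Longrightarrow> b \<in> opp K x a \<longleftrightarrow> {a, b} \<in> link_edges K x"
  by (simp add: opp_iff_face link_edge_mem)

lemma opp_swap: "b \<noteq> x \<Longrightarrow> a \<noteq> x \<Longrightarrow> b \<in> opp K x a \<longleftrightarrow> a \<in> opp K x b"
  by (simp add: opp_link insert_commute)

lemma nbrs_sym: "a \<in> nbrs K b \<longleftrightarrow> b \<in> nbrs K a"
  by (auto simp: nbrs_def insert_commute)

lemma nbrs_not_self: "a \<notin> nbrs K a"
  by (simp add: nbrs_def)

lemma nbrs_edge: "a \<in> nbrs K b \<longleftrightarrow> a \<noteq> b \<and> {b, a} \<in> K"
  by (auto simp: nbrs_def)

lemma nbrs_eqI: "A \<subseteq> nbrs K x \<Longrightarrow> deg K x \<le> card A \<Longrightarrow> nbrs K x = A"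
  unfolding deg_def using card_seteq[OF finite_nbrs] by metis

lemma opp_sub: "opp K x a \<subseteq> nbrs K x - {a}"
  using opp_subset_nbrs by (auto simp: opp_def)

lemma opp_nonempty': "a \<in> nbrs K x \<Longrightarrow> opp K x a \<noteq> {}"
  using opp_nonempty by (auto simp: nbrs_def)

lemma inner_opp: "inner_at K x \<Longrightarrow> a \<in> nbrs K x \<Longrightarrow> card (opp K x a) = 2"
  unfolding inner_at_def nbrs_def by auto

lemma opp_eq2: "card (opp K x a) = 2 \<Longrightarrow> b \<in> opp K x a \<Longrightarrow> \<exists>c. c \<noteq> b \<and> opp K x a = {b, c}"
  by (auto simp: card_2_iff)

lemma deg_ge: "A \<subseteq> nbrs K x \<Longrightarrow> card A \<le> deg K x"
  unfolding deg_def by (rule card_mono[OF finite_nbrs])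

text \<open>From \<open>u v\<close> the link is followed one step beyond each end, to
  \<open>z\<close> and \<open>y\<close>. If these coincided the link would be a triangle and the
  degree 3. As \<open>y\<close> needs two link neighbours and \<open>u\<close> is not among them,
  the edge \<open>y z\<close> closes the square.\<close>

lemma inner_degree_four:
  assumes i: "inner_at K x" and d: "deg K x = 4" and f: "{u, v} \<in> link_edges K x"
  shows "\<exists>y z. distinct [x, u, v, y, z] \<and> link_edges K x = {{u, v}, {v, y}, {y, z}, {z, u}}"
proof -
  have xuv: "distinct [x, u, v]" using f unfolding link_edge_mem face_mem by blast
  then have n: "x \<noteq> u" "x \<noteq> v" "u \<noteq> v" by auto
  have uv: "u \<in> nbrs K x" "v \<in> nbrs K x" using f by (auto simp: nbrs_link_edges)
  have o: "u \<in> opp K x v" "v \<in> opp K x u" using f n by (simp_all add: opp_link insert_commute)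
  obtain y where y: "y \<noteq> u" "opp K x v = {u, y}" using opp_eq2 inner_opp[OF i uv(2)] o(1) by metis
  obtain z where z: "z \<noteq> v" "opp K x u = {v, z}" using opp_eq2 inner_opp[OF i uv(1)] o(2) by metis
  have yz: "y \<in> nbrs K x" "z \<in> nbrs K x" "y \<noteq> v" "z \<noteq> u" using opp_sub[of x v] opp_sub[of x u] y z by auto
  have yzx: "y \<noteq> x" "z \<noteq> x" using yz nbrs_not_self by auto
  have L: "{v, y} \<in> link_edges K x" "{u, z} \<in> link_edges K x"
    using y z opp_link[of v x y] opp_link[of u x z] n by auto
  have ne: "y \<noteq> z"
  proof
    assume "y = z"
    then have "deg K x = 3" using triangle_link(3)[of x u v y] f L n yz y by (simp add: link_edge_mem)
    then show False using d by simp
  qed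
  have N: "nbrs K x = {u, v, y, z}"
    by (rule nbrs_eqI) (use uv yz d n ne y z in auto)
  have "opp K x y \<subseteq> {u, v, z}" using opp_sub[of x y] N by auto
  moreover have "u \<notin> opp K x y" using opp_swap[of u x y] yzx n z y(1) ne yz by auto
  ultimately have "opp K x y \<subseteq> {v, z}" by auto
  moreover have "card {v, z} \<le> card (opp K x y)" using inner_opp[OF i yz(1)] by (simp add: card_insert_if)
  ultimately have "opp K x y = {v, z}" using card_seteq[of "{v, z}" "opp K x y"] by simp
  then have "{y, z} \<in> link_edges K x" using opp_link[of y x z] yzx by auto
  then have "{{u, v}, {v, y}, {y, z}, {z, u}} \<subseteq> link_edges K x" using f L by (simp add: insert_commute)
  moreover have "distinct [u, v, y, z]" using n y z yz ne by auto
  ultimately have "link_edges K x = {{u, v}, {v, y}, {y, z}, {z, u}}"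
    using cycle_link_inner(1) two_regular_square by (metis insert_not_empty)
  moreover have "distinct [x, u, v, y, z]" using n y(1) z(1) yz(3,4) ne yzx by auto
  ultimately show ?thesis by blast
qed

text \<open>The third neighbour \<open>y\<close> is joined in the link to exactly one of
  \<open>u\<close> and \<open>v\<close>, because being joined to both would make \<open>x\<close>
  inner.\<close>

lemma boundary_degree_three:
  assumes ok: "degree_ok K" and i: "\<not> inner_at K x" and d: "deg K x = 3" and f: "{u, v} \<in> link_edges K x"
  shows "\<exists>y. distinct [x, u, v, y] \<and>
    (link_edges K x = {{u, v}, {v, y}} \<or> link_edges K x = {{v, u}, {u, y}})"
proof -
  have "distinct [x, u, v]" using f unfolding link_edge_mem face_mem by blast
  then have n: "x \<noteq> u" "x \<noteq> v" "u \<noteq> v" by auto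
  have uv: "u \<in> nbrs K x" "v \<in> nbrs K x" using f by (auto simp: nbrs_link_edges)
  have "card (nbrs K x - {u, v}) = 1" using d uv n by (simp add: deg_def card_Diff_subset)
  then obtain y where "nbrs K x - {u, v} = {y}" by (auto simp: card_1_singleton_iff)
  then have y: "nbrs K x = {u, v, y}" "y \<noteq> u" "y \<noteq> v" using uv by auto
  have yx: "y \<noteq> x" using y nbrs_not_self by auto
  have oy: "opp K x y \<subseteq> {u, v}" "opp K x y \<noteq> {}" using opp_sub[of x y] opp_nonempty'[of y x] y by auto
  have nb: "\<not> (u \<in> opp K x y \<and> v \<in> opp K x y)"
  proof
    assume "u \<in> opp K x y \<and> v \<in> opp K x y"
    then have "inner_at K x"
      using triangle_link(2)[of x u v y] f n y yx by (simp add: link_edge_mem opp_iff_face insert_commute)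
    then show False using i by simp
  qed
  have ov: "v \<in> opp K x u" "u \<in> opp K x v" using f n by (simp_all add: opp_link insert_commute)
  have su: "opp K x u \<subseteq> {v, y}" "opp K x v \<subseteq> {u, y}" using opp_sub[of x u] opp_sub[of x v] y by auto
  have le: "link_edges K x = (\<lambda>b. {u, b}) ` opp K x u \<union> (\<lambda>b. {v, b}) ` opp K x v \<union> (\<lambda>b. {y, b}) ` opp K x y"
    unfolding link_edges_from_opp[of x] y by auto
  consider "opp K x y = {v}" | "opp K x y = {u}" using oy nb by blast
  then show ?thesis
  proof cases
    case 1
    then have "opp K x u = {v}" "opp K x v = {u, y}"
      using su ov opp_swap[of y x u] opp_swap[of y x v] n yx y by auto
    then have "link_edges K x = {{u, v}, {v, y}}" unfolding le 1 by (auto simp: insert_commute)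
    then show ?thesis using n yx y by auto
  next
    case 2
    then have "opp K x v = {u}" "opp K x u = {v, y}"
      using su ov opp_swap[of y x u] opp_swap[of y x v] n yx y by auto
    then have "link_edges K x = {{v, u}, {u, y}}" unfolding le 2 by (auto simp: insert_commute)
    then show ?thesis using n yx y by auto
  qed
qed

end

text \<open>A triangulation of the class to which no reducing step applies. Comparing the numbers of
  simplices keeps the steps in line with the induction of the final theorem.\<close>

locale stuck =
  fixes F :: "'a topology" and K :: "'v set set"
  assumes punct: "punctured_surface F" and KF: "K \<in> F4 F"
    and nodisk: "\<not> F homeomorphic_space closed_disk"
    and nostep: "\<And>H. generating_step F H K \<Longrightarrow> card H < card K \<Longrightarrow> False"
begin

lemma tri: "triangulates K F" and ok: "degree_ok K"
  using KF F4_iff[OF punct] by auto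

sublocale surface_complex K
  using triangulates_surface_complex(1)[OF punct tri] .

lemma inner_vertex_iff: "inner_vertex K v \<longleftrightarrow> {v} \<in> K \<and> inner_at K v"
  using triangulates_surface_complex(2)[OF punct tri] unfolding inner_at_def .

lemma boundary_vertex_iff: "boundary_vertex K v \<longleftrightarrow> {v} \<in> K \<and> \<not> inner_at K v"
  using inner_vertex_iff[of v] unfolding inner_vertex_def boundary_vertex_def by (auto simp: bd_def)

lemma bd_iff: "u \<noteq> v \<Longrightarrow> {u, v} \<in> bd K \<longleftrightarrow> {u, v} \<in> K \<and> card (opp K u v) = 1"
  using triangulates_surface_complex(3)[OF punct tri] .

lemma same_body_triangulates: "same_body K L \<Longrightarrow> triangulates L F"
  using tri homeomorphic_space_trans homeomorphic_space_sym unfolding same_body_def triangulates_def by metis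

text \<open>Without a light opposite vertex the contraction stays in the class by
  \<open>light_opposite\<close>. There a vertex of degree 3 is not inner, hence a triode, so the
  edge is triode detecting and the contraction is a reducing step.\<close>

lemma contract_light:
  assumes uv: "u \<noteq> v" "{u, v} \<in> K" and t: "triangulates (contract u v K) F"
  shows "\<exists>x\<in>opp K u v. light K x"
    and "\<And>w. w \<in> nbrs K u \<Longrightarrow> w \<in> nbrs K v \<Longrightarrow> w \<in> opp K u v"
proof -
  let ?L = "contract u v K"
  have L: "surface_complex ?L" using triangulates_surface_complex(1)[OF punct t] .
  have h: "body ?L homeomorphic_space body K"
    using t tri homeomorphic_space_trans homeomorphic_space_sym unfolding triangulates_def by metis
  show lc: "w \<in> opp K u v" if "w \<in> nbrs K u" "w \<in> nbrs K v" for w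
    using link_condition[OF surface_complex_axioms L h ok uv, of w] that by (auto simp: nbrs_def)
  show "\<exists>x\<in>opp K u v. light K x"
  proof (rule ccontr)
    assume "\<not> ?thesis"
    then have "degree_ok ?L"
      using light_opposite[OF surface_complex_axioms L ok uv] lc by (auto simp: nbrs_def)
    then have LF: "?L \<in> F4 F" using t by (simp add: F4_iff[OF punct])
    have "three_splitting_triode F ?L K"
      unfolding three_splitting_triode_def triode_detecting_edge_def
    proof (rule exI[of _ u], rule exI[of _ v], intro conjI ballI impI refl KF)
      show "contractible_edge F K u v" using uv t by (simp add: contractible_edge_def)
      fix w assume w: "w \<in> vertices ?L" "deg ?L w = 3 \<and> (w = u \<or> deg K w \<noteq> 3)"
      have "\<not> inner_vertex ?L w" using LF w unfolding F4_def by fastforce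
      then show "triode ?L w" using w by (auto simp: triode_def boundary_vertex_def inner_vertex_def vertices_def)
    qed
    then have "generating_step F ?L K" using LF KF by (simp add: generating_step_def)
    moreover have "card ?L < card K"
    proof -
      have "{u} \<in> K" "{v} \<in> K" using uv edge_ends by auto
      \<comment> \<open>The vertices \<open>u\<close> and \<open>v\<close> have the same image, so
        the number of simplices drops.\<close>
      then have "\<not> inj_on (\<lambda>s. (\<lambda>x. if x = v then u else x) ` s) K"
        using uv(1) unfolding inj_on_def by (intro notI) (drule bspec[of _ _ "{u}"], simp, drule bspec[of _ _ "{v}"], auto)
      then have "card ?L \<noteq> card K"
        using eq_card_imp_inj_on[OF complex_finite_all[OF complex]] unfolding contract_def by blast
      moreover have "card ?L \<le> card K"
        unfolding contract_def by (rule card_image_le[OF complex_finite_all[OF complex]])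
      ultimately show ?thesis by simp
    qed
    ultimately show False using nostep by blast
  qed
qed

lemma contract_light':
  assumes "u \<noteq> v" "{u, v} \<in> K" "same_body K (contract u v K)"
  shows "\<exists>x\<in>opp K u v. light K x"
  using contract_light(1)[OF assms(1,2) same_body_triangulates[OF assms(3)]] .

lemma not_light_degree: "deg K x \<ge> 5 \<Longrightarrow> \<not> light K x"
  by (auto simp: light_def)

lemma not_light_boundary: "\<not> inner_at K x \<Longrightarrow> deg K x \<ge> 4 \<Longrightarrow> \<not> light K x"
  by (auto simp: light_def)

lemma inner_degree_ge: "inner_at K x \<Longrightarrow> {x} \<in> K \<Longrightarrow> deg K x \<ge> 4"
  and degree_ge: "{x} \<in> K \<Longrightarrow> deg K x \<ge> 3"
  using ok unfolding degree_ok_def vertices_def by auto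

lemma not_inner: "a \<in> nbrs K x \<Longrightarrow> card (opp K x a) = 1 \<Longrightarrow> \<not> inner_at K x"
  using inner_opp by fastforce

text \<open>A vertex has at most two boundary edges, so a part of its link that is closed under
  adjacency and reaches two of them is the whole link.\<close>

lemma path_link_closed:
  assumes \<Gamma>: "\<Gamma> \<subseteq> link_edges K x" "\<Gamma> \<noteq> {}"
    and closed: "\<And>v e. v \<in> \<Union>\<Gamma> \<Longrightarrow> e \<in> link_edges K x \<Longrightarrow> v \<in> e \<Longrightarrow> e \<in> \<Gamma>"
    and w: "w1 \<noteq> w2" "w1 \<in> \<Union>\<Gamma>" "w2 \<in> \<Union>\<Gamma>" "card (opp K x w1) = 1" "card (opp K x w2) = 1"
  shows "link_edges K x = \<Gamma>" "nbrs K x = \<Union>\<Gamma>"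
proof -
  let ?D = "link_edges K x - \<Gamma>"
  have "?D = {}"
  proof (rule ccontr)
    assume ne: "?D \<noteq> {}"
    have D: "{e \<in> ?D. v \<in> e} = {e \<in> link_edges K x. v \<in> e}" if "e \<in> ?D" "v \<in> e" for e v
      using closed that by blast
    \<comment> \<open>An edge of \<open>?D\<close> has no vertex in common with \<Gamma>. A vertex
      of \<open>?D\<close> with only one link edge would therefore give a third boundary edge at
      \<open>x\<close>, beside those to \<open>w1\<close> and \<open>w2\<close>.\<close>
    have "two_regular ?D"
      unfolding two_regular_def
    proof (intro conjI ballI)
      show "finite ?D" using finite_link_edges[OF complex] by blast
      show "card e = 2" if "e \<in> ?D" for e using that by (auto simp: link_edges_def)
      fix e v assume e: "e \<in> ?D" "v \<in> e"
      then have v: "v \<in> nbrs K x" by (auto simp: nbrs_link_edges)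
      then have vx: "v \<noteq> x" "{x, v} \<in> K" by (auto simp: nbrs_def)
      have "card {e' \<in> ?D. v \<in> e'} = card (opp K x v)" using D[OF e] link_edges_at(2)[OF vx(1)] by simp
      moreover have "card (opp K x v) \<noteq> 1"
      proof
        assume c: "card (opp K x v) = 1"
        have wn: "w1 \<in> nbrs K x" "w2 \<in> nbrs K x" using w \<Gamma> by (auto simp: nbrs_link_edges)
        have "v \<notin> \<Union>\<Gamma>" using closed[of v e] e by auto
        then have d: "distinct [x, w1, w2, v]" using w wn vx by (auto simp: nbrs_def)
        show False
          by (rule triangulates_boundary_degree[OF punct tri d]) (use w wn c vx in \<open>auto simp: nbrs_def\<close>)
      qed
      ultimately show "card {e' \<in> ?D. v \<in> e'} = 2" using card_opp[of x v] vx by auto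
    qed
    then have "?D = link_edges K x" using cycle_link[of ?D x] ne by blast
    then show False using \<Gamma> by blast
  qed
  then show *: "link_edges K x = \<Gamma>" using \<Gamma> by blast
  then show "nbrs K x = \<Union>\<Gamma>" using nbrs_link_edges by simp
qed

lemma removal_step:
  assumes "same_body K L" "degree_ok L" "card L < card K" "L \<in> F4 F \<Longrightarrow> flag_addition F L K \<or> octahedron_addition F L K"
  shows False
proof -
  have LF: "L \<in> F4 F" using assms(1,2) same_body_triangulates F4_iff[OF punct] by blast
  then have "generating_step F L K" using assms(4) KF by (auto simp: generating_step_def)
  then show False using nostep assms(3) by blast
qed

lemma all_vertices:
  assumes "A \<noteq> {}" "A \<subseteq> vertices K" "\<And>a. a \<in> A \<Longrightarrow> nbrs K a \<subseteq> A"
  shows "vertices K = A"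
proof -
  have "A = vertices K"
  proof (rule connected[OF assms(1,2)])
    fix a b assume "a \<in> A" "{a, b} \<in> K"
    then show "b \<in> A" using assms(3)[of a] by (cases "a = b") (auto simp: nbrs_def)
  qed
  then show ?thesis by simp
qed

text \<open>The place where the disk is excluded: a configuration that makes up the whole
  triangulation reduces to a single triangle.\<close>

lemma not_triangle: "distinct [a, b, c] \<Longrightarrow> \<not> same_body K (face_complex {a, b, c})"
  using same_body_triangulates[of "face_complex {a, b, c}"] triangle_body_disk[of a b c] nodisk
    homeomorphic_space_trans homeomorphic_space_sym unfolding triangulates_def by metis

end

section \<open>Flags\<close>

lemma subset_pair: "s \<subseteq> {a, b} \<Longrightarrow> s \<noteq> {} \<Longrightarrow> s = {a} \<or> s = {b} \<or> s = {a, b}"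
  by blast

text \<open>A removal must not create inner vertices. It suffices to look at each edge at
  \<open>v\<close>: either it had two faces before, or it survives with the same number of
  faces.\<close>

lemma inner_at_transfer:
  assumes "inner_at L v"
    and "\<And>y. y \<in> nbrs K v \<Longrightarrow> card (opp K v y) = 2 \<or> y \<in> nbrs L v \<and> card (opp L v y) = card (opp K v y)"
  shows "inner_at K v"
  using assms unfolding inner_at_def nbrs_def by (metis (mono_tags, lifting) mem_Collect_eq)

context surface_complex
begin

lemma opp_link_set: "a \<noteq> x \<Longrightarrow> opp K x a = {b. {a, b} \<in> link_edges K x}"
  using opp_link by blast

lemma square_link:
  assumes l: "link_edges K x = {{p, q}, {q, r}, {r, s}, {s, p}}" and d: "distinct [x, p, q, r, s]"
  shows "inner_at K x" "nbrs K x = {p, q, r, s}" "deg K x = 4"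
    "opp K x p = {q, s}" "opp K x q = {p, r}" "opp K x r = {q, s}" "opp K x s = {r, p}"
proof -
  have d': "distinct [p, q, r, s]" using d by simp
  have n: "p \<noteq> x" "q \<noteq> x" "r \<noteq> x" "s \<noteq> x" "p \<noteq> q" "p \<noteq> r" "p \<noteq> s" "q \<noteq> r" "q \<noteq> s" "r \<noteq> s" using d by auto
  have g: "{{p, q}, {q, r}, {r, s}, {s, p}} \<subseteq> link_edges K x" "{{p, q}, {q, r}, {r, s}, {s, p}} \<noteq> {}" using l by auto
  note c = cycle_link_inner[OF g two_regular_square[OF d']]
  show "inner_at K x" by (rule c(3))
  show *: "nbrs K x = {p, q, r, s}" using c(2) by auto
  show "deg K x = 4" unfolding deg_def * using d by auto
  show "opp K x p = {q, s}" "opp K x q = {p, r}" "opp K x r = {q, s}" "opp K x s = {r, p}"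
    unfolding opp_link_set[OF n(1)] opp_link_set[OF n(2)] opp_link_set[OF n(3)] opp_link_set[OF n(4)] l
    using n by (auto simp: doubleton_eq_iff)
qed

lemma opp_faces: "b \<in> opp K x a \<Longrightarrow> a \<noteq> x \<Longrightarrow> {x, a, b} \<in> faces K"
  by (simp add: opp_iff_face)

lemma opp_three: "a \<noteq> x \<Longrightarrow> b \<in> opp K x a \<Longrightarrow> x \<in> opp K a b \<and> x \<in> opp K b a \<and> a \<in> opp K x b \<and> a \<in> opp K b x \<and> b \<in> opp K a x"
  by (auto simp: opp_def insert_commute)

lemma vertex_of_nbr: "a \<in> nbrs K b \<Longrightarrow> {a} \<in> K \<and> {b} \<in> K"
  using edge_ends[of b a] by (auto simp: nbrs_def)

end

context stuck
begin

text \<open>The local shape of a flag. The remaining requirements of \<open>flag\<close>, on the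
  degrees of \<open>x1\<close> and \<open>x2\<close> and on the edge between them, are proved from
  the absence of reducing steps.\<close>

definition flag_at :: "'v \<Rightarrow> 'v \<Rightarrow> 'v \<Rightarrow> 'v \<Rightarrow> 'v \<Rightarrow> bool" where
  "flag_at x x1 a b x2 \<longleftrightarrow> link_edges K x = {{x1, a}, {a, b}, {b, x2}, {x2, x1}} \<and>
     distinct [x, x1, a, b, x2] \<and> deg K a = 3 \<and> deg K b = 3 \<and> \<not> inner_at K a \<and> \<not> inner_at K b"

lemma flag_at_reflect: "flag_at x x1 a b x2 \<Longrightarrow> flag_at x x2 b a x1"
proof -
  have "{{x1, a}, {a, b}, {b, x2}, {x2, x1}} = {{x2, b}, {b, a}, {a, x1}, {x1, x2}}"
    by (auto simp: insert_commute)
  then show "flag_at x x1 a b x2 \<Longrightarrow> flag_at x x2 b a x1" unfolding flag_at_def by auto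
qed

text \<open>The boundary vertex \<open>a\<close> has three neighbours, and a face
  \<open>a x1 b\<close> would close its link to a triangle. So the link is the path
  \<open>x1 x b\<close>.\<close>

lemma flag_link:
  assumes f: "flag_at x x1 a b x2"
  shows "nbrs K a = {x1, x, b}" "opp K a x = {x1, b}" "opp K a x1 = {x}" "opp K a b = {x}"
    "link_edges K a = {{x1, x}, {x, b}}"
proof -
  have l: "link_edges K x = {{x1, a}, {a, b}, {b, x2}, {x2, x1}}" and d: "distinct [x, x1, a, b, x2]"
    and da: "deg K a = 3" and ni: "\<not> inner_at K a"
    using f unfolding flag_at_def by auto
  note sq = square_link[OF l d]
  have n: "a \<noteq> x" "x1 \<noteq> x" "b \<noteq> x" "a \<noteq> b" "a \<noteq> x1" "b \<noteq> x1" using d by auto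
  show oax: "opp K a x = {x1, b}" using sq(5) opp_commute by metis
  have "x \<in> nbrs K a" using sq(2) nbrs_sym by auto
  moreover have "{x1, b} \<subseteq> nbrs K a" using opp_subset_nbrs[of a x] oax by simp
  ultimately show N: "nbrs K a = {x1, x, b}"
    by (intro nbrs_eqI) (use da n in auto)
  have "b \<notin> opp K a x1"
  proof
    assume "b \<in> opp K a x1"
    then have "{a, x1, b} \<in> faces K" using opp_faces n by metis
    moreover have "{a, x1, x} \<in> faces K" "{a, x, b} \<in> faces K"
      using opp_faces[of x1 a x] opp_faces[of b a x] oax n by (auto simp: insert_commute)
    ultimately show False using triangle_link(2)[of a x1 x b] n ni by auto
  qed
  moreover have "x \<in> opp K a x1" "x \<in> opp K a b" using opp_three[of x a x1] opp_three[of x a b] oax n by auto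
  moreover have "x1 \<notin> opp K a b" using calculation(1) opp_swap[of b a x1] n by auto
  ultimately show o: "opp K a x1 = {x}" "opp K a b = {x}" using opp_sub[of a x1] opp_sub[of a b] N by auto
  show "link_edges K a = {{x1, x}, {x, b}}"
    unfolding link_edges_from_opp[of a] N using o oax by (auto simp: insert_commute)
qed

text \<open>If \<open>x1\<close> had no neighbours but \<open>a\<close>, \<open>x\<close>,
  \<open>x2\<close>, \<open>z\<close>, its link would be the path through them in this order, and
  \<open>z x1\<close> could be contracted. The only vertex opposite to that edge is
  \<open>x2\<close>, which is not light: it is on the boundary and has the four neighbours
  \<open>b\<close>, \<open>x\<close>, \<open>x1\<close>, \<open>z\<close>.\<close>

lemma flag_end_degree:
  assumes f: "flag_at x x1 a b x2" and o: "opp K x1 x2 = {x, z}" "x \<noteq> z"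
  shows "deg K x1 \<ge> 5" "z \<notin> {x, x1, a, b, x2}"
proof -
  have l: "link_edges K x = {{x1, a}, {a, b}, {b, x2}, {x2, x1}}" and d: "distinct [x, x1, a, b, x2]"
    using f unfolding flag_at_def by auto
  note sq = square_link[OF l d] and fa = flag_link[OF f] and fb = flag_link[OF flag_at_reflect[OF f]]
  have n: "x \<noteq> x1" "x \<noteq> a" "x \<noteq> b" "x \<noteq> x2" "x1 \<noteq> a" "x1 \<noteq> b" "x1 \<noteq> x2" "a \<noteq> b" "a \<noteq> x2" "b \<noteq> x2" using d by auto
  have zn: "z \<in> nbrs K x1" "z \<in> nbrs K x2" using opp_subset_nbrs[of x1 x2] opp_subset_nbrs'[of x1 x2] o by auto
  show z: "z \<notin> {x, x1, a, b, x2}"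
    using o(2) zn fa(1) fb(1) nbrs_sym[of x2 a] nbrs_sym[of x1 b] nbrs_not_self n by auto
  have x1n: "{a, x, x2, z} \<subseteq> nbrs K x1"
    using fa(1) nbrs_sym[of x1 a] sq(2) nbrs_sym[of x1 x] opp_subset_nbrs[of x1 x] zn sq(4) opp_commute[of K x x1] by auto
  have x2n: "{b, x, x1, z} \<subseteq> nbrs K x2"
    using fb(1) nbrs_sym[of x2 b] sq(2) nbrs_sym[of x2 x] zn nbrs_sym[of x1 x2] x1n by auto
  have c4: "card {a, x, x2, z} = 4" "card {b, x, x1, z} = 4" using n z by auto
  have ge: "deg K x1 \<ge> 4" "deg K x2 \<ge> 4" using deg_ge[OF x1n] deg_ge[OF x2n] c4 by auto
  show "deg K x1 \<ge> 5"
  proof (rule ccontr)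
    assume "\<not> ?thesis"
    then have "deg K x1 \<le> 4" by simp
    then have N: "nbrs K x1 = {a, x, x2, z}" using nbrs_eqI[OF x1n] c4 by simp
    have oa: "opp K x1 a = {x}" using fa(3) opp_commute by metis
    have ox: "opp K x1 x = {a, x2}" using sq(4) opp_commute by metis
    have oz: "opp K x1 z = {x2}"
    proof -
      have "x2 \<in> opp K x1 z" using opp_three[of x2 x1 z] o n by auto
      moreover have "a \<notin> opp K x1 z" using opp_swap[of a x1 z] oa n z by auto
      moreover have "x \<notin> opp K x1 z" using opp_swap[of x x1 z] ox n z by auto
      ultimately show ?thesis using opp_sub[of x1 z] N by auto
    qed
    have L: "link_edges K x1 = {{a, x}, {x, x2}, {x2, z}}"
      unfolding link_edges_from_opp[of x1] N using oa ox oz o(1) by (auto simp: insert_commute)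
    have st: "star_in K x1 {{a, x}, {x, x2}, {x2, z}}" using star_in_link[of x1] unfolding L .
    have za: "{a, z} \<notin> K" "{x, z} \<notin> K" using fa(1) sq(2) z n by (auto simp: nbrs_def set_eq_iff)
    have dd: "distinct [x1, a, x, x2, z]" using n z by auto
    have "same_body K (contract z x1 K)" by (rule contract_path4[OF complex st dd za])
    moreover have "{z, x1} \<in> K" "z \<noteq> x1" using zn z by (auto simp: nbrs_def insert_commute)
    ultimately have "\<exists>w\<in>opp K z x1. light K w" using contract_light' by blast
    then have "light K x2" using oz opp_commute[of K z x1] by auto
    moreover have "\<not> inner_at K x2"
      using not_inner[of b x2] x2n fb(3) opp_commute[of K x2 b] by auto
    ultimately show False using not_light_boundary ge by blast
  qed
qed

text \<open>If \<open>x1 x2\<close> is a boundary edge, the flag is the whole triangulation and the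
  surface is a disk. Otherwise the flag is removable: \<open>x1\<close> and \<open>x2\<close> lose
  two of at least five neighbours and stay on the boundary.\<close>

lemma no_flag: assumes f: "flag_at x x1 a b x2" shows False
proof -
  have l: "link_edges K x = {{x1, a}, {a, b}, {b, x2}, {x2, x1}}" and d: "distinct [x, x1, a, b, x2]"
    and dab: "deg K a = 3" "deg K b = 3" and ni: "\<not> inner_at K a" "\<not> inner_at K b"
    using f unfolding flag_at_def by auto
  note f' = flag_at_reflect[OF f]
  note sq = square_link[OF l d] and fa = flag_link[OF f] and fb = flag_link[OF f']
  have n: "x \<noteq> x1" "x \<noteq> a" "x \<noteq> b" "x \<noteq> x2" "x1 \<noteq> a" "x1 \<noteq> b" "x1 \<noteq> x2" "a \<noteq> b" "a \<noteq> x2" "b \<noteq> x2" using d by auto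
  have sx: "star_in K x {{x1, a}, {a, b}, {b, x2}, {x2, x1}}" using star_in_link[of x] l by simp
  have sa: "star_in K a {{x1, x}, {x, b}}" using star_in_link[of a] fa(5) by simp
  have "link_edges K b = {{a, x}, {x, x2}}" using fb(5) by (auto simp: insert_commute)
  then have sb: "star_in K b {{a, x}, {x, x2}}" using star_in_link[of b] by simp
  have xo: "x \<in> opp K x1 x2" using opp_three[of x1 x x2] sq(4) n by auto
  have x12: "x2 \<in> nbrs K x1" using opp_subset_nbrs[of x1 x] sq(4) opp_commute[of K x x1] by auto
  then have x12K: "{x1, x2} \<in> K" by (simp add: nbrs_def)
  have one: "card (opp K x1 a) = 1" "card (opp K x2 b) = 1" using fa(3) fb(3) opp_commute[of K x1 a] opp_commute[of K x2 b] by auto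
  have an: "a \<in> nbrs K x1" "b \<in> nbrs K x2" using fa(1) fb(1) nbrs_sym by auto
  have ni12: "\<not> inner_at K x1" "\<not> inner_at K x2" using not_inner an one by blast+
  have vK: "{x} \<in> K" "{a} \<in> K" "{b} \<in> K" "{x1} \<in> K" "{x2} \<in> K"
    using vertex_of_nbr[of x1 x] vertex_of_nbr[of a x] vertex_of_nbr[of b x] vertex_of_nbr[of x2 x] sq(2) by auto
  have "card (opp K x1 x2) = 1 \<or> card (opp K x1 x2) = 2" using card_opp[OF n(7) x12K] .
  then show False
  proof
    assume "card (opp K x1 x2) = 1"
    then have o: "opp K x1 x2 = {x}" using xo by (auto simp: card_1_singleton_iff)
    \<comment> \<open>The edges from \<open>x1\<close> to \<open>a\<close> and to \<open>x2\<close>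
      are its two boundary edges, so the path \<open>a x x2\<close> between them is the whole
      link.\<close>
    have nb: "nbrs K x1 = {a, x, x2}"
    proof -
      have ox: "opp K x1 x = {a, x2}" using sq(4) opp_commute by metis
      have oa: "opp K x1 a = {x}" using fa(3) opp_commute by metis
      have cl: "e \<in> {{a, x}, {x, x2}}" if e: "e \<in> link_edges K x1" "v \<in> e" "v \<in> \<Union>{{a, x}, {x, x2}}" for e v
      proof -
        have v: "v = a \<or> v = x \<or> v = x2" using e by auto
        then have "v \<noteq> x1" using n by auto
        then have "e \<in> (\<lambda>b. {v, b}) ` opp K x1 v" using link_edges_at(1)[of v x1 K] e by auto
        then obtain c where "e = {v, c}" "c \<in> opp K x1 v" by blast
        with v show ?thesis by (elim disjE) (simp_all add: ox oa o insert_commute, blast?)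
      qed
      have g: "{{a, x}, {x, x2}} \<subseteq> link_edges K x1"
        using ox opp_link[of x x1 a] opp_link[of x x1 x2] n by (simp add: insert_commute)
      have "nbrs K x1 = \<Union>{{a, x}, {x, x2}}"
        by (rule path_link_closed(2)[OF g _ _ n(9)]) (use cl oa o in auto)
      then show ?thesis by auto
    qed
    have nb2: "nbrs K x2 = {b, x, x1}"
    proof -
      have ox: "opp K x2 x = {b, x1}" using sq(7) opp_commute by metis
      have oa: "opp K x2 b = {x}" using fb(3) opp_commute by metis
      have o': "opp K x2 x1 = {x}" using o opp_commute by metis
      have cl: "e \<in> {{b, x}, {x, x1}}" if e: "e \<in> link_edges K x2" "v \<in> e" "v \<in> \<Union>{{b, x}, {x, x1}}" for e v
      proof -
        have v: "v = b \<or> v = x \<or> v = x1" using e by auto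
        then have "v \<noteq> x2" using n by auto
        then have "e \<in> (\<lambda>b. {v, b}) ` opp K x2 v" using link_edges_at(1)[of v x2 K] e by auto
        then obtain c where "e = {v, c}" "c \<in> opp K x2 v" by blast
        with v show ?thesis by (elim disjE) (simp_all add: ox oa o' insert_commute, blast?)
      qed
      have g: "{{b, x}, {x, x1}} \<subseteq> link_edges K x2"
        using ox opp_link[of x x2 b] opp_link[of x x2 x1] n by (simp add: insert_commute)
      have "nbrs K x2 = \<Union>{{b, x}, {x, x1}}"
        by (rule path_link_closed(2)[OF g _ _ n(6)[symmetric]]) (use cl oa o' in auto)
      then show ?thesis by auto
    qed
    have V: "vertices K = {x, x1, a, b, x2}"
      by (rule all_vertices) (use vK sq(2) fa(1) fb(1) nb nb2 in \<open>auto simp: vertices_def\<close>)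
    let ?K2 = "del {a, x} K \<union> {{x1, b}, {x1, b, x2}}"
    have sb2: "same_body K ?K2" by (rule flag_to_triangle(1)[OF complex d sx sa sb])
    have "?K2 = face_complex {x1, b, x2}"
    proof
      show "?K2 \<subseteq> face_complex {x1, b, x2}"
      proof
        fix s assume s: "s \<in> ?K2"
        show "s \<in> face_complex {x1, b, x2}"
        proof (cases "s \<in> del {a, x} K")
          case True
          then have "s \<in> K" "a \<notin> s" "x \<notin> s" by (auto simp: del_def)
          moreover from this have "s \<subseteq> vertices K" "s \<noteq> {}" using simplex_vertices[OF complex] complex_nonempty[OF complex] by auto
          ultimately show ?thesis using V by (auto simp: face_complex_def)
        qed (use s in \<open>auto simp: face_complex_def\<close>)
      qed
      show "face_complex {x1, b, x2} \<subseteq> ?K2"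
        by (rule simplex_subset) (use sb2 in \<open>auto simp: same_body_def\<close>)
    qed
    then show False using sb2 not_triangle[of x1 b x2] n by simp
  next
    assume "card (opp K x1 x2) = 2"
    then obtain z where z: "z \<noteq> x" "opp K x1 x2 = {x, z}" using opp_eq2 xo by metis
    have z2: "opp K x2 x1 = {x, z}" using z opp_commute by metis
    note e1 = flag_end_degree[OF f z(2) z(1)[symmetric]] and e2 = flag_end_degree[OF f' z2 z(1)[symmetric]]
    have zn: "z \<noteq> x" "z \<noteq> x1" "z \<noteq> a" "z \<noteq> b" "z \<noteq> x2" using e1(2) by auto
    let ?L = "del {a, b, x} K"
    have zK: "{x1, x2, z} \<in> K" using z by (auto simp: opp_def)
    have d6: "distinct [x, x1, a, b, x2, z]" using d zn by auto
    have sbL: "same_body K ?L"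
      by (rule remove_flag[OF complex d6 sx sa sb zK]) (use edge_cofaces[OF n(7) z(2)] in blast)
    have nbL: "nbrs ?L v = nbrs K v - {a, b, x}" if "v \<notin> {a, b, x}" for v using nbrs_del[OF that] .
    have fin: "finite (nbrs K v)" for v by (rule finite_nbrs)
    have x1X: "nbrs K x1 \<inter> {a, b, x} = {a, x}"
      using an(1) nbrs_sym[of x1 x] sq(2) fb(1) nbrs_sym[of x1 b] n by auto
    have x2X: "nbrs K x2 \<inter> {a, b, x} = {b, x}"
      using an(2) nbrs_sym[of x2 x] sq(2) fa(1) nbrs_sym[of x2 a] n by auto
    have dx: "deg ?L v = deg K v - 2" if "v \<notin> {a, b, x}" "nbrs K v \<inter> {a, b, x} = {y, x}" "y \<noteq> x" for v y
    proof -
      have "nbrs ?L v = nbrs K v - {y, x}" using nbL[OF that(1)] that(2) by blast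
      moreover have "{y, x} \<subseteq> nbrs K v" using that(2) by blast
      ultimately show ?thesis using that(3) by (simp add: deg_def card_Diff_subset)
    qed
    have okL: "degree_ok ?L"
      unfolding degree_ok_def
    proof
      fix v assume "v \<in> vertices ?L"
      then have v: "{v} \<in> K" "v \<notin> {a, b, x}" by (auto simp: vertices_def del_def)
      have zL: "{x1, x2} \<in> ?L" using x12K n by (auto simp: del_def)
      \<comment> \<open>After the removal \<open>x1 x2\<close> is a boundary edge, so degree 3
        suffices at both ends.\<close>
      have oL: "opp ?L x1 x2 = {z}" "opp ?L x2 x1 = {z}"
        using opp_del[of x1 "{a, b, x}" x2 K] opp_del[of x2 "{a, b, x}" x1 K] n z(2) z2 zn by auto
      consider "v = x1" | "v = x2" | "v \<noteq> x1" "v \<noteq> x2" by blast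
      then show "deg ?L v \<ge> 3 \<and> (inner_at ?L v \<longrightarrow> deg ?L v \<ge> 4)"
      proof cases
        case 1
        have "\<not> inner_at ?L x1" using zL oL(1) n by (auto simp: inner_at_def)
        then show ?thesis using 1 dx[OF v(2), of a] x1X n e1(1) by auto
      next
        case 2
        have "\<not> inner_at ?L x2" using zL oL(2) n by (auto simp: inner_at_def insert_commute)
        then show ?thesis using 2 dx[OF v(2), of b] x2X n e2(1) by auto
      next
        case 3
        have "a \<notin> nbrs K v" "b \<notin> nbrs K v" "x \<notin> nbrs K v"
          using 3 v(2) fa(1) fb(1) sq(2) nbrs_sym[of a v] nbrs_sym[of b v] nbrs_sym[of x v] by auto
        then have N: "nbrs ?L v = nbrs K v" using nbL[OF v(2)] by blast
        have "opp ?L v y = opp K v y" if "y \<notin> {a, b, x}" for y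
          using opp_del[OF v(2) that, of K] opp_subset_nbrs[of v y] \<open>a \<notin> nbrs K v\<close> \<open>b \<notin> nbrs K v\<close> \<open>x \<notin> nbrs K v\<close> by auto
        note oo = this
        have "inner_at K v" if "inner_at ?L v"
        proof (rule inner_at_transfer[OF that])
          fix y assume y: "y \<in> nbrs K v"
          then have "y \<notin> {a, b, x}" using \<open>a \<notin> nbrs K v\<close> \<open>b \<notin> nbrs K v\<close> \<open>x \<notin> nbrs K v\<close> by blast
          then show "card (opp K v y) = 2 \<or> y \<in> nbrs ?L v \<and> card (opp ?L v y) = card (opp K v y)"
            using oo N y by simp
        qed
        then show ?thesis using N degree_ge[OF v(1)] inner_degree_ge v(1) by (auto simp: deg_def)
      qed
    qed
    have bd1: "{x1, a} \<in> bd K" "{a, b} \<in> bd K" "{b, x2} \<in> bd K"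
    proof -
      have "{x1, a} \<in> K" "{a, b} \<in> K" "{b, x2} \<in> K"
        using nbrs_edge[of a x1] nbrs_edge[of b a] nbrs_edge[of x2 b] an fa(1) fb(1) by simp_all
      then show "{x1, a} \<in> bd K" "{a, b} \<in> bd K" "{b, x2} \<in> bd K"
        using bd_iff[of x1 a] bd_iff[of a b] bd_iff[of b x2] n fa(3,4) fb(3) opp_commute[of K x1 a] by auto
    qed
    have "flag K x x1 a b x2"
      unfolding flag_def
    proof (intro conjI)
      show "inner_vertex K x" using inner_vertex_iff vK sq(1) by simp
      show "\<forall>y\<in>nbrs K x. deg K y \<noteq> 4" using sq(2) dab e1(1) e2(1) by auto
      show "link K x = {{x1}, {a}, {b}, {x2}, {x1, a}, {a, b}, {b, x2}, {x2, x1}}"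
      proof (intro equalityI subsetI)
        fix s assume s: "s \<in> link K x"
        then obtain e where e: "e \<in> link_edges K x" "insert x s \<subseteq> insert x e"
          using star_in_cover[OF star_in_link[of x], of "insert x s"] by (auto simp: link_def)
        then have "s \<subseteq> e" "s \<noteq> {}" using s by (auto simp: link_def)
        then show "s \<in> {{x1}, {a}, {b}, {x2}, {x1, a}, {a, b}, {b, x2}, {x2, x1}}"
        proof -
          have "e = {x1, a} \<or> e = {a, b} \<or> e = {b, x2} \<or> e = {x2, x1}" using e(1) unfolding l by blast
          then show ?thesis
            using subset_pair[of s x1 a] subset_pair[of s a b] subset_pair[of s b x2] subset_pair[of s x2 x1]
              \<open>s \<subseteq> e\<close> \<open>s \<noteq> {}\<close> by (elim disjE; simp; argo)
        qed
      next
        fix s assume s: "s \<in> {{x1}, {a}, {b}, {x2}, {x1, a}, {a, b}, {b, x2}, {x2, x1}}"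
        then have "\<exists>e\<in>link_edges K x. s \<subseteq> e \<and> s \<noteq> {}" unfolding l by auto
        then obtain e where e: "e \<in> link_edges K x" "s \<subseteq> e" "s \<noteq> {}" by blast
        then have "insert x e \<in> K" "x \<notin> e" by (auto simp: link_edges_def)
        then show "s \<in> link K x" using complex_mono[OF complex, of "insert x e" "insert x s"] e by (auto simp: link_def)
      qed
      have "{x1} \<in> bd K" "{x2} \<in> bd K"
        using boundary_vertex_iff[of x1] boundary_vertex_iff[of x2] vK ni12 by (auto simp: boundary_vertex_def)
      moreover have "{x1, x2} \<notin> bd K" using bd_iff[OF n(7)] z by auto
      moreover have "{} \<notin> bd K" using complex_nonempty[OF complex] by (auto simp: bd_def)
      ultimately show "{s \<in> bd K. s \<subseteq> {x1, x2}} = {{x1}, {x2}}"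
        using subset_pair[of _ x1 x2] by blast
    qed (use d sq dab bd1 in auto)
    then have "flag_addition F ?L K" if "?L \<in> F4 F" using that unfolding flag_addition_def by blast
    then show False using removal_step[OF sbL okL card_del[OF complex vK(1)]] by simp
  qed
qed

end

section \<open>Octahedra\<close>

lemma triple_index_cases:
  assumes "{i, j, k} = {1, 2, 3::nat}"
  shows "(i = 1 \<and> j = 2 \<and> k = 3) \<or> (i = 1 \<and> j = 3 \<and> k = 2) \<or> (i = 2 \<and> j = 1 \<and> k = 3) \<or>
    (i = 2 \<and> j = 3 \<and> k = 1) \<or> (i = 3 \<and> j = 1 \<and> k = 2) \<or> (i = 3 \<and> j = 2 \<and> k = 1)"
proof -
  have "i \<in> {1, 2, 3}" "j \<in> {1, 2, 3}" "k \<in> {1, 2, 3}" using assms by blast+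
  moreover have "card {i, j, k} = 3" unfolding assms by simp
  then have "i \<noteq> j" "i \<noteq> k" "j \<noteq> k" by (auto simp: card_insert_if split: if_splits)
  ultimately show ?thesis by auto
qed

context stuck
begin

text \<open>The triangle \<open>x p q\<close> is the centre, and \<open>w\<close>, \<open>r\<close>,
  \<open>s\<close> are the outer vertices missed by \<open>x\<close>, \<open>p\<close>,
  \<open>q\<close> in this order. All three central links are closed squares, so this is the
  component with no central vertex on the boundary. The absent face \<open>w r s\<close> excludes a
  closed octahedron.\<close>

definition octa_at :: "'v \<Rightarrow> 'v \<Rightarrow> 'v \<Rightarrow> 'v \<Rightarrow> 'v \<Rightarrow> 'v \<Rightarrow> bool" where
  "octa_at x p q r s w \<longleftrightarrow> distinct [x, p, q, r, s, w] \<and>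
     link_edges K x = {{p, q}, {q, r}, {r, s}, {s, p}} \<and>
     link_edges K p = {{q, x}, {x, s}, {s, w}, {w, q}} \<and>
     link_edges K q = {{p, x}, {x, r}, {r, w}, {w, p}} \<and> {w, r, s} \<notin> K"

text \<open>Together with the reflection it reduces statements about all outer vertices to
  statements about \<open>w\<close>.\<close>

lemma octa_rotate: "octa_at x p q r s w \<Longrightarrow> octa_at p q x s w r"
proof -
  assume o: "octa_at x p q r s w"
  have "{{p, x}, {x, r}, {r, w}, {w, p}} = {{x, p}, {p, w}, {w, r}, {r, x}}"
    "{{p, q}, {q, r}, {r, s}, {s, p}} = {{q, p}, {p, s}, {s, r}, {r, q}}" "{w, r, s} = {r, s, w}"
    by (auto simp: insert_commute)
  then show "octa_at p q x s w r" using o unfolding octa_at_def by auto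
qed

lemma octa_reflect: "octa_at x p q r s w \<Longrightarrow> octa_at x q p s r w"
proof -
  assume o: "octa_at x p q r s w"
  have "{{p, q}, {q, r}, {r, s}, {s, p}} = {{q, p}, {p, s}, {s, r}, {r, q}}" "{w, r, s} = {w, s, r}"
    by (auto simp: insert_commute)
  then show "octa_at x q p s r w" using o unfolding octa_at_def by auto
qed

lemma octa_facts:
  assumes o: "octa_at x p q r s w"
  shows "nbrs K x = {p, q, r, s}" "nbrs K p = {q, x, s, w}" "nbrs K q = {p, x, r, w}"
    "inner_at K x" "deg K x = 4"
    "opp K w p = {s, q}" "opp K w q = {r, p}" "q \<in> opp K w r" "p \<in> opp K w s"
    "opp K r x = {q, s}" "opp K r q = {x, w}" "x \<in> opp K r s"
    "{s, p, q, r} \<subseteq> nbrs K w" "{w, q, x, s} \<subseteq> nbrs K r"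
    "s \<notin> opp K w r" "r \<notin> opp K w s"
proof -
  have d: "distinct [x, p, q, r, s, w]" and lx: "link_edges K x = {{p, q}, {q, r}, {r, s}, {s, p}}"
    and lp: "link_edges K p = {{q, x}, {x, s}, {s, w}, {w, q}}"
    and lq: "link_edges K q = {{p, x}, {x, r}, {r, w}, {w, p}}" and n: "{w, r, s} \<notin> K"
    using o unfolding octa_at_def by auto
  have dx: "distinct [x, p, q, r, s]" and dp: "distinct [p, q, x, s, w]" and dq: "distinct [q, p, x, r, w]"
    using d by auto
  note X = square_link[OF lx dx] and P = square_link[OF lp dp] and Q = square_link[OF lq dq]
  show "nbrs K x = {p, q, r, s}" "nbrs K p = {q, x, s, w}" "nbrs K q = {p, x, r, w}"
    "inner_at K x" "deg K x = 4" using X P Q by auto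
  show wp: "opp K w p = {s, q}" using P(7) opp_commute by metis
  show wq: "opp K w q = {r, p}" using Q(7) opp_commute by metis
  show wr: "q \<in> opp K w r" and ws: "p \<in> opp K w s"
    using opp_three[of q w r] opp_three[of p w s] wq wp d by auto
  show rx: "opp K r x = {q, s}" using X(6) opp_commute by metis
  show rq: "opp K r q = {x, w}" using Q(6) opp_commute by metis
  show rs: "x \<in> opp K r s" using opp_three[of x r s] rx d by auto
  show "{s, p, q, r} \<subseteq> nbrs K w"
    using opp_subset_nbrs[of w p] opp_subset_nbrs[of w q] wp wq by auto
  show "{w, q, x, s} \<subseteq> nbrs K r"
    using opp_subset_nbrs[of r x] opp_subset_nbrs[of r q] rx rq by auto
  show "s \<notin> opp K w r" "r \<notin> opp K w s"
    using n by (auto simp: opp_def insert_commute)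
qed

text \<open>The link of \<open>w\<close> contains the path \<open>s p q r\<close>, and without the
  face \<open>w r s\<close> it cannot close directly. With at most five neighbours it closes through
  one more vertex \<open>t\<close>, and \<open>t w\<close> can be contracted. One of the opposite
  vertices \<open>s\<close> and \<open>r\<close> would be light, but both have at least five
  neighbours.\<close>

lemma octa_inner_degree:
  assumes o: "octa_at x p q r s w" and i: "inner_at K w"
  shows "deg K w \<ge> 6"
proof (rule ccontr)
  assume lt: "\<not> ?thesis"
  have d: "distinct [x, p, q, r, s, w]" using o unfolding octa_at_def by auto
  then have n: "x \<noteq> p" "x \<noteq> q" "x \<noteq> r" "x \<noteq> s" "x \<noteq> w" "p \<noteq> q" "p \<noteq> r" "p \<noteq> s" "p \<noteq> w" "q \<noteq> r" "q \<noteq> s" "q \<noteq> w" "r \<noteq> s" "r \<noteq> w" "s \<noteq> w" by auto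
  note F = octa_facts[OF o]
  have ow: "card (opp K w s) = 2" "card (opp K w r) = 2" using inner_opp[OF i] F(13) by auto
  obtain t where t: "t \<noteq> p" "opp K w s = {p, t}" using opp_eq2[OF ow(1) F(9)] by blast
  have tn: "t \<in> nbrs K w" "t \<in> nbrs K s" using opp_subset_nbrs[of w s] opp_subset_nbrs'[of w s] t by auto
  have tq: "t \<noteq> q" using opp_swap[of q w s] t(2) F(7) n by auto
  have ts: "t \<noteq> s" "t \<noteq> w" "t \<noteq> r" "t \<noteq> x"
    using tn nbrs_not_self F(16) t(2) nbrs_sym[of x w] F(1) n by auto
  have nb: "{s, p, q, r, t} \<subseteq> nbrs K w" using F(13) tn by auto
  have "card {s, p, q, r, t} = 5" using n t(1) tq ts by auto
  then have N: "nbrs K w = {s, p, q, r, t}" using nbrs_eqI[OF nb] lt by simp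
  obtain t' where t': "t' \<noteq> q" "opp K w r = {q, t'}" using opp_eq2[OF ow(2) F(8)] by blast
  have "t' \<in> nbrs K w - {r}" using opp_sub[of w r] t' by auto
  moreover have "t' \<noteq> p" using opp_swap[of p w r] t'(2) F(6) n by auto
  moreover have "t' \<noteq> s" using t' F(15) by auto
  ultimately have tt: "opp K w r = {q, t}" using t' N by auto
  have "s \<in> opp K w t" "r \<in> opp K w t" using opp_swap[of t w s] opp_swap[of t w r] t(2) tt n ts by auto
  then have "{s, r} \<subseteq> opp K w t" by simp
  moreover have "card (opp K w t) \<le> card {s, r}" using inner_opp[OF i tn(1)] n by simp
  ultimately have ot: "opp K w t = {s, r}" using card_seteq finite_opp[OF complex] by metis
  have L: "link_edges K w = {{s, p}, {p, q}, {q, r}, {r, t}, {t, s}}"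
    unfolding link_edges_from_opp[of w] N using F(6,7) t(2) tt ot by (auto simp: insert_commute)
  have st: "star_in K w {{s, p}, {p, q}, {q, r}, {r, t}, {t, s}}" using star_in_link[of w] unfolding L .
  have pt: "{p, t} \<notin> K" "{q, t} \<notin> K"
    using nbrs_edge[of t p] nbrs_edge[of t q] F(2,3) t(1) tq ts n by auto
  have dd: "distinct [w, s, p, q, r, t]" using n t(1) tq ts by auto
  have "same_body K (contract t w K)" by (rule contract_cycle5[OF complex st dd pt])
  moreover have "{t, w} \<in> K" using tn(1) by (simp add: nbrs_edge insert_commute)
  ultimately have "\<exists>y\<in>opp K t w. light K y" using contract_light' ts by blast
  then have "light K s \<or> light K r" using ot opp_commute[of K t w] by auto
  moreover have "t \<in> nbrs K r" using opp_subset_nbrs'[of w r] tt by auto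
  then have "{w, q, x, s, t} \<subseteq> nbrs K r" using F(14) by auto
  from deg_ge[OF this] have "deg K r \<ge> 5" using n t(1) tq ts by auto
  moreover have "{w, p, x, r, t} \<subseteq> nbrs K s" using octa_facts(14)[OF octa_reflect[OF o]] tn by auto
  from deg_ge[OF this] have "deg K s \<ge> 5" using n t(1) tq ts by auto
  ultimately show False using not_light_degree by blast
qed

lemma octa_external_link:
  assumes o: "octa_at x p q r s w" and i: "\<not> inner_at K w" and dw: "deg K w = 4"
  shows "nbrs K w = {s, p, q, r}" "opp K w s = {p}" "opp K w r = {q}"
    "link_edges K w = {{s, p}, {p, q}, {q, r}}"
proof -
  have d: "distinct [x, p, q, r, s, w]" using o unfolding octa_at_def by auto
  then have n: "p \<noteq> q" "p \<noteq> r" "p \<noteq> s" "q \<noteq> r" "q \<noteq> s" "r \<noteq> s" "w \<noteq> p" "w \<noteq> q" "w \<noteq> r" "w \<noteq> s" by auto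
  note F = octa_facts[OF o]
  show N: "nbrs K w = {s, p, q, r}" by (rule nbrs_eqI[OF F(13)]) (use dw n in simp)
  have "q \<notin> opp K w s" "p \<notin> opp K w r" using opp_swap[of q w s] opp_swap[of p w r] F(6,7) n by auto
  then show e: "opp K w s = {p}" "opp K w r = {q}"
    using opp_sub[of w s] opp_sub[of w r] N F(8,9,15,16) by auto
  show "link_edges K w = {{s, p}, {p, q}, {q, r}}"
    unfolding link_edges_from_opp[of w] N using F(6,7) e by (auto simp: insert_commute)
qed

text \<open>The edges from \<open>r\<close> to \<open>w\<close> and to \<open>s\<close> are its two
  boundary edges, so the path \<open>w q x s\<close> between them is the whole link.\<close>

lemma octa_external_corner:
  assumes o: "octa_at x p q r s w" and i: "\<not> inner_at K w" and dw: "deg K w = 4"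
    and rs: "opp K r s = {x}"
  shows "nbrs K r = {w, q, x, s}"
proof -
  have d: "distinct [x, p, q, r, s, w]" using o unfolding octa_at_def by auto
  then have n: "x \<noteq> r" "q \<noteq> r" "s \<noteq> r" "w \<noteq> r" "s \<noteq> w" by auto
  note F = octa_facts[OF o] and E = octa_external_link[OF o i dw]
  have rw: "opp K r w = {q}" using E(3) opp_commute by metis
  let ?G = "{{w, q}, {q, x}, {x, s}}"
  have cl: "e \<in> ?G" if e: "e \<in> link_edges K r" "v \<in> e" "v \<in> \<Union>?G" for e v
  proof -
    have v: "v = w \<or> v = q \<or> v = x \<or> v = s" using e(3) by auto
    then have "v \<noteq> r" using n by auto
    then have "e \<in> (\<lambda>b. {v, b}) ` opp K r v" using link_edges_at(1)[of v r K] e by auto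
    then obtain c where "e = {v, c}" "c \<in> opp K r v" by blast
    with v show ?thesis by (elim disjE) (simp_all add: rw F(10,11) rs insert_commute, blast+)
  qed
  have g: "?G \<subseteq> link_edges K r"
    using F(10,11) opp_link[of q r w] opp_link[of q r x] opp_link[of x r s] n by (simp add: insert_commute)
  have "nbrs K r = \<Union>?G"
    by (rule path_link_closed(2)[OF g _ _ n(5)]) (use cl rw rs in auto)
  then show ?thesis by auto
qed

text \<open>With only five neighbours \<open>r\<close> would have the path \<open>w q x s z\<close>
  as link, and \<open>z r\<close> could be contracted. The only vertex opposite to that edge is
  \<open>s\<close>, which has at least five neighbours and is not light. Degree 6 is the right bound
  because the deletion takes \<open>w\<close>, \<open>q\<close> and \<open>x\<close> from
  \<open>r\<close>.\<close>

lemma octa_external_corner_degree: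
  assumes o: "octa_at x p q r s w" and i: "\<not> inner_at K w" and dw: "deg K w = 4"
    and rs: "opp K r s = {x, z}" "z \<noteq> x"
  shows "deg K r \<ge> 6" "z \<notin> {x, p, q, r, s, w}"
proof -
  have d: "distinct [x, p, q, r, s, w]" using o unfolding octa_at_def by auto
  then have n: "x \<noteq> p" "x \<noteq> q" "x \<noteq> r" "x \<noteq> s" "x \<noteq> w" "p \<noteq> q" "p \<noteq> r" "p \<noteq> s" "p \<noteq> w" "q \<noteq> r" "q \<noteq> s" "q \<noteq> w" "r \<noteq> s" "r \<noteq> w" "s \<noteq> w" by auto
  note F = octa_facts[OF o] and E = octa_external_link[OF o i dw]
  note F' = octa_facts[OF octa_reflect[OF o]]
  have rw: "opp K r w = {q}" using E(3) opp_commute by metis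
  have zn: "z \<in> nbrs K r" "z \<in> nbrs K s" using opp_subset_nbrs[of r s] opp_subset_nbrs'[of r s] rs by auto
  have zw: "z \<noteq> w" using opp_swap[of w r s] rs(1) rw n by auto
  show z: "z \<notin> {x, p, q, r, s, w}"
    using zn zw rs(2) nbrs_not_self nbrs_sym[of p r] nbrs_sym[of q s] F(2,3) n by auto
  have rn: "{w, q, x, s, z} \<subseteq> nbrs K r" using F(14) zn by auto
  have sn: "{w, p, x, r, z} \<subseteq> nbrs K s" using F'(14) zn by auto
  have c5: "card {w, q, x, s, z} = 5" "card {w, p, x, r, z} = 5" using n z by auto
  show "deg K r \<ge> 6"
  proof (rule ccontr)
    assume "\<not> ?thesis"
    then have N: "nbrs K r = {w, q, x, s, z}" using nbrs_eqI[OF rn] c5 by simp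
    have "s \<in> opp K r z" using opp_three[of s r z] opp_swap[of z r s] rs n z by auto
    moreover have "w \<notin> opp K r z" "q \<notin> opp K r z" "x \<notin> opp K r z"
      using opp_swap[of w r z] opp_swap[of q r z] opp_swap[of x r z] rw F(10,11) n z by auto
    ultimately have rz: "opp K r z = {s}" using opp_sub[of r z] N by auto
    have L: "link_edges K r = {{w, q}, {q, x}, {x, s}, {s, z}}"
      unfolding link_edges_from_opp[of r] N using F(10,11) rw rz rs(1) by (auto simp: insert_commute)
    have st: "star_in K r {{w, q}, {q, x}, {x, s}, {s, z}}" using star_in_link[of r] unfolding L .
    have nz: "{w, z} \<notin> K" "{q, z} \<notin> K" "{x, z} \<notin> K"
      using nbrs_edge[of z w] nbrs_edge[of z q] nbrs_edge[of z x] E(1) F(1,3) z by auto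
    have dd: "distinct [r, w, q, x, s, z]" using n z by auto
    have "same_body K (contract z r K)" by (rule contract_path5[OF complex st dd nz])
    moreover have "{z, r} \<in> K" "z \<noteq> r" using zn(1) z by (auto simp: nbrs_edge insert_commute)
    ultimately have "\<exists>y\<in>opp K z r. light K y" using contract_light' by blast
    then have "light K s" using rz opp_commute[of K z r] by auto
    then show False using not_light_degree[of s] deg_ge[OF sn] c5 by simp
  qed
qed

lemma octa_stars:
  assumes o: "octa_at x p q r s w"
  shows "distinct [x, p, q, r, s, w]" "star_in K x {{p, q}, {q, r}, {r, s}, {s, p}}"
    "star_in K p {{s, x}, {x, q}, {q, w}, {w, s}}" "star_in K q {{p, x}, {x, r}, {r, w}, {w, p}}"
    "{w, r, s} \<notin> K"
proof -
  have l: "distinct [x, p, q, r, s, w]" "link_edges K x = {{p, q}, {q, r}, {r, s}, {s, p}}"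
    "link_edges K p = {{q, x}, {x, s}, {s, w}, {w, q}}" "link_edges K q = {{p, x}, {x, r}, {r, w}, {w, p}}" "{w, r, s} \<notin> K"
    using o unfolding octa_at_def by auto
  show "distinct [x, p, q, r, s, w]" "{w, r, s} \<notin> K" by fact+
  show "star_in K x {{p, q}, {q, r}, {r, s}, {s, p}}" "star_in K q {{p, x}, {x, r}, {r, w}, {w, p}}"
    using star_in_link[of x] star_in_link[of q] l by simp_all
  have "link_edges K p = {{s, x}, {x, q}, {q, w}, {w, s}}" using l(3) by (auto simp: insert_commute)
  then show "star_in K p {{s, x}, {x, q}, {q, w}, {w, s}}" using star_in_link[of p] by simp
qed

abbreviation tri3 :: "'b \<Rightarrow> 'b \<Rightarrow> 'b \<Rightarrow> nat \<Rightarrow> 'b" where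
  "tri3 a b c \<equiv> (\<lambda>i. if i = 1 then a else if i = 2 then b else c)"

lemma octa_component:
  assumes o: "octa_at x p q r s w"
  shows "octahedron_component K (tri3 x p q) (tri3 w r s)"
    and "\<forall>i\<in>{1, 2, 3}. \<not> boundary_vertex K (tri3 x p q i)"
proof -
  note S = octa_stars[OF o] and F = octa_facts[OF o]
  note o1 = octa_rotate[OF o] note o2 = octa_rotate[OF o1]
  note F1 = octa_facts[OF o1] and F2 = octa_facts[OF o2]
  have n: "x \<noteq> p" "x \<noteq> q" "x \<noteq> r" "x \<noteq> s" "x \<noteq> w" "p \<noteq> q" "p \<noteq> r" "p \<noteq> s" "p \<noteq> w" "q \<noteq> r" "q \<noteq> s" "q \<noteq> w" "r \<noteq> s" "r \<noteq> w" "s \<noteq> w"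
    using S(1) by auto
  show nb: "\<forall>i\<in>{1, 2, 3}. \<not> boundary_vertex K (tri3 x p q i)"
    using boundary_vertex_iff F(4) F1(4) F2(4) by auto
  have e: "{x, p} \<in> K" "{p, q} \<in> K" "{x, q} \<in> K" "{w, r} \<in> K" "{r, s} \<in> K" "{w, s} \<in> K"
    using nbrs_edge[of p x] nbrs_edge[of q p] nbrs_edge[of q x] nbrs_edge[of r w] nbrs_edge[of s r] nbrs_edge[of s w]
      F(1,2,13,14) by auto
  have c: "cycle3 x p q \<subseteq> K" "cycle3 w r s \<subseteq> K"
    using e edge_ends unfolding cycle3_def by auto
  have com: "(nbrs K p \<inter> nbrs K q) - {x} = {w}" "(nbrs K x \<inter> nbrs K q) - {p} = {r}" "(nbrs K x \<inter> nbrs K p) - {q} = {s}"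
    unfolding F(1,2,3) using n by auto
  show "octahedron_component K (tri3 x p q) (tri3 w r s)"
    unfolding octahedron_component_def
  proof (intro conjI disjI1 nb)
    show "\<forall>i j k. {i, j, k} = {1, 2, 3} \<longrightarrow> nbrs K (tri3 x p q j) \<inter> nbrs K (tri3 x p q k) - {tri3 x p q i} = {tri3 w r s i}"
    proof (intro allI impI)
      fix i j k :: nat assume "{i, j, k} = {1, 2, 3}"
      from triple_index_cases[OF this]
      show "nbrs K (tri3 x p q j) \<inter> nbrs K (tri3 x p q k) - {tri3 x p q i} = {tri3 w r s i}"
        using com by (elim disjE conjE) (simp_all add: Int_commute)
    qed
    show "\<forall>i\<in>{1, 2, 3}. deg K (tri3 x p q i) = 4" using F(5) F1(5) F2(5) by auto
  qed (use c n in \<open>auto simp: inj_on_def\<close>)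
qed

text \<open>The vertex \<open>w\<close> loses \<open>p\<close> and \<open>q\<close>. At the edges
  \<open>w r\<close> and \<open>w s\<close> the new face \<open>w r s\<close> takes the place of the
  lost faces \<open>w r q\<close> and \<open>w s p\<close>, so the numbers of faces there do not
  change.\<close>

lemma octa_removed_degree:
  assumes o: "octa_at x p q r s w" and L: "L = del {x, p, q} K \<union> {{w, r, s}}"
  shows "deg L w = deg K w - 2" "inner_at L w \<Longrightarrow> inner_at K w"
proof -
  note S = octa_stars[OF o] and F = octa_facts[OF o]
  have n: "x \<noteq> p" "x \<noteq> q" "x \<noteq> r" "x \<noteq> s" "x \<noteq> w" "p \<noteq> q" "p \<noteq> r" "p \<noteq> s" "p \<noteq> w" "q \<noteq> r" "q \<noteq> s" "q \<noteq> w" "r \<noteq> s" "r \<noteq> w" "s \<noteq> w"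
    using S(1) by auto
  have nL: "nbrs L w = nbrs K w - {x, p, q}"
    unfolding L nbrs_def del_def using n by (auto simp: set_eq_iff)
  have xw: "x \<notin> nbrs K w" using nbrs_sym[of x w] F(1) n by auto
  then have "nbrs L w = nbrs K w - {p, q}" using nL by blast
  then show "deg L w = deg K w - 2"
    using F(13) n by (simp add: deg_def card_Diff_subset)
  have oL: "opp L w y = (opp K w y - {x, p, q}) \<union> {t. {w, y, t} = {w, r, s} \<and> t \<noteq> w \<and> t \<noteq> y}"
    if "y \<notin> {x, p, q}" for y
    unfolding L opp_def del_def using that n by auto
  have xo: "x \<notin> opp K w y" for y using opp_subset_nbrs[of w y] xw by auto
  show "inner_at K w" if i: "inner_at L w"
  proof (rule inner_at_transfer[OF i])
    fix y assume y: "y \<in> nbrs K w"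
    have yw: "y \<noteq> w" using y nbrs_not_self by auto
    consider "y = p" | "y = q" | "y = r" | "y = s" | "y \<notin> {x, p, q, r, s}" using y xw by blast
    then show "card (opp K w y) = 2 \<or> y \<in> nbrs L w \<and> card (opp L w y) = card (opp K w y)"
    proof cases
      case 1 then show ?thesis using F(6) n by auto
    next
      case 2 then show ?thesis using F(7) n by auto
    next
      case 3
      have "{t. {w, r, t} = {w, r, s} \<and> t \<noteq> w \<and> t \<noteq> r} = {s}" using n by (auto simp: set_eq_iff)
      moreover have "p \<notin> opp K w r" using opp_swap[of p w r] F(6) n by auto
      ultimately have "opp L w r = insert s (opp K w r - {q})" using oL[of r] xo[of r] n by auto
      moreover have "card (insert s (opp K w r - {q})) = card (opp K w r)"
        using F(8,15) finite_opp[OF complex] n by (metis card_Suc_Diff1 card_insert_disjoint finite_Diff Diff_iff)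
      ultimately show ?thesis using 3 y nL n by auto
    next
      case 4
      have "{t. {w, s, t} = {w, r, s} \<and> t \<noteq> w \<and> t \<noteq> s} = {r}" using n by (auto simp: set_eq_iff)
      moreover have "q \<notin> opp K w s" using opp_swap[of q w s] F(7) n by auto
      ultimately have "opp L w s = insert r (opp K w s - {p})" using oL[of s] xo[of s] n by auto
      moreover have "card (insert r (opp K w s - {p})) = card (opp K w s)"
        using F(9,16) finite_opp[OF complex] n by (metis card_Suc_Diff1 card_insert_disjoint finite_Diff Diff_iff)
      ultimately show ?thesis using 4 y nL n by auto
    next
      case 5
      have "{t. {w, y, t} = {w, r, s} \<and> t \<noteq> w \<and> t \<noteq> y} = {}" using 5 yw by (auto simp: set_eq_iff)
      moreover have "p \<notin> opp K w y" "q \<notin> opp K w y"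
        using opp_swap[of p w y] opp_swap[of q w y] F(6,7) n yw 5 by auto
      ultimately have "opp L w y = opp K w y" using oL[of y] xo[of y] 5 by auto
      then show ?thesis using 5 y nL by auto
    qed
  qed
qed

lemma octa_vertex_mem: "octa_at x p q r s w \<Longrightarrow> {x} \<in> K \<and> {p} \<in> K \<and> {q} \<in> K \<and> {r} \<in> K \<and> {s} \<in> K \<and> {w} \<in> K"
  using octa_facts(1,13)[of x p q r s w] vertex_of_nbr[of p x] vertex_of_nbr[of q x] vertex_of_nbr[of r x] vertex_of_nbr[of s x] vertex_of_nbr[of p w] by auto

text \<open>The link of \<open>w\<close> is the path \<open>s p q r\<close>, so \<open>w r\<close>
  and \<open>w s\<close> are boundary edges and the octahedron is external. If \<open>r s\<close> is
  a boundary edge too, the octahedron is everything and reduces to the triangle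
  \<open>w r s\<close>. Otherwise it is redundant, since \<open>r\<close> and \<open>s\<close> lose
  three of at least six neighbours and stay on the boundary.\<close>

lemma no_external_octa:
  assumes o: "octa_at x p q r s w" and i: "\<not> inner_at K w" and dw: "deg K w = 4"
  shows False
proof -
  note S = octa_stars[OF o] and F = octa_facts[OF o] and E = octa_external_link[OF o i dw]
  note o' = octa_reflect[OF o]
  note F' = octa_facts[OF o'] and V = octa_vertex_mem[OF o]
  have n: "x \<noteq> p" "x \<noteq> q" "x \<noteq> r" "x \<noteq> s" "x \<noteq> w" "p \<noteq> q" "p \<noteq> r" "p \<noteq> s" "p \<noteq> w" "q \<noteq> r" "q \<noteq> s" "q \<noteq> w" "r \<noteq> s" "r \<noteq> w" "s \<noteq> w"
    using S(1) by auto
  have rsK: "{r, s} \<in> K" using F(14) by (simp add: nbrs_edge)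
  have "card (opp K r s) = 1 \<or> card (opp K r s) = 2" using card_opp[OF n(13) rsK] .
  then show False
  proof
    assume "card (opp K r s) = 1"
    then have rs: "opp K r s = {x}" using F(12) by (auto simp: card_1_singleton_iff)
    then have sr: "opp K s r = {x}" using opp_commute by metis
    have nr: "nbrs K r = {w, q, x, s}" by (rule octa_external_corner[OF o i dw rs])
    have ns: "nbrs K s = {w, p, x, r}" by (rule octa_external_corner[OF o' i dw sr])
    have VK: "vertices K = {x, p, q, r, s, w}"
    proof (rule all_vertices)
      show "nbrs K a \<subseteq> {x, p, q, r, s, w}" if "a \<in> {x, p, q, r, s, w}" for a
        using that by (elim insertE emptyE) (simp_all add: F(1,2,3) E(1) nr ns)
    qed (use V in \<open>simp_all add: vertices_def\<close>)
    let ?L = "del {x, p, q} K \<union> {{w, r, s}}"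
    have sb: "same_body K ?L" by (rule remove_octahedron_body[OF complex S])
    have "?L = face_complex {w, r, s}"
    proof
      show "?L \<subseteq> face_complex {w, r, s}"
      proof
        fix f assume f: "f \<in> ?L"
        show "f \<in> face_complex {w, r, s}"
        proof (cases "f \<in> del {x, p, q} K")
          case True
          then have "f \<in> K" "x \<notin> f" "p \<notin> f" "q \<notin> f" by (auto simp: del_def)
          moreover from this have "f \<subseteq> vertices K" "f \<noteq> {}" using simplex_vertices[OF complex] complex_nonempty[OF complex] by auto
          ultimately show ?thesis using VK by (auto simp: face_complex_def)
        qed (use f in \<open>auto simp: face_complex_def\<close>)
      qed
      show "face_complex {w, r, s} \<subseteq> ?L"
        by (rule simplex_subset) (use sb in \<open>auto simp: same_body_def\<close>)
    qed
    then show False using sb not_triangle[of w r s] n by simp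
  next
    assume "card (opp K r s) = 2"
    then obtain z where z: "z \<noteq> x" "opp K r s = {x, z}" using opp_eq2 F(12) by metis
    have z': "opp K s r = {x, z}" using z opp_commute by metis
    note D = octa_external_corner_degree[OF o i dw z(2,1)] and D' = octa_external_corner_degree[OF o' i dw z' z(1)]
    have zn: "z \<noteq> x" "z \<noteq> p" "z \<noteq> q" "z \<noteq> r" "z \<noteq> s" "z \<noteq> w" using D(2) by auto
    let ?L = "del {w, x, p, q} K"
    have zK: "{r, s, z} \<in> K" using z by (auto simp: opp_def)
    have d7: "distinct [x, p, q, r, s, w, z]" using S(1) zn by auto
    have sw: "star_in K w {{s, p}, {p, q}, {q, r}}" using star_in_link[of w] unfolding E(4) .
    have sbL: "same_body K ?L"
      by (rule remove_external_octahedron[OF complex d7 S(2,3,4) sw zK]) (use edge_cofaces[OF n(13) z(2)] in blast)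
    have pr: "p \<notin> nbrs K r" "q \<notin> nbrs K s" using nbrs_sym[of p r] nbrs_sym[of q s] F(2,3) n by auto
    have okL: "degree_ok ?L"
      unfolding degree_ok_def
    proof
      fix v assume "v \<in> vertices ?L"
      then have v: "{v} \<in> K" "v \<notin> {w, x, p, q}" by (auto simp: vertices_def del_def)
      have rsL: "{r, s} \<in> ?L" using rsK n by (auto simp: del_def)
      have oL: "opp ?L r s = {z}" "opp ?L s r = {z}"
        using opp_del[of r "{w, x, p, q}" s K] opp_del[of s "{w, x, p, q}" r K] n z(2) z' zn by auto
      consider "v = r" | "v = s" | "v \<noteq> r" "v \<noteq> s" by blast
      then show "deg ?L v \<ge> 3 \<and> (inner_at ?L v \<longrightarrow> deg ?L v \<ge> 4)"
      proof cases
        case 1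
        have "\<not> inner_at ?L r" using rsL oL(1) n by (auto simp: inner_at_def)
        moreover have "nbrs ?L r = nbrs K r - {w, q, x}" using nbrs_del[of r "{w, x, p, q}" K] pr n by auto
        then have "deg ?L r = deg K r - 3" using F(14) n by (simp add: deg_def card_Diff_subset)
        ultimately show ?thesis using 1 D(1) by simp
      next
        case 2
        have "\<not> inner_at ?L s" using rsL oL(2) n by (auto simp: inner_at_def insert_commute)
        moreover have "nbrs ?L s = nbrs K s - {w, p, x}" using nbrs_del[of s "{w, x, p, q}" K] pr n by auto
        then have "deg ?L s = deg K s - 3" using F'(14) n by (simp add: deg_def card_Diff_subset)
        ultimately show ?thesis using 2 D'(1) by simp
      next
        case 3
        have nX: "nbrs K v \<inter> {w, x, p, q} = {}"
          using 3 v(2) F(1,2,3) E(1) nbrs_sym[of w v] nbrs_sym[of x v] nbrs_sym[of p v] nbrs_sym[of q v] by auto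
        then have N: "nbrs ?L v = nbrs K v" using nbrs_del[OF v(2), of K] by blast
        have "inner_at K v" if i: "inner_at ?L v"
        proof (rule inner_at_transfer[OF i])
          fix y assume y: "y \<in> nbrs K v"
          then have "y \<notin> {w, x, p, q}" using nX by blast
          then have "opp ?L v y = opp K v y" using opp_del[OF v(2), of y K] opp_subset_nbrs[of v y] nX by blast
          then show "card (opp K v y) = 2 \<or> y \<in> nbrs ?L v \<and> card (opp ?L v y) = card (opp K v y)"
            using N y by simp
        qed
        then show ?thesis using N degree_ge[OF v(1)] inner_degree_ge v(1) by (auto simp: deg_def)
      qed
    qed
    have "octahedron_addition F ?L K" if "?L \<in> F4 F"
    proof -
      have "{r, w} \<in> K" "{w, s} \<in> K" using F(13) by (auto simp: nbrs_edge insert_commute)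
      then have bd: "{r, w} \<in> bd K" "{w, s} \<in> bd K"
        using bd_iff[of r w] bd_iff[of w s] n E(2,3) opp_commute[of K r w] by auto
      have "redundant_octahedron F K (tri3 x p q) (tri3 w r s) 1"
        unfolding redundant_octahedron_def
      proof (intro conjI exI)
        show "octahedron_component K (tri3 x p q) (tri3 w r s)" by (rule octa_component(1)[OF o])
        show "{2, 1, 3} = {1, 2, 3::nat}" by auto
        show "{tri3 w r s 2, tri3 w r s 1} \<in> bd K" "{tri3 w r s 1, tri3 w r s 3} \<in> bd K" using bd by simp_all
        show "del {tri3 w r s 1, tri3 x p q 1, tri3 x p q 2, tri3 x p q 3} K \<in> F4 F" using that by simp
      qed
      moreover have "?L = del {tri3 w r s 1, tri3 x p q 1, tri3 x p q 2, tri3 x p q 3} K" by simp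
      ultimately show ?thesis unfolding octahedron_addition_def by blast
    qed
    moreover have "card ?L < card K" by (rule card_del[OF complex]) (use V in auto)
    ultimately show False using removal_step[OF sbL okL] by blast
  qed
qed

text \<open>These bounds are what the removal of the octahedron needs, as each outer vertex loses
  two neighbours.\<close>

lemma octa_outer_degree:
  assumes o: "octa_at x p q r s w"
  shows "deg K w \<ge> 5 \<and> (inner_at K w \<longrightarrow> deg K w \<ge> 6)"
proof -
  have d: "distinct [x, p, q, r, s, w]" using o unfolding octa_at_def by auto
  have "card {s, p, q, r} = 4" using d by auto
  then have "deg K w \<ge> 4" using deg_ge[OF octa_facts(13)[OF o]] by simp
  then show ?thesis using octa_inner_degree[OF o] no_external_octa[OF o] by fastforce
qed

lemma no_octa:
  assumes o: "octa_at x p q r s w" shows False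
proof -
  note S = octa_stars[OF o] and F = octa_facts[OF o] and V = octa_vertex_mem[OF o]
  note o1 = octa_rotate[OF o] note o2 = octa_rotate[OF o1]
  have n: "x \<noteq> p" "x \<noteq> q" "x \<noteq> r" "x \<noteq> s" "x \<noteq> w" "p \<noteq> q" "p \<noteq> r" "p \<noteq> s" "p \<noteq> w" "q \<noteq> r" "q \<noteq> s" "q \<noteq> w" "r \<noteq> s" "r \<noteq> w" "s \<noteq> w"
    using S(1) by auto
  let ?L = "del {x, p, q} K \<union> {{w, r, s}}"
  have L1: "?L = del {p, q, x} K \<union> {{r, s, w}}" "?L = del {q, x, p} K \<union> {{s, w, r}}"
    by (simp_all add: insert_commute)
  have sbL: "same_body K ?L" by (rule remove_octahedron_body[OF complex S])
  \<comment> \<open>The removed complex looks the same from each outer vertex, so the two rotations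
    carry the bounds for \<open>w\<close> over to \<open>r\<close> and \<open>s\<close>.\<close>
  have outer: "deg ?L v \<ge> 3 \<and> (inner_at ?L v \<longrightarrow> deg ?L v \<ge> 4)" if "v = w \<or> v = r \<or> v = s" for v
    using that
  proof (elim disjE)
    assume v: "v = w"
    show ?thesis unfolding v using octa_outer_degree[OF o] octa_removed_degree[OF o refl] by linarith
  next
    assume v: "v = r"
    show ?thesis unfolding v using octa_outer_degree[OF o1] octa_removed_degree[OF o1 L1(1)] by linarith
  next
    assume v: "v = s"
    show ?thesis unfolding v using octa_outer_degree[OF o2] octa_removed_degree[OF o2 L1(2)] by linarith
  qed
  have okL: "degree_ok ?L"
    unfolding degree_ok_def
  proof
    fix v assume "v \<in> vertices ?L"
    then have v: "{v} \<in> K" "v \<notin> {x, p, q}" using n by (auto simp: vertices_def del_def)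
    show "deg ?L v \<ge> 3 \<and> (inner_at ?L v \<longrightarrow> deg ?L v \<ge> 4)"
    proof (cases "v = w \<or> v = r \<or> v = s")
      case False
      have nX: "nbrs K v \<inter> {x, p, q} = {}"
        using False v(2) F(1,2,3) nbrs_sym[of x v] nbrs_sym[of p v] nbrs_sym[of q v] by auto
      have out: "t \<notin> {{w, r, s}}" if "v \<in> t" for t using that False by auto
      have "{v, t} \<in> ?L \<longleftrightarrow> {v, t} \<in> del {x, p, q} K" for t using out[of "{v, t}"] by simp
      then have "nbrs ?L v = nbrs (del {x, p, q} K) v" unfolding nbrs_def by simp
      then have N: "nbrs ?L v = nbrs K v" using nbrs_del[OF v(2), of K] nX by blast
      have "inner_at K v" if i: "inner_at ?L v"
      proof (rule inner_at_transfer[OF i])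
        fix y assume y: "y \<in> nbrs K v"
        then have "y \<notin> {x, p, q}" using nX by blast
        then have "opp (del {x, p, q} K) v y = opp K v y"
          using opp_del[OF v(2), of y K] opp_subset_nbrs[of v y] nX by blast
        moreover have "opp ?L v y = opp (del {x, p, q} K) v y" using out unfolding opp_def by blast
        ultimately show "card (opp K v y) = 2 \<or> y \<in> nbrs ?L v \<and> card (opp ?L v y) = card (opp K v y)"
          using N y by simp
      qed
      then show ?thesis using N degree_ge[OF v(1)] inner_degree_ge v(1) by (auto simp: deg_def)
    qed (use outer in blast)
  qed
  have "octahedron_addition F ?L K" if LF: "?L \<in> F4 F"
  proof -
    have e: "remove_octahedron K (tri3 x p q) (tri3 w r s) = ?L"
      using octa_component(2)[OF o] by (simp add: remove_octahedron_def)
    have "removable_octahedron F K (tri3 x p q) (tri3 w r s)"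
      unfolding removable_octahedron_def e using octa_component(1)[OF o] LF by blast
    then show ?thesis unfolding octahedron_addition_def using e[symmetric] by blast
  qed
  moreover have "card ?L < card K"
  proof -
    have fin: "finite K" by (rule complex_finite_all[OF complex])
    \<comment> \<open>The removal may put in one new face, so at least two lost simplices have to be
      exhibited.\<close>
    have "del {x, p, q} K \<subseteq> K - {{x}, {p}}" by (auto simp: del_def)
    then have "card (del {x, p, q} K) \<le> card (K - {{x}, {p}})" using fin by (intro card_mono) auto
    also have "\<dots> = card K - 2" using V n fin by (simp add: card_Diff_subset)
    finally have "card (del {x, p, q} K) \<le> card K - 2" .
    moreover have "card K \<ge> 2" using card_mono[OF fin, of "{{x}, {p}}"] V n by simp
    moreover have "card ?L \<le> Suc (card (del {x, p, q} K))"
      by (simp add: card_insert_if fin del_def)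
    ultimately show ?thesis by linarith
  qed
  ultimately show False using removal_step[OF sbL okL] by blast
qed

section \<open>Light vertices\<close>

text \<open>With the face \<open>w r s\<close> all six links are closed squares. By connectedness
  these are all the vertices, and none of them lies on a boundary edge.\<close>

lemma no_closed_octahedron:
  assumes d: "distinct [x, p, q, r, s, w]" and lx: "link_edges K x = {{p, q}, {q, r}, {r, s}, {s, p}}"
    and lp: "link_edges K p = {{q, x}, {x, s}, {s, w}, {w, q}}"
    and lq: "link_edges K q = {{p, x}, {x, r}, {r, w}, {w, p}}" and wrs: "{w, r, s} \<in> K"
  shows False
proof -
  have n: "x \<noteq> p" "x \<noteq> q" "x \<noteq> r" "x \<noteq> s" "x \<noteq> w" "p \<noteq> q" "p \<noteq> r" "p \<noteq> s" "p \<noteq> w" "q \<noteq> r" "q \<noteq> s" "q \<noteq> w" "r \<noteq> s" "r \<noteq> w" "s \<noteq> w"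
    using d by auto
  have dx: "distinct [x, p, q, r, s]" and dp: "distinct [p, q, x, s, w]" and dq: "distinct [q, p, x, r, w]"
    using d by auto
  note X = square_link[OF lx dx] and P = square_link[OF lp dp] and Q = square_link[OF lq dq]
  have f: "{x, q, r} \<in> faces K" "{x, r, s} \<in> faces K" "{x, s, p} \<in> faces K" "{p, s, w} \<in> faces K"
    "{p, w, q} \<in> faces K" "{q, r, w} \<in> faces K" "{w, r, s} \<in> faces K"
    using lx lp lq wrs n by (simp_all flip: link_edge_mem) (simp add: link_edge_mem face_mem)
  have gw: "{{s, p}, {p, q}, {q, r}, {r, s}} \<subseteq> link_edges K w"
    using f by (simp add: link_edge_mem insert_commute)
  have gr: "{{w, q}, {q, x}, {x, s}, {s, w}} \<subseteq> link_edges K r"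
    using f by (simp add: link_edge_mem insert_commute)
  have gs: "{{w, p}, {p, x}, {x, r}, {r, w}} \<subseteq> link_edges K s"
    using f by (simp add: link_edge_mem insert_commute)
  have dw: "distinct [s, p, q, r]" and dr: "distinct [w, q, x, s]" and ds: "distinct [w, p, x, r]" using d by auto
  note W = cycle_link_inner(2,3)[OF gw _ two_regular_square[OF dw]]
    and R = cycle_link_inner(2,3)[OF gr _ two_regular_square[OF dr]]
    and S = cycle_link_inner(2,3)[OF gs _ two_regular_square[OF ds]]
  have N: "nbrs K w = {s, p, q, r}" "nbrs K r = {w, q, x, s}" "nbrs K s = {w, p, x, r}" using W(1) R(1) S(1) by auto
  have I: "inner_at K a" if "a \<in> {x, p, q, r, s, w}" for a
    using that X(1) P(1) Q(1) W(2) R(2) S(2) by auto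
  have VK: "vertices K = {x, p, q, r, s, w}"
  proof (rule all_vertices)
    show "nbrs K a \<subseteq> {x, p, q, r, s, w}" if "a \<in> {x, p, q, r, s, w}" for a
      using that by (elim insertE emptyE) (simp_all add: X(2) P(2) Q(2) N)
    show "{x, p, q, r, s, w} \<subseteq> vertices K"
      using face_edges[of x q r] face_edges[of p s w] f by (auto simp: faces_def vertices_def)
  qed simp
  obtain u v where uv: "u \<noteq> v" "{u, v} \<in> K" "card (opp K u v) = 1" using boundary by blast
  then have "inner_at K u" using I VK edge_ends by (auto simp: vertices_def)
  then show False using uv unfolding inner_at_def by auto
qed

text \<open>The neighbours of \<open>p\<close> are \<open>q\<close>, \<open>s\<close> and
  \<open>x\<close>. As \<open>q s\<close> is not an edge, \<open>x\<close> is the only vertex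
  opposite to \<open>p q\<close>, and this boundary edge puts \<open>q\<close> on the boundary.
  Hence two adjacent light vertices are both inner or both on the boundary.\<close>

lemma boundary_light_neighbour:
  assumes n: "p \<noteq> x" "q \<noteq> x" "p \<noteq> q" "s \<noteq> p" "s \<noteq> q" "s \<noteq> x"
    and o: "opp K p x = {q, s}" and qs: "{q, s} \<notin> K" and p: "\<not> inner_at K p" "deg K p = 3"
  shows "\<not> inner_at K q"
proof -
  have "x \<in> nbrs K p" using opp_three[of x p q] o n opp_subset_nbrs[of p q] by auto
  then have "{q, s, x} \<subseteq> nbrs K p" using opp_subset_nbrs[of p x] o by auto
  then have N: "nbrs K p = {q, s, x}" by (rule nbrs_eqI) (use p n in auto)
  have "s \<notin> opp K p q" using qs face_edges[of p q s] by (auto simp: opp_def)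
  moreover have "x \<in> opp K p q" using opp_three[of x p q] o n by auto
  ultimately have "opp K p q = {x}" using opp_sub[of p q] N by auto
  then have "card (opp K q p) = 1" by (simp add: opp_commute)
  moreover have "p \<in> nbrs K q" using N nbrs_sym by auto
  ultimately show ?thesis using not_inner by blast
qed

lemma no_light_pair:
  assumes l: "link_edges K x = {{p, q}, {q, r}, {r, s}, {s, p}}" and d: "distinct [x, p, q, r, s]"
    and pr: "{p, r} \<notin> K" and qs: "{q, s} \<notin> K" and lt: "light K p" "light K q"
  shows False
proof -
  have n: "x \<noteq> p" "x \<noteq> q" "x \<noteq> r" "x \<noteq> s" "p \<noteq> q" "p \<noteq> r" "p \<noteq> s" "q \<noteq> r" "q \<noteq> s" "r \<noteq> s" using d by auto
  note X = square_link[OF l d]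
  have op: "opp K p x = {q, s}" using X(4) opp_commute by metis
  have oq: "opp K q x = {p, r}" using X(5) opp_commute by metis
  have iff: "inner_at K p \<longleftrightarrow> inner_at K q"
  proof
    assume i: "inner_at K p"
    show "inner_at K q"
    proof (rule ccontr)
      assume ni: "\<not> inner_at K q"
      then have "deg K q = 3" using lt(2) by (simp add: light_def)
      then show False using boundary_light_neighbour[OF _ _ _ _ _ _ oq pr ni] n i by auto
    qed
  next
    assume i: "inner_at K q"
    show "inner_at K p"
    proof (rule ccontr)
      assume ni: "\<not> inner_at K p"
      then have "deg K p = 3" using lt(1) by (simp add: light_def)
      then show False using boundary_light_neighbour[OF _ _ _ _ _ _ op qs ni] n i by auto
    qed
  qed
  show False
  proof (cases "inner_at K p")
    case False
    then have "deg K p = 3" "deg K q = 3" "\<not> inner_at K q" using lt iff by (auto simp: light_def)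
    moreover have "{{p, q}, {q, r}, {r, s}, {s, p}} = {{s, p}, {p, q}, {q, r}, {r, s}}" by auto
    ultimately have "flag_at x s p q r" unfolding flag_at_def using l False n by auto
    then show False by (rule no_flag)
  next
    case True
    then have i: "inner_at K q" and dd: "deg K p = 4" "deg K q = 4" using lt iff by (auto simp: light_def)
    have fp: "{q, x} \<in> link_edges K p" and fq: "{p, x} \<in> link_edges K q"
      using opp_link[of x p q] opp_link[of x q p] op oq n by (auto simp: insert_commute)
    obtain y w where p: "distinct [p, q, x, y, w]" "link_edges K p = {{q, x}, {x, y}, {y, w}, {w, q}}"
      using inner_degree_four[OF True dd(1) fp] by blast
    obtain y' w' where q: "distinct [q, p, x, y', w']" "link_edges K q = {{p, x}, {x, y'}, {y', w'}, {w', p}}"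
      using inner_degree_four[OF i dd(2) fq] by blast
    note P = square_link[OF p(2,1)] and Q = square_link[OF q(2,1)]
    have y: "y = s" using P(5) op p(1) by (auto simp: doubleton_eq_iff)
    have y': "y' = r" using Q(5) oq q(1) by (auto simp: doubleton_eq_iff)
    \<comment> \<open>Both sets consist of the vertices opposite to the edge \<open>p q\<close>, so
      the squares around \<open>p\<close> and \<open>q\<close> share their outer vertex.\<close>
    have "{x, w} = {x, w'}" using P(4) Q(4) opp_commute by metis
    then have w: "w' = w" by (auto simp: doubleton_eq_iff)
    have d6: "distinct [x, p, q, r, s, w]" using n p(1) q(1) unfolding y y' w by auto
    have lp: "link_edges K p = {{q, x}, {x, s}, {s, w}, {w, q}}" using p(2) y by simp
    have lq: "link_edges K q = {{p, x}, {x, r}, {r, w}, {w, p}}" using q(2) y' w by simp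
    have "{w, r, s} \<notin> K" using no_closed_octahedron[OF d6 l lp lq] by blast
    then have "octa_at x p q r s w" unfolding octa_at_def using d6 l lp lq by blast
    then show False by (rule no_octa)
  qed
qed

text \<open>As both diagonals are absent, \<open>u x\<close> and \<open>v x\<close> can both be
  contracted. The first gives a light vertex among \<open>v\<close> and \<open>z\<close>, the second
  one among \<open>u\<close> and \<open>y\<close>, and any two such vertices are adjacent in the
  square.\<close>

lemma no_square_link:
  assumes l: "link_edges K x = {{u, v}, {v, y}, {y, z}, {z, u}}" and d: "distinct [x, u, v, y, z]"
    and uy: "{u, y} \<notin> K" and vz: "{v, z} \<notin> K"
  shows False
proof -
  have n: "x \<noteq> u" "x \<noteq> v" "x \<noteq> y" "x \<noteq> z" using d by auto
  have l1: "link_edges K x = {{v, y}, {y, z}, {z, u}, {u, v}}" using l by auto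
  have l2: "link_edges K x = {{z, u}, {u, v}, {v, y}, {y, z}}" using l by auto
  have l3: "link_edges K x = {{y, z}, {z, u}, {u, v}, {v, y}}" using l by auto
  have d1: "distinct [x, v, y, z, u]" and d2: "distinct [x, z, u, v, y]" and d3: "distinct [x, y, z, u, v]" using d by auto
  have yu: "{y, u} \<notin> K" and zv: "{z, v} \<notin> K" using uy vz by (simp_all add: insert_commute)
  note X = square_link[OF l d]
  have ux: "{u, x} \<in> K" "{v, x} \<in> K" using X(2) nbrs_edge[of u x] nbrs_edge[of v x] by (auto simp: insert_commute)
  have "same_body K (contract u x K)"
    using contract_square_vertex[OF complex _ d uy] star_in_link[of x] l by simp
  then have 1: "light K v \<or> light K z"
    using contract_light'[OF n(1)[symmetric] ux(1)] X(4) opp_commute[of K u x] by auto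
  have "same_body K (contract v x K)"
    using contract_square_vertex[OF complex _ d1 vz] star_in_link[of x] l1 by simp
  then have 2: "light K u \<or> light K y"
    using contract_light'[OF n(2)[symmetric] ux(2)] X(5) opp_commute[of K v x] by auto
  show False
    using 1 2 no_light_pair[OF l d uy vz] no_light_pair[OF l1 d1 vz yu]
      no_light_pair[OF l2 d2 zv uy] no_light_pair[OF l3 d3 yu zv] by blast
qed

text \<open>The contraction of \<open>u x\<close> has only \<open>v\<close> opposite to it, so
  \<open>v\<close> is light. If \<open>v\<close> is inner, its link is a square and
  \<open>x v\<close> can be contracted too. Then \<open>u\<close> or \<open>y\<close> is light, and
  it forms with \<open>x\<close> the boundary side of a flag centred at \<open>v\<close>.\<close>

lemma no_boundary_path_link:
  assumes x: "\<not> inner_at K x" "deg K x = 3" and l: "link_edges K x = {{u, v}, {v, y}}"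
    and d: "distinct [x, u, v, y]" and uy: "{u, y} \<notin> K"
  shows False
proof -
  have n: "x \<noteq> u" "x \<noteq> v" "x \<noteq> y" "u \<noteq> v" "u \<noteq> y" "v \<noteq> y" "u \<noteq> x" "v \<noteq> x" "y \<noteq> x" using d by auto
  have Nx: "nbrs K x = {u, v, y}" using nbrs_link_edges[of x] l by auto
  have ox: "opp K x u = {v}" "opp K x v = {u, y}" "opp K x y = {v}"
    unfolding opp_link_set[OF n(7)] opp_link_set[OF n(8)] opp_link_set[OF n(9)] l using n by (auto simp: doubleton_eq_iff)
  have oux: "opp K u x = {v}" "opp K v x = {u, y}" "opp K y x = {v}" using ox opp_commute by metis+
  have xK: "{u, x} \<in> K" "{x, v} \<in> K" using Nx nbrs_edge[of u x] nbrs_edge[of v x] by (auto simp: insert_commute)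
  have xn: "x \<in> nbrs K u" "x \<in> nbrs K v" "x \<in> nbrs K y" using Nx nbrs_sym by auto
  have "same_body K (contract u x K)"
    using contract_path_vertex[OF complex _ d uy] star_in_link[of x] l by simp
  then have lv: "light K v"
    using contract_light'[OF n(7) xK(1)] oux(1) by auto
  show False
  proof (cases "inner_at K v")
    case False
    then have dv: "deg K v = 3" using lv by (simp add: light_def)
    have "{u, y, x} \<subseteq> nbrs K v" using opp_subset_nbrs[of v x] oux(2) xn by auto
    then have Nv: "nbrs K v = {u, y, x}" by (rule nbrs_eqI) (use dv n in auto)
    have "y \<notin> opp K v u" using uy face_edges[of v u y] by (auto simp: opp_def)
    moreover have "x \<in> opp K v u" using opp_three[of x v u] oux(2) n by auto
    ultimately have "opp K v u = {x}" using opp_sub[of v u] Nv by auto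
    then have ouv: "opp K u v = {x}" using opp_commute by metis
    have cl: "e \<in> {{v, x}}" if e: "e \<in> link_edges K u" "t \<in> e" "t \<in> \<Union>{{v, x}}" for e t
    proof -
      have t: "t = v \<or> t = x" using e(3) by auto
      then have "t \<noteq> u" using n by auto
      then have "e \<in> (\<lambda>b. {t, b}) ` opp K u t" using link_edges_at(1)[of t u K] e by auto
      then obtain c where "e = {t, c}" "c \<in> opp K u t" by blast
      with t show ?thesis by (elim disjE) (simp_all add: ouv oux insert_commute)
    qed
    have g: "{{v, x}} \<subseteq> link_edges K u" using opp_link[of v u x] ouv n by simp
    have "nbrs K u = \<Union>{{v, x}}"
      by (rule path_link_closed(2)[OF g _ _ n(8)]) (use cl ouv oux in auto)
    \<comment> \<open>If \<open>v\<close> is on the boundary with degree 3, the edges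
      \<open>u x\<close> and \<open>u v\<close> are both boundary edges and leave no other neighbour
      to \<open>u\<close>.\<close>
    then have "deg K u = 2" using n by (simp add: deg_def)
    moreover have "{u} \<in> K" using vertex_of_nbr xn(1) by blast
    ultimately show False using degree_ge[of u] by simp
  next
    case True
    then have dv: "deg K v = 4" using lv by (simp add: light_def)
    have "{u, x} \<in> link_edges K v" using opp_link[of x v u] oux(2) n by (simp add: insert_commute)
    then obtain y' w where v: "distinct [v, u, x, y', w]" "link_edges K v = {{u, x}, {x, y'}, {y', w}, {w, u}}"
      using inner_degree_four[OF True dv] by blast
    note V = square_link[OF v(2,1)]
    have y': "y' = y" using V(5) oux(2) v(1) by (auto simp: doubleton_eq_iff)
    have lv1: "link_edges K v = {{x, y}, {y, w}, {w, u}, {u, x}}" using v(2) y' by auto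
    have d5: "distinct [v, x, y, w, u]" using v(1) y' by auto
    have xw: "{x, w} \<notin> K" using Nx nbrs_edge[of w x] v(1) y' by auto
    have "same_body K (contract x v K)"
      using contract_square_vertex[OF complex _ d5 xw] star_in_link[of v] lv1 by simp
    then have "light K u \<or> light K y"
      using contract_light'[OF n(2) xK(2)] ox(2) by auto
    then show False
    proof
      assume "light K u"
      moreover have nu: "\<not> inner_at K u" using not_inner[OF xn(1)] oux(1) by simp
      ultimately have du: "deg K u = 3" by (simp add: light_def)
      have "link_edges K v = {{w, u}, {u, x}, {x, y}, {y, w}}" using lv1 by auto
      then have "flag_at v w u x y" unfolding flag_at_def using d5 du nu x by auto
      then show False by (rule no_flag)
    next
      assume "light K y"
      moreover have ny: "\<not> inner_at K y" using not_inner[OF xn(3)] oux(3) by simp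
      ultimately have dy: "deg K y = 3" by (simp add: light_def)
      have "link_edges K v = {{w, y}, {y, x}, {x, u}, {u, w}}" using lv1 by (auto simp: insert_commute)
      then have "flag_at v w y x u" unfolding flag_at_def using d5 dy ny x by auto
      then show False by (rule no_flag)
    qed
  qed
qed

lemma irreducible: "irreducible_triangulation F K"
proof (rule ccontr)
  assume "\<not> ?thesis"
  then obtain u v where "contractible_edge F K u v" using tri unfolding irreducible_triangulation_def by blast
  then have uv: "u \<noteq> v" "{u, v} \<in> K" and t: "triangulates (contract u v K) F"
    unfolding contractible_edge_def by auto
  obtain x where x: "x \<in> opp K u v" "light K x" using contract_light(1)[OF uv t] by blast
  note lc = contract_light(2)[OF uv t]
  have xf: "{u, v, x} \<in> faces K" using x(1) opp_iff_face uv(1) by metis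
  then have f: "{u, v} \<in> link_edges K x" by (simp add: link_edge_mem insert_commute)
  \<comment> \<open>An edge \<open>a y\<close> would make \<open>y\<close> a common neighbour of
    \<open>u\<close> and \<open>v\<close>, hence opposite to \<open>u v\<close>. Then the faces
    \<open>b x a\<close>, \<open>b a y\<close> and \<open>b x y\<close> would close the link of
    \<open>b\<close> to a triangle.\<close>
  have no: "{a, y} \<notin> K" if ab: "{a, b} = {u, v}" "a \<noteq> b" and y: "{x, b, y} \<in> faces K" "y \<noteq> a" for a b y
  proof
    assume ay: "{a, y} \<in> K"
    have "distinct [x, b, y]" using y(1) unfolding face_mem by blast
    then have yn: "y \<noteq> x" "y \<noteq> b" by auto
    have "y \<in> nbrs K a" "y \<in> nbrs K b" using ay yn y(2) face_edges[of x b y] y(1) by (auto simp: nbrs_edge faces_def)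
    then have "y \<in> opp K u v" using lc ab by (auto simp: doubleton_eq_iff)
    then have "{b, a, y} \<in> faces K" using opp_iff_face[OF uv(1)] ab by (auto simp: doubleton_eq_iff insert_commute)
    moreover have "{b, x, a} \<in> faces K" using xf ab by (auto simp: doubleton_eq_iff insert_commute)
    moreover have "{b, x, y} \<in> faces K" using y(1) by (simp add: insert_commute)
    moreover have "x \<noteq> a" using xf ab unfolding face_mem by (auto simp: doubleton_eq_iff)
    ultimately show False using degree_ok_no_triangle_link[OF ok, of b x a y] y(2) yn by auto
  qed
  show False
  proof (cases "inner_at K x")
    case True
    then have "deg K x = 4" using x(2) by (simp add: light_def)
    then obtain y z where yz: "distinct [x, u, v, y, z]" "link_edges K x = {{u, v}, {v, y}, {y, z}, {z, u}}"
      using inner_degree_four[OF True _ f] by blast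
    have "{v, y} \<in> link_edges K x" "{u, z} \<in> link_edges K x" unfolding yz(2) by auto
    then have "{x, v, y} \<in> faces K" "{x, u, z} \<in> faces K" by (simp_all only: link_edge_mem)
    then have "{u, y} \<notin> K" "{v, z} \<notin> K" using no[of u v y] no[of v u z] yz(1) by (auto simp: insert_commute)
    then show False using no_square_link[OF yz(2,1)] by blast
  next
    case False
    then have dx: "deg K x = 3" using x(2) by (simp add: light_def)
    obtain y where y: "distinct [x, u, v, y]"
      "link_edges K x = {{u, v}, {v, y}} \<or> link_edges K x = {{v, u}, {u, y}}"
      using boundary_degree_three[OF ok False dx f] by blast
    from y(2) show False
    proof
      assume l: "link_edges K x = {{u, v}, {v, y}}"
      then have "{x, v, y} \<in> faces K" by (simp flip: link_edge_mem)
      then have "{u, y} \<notin> K" using no[of u v y] y(1) by auto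
      then show False using no_boundary_path_link[OF False dx l y(1)] by blast
    next
      assume l: "link_edges K x = {{v, u}, {u, y}}"
      then have "{x, u, y} \<in> faces K" by (simp flip: link_edge_mem)
      then have "{v, y} \<notin> K" using no[of v u y] y(1) by (auto simp: insert_commute)
      moreover have "distinct [x, v, u, y]" using y(1) by auto
      ultimately show False using no_boundary_path_link[OF False dx l] by blast
    qed
  qed
qed

end

theorem theorem1:
  fixes F :: "'a topology" and G :: "'v set set"
  assumes "punctured_surface F"
    and "\<not> F homeomorphic_space closed_disk"
    and "G \<in> F4 F"
  shows "\<exists>G\<^sub>0. irreducible_triangulation F G\<^sub>0 \<and> (generating_step F)\<^sup>*\<^sup>* G\<^sub>0 G"
  using assms(3)
proof (induction "card G" arbitrary: G rule: less_induct)
  case less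
  show ?case
  proof (cases "\<exists>H. generating_step F H G \<and> card H < card G")
    case True
    then obtain H where H: "generating_step F H G" "card H < card G" by blast
    then have "H \<in> F4 F" by (simp add: generating_step_def)
    then obtain G\<^sub>0 where "irreducible_triangulation F G\<^sub>0" "(generating_step F)\<^sup>*\<^sup>* G\<^sub>0 H"
      using less.hyps[OF H(2)] by blast
    then show ?thesis using H(1) by (meson rtranclp.rtrancl_into_rtrancl)
  next
    case False
    interpret stuck F G
      by unfold_locales (use assms(1,2) less.prems False in blast)+
    show ?thesis using irreducible by blast
  qed
qed

end
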